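(* Let $G(1/2)$ (the Gap Conjecture) and $G^*(1/2)$ be the assertions about finitely generated infinite groups defined in the context. (a) If $G(1/2)$ holds for the class of residually finite groups and for the class of simple groups, then $G(1/2)$ holds for the class of all groups. That is: if every finitely generated infinite group $G$ that is residually finite or simple and satisfies $\gamma_G(n)\prec e^{\sqrt n}$ has polynomial growth, then every finitely generated infinite group $G$ with $\gamma_G(n)\prec e^{\sqrt n}$ has polynomial growth. (b) If $G^*(1/2)$ holds for the class of residually finite groups and for the class of simple groups, then $G^*(1/2)$ holds for the class of all groups. That is: if every finitely generated infinite group $G$ that is residually finite or simple and is not virtually nilpotent satisfies $\gamma_G(n)\succeq e^{\sqrt n}$, then every finitely generated infinite group $G$ that is not virtually nilpotent satisfies $\gamma_G(n)\succeq e^{\sqrt n}$.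
   Context: All groups whose growth is considered are infinite and finitely generated, and generating sets are finite. For a group $G$ with finite generating set $A$, $|g|_A$ is the least length of an expression of $g$ as a product of elements of $A\cup A^{-1}$, and the growth function is $\gamma_G(n)=\gamma_G^A(n)=|\{g\in G:|g|_A\le n\}|$, $n\in\mathbb N$. Comparison of functions on the natural numbers: $\gamma_1\preceq\gamma_2$ (equivalently $\gamma_2\succeq\gamma_1$) means there is an integer $C>1$ with $\gamma_1(n)\le\gamma_2(Cn)$ for all $n\ge1$; $\gamma_1\prec\gamma_2$ is the strict version: $\gamma_1\preceq\gamma_2$ but not $\gamma_2\preceq\gamma_1$. The validity of these comparisons for $\gamma_G$ does not depend on the choice of $A$. $G$ has polynomial growth if there are $C,d>0$ with $\gamma_G(n)<Cn^d$ for all $n\ge1$. A group is virtually nilpotent if it has a nilpotent subgroup of finite index. For $0<\beta<1$ and a class $\mathcal C$ of groups: "$G(\beta)$ holds for $\mathcal C$" means: every finitely generated infinite group $G\in\mathcal C$ with $\gamma_G(n)\prec e^{n^\beta}$ has polynomial growth. "$G^*(\beta)$ holds for $\mathcal C$" means: every finitely generated infinite group $G\in\mathcal C$ which is not virtually nilpotent satisfies $\gamma_G(n)\succeq e^{n^\beta}$. The Gap Conjecture is $G(1/2)$. *)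

theory Defs
  imports Complex_Main "HOL-Algebra.Algebra"
begin

definition fin_gen_set :: "('a, 'b) monoid_scheme \<Rightarrow> 'a set \<Rightarrow> bool" where
  "fin_gen_set G A \<longleftrightarrow> finite A \<and> A \<subseteq> carrier G \<and> generate G A = carrier G"

definition word_length :: "('a, 'b) monoid_scheme \<Rightarrow> 'a set \<Rightarrow> 'a \<Rightarrow> nat" where
  "word_length G A g =
     (LEAST k. \<exists>w. length w = k \<and> set w \<subseteq> A \<union> (\<lambda>a. inv\<^bsub>G\<^esub> a) ` A \<and>
                    foldr (\<otimes>\<^bsub>G\<^esub>) w \<one>\<^bsub>G\<^esub> = g)"

(* Only meaningful when A generates G: otherwise word_length is a LEAST over an empty set
   for some g. All uses below are guarded by fin_gen_set. The balls are then finite. *)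
definition growth :: "('a, 'b) monoid_scheme \<Rightarrow> 'a set \<Rightarrow> nat \<Rightarrow> real" where
  "growth G A n = real (card {g \<in> carrier G. word_length G A g \<le> n})"

definition growth_preceq :: "(nat \<Rightarrow> real) \<Rightarrow> (nat \<Rightarrow> real) \<Rightarrow> bool" (infix "\<preceq>\<^sub>g" 50) where
  "f \<preceq>\<^sub>g h \<longleftrightarrow> (\<exists>C::nat. C > 1 \<and> (\<forall>n\<ge>1. f n \<le> h (C * n)))"

definition growth_prec :: "(nat \<Rightarrow> real) \<Rightarrow> (nat \<Rightarrow> real) \<Rightarrow> bool" (infix "\<prec>\<^sub>g" 50) where
  "f \<prec>\<^sub>g h \<longleftrightarrow> f \<preceq>\<^sub>g h \<and> \<not> h \<preceq>\<^sub>g f"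

definition polynomially_bounded :: "(nat \<Rightarrow> real) \<Rightarrow> bool" where
  "polynomially_bounded f \<longleftrightarrow> (\<exists>C d::real. C > 0 \<and> d > 0 \<and> (\<forall>n\<ge>1. f n < C * real n powr d))"

definition residually_finite :: "('a, 'b) monoid_scheme \<Rightarrow> bool" where
  "residually_finite G \<longleftrightarrow>
     (\<forall>g \<in> carrier G. g \<noteq> \<one>\<^bsub>G\<^esub> \<longrightarrow> (\<exists>N. N \<lhd> G \<and> finite (rcosets\<^bsub>G\<^esub> N) \<and> g \<notin> N))"

(* The library's locale simple_group demands order G > 1, where order is a card, so it
   excludes infinite simple groups; the groups of interest here are all infinite. *)
definition is_simple :: "('a, 'b) monoid_scheme \<Rightarrow> bool" where
  "is_simple G \<longleftrightarrow> carrier G \<noteq> {\<one>\<^bsub>G\<^esub>} \<and> (\<forall>N. N \<lhd> G \<longrightarrow> N = carrier G \<or> N = {\<one>\<^bsub>G\<^esub>})"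

primrec lower_central :: "('a, 'b) monoid_scheme \<Rightarrow> nat \<Rightarrow> 'a set" where
  "lower_central G 0 = carrier G"
| "lower_central G (Suc k) =
     generate G (\<Union>x \<in> lower_central G k. \<Union>y \<in> carrier G.
       {x \<otimes>\<^bsub>G\<^esub> y \<otimes>\<^bsub>G\<^esub> inv\<^bsub>G\<^esub> x \<otimes>\<^bsub>G\<^esub> inv\<^bsub>G\<^esub> y})"

definition nilpotent_group :: "('a, 'b) monoid_scheme \<Rightarrow> bool" where
  "nilpotent_group G \<longleftrightarrow> (\<exists>k. lower_central G k = {\<one>\<^bsub>G\<^esub>})"

definition virtually_nilpotent :: "('a, 'b) monoid_scheme \<Rightarrow> bool" where
  "virtually_nilpotent G \<longleftrightarrow>
     (\<exists>H. subgroup H G \<and> finite (rcosets\<^bsub>G\<^esub> H) \<and> nilpotent_group (G\<lparr>carrier := H\<rparr>))"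

(* gap_holds b K is G(b), and gap_star_holds b K is G*(b), for the class K of groups, where
   0 < b < 1. The growth conditions do not depend on the finite generating set, so the
   assertions are made for each one of them.
   A class is a predicate on groups with elements in the type 'a. A finitely generated
   group is countable, so taking 'a = nat covers all finitely generated infinite groups up
   to isomorphism. *)
definition gap_holds :: "real \<Rightarrow> ('a monoid \<Rightarrow> bool) \<Rightarrow> bool" where
  "gap_holds \<beta> K \<longleftrightarrow>
     (\<forall>G A. group G \<and> infinite (carrier G) \<and> fin_gen_set G A \<and> K G \<and>
            growth G A \<prec>\<^sub>g (\<lambda>n. exp (real n powr \<beta>))
        \<longrightarrow> polynomially_bounded (growth G A))"

definition gap_star_holds :: "real \<Rightarrow> ('a monoid \<Rightarrow> bool) \<Rightarrow> bool" where
  "gap_star_holds \<beta> K \<longleftrightarrow>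
     (\<forall>G A. group G \<and> infinite (carrier G) \<and> fin_gen_set G A \<and> K G \<and>
            \<not> virtually_nilpotent G
        \<longrightarrow> (\<lambda>n. exp (real n powr \<beta>)) \<preceq>\<^sub>g growth G A)"

end

theory Submission
  imports Defs "HOL-Complex_Analysis.Great_Picard" "HOL-Real_Asymp.Real_Asymp"
begin

text \<open>Let \<open>R\<close> be the intersection of the normal subgroups of finite index of a slowly growing
  group \<open>G\<close>. The quotient \<open>G / R\<close> is residually finite and grows no faster, so by hypothesis it has
  polynomial growth or is virtually nilpotent; either way it is virtually polycyclic. By Milnor's
  argument the kernel \<open>R\<close> of a map from a group of subexponential growth onto a virtually
  polycyclic group is finitely generated. A finite-index subgroup of \<open>R\<close> contains \<open>R \<inter> L\<close> for
  some finite-index \<open>L \<le> G\<close>, because \<open>R\<close> is finitely generated and \<open>G / R\<close> is built from finite and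
  infinite cyclic steps; hence \<open>R\<close> has no proper subgroup of finite index. If \<open>R\<close> were infinite, its
  quotient by a maximal normal subgroup would be an infinite simple group growing no faster than
  \<open>G\<close>, hence virtually polycyclic, hence with a proper subgroup of finite index: a contradiction. So
  \<open>R\<close> is finite, and \<open>G\<close> inherits polynomial growth or virtual nilpotency from \<open>G / R\<close>.

  That polynomial growth implies virtually polycyclic is the core of Gromov's theorem. It is obtained
  from random walks. The differences \<open>\<mu>\<^sup>2\<^sup>k(e) - \<mu>\<^sup>2\<^sup>k(x)\<close> of the return kernel yield in the limit a
  nonconstant Lipschitz harmonic function. Entropy is at most \<open>O(log n)\<close>, so at infinitely many times it
  increases by \<open>O(1/n)\<close>, and at these times the averages of the walk become translation
  invariant. They define an invariant inner product on the span of the translates of the harmonic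
  function, in which pointwise gradients are bounded by the norm; this makes the span
  finite-dimensional and its isometry group totally bounded. Commutators of near-identity isometries
  contract quadratically, and in a group of polynomial growth this forces a finite-index subgroup with abelian
  image, whence a finite-index subgroup maps onto the integers. Its kernel has growth of smaller degree.\<close>

section \<open>Word balls, finite index and virtually polycyclic extensions\<close>

text \<open>The hypotheses concern only residually finite and simple groups, so \<open>R\<close> has
  to be cut out of \<open>G\<close> before anything can be said about it. In (a) all that is known
  about \<open>G / R\<close> is a polynomial bound, which by itself says nothing about subgroups;
  this is why part of Gromov's theorem has to be proved on the way. Virtual polycyclicity, in the
  form \<open>pc\<close>, is a convenient target: it is weaker than virtual nilpotency, it can be
  reached in both (a) and (b), and finite generation as well as finite-index subgroups can be
  transported along it one step at a time. Hence (a) and (b) share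
  \<open>finite_residual_finite\<close> and differ only in the input and in the final descent
  through the finite kernel. All subgroups stay sets inside one ambient group; a new carrier type
  appears only for quotients, which are coded on \<open>nat\<close> because the hypotheses are
  stated there. The generating set of the walk contains the identity. This laziness keeps the
  spectrum away from -1, which drives the energy decay, and makes the times \<open>n\<close> and
  \<open>n + 1\<close> comparable in the entropy argument.\<close>

primrec wball :: "('a, 'b) monoid_scheme \<Rightarrow> 'a set \<Rightarrow> nat \<Rightarrow> 'a set" where
  "wball G S 0 = {\<one>\<^bsub>G\<^esub>}"
| "wball G S (Suc n) = (\<Union>s\<in>S. (\<lambda>x. s \<otimes>\<^bsub>G\<^esub> x) ` wball G S n)"

text \<open>With the identity as a generator, the words of length exactly \<open>n\<close> that
  \<open>wball\<close> collects fill the whole ball of radius \<open>n\<close>, and the walk on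
  \<open>S\<close> may stand still.\<close>

definition symgen :: "('a, 'b) monoid_scheme \<Rightarrow> 'a set \<Rightarrow> bool" where
  "symgen G S \<longleftrightarrow> finite S \<and> S \<subseteq> carrier G \<and> \<one>\<^bsub>G\<^esub> \<in> S \<and> (\<forall>s\<in>S. inv\<^bsub>G\<^esub> s \<in> S)"

definition sgen :: "('a, 'b) monoid_scheme \<Rightarrow> 'a set \<Rightarrow> 'a set \<Rightarrow> bool" where
  "sgen G S H \<longleftrightarrow> symgen G S \<and> H = (\<Union>n. wball G S n)"

text \<open>Finitely many representatives cover \<open>H\<close> by right cosets \<open>K f\<close>.
  This relative form compares two subsets of the ambient group without a coset space;
  \<open>findex_rcosets\<close> links it to the official notion.\<close>

definition findex :: "('a, 'b) monoid_scheme \<Rightarrow> 'a set \<Rightarrow> 'a set \<Rightarrow> bool" where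
  "findex G K H \<longleftrightarrow> (\<exists>F. finite F \<and> F \<subseteq> H \<and> (\<forall>h\<in>H. \<exists>f\<in>F. h \<otimes>\<^bsub>G\<^esub> inv\<^bsub>G\<^esub> f \<in> K))"

text \<open>A weak form of subexponential growth: exactly what the pigeonhole step of Milnor's argument
  needs, and stable under change of the finite set \<open>S\<close> because of the factor \<open>c\<close>.\<close>

definition subexp :: "('a, 'b) monoid_scheme \<Rightarrow> 'a set \<Rightarrow> bool" where
  "subexp G S \<longleftrightarrow> (\<forall>c. \<exists>m. card (wball G S (c * m)) < 2 ^ m)"

text \<open>A surjection of \<open>H\<close> onto the integers. Attaining 1 is enough for
  surjectivity and supplies the lift \<open>t\<close> of the generator on which the integer steps
  are built.\<close>

definition zhom :: "('a, 'b) monoid_scheme \<Rightarrow> 'a set \<Rightarrow> ('a \<Rightarrow> int) \<Rightarrow> bool" where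
  "zhom G H \<psi> \<longleftrightarrow> (\<forall>x\<in>H. \<forall>y\<in>H. \<psi> (x \<otimes>\<^bsub>G\<^esub> y) = \<psi> x + \<psi> y) \<and> (\<exists>t\<in>H. \<psi> t = 1)"

text \<open>\<open>pc G N H\<close>: the subgroup \<open>H\<close> is reached from \<open>N\<close> by finitely many extensions, each of finite index or
  with quotient the integers. For \<open>N\<close> trivial this is virtually polycyclic. A finite-index
  step need not be normal.\<close>

inductive pc :: "('a, 'b) monoid_scheme \<Rightarrow> 'a set \<Rightarrow> 'a set \<Rightarrow> bool" for G where
  refl: "subgroup N G \<Longrightarrow> pc G N N"
| fin: "pc G N K \<Longrightarrow> subgroup H G \<Longrightarrow> K \<subseteq> H \<Longrightarrow> findex G K H \<Longrightarrow> pc G N H"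
| zstep: "pc G N K \<Longrightarrow> subgroup H G \<Longrightarrow> zhom G H \<psi> \<Longrightarrow> K = {x\<in>H. \<psi> x = 0} \<Longrightarrow> pc G N H"

lemma wball_restrict [simp]: "wball (G\<lparr>carrier := H\<rparr>) S n = wball G S n"
  by (induction n) auto

lemma finite_wball: "finite S \<Longrightarrow> finite (wball G S n)"
  by (induction n) auto

context group
begin

lemma inv_cancel1 [simp]: "x \<in> carrier G \<Longrightarrow> y \<in> carrier G \<Longrightarrow> inv x \<otimes> (x \<otimes> y) = y"
  by (metis inv_closed l_inv l_one m_assoc)

lemma inv_cancel2 [simp]: "x \<in> carrier G \<Longrightarrow> y \<in> carrier G \<Longrightarrow> x \<otimes> (inv x \<otimes> y) = y"
  by (metis inv_closed r_inv l_one m_assoc)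

lemmas group_assoc_simps = m_assoc inv_mult_group

section \<open>Word balls and the subgroups they exhaust\<close>

lemma wball_carrier: "S \<subseteq> carrier G \<Longrightarrow> wball G S n \<subseteq> carrier G"
  by (induction n) auto

lemma wball_add:
  "S \<subseteq> carrier G \<Longrightarrow> x \<in> wball G S m \<Longrightarrow> y \<in> wball G S n \<Longrightarrow> x \<otimes> y \<in> wball G S (m + n)"
proof (induction m arbitrary: x)
  case 0
  then show ?case using subsetD[OF wball_carrier[OF 0(1)] 0(3)] by simp
next
  case (Suc m)
  then obtain s z where sz: "s \<in> S" "z \<in> wball G S m" "x = s \<otimes> z" by auto
  have "s \<in> carrier G" "z \<in> carrier G" "y \<in> carrier G"
    using sz Suc.prems wball_carrier by auto
  then have "x \<otimes> y = s \<otimes> (z \<otimes> y)" using sz by (simp add: m_assoc)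
  then show ?case using Suc.IH[OF Suc.prems(1) sz(2) Suc.prems(3)] sz by auto
qed

lemma wball_gen: "symgen G S \<Longrightarrow> s \<in> S \<Longrightarrow> s \<in> wball G S (Suc 0)"
  by (force simp: symgen_def)

lemma wball_Suc_mono: "symgen G S \<Longrightarrow> wball G S n \<subseteq> wball G S (Suc n)"
proof
  fix x assume "symgen G S" "x \<in> wball G S n"
  then have "x = \<one> \<otimes> x" "\<one> \<in> S" using wball_carrier[of S n] by (auto simp: symgen_def)
  then show "x \<in> wball G S (Suc n)" using \<open>x \<in> wball G S n\<close> by auto
qed

lemma wball_mono: "symgen G S \<Longrightarrow> m \<le> n \<Longrightarrow> wball G S m \<subseteq> wball G S n"
  using lift_Suc_mono_le[of "wball G S"] wball_Suc_mono by blast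

lemma wball_Suc2: assumes "symgen G S"
  shows "wball G S (Suc n) = (\<Union>s\<in>S. (\<lambda>x. x \<otimes> s) ` wball G S n)"
proof (induction n)
  case 0
  then show ?case using assms by (force simp: symgen_def)
next
  case (Suc n)
  have C: "\<And>s. s \<in> S \<Longrightarrow> s \<in> carrier G" "\<And>x. x \<in> wball G S n \<Longrightarrow> x \<in> carrier G"
    using assms wball_carrier by (auto simp: symgen_def)
  have "wball G S (Suc (Suc n)) = (\<Union>s\<in>S. (\<lambda>x. s \<otimes> x) ` (\<Union>s'\<in>S. (\<lambda>x. x \<otimes> s') ` wball G S n))"
    using Suc by (metis wball.simps(2))
  also have "\<dots> = (\<Union>s\<in>S. \<Union>s'\<in>S. (\<lambda>x. (s \<otimes> x) \<otimes> s') ` wball G S n)"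
    using C by (auto simp: image_iff m_assoc)
  also have "\<dots> = (\<Union>s'\<in>S. (\<lambda>x. x \<otimes> s') ` wball G S (Suc n))"
    by (auto simp: image_iff)
  finally show ?case .
qed

lemma wball_inv: "symgen G S \<Longrightarrow> x \<in> wball G S n \<Longrightarrow> inv x \<in> wball G S n"
proof (induction n arbitrary: x)
  case 0
  then show ?case by auto
next
  case (Suc n)
  then obtain s z where sz: "s \<in> S" "z \<in> wball G S n" "x = s \<otimes> z" by auto
  have C: "s \<in> carrier G" "z \<in> carrier G" "inv s \<in> S"
    using sz Suc.prems wball_carrier by (auto simp: symgen_def)
  then have "inv x = inv z \<otimes> inv s" using sz by (simp add: inv_mult_group)
  then show ?case using Suc.IH[OF Suc.prems(1) sz(2)] C Suc.prems(1) by (subst wball_Suc2) auto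
qed

lemma one_in_wball: "symgen G S \<Longrightarrow> \<one> \<in> wball G S n"
  using wball_mono[of S 0 n] by auto

lemma sgen_subgroup: "sgen G S H \<Longrightarrow> subgroup H G"
proof (rule subgroupI)
  assume a: "sgen G S H"
  then have s: "symgen G S" and H: "H = (\<Union>n. wball G S n)" by (auto simp: sgen_def)
  show "H \<subseteq> carrier G" using wball_carrier s H by (auto simp: symgen_def)
  show "H \<noteq> {}" using one_in_wball[OF s] H by auto
  show "\<And>x. x \<in> H \<Longrightarrow> inv x \<in> H" using wball_inv[OF s] H by auto
  show "\<And>x y. x \<in> H \<Longrightarrow> y \<in> H \<Longrightarrow> x \<otimes> y \<in> H"
  proof -
    fix x y assume "x \<in> H" "y \<in> H"
    then obtain m n where "x \<in> wball G S m" "y \<in> wball G S n" using H by auto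
    then have "x \<otimes> y \<in> wball G S (m + n)" using wball_add s by (auto simp: symgen_def)
    then show "x \<otimes> y \<in> H" using H by blast
  qed
qed

lemma wball_subgroup: "subgroup H G \<Longrightarrow> S \<subseteq> H \<Longrightarrow> wball G S n \<subseteq> H"
  by (induction n) (auto simp: subgroup.one_closed intro!: subgroup.m_closed)

lemma sgen_subset: "sgen G S H \<Longrightarrow> S \<subseteq> H"
  using wball_gen unfolding sgen_def by blast

lemma sgen_finite_subset:
  assumes "sgen G S H" "finite F" "F \<subseteq> H" shows "\<exists>c\<ge>1. F \<subseteq> wball G S c"
  using assms(2,3)
proof (induction F)
  case empty then show ?case by auto
next
  case (insert x F)
  then obtain c where "c \<ge> 1" "F \<subseteq> wball G S c" by auto
  moreover obtain n where "x \<in> wball G S n" using insert assms by (auto simp: sgen_def)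
  ultimately show ?case using assms wball_mono[of S c "max c n"] wball_mono[of S n "max c n"]
    by (intro exI[of _ "max c n"]) (auto simp: sgen_def)
qed

lemma wball_subst: assumes "symgen G S" "T \<subseteq> wball G S c" shows "wball G T n \<subseteq> wball G S (c * n)"
proof (induction n)
  case 0 then show ?case by auto
next
  case (Suc n)
  then show ?case using assms wball_add[of S _ c _ "c * n"] unfolding symgen_def by auto
qed

lemma card_wball_subst: assumes "symgen G S" "T \<subseteq> wball G S c"
  shows "card (wball G T n) \<le> card (wball G S (c * n))"
  using wball_subst[OF assms] assms finite_wball by (intro card_mono) (auto simp: symgen_def)

lemma sgen_generate:
  assumes "finite A" "A \<subseteq> carrier G"
  shows "sgen G (insert \<one> (A \<union> (\<lambda>a. inv a) ` A)) (generate G A)"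
proof -
  let ?S = "insert \<one> (A \<union> (\<lambda>a. inv a) ` A)"
  have s: "symgen G ?S" using assms by (auto simp: symgen_def)
  then have sg: "sgen G ?S (\<Union>n. wball G ?S n)" by (auto simp: sgen_def)
  have sub: "subgroup (generate G A) G" using assms generate_is_subgroup by auto
  have "?S \<subseteq> generate G A" using generate.intros by fast
  then have "(\<Union>n. wball G ?S n) \<subseteq> generate G A" using wball_subgroup[OF sub] by blast
  moreover have "generate G A \<subseteq> (\<Union>n. wball G ?S n)"
    using sgen_subgroup[OF sg] sgen_subset[OF sg] by (intro generate_subgroup_incl) auto
  ultimately have "generate G A = (\<Union>n. wball G ?S n)" by blast
  then show ?thesis using sg by presburger
qed

lemma sgen_generate_iff:
  assumes "sgen G S H" shows "generate G S = H"
proof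
  have sub: "subgroup H G" using sgen_subgroup assms by auto
  show "generate G S \<subseteq> H" using generate_subgroup_incl sub sgen_subset assms by auto
  have "subgroup (generate G S) G" using assms generate_is_subgroup by (auto simp: sgen_def symgen_def)
  then have "wball G S n \<subseteq> generate G S" for n by (intro wball_subgroup) (auto intro: generate.incl)
  then show "H \<subseteq> generate G S" using assms by (auto simp: sgen_def)
qed

lemma words_wball: "wball G S n = {foldr (\<otimes>) w \<one> | w. length w = n \<and> set w \<subseteq> S}"
proof (induction n)
  case 0 then show ?case by auto
next
  case (Suc n)
  show ?case
  proof (intro subset_antisym subsetI)
    fix x assume "x \<in> wball G S (Suc n)"
    then obtain s w where "s \<in> S" "x = s \<otimes> foldr (\<otimes>) w \<one>" "length w = n" "set w \<subseteq> S"
      using Suc by auto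
    then show "x \<in> {foldr (\<otimes>) w \<one> | w. length w = Suc n \<and> set w \<subseteq> S}"
      by (auto intro!: exI[of _ "s # w"])
  next
    fix x assume "x \<in> {foldr (\<otimes>) w \<one> | w. length w = Suc n \<and> set w \<subseteq> S}"
    then obtain w where w: "x = foldr (\<otimes>) w \<one>" "length w = Suc n" "set w \<subseteq> S" by auto
    then obtain s w' where "w = s # w'" by (cases w) auto
    then show "x \<in> wball G S (Suc n)" using w Suc by auto
  qed
qed

text \<open>With the identity added as a letter every word can be padded to length \<open>n\<close>,
  so counting the elements of length at most \<open>n\<close> becomes counting the values of words
  of one exact length.\<close>

lemma growth_eq_wball:
  assumes "fin_gen_set G A"
  shows "growth G A n = real (card (wball G (insert \<one> (A \<union> (\<lambda>a. inv a) ` A)) n))"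
proof -
  let ?B = "A \<union> (\<lambda>a. inv a) ` A" let ?S = "insert \<one> ?B"
  have A: "finite A" "A \<subseteq> carrier G" "generate G A = carrier G" using assms by (auto simp: fin_gen_set_def)
  then have sg: "sgen G ?S (carrier G)" using sgen_generate by metis
  then have s: "symgen G ?S" by (auto simp: sgen_def)
  have Bc: "?B \<subseteq> carrier G" using A by auto
  have mono: "wball G ?B k \<subseteq> wball G ?S n" if "k \<le> n" for k n
  proof -
    have "wball G B' k \<subseteq> wball G S' k" if "B' \<subseteq> S'" for B' S'
      using that by (induction k) (simp, fastforce)
    then have "wball G ?B k \<subseteq> wball G ?S k" by blast
    then show ?thesis using wball_mono[OF s that] by auto
  qed
  \<comment> \<open>Deleting identity letters turns a padded word into a shorter one over
    \<open>A\<close> and its inverses.\<close>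
  have red: "\<exists>k\<le>n. x \<in> wball G ?B k" if "x \<in> wball G ?S n" for x n
    using that
  proof (induction n arbitrary: x)
    case 0 then show ?case by auto
  next
    case (Suc n)
    then obtain t z where tz: "t \<in> ?S" "z \<in> wball G ?S n" "x = t \<otimes> z" by auto
    then obtain k where k: "k \<le> n" "z \<in> wball G ?B k" using Suc by auto
    show ?case
    proof (cases "t = \<one>")
      case True
      then have "x = z" using tz k subsetD[OF wball_carrier[OF Bc, of k]] by auto
      then show ?thesis using k by (auto intro: exI[of _ k])
    next
      case False
      then have "x \<in> wball G ?B (Suc k)" using tz k by auto
      then show ?thesis using k by (intro exI[of _ "Suc k"]) auto
    qed
  qed
  have "{g \<in> carrier G. word_length G A g \<le> n} = wball G ?S n"
  proof (intro subset_antisym subsetI)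
    fix g assume g: "g \<in> {g \<in> carrier G. word_length G A g \<le> n}"
    then obtain m where "g \<in> wball G ?S m" using sg by (auto simp: sgen_def)
    then obtain k where "g \<in> wball G ?B k" using red by blast
    then have "\<exists>k. \<exists>w. length w = k \<and> set w \<subseteq> ?B \<and> foldr (\<otimes>) w \<one> = g"
      using words_wball by auto
    then have "\<exists>w. length w = word_length G A g \<and> set w \<subseteq> ?B \<and> foldr (\<otimes>) w \<one> = g"
      unfolding word_length_def by (rule LeastI_ex)
    then have "g \<in> wball G ?B (word_length G A g)" using words_wball by auto
    then show "g \<in> wball G ?S n" using mono g by blast
  next
    fix g assume g: "g \<in> wball G ?S n"
    then obtain k where k: "k \<le> n" "g \<in> wball G ?B k" using red by blast
    then have "word_length G A g \<le> k" unfolding word_length_def words_wball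
      by (intro Least_le) auto
    then show "g \<in> {g \<in> carrier G. word_length G A g \<le> n}"
      using k g subsetD[OF wball_carrier[OF Bc, of k]] by auto
  qed
  then show ?thesis unfolding growth_def by simp
qed

text \<open>Finite index is proved by a finite colouring in which elements of one colour share a
  right coset of \<open>K\<close>. Colours may have any type; pairs, functions and residues occur
  below, which makes towers and intersections immediate.\<close>

lemma findexI:
  assumes "finite (c ` H)" "\<And>h h'. h \<in> H \<Longrightarrow> h' \<in> H \<Longrightarrow> c h = c h' \<Longrightarrow> h \<otimes> inv h' \<in> K"
  shows "findex G K H"
proof -
  obtain F where F: "F \<subseteq> H" "finite F" "c ` F = c ` H"
    using finite_subset_image[OF assms(1), of c H] by auto
  have "\<exists>f\<in>F. h \<otimes> inv f \<in> K" if "h \<in> H" for h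
  proof -
    have "c h \<in> c ` F" using F that by auto
    then obtain f where "f \<in> F" "c f = c h" by auto
    then show ?thesis using assms(2)[OF that, of f] F by auto
  qed
  then show ?thesis unfolding findex_def using F by blast
qed

text \<open>The converse of the colouring criterion: \<open>c\<close> picks a representative of each
  coset, and is therefore itself such a colouring.\<close>

lemma findexE:
  assumes "findex G K H" "subgroup K G" "subgroup H G"
  obtains c where "finite (c ` H)" "c ` H \<subseteq> H" "\<And>h h'. h \<in> H \<Longrightarrow> h' \<in> H \<Longrightarrow> c h = c h' \<Longrightarrow> h \<otimes> inv h' \<in> K"
    "\<And>h. h \<in> H \<Longrightarrow> h \<otimes> inv (c h) \<in> K"
proof -
  obtain F where F: "finite F" "F \<subseteq> H" "\<forall>h\<in>H. \<exists>f\<in>F. h \<otimes> inv f \<in> K" using assms by (auto simp: findex_def)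
  then obtain c where c: "\<And>h. h \<in> H \<Longrightarrow> c h \<in> F \<and> h \<otimes> inv (c h) \<in> K" by metis
  show thesis
  proof (rule that[of c])
    have "c ` H \<subseteq> F" using c by auto
    then show "finite (c ` H)" "c ` H \<subseteq> H" using F finite_subset by auto
    show "\<And>h. h \<in> H \<Longrightarrow> h \<otimes> inv (c h) \<in> K" using c by auto
    fix h h' assume h: "h \<in> H" "h' \<in> H" "c h = c h'"
    have C: "h \<in> carrier G" "h' \<in> carrier G" "c h' \<in> carrier G"
      using h c F subgroup.subset[OF assms(3)] by blast+
    have "(h \<otimes> inv (c h)) \<otimes> inv (h' \<otimes> inv (c h')) \<in> K"
      using c[of h] c[of h'] h(1,2) assms(2) by (auto intro: subgroup.m_closed subgroup.m_inv_closed)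
    moreover have "(h \<otimes> inv (c h)) \<otimes> inv (h' \<otimes> inv (c h')) = h \<otimes> inv h'"
      using C h by (simp add: group_assoc_simps)
    ultimately show "h \<otimes> inv h' \<in> K" by simp
  qed
qed

lemma findex_refl: "subgroup H G \<Longrightarrow> findex G H H"
  by (rule findexI[of "\<lambda>_. ()"]) (auto intro: subgroup.m_closed subgroup.m_inv_closed)

lemma findex_trans:
  assumes "findex G L K" "findex G K H" "subgroup L G" "subgroup K G" "subgroup H G" "K \<subseteq> H"
  shows "findex G L H"
proof -
  obtain c where c: "finite (c ` H)" "c ` H \<subseteq> H" "\<And>h h'. h \<in> H \<Longrightarrow> h' \<in> H \<Longrightarrow> c h = c h' \<Longrightarrow> h \<otimes> inv h' \<in> K"
      "\<And>h. h \<in> H \<Longrightarrow> h \<otimes> inv (c h) \<in> K"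
    by (rule findexE[OF assms(2,4,5)]) blast
  obtain d where d: "finite (d ` K)" "d ` K \<subseteq> K" "\<And>h h'. h \<in> K \<Longrightarrow> h' \<in> K \<Longrightarrow> d h = d h' \<Longrightarrow> h \<otimes> inv h' \<in> L"
      "\<And>h. h \<in> K \<Longrightarrow> h \<otimes> inv (d h) \<in> L"
    by (rule findexE[OF assms(1,3,4)]) blast
  show ?thesis
  proof (rule findexI[of "\<lambda>h. (c h, d (h \<otimes> inv (c h)))"])
    have "(\<lambda>h. (c h, d (h \<otimes> inv (c h)))) ` H \<subseteq> c ` H \<times> d ` K" using c(4) by auto
    then show "finite ((\<lambda>h. (c h, d (h \<otimes> inv (c h)))) ` H)"
      by (rule finite_subset) (use c(1) d(1) in auto)
    fix h h' assume h: "h \<in> H" "h' \<in> H" "(c h, d (h \<otimes> inv (c h))) = (c h', d (h' \<otimes> inv (c h')))"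
    have C: "h \<in> carrier G" "h' \<in> carrier G" "c h' \<in> carrier G"
      using h c(2) subgroup.subset[OF assms(5)] by blast+
    have e: "c h = c h'" "d (h \<otimes> inv (c h)) = d (h' \<otimes> inv (c h'))" using h(3) unfolding prod.inject by blast+
    have "(h \<otimes> inv (c h)) \<otimes> inv (h' \<otimes> inv (c h')) \<in> L"
      by (rule d(3)[OF c(4)[OF h(1)] c(4)[OF h(2)] e(2)])
    moreover have "(h \<otimes> inv (c h)) \<otimes> inv (h' \<otimes> inv (c h')) = h \<otimes> inv h'"
      using C e(1) by (simp add: group_assoc_simps)
    ultimately show "h \<otimes> inv h' \<in> L" by simp
  qed
qed

lemma findex_Inter:
  assumes "finite \<L>" "\<L> \<noteq> {}" "\<And>L. L \<in> \<L> \<Longrightarrow> subgroup L G \<and> findex G L H" "subgroup H G"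
  shows "findex G (\<Inter>\<L>) H"
proof -
  have "\<exists>c :: 'a \<Rightarrow> 'a. finite (c ` H) \<and> (\<forall>h\<in>H. \<forall>h'\<in>H. c h = c h' \<longrightarrow> h \<otimes> inv h' \<in> L)" if "L \<in> \<L>" for L
  proof -
    have L: "subgroup L G" "findex G L H" using assms(3)[OF that] by auto
    obtain c where "finite (c ` H)" "c ` H \<subseteq> H" "\<And>h h'. h \<in> H \<Longrightarrow> h' \<in> H \<Longrightarrow> c h = c h' \<Longrightarrow> h \<otimes> inv h' \<in> L"
      "\<And>h. h \<in> H \<Longrightarrow> h \<otimes> inv (c h) \<in> L"
      by (rule findexE[of L H]) (use L assms(4) in blast)+
    then show ?thesis by (intro exI[of _ c]) blast
  qed
  then have "\<forall>L\<in>\<L>. \<exists>c :: 'a \<Rightarrow> 'a. finite (c ` H) \<and> (\<forall>h\<in>H. \<forall>h'\<in>H. c h = c h' \<longrightarrow> h \<otimes> inv h' \<in> L)"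
    by blast
  from bchoice[OF this] obtain c :: "'a set \<Rightarrow> 'a \<Rightarrow> 'a"
    where c0: "\<forall>L\<in>\<L>. finite (c L ` H) \<and> (\<forall>h\<in>H. \<forall>h'\<in>H. c L h = c L h' \<longrightarrow> h \<otimes> inv h' \<in> L)"
    by blast
  have c: "\<And>L. L \<in> \<L> \<Longrightarrow> finite (c L ` H)"
    "\<And>L h h'. L \<in> \<L> \<Longrightarrow> h \<in> H \<Longrightarrow> h' \<in> H \<Longrightarrow> c L h = c L h' \<Longrightarrow> h \<otimes> inv h' \<in> L"
    using c0 by blast+
  show ?thesis
  proof (rule findexI[of "\<lambda>h. \<lambda>L\<in>\<L>. c L h"])
    have "(\<lambda>h. \<lambda>L\<in>\<L>. c L h) ` H \<subseteq> (\<Pi>\<^sub>E L\<in>\<L>. c L ` H)" by auto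
    then show "finite ((\<lambda>h. \<lambda>L\<in>\<L>. c L h) ` H)" using c assms finite_PiE finite_subset by metis
    fix h h' assume h: "h \<in> H" "h' \<in> H" "(\<lambda>L\<in>\<L>. c L h) = (\<lambda>L\<in>\<L>. c L h')"
    have "c L h = c L h'" if "L \<in> \<L>" for L using fun_cong[OF h(3), of L] that by simp
    then show "h \<otimes> inv h' \<in> \<Inter>\<L>" using c h by blast
  qed
qed

lemma findex_trivial_finite:
  assumes "findex G K H" "finite K" "subgroup H G" shows "finite H"
proof -
  obtain F where F: "finite F" "F \<subseteq> H" "\<forall>h\<in>H. \<exists>f\<in>F. h \<otimes> inv f \<in> K" using assms by (auto simp: findex_def)
  have "H \<subseteq> (\<lambda>(k,f). k \<otimes> f) ` (K \<times> F)"
  proof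
    fix h assume h: "h \<in> H"
    then obtain f where f: "f \<in> F" "h \<otimes> inv f \<in> K" using F by auto
    have "h \<in> carrier G" "f \<in> carrier G" using h f F subgroup.subset[OF assms(3)] by auto
    then have "h = (h \<otimes> inv f) \<otimes> f" by (simp add: m_assoc)
    then show "h \<in> (\<lambda>(k,f). k \<otimes> f) ` (K \<times> F)" using f by force
  qed
  then show ?thesis using F assms by (meson finite_SigmaI finite_imageI finite_subset)
qed

lemma finite_findex: "finite H \<Longrightarrow> subgroup H G \<Longrightarrow> subgroup K G \<Longrightarrow> findex G K H"
  by (rule findexI[of "\<lambda>h. h"]) (auto simp: subgroup.one_closed subgroup.mem_carrier)

lemma findex_rcosets:
  assumes "subgroup K G" shows "finite (rcosets K) \<longleftrightarrow> findex G K (carrier G)"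
proof
  assume f: "finite (rcosets K)"
  show "findex G K (carrier G)"
  proof (rule findexI[of "\<lambda>h. K #> h"])
    show "finite ((\<lambda>h. K #> h) ` carrier G)" using f by (auto simp: RCOSETS_def UNION_singleton_eq_range)
    fix h h' assume h: "h \<in> carrier G" "h' \<in> carrier G" "K #> h = K #> h'"
    then show "h \<otimes> inv h' \<in> K"
      using repr_independenceD[OF assms] subgroup.rcos_module_imp[OF assms group_axioms] rcos_self[OF h(1) assms] by auto
  qed
next
  assume "findex G K (carrier G)"
  then obtain F where F: "finite F" "F \<subseteq> carrier G" "\<forall>h\<in>carrier G. \<exists>f\<in>F. h \<otimes> inv f \<in> K" by (auto simp: findex_def)
  have "rcosets K \<subseteq> (\<lambda>f. K #> f) ` F"
  proof
    fix C assume "C \<in> rcosets K"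
    then obtain h where h: "h \<in> carrier G" "C = K #> h" by (auto simp: RCOSETS_def)
    then obtain f where f: "f \<in> F" "h \<otimes> inv f \<in> K" using F by auto
    then have "h \<in> K #> f" using subgroup.rcos_module_rev[OF assms group_axioms] F h by auto
    then have "K #> h = K #> f" using repr_independence[OF _ _ assms] F f by blast
    then show "C \<in> (\<lambda>f. K #> f) ` F" using h f by auto
  qed
  then show "finite (rcosets K)" using F by (meson finite_imageI finite_subset)
qed

text \<open>Schreier's lemma. While a word is read letter by letter, the coset representative
  reached so far is carried along, and each letter \<open>s\<close> contributes one factor
  \<open>f s inv f'\<close> from \<open>K\<close>.\<close>

lemma schreier:
  assumes "sgen G S H" "subgroup K G" "K \<subseteq> H" "findex G K H"
  shows "\<exists>T. sgen G T K"
proof -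
  have H: "subgroup H G" and s: "symgen G S" using assms sgen_subgroup by (auto simp: sgen_def)
  obtain F0 where F0: "finite F0" "F0 \<subseteq> H" "\<forall>h\<in>H. \<exists>f\<in>F0. h \<otimes> inv f \<in> K" using assms by (auto simp: findex_def)
  \<comment> \<open>The identity starts the reading. It also turns a last representative
    \<open>f\<close> that lies in \<open>K\<close> into an element of \<open>T\<close>, with letter
    and second representative equal to the identity.\<close>
  define F where "F = insert \<one> F0"
  have F: "finite F" "F \<subseteq> H" "\<one> \<in> F" "\<forall>h\<in>H. \<exists>f\<in>F. h \<otimes> inv f \<in> K"
    using F0 H by (auto simp: F_def subgroup.one_closed)
  note Hc = subgroup.mem_carrier[OF H]
  define T where "T = (\<lambda>(f,s,f'). f \<otimes> s \<otimes> inv f') ` (F \<times> S \<times> F) \<inter> K"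
  have T: "finite T" "T \<subseteq> K" using F s by (auto simp: T_def symgen_def)
  have Kc: "K \<subseteq> carrier G" using subgroup.subset[OF assms(2)] .
  have *: "\<exists>f\<in>F. x \<otimes> inv f \<in> generate G T" if "x \<in> wball G S n" for n x
    using that
  proof (induction n arbitrary: x)
    case 0
    then show ?case using F generate.one by (intro bexI[of _ \<one>]) auto
  next
    case (Suc n)
    then obtain y t where y: "y \<in> wball G S n" "t \<in> S" "x = y \<otimes> t"
      using Suc.prems unfolding wball_Suc2[OF s] by blast
    then obtain f where f: "f \<in> F" "y \<otimes> inv f \<in> generate G T" using Suc by auto
    have c: "f \<in> carrier G" "t \<in> carrier G" "y \<in> carrier G"
      using f y F Hc wball_carrier[of S n] s by (auto simp: symgen_def)
    have "f \<otimes> t \<in> H" using f y F H sgen_subset[OF assms(1)] by (auto intro: subgroup.m_closed)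
    then obtain f' where f': "f' \<in> F" "f \<otimes> t \<otimes> inv f' \<in> K" using F by blast
    then have "f \<otimes> t \<otimes> inv f' \<in> T" using f y by (force simp: T_def)
    then have "(y \<otimes> inv f) \<otimes> (f \<otimes> t \<otimes> inv f') \<in> generate G T"
      using f by (auto intro: generate.incl generate.eng)
    moreover have "(y \<otimes> inv f) \<otimes> (f \<otimes> t \<otimes> inv f') = x \<otimes> inv f'"
      using c y f' F Hc by (auto simp: group_assoc_simps)
    ultimately show ?case using f' by auto
  qed
  have "K \<subseteq> generate G T"
  proof
    fix x assume x: "x \<in> K"
    then obtain n where "x \<in> wball G S n" using assms by (auto simp: sgen_def)
    then obtain f where f: "f \<in> F" "x \<otimes> inv f \<in> generate G T" using * by auto
    have c: "x \<in> carrier G" "f \<in> carrier G" using x Kc f F Hc by auto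
    have gK: "generate G T \<subseteq> K" using generate_subgroup_incl T assms(2) by auto
    have "inv (x \<otimes> inv f) \<otimes> x \<in> K" using f x gK assms(2) by (auto intro: subgroup.m_closed subgroup.m_inv_closed)
    moreover have "inv (x \<otimes> inv f) \<otimes> x = f" using c by (simp add: group_assoc_simps)
    ultimately have "f \<in> K" by simp
    then have "f \<in> T" using f F s c by (auto simp: T_def symgen_def intro!: image_eqI[where x="(f,\<one>,\<one>)"])
    then have "(x \<otimes> inv f) \<otimes> f \<in> generate G T" using f by (auto intro: generate.incl generate.eng)
    then show "x \<in> generate G T" using c by (simp add: m_assoc)
  qed
  then have "generate G T = K" using generate_subgroup_incl T assms(2) by blast
  then show ?thesis using sgen_generate[of T] T Kc by auto
qed

lemma subexp_subset:
  assumes "subexp G S" "sgen G S H" "sgen G T K" "K \<subseteq> H"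
  shows "subexp G T"
proof -
  obtain c where c: "T \<subseteq> wball G S c" using sgen_finite_subset[OF assms(2), of T] assms(3,4) sgen_subset[OF assms(3)]
    unfolding sgen_def symgen_def by (meson subset_trans)
  show ?thesis unfolding subexp_def
  proof
    fix d
    obtain m where "card (wball G S (c * d * m)) < 2 ^ m" using assms(1) by (auto simp: subexp_def)
    moreover have "card (wball G T (d * m)) \<le> card (wball G S (c * (d * m)))"
      using card_wball_subst[OF _ c] assms(2) by (auto simp: sgen_def)
    ultimately show "\<exists>m. card (wball G T (d * m)) < 2 ^ m" by (intro exI[of _ m]) (simp add: mult.assoc)
  qed
qed

end

section \<open>Chains of extensions and abelian quotients\<close>

context group
begin

lemma pc_subgroups: "pc G N H \<Longrightarrow> subgroup N G \<and> subgroup H G \<and> N \<subseteq> H"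
  by (induction rule: pc.induct) auto

lemma pc_trans: "pc G K H \<Longrightarrow> pc G N K \<Longrightarrow> pc G N H"
proof (induction rule: pc.induct)
  case refl then show ?case by simp
next
  case fin then show ?case by (blast intro: pc.fin)
next
  case zstep then show ?case by (blast intro: pc.zstep)
qed

lemma subgroup_conj_int:
  assumes "subgroup H G" "x \<in> H" "t \<in> H" shows "t [^] (i::int) \<otimes> x \<otimes> t [^] (-i) \<in> H"
  using assms subgroup_int_pow_closed[OF assms(1)] by (intro subgroup.m_closed) auto

lemma zhom_facts:
  assumes "zhom G H \<psi>" "subgroup H G"
  shows "\<psi> \<one> = 0" "x \<in> H \<Longrightarrow> \<psi> (inv x) = - \<psi> x" "x \<in> H \<Longrightarrow> y \<in> H \<Longrightarrow> \<psi> (x \<otimes> y) = \<psi> x + \<psi> y"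
    "x \<in> H \<Longrightarrow> \<psi> (x [^] (i::int)) = i * \<psi> x"
    "subgroup {x\<in>H. \<psi> x = 0} G"
proof -
  have m: "\<psi> (x \<otimes> y) = \<psi> x + \<psi> y" if "x \<in> H" "y \<in> H" for x y
    using assms that by (auto simp: zhom_def)
  note Hc = subgroup.mem_carrier[OF assms(2)]
  show one: "\<psi> \<one> = 0" using m[of \<one> \<one>] subgroup.one_closed[OF assms(2)] by simp
  have i: "\<psi> (inv x) = - \<psi> x" if "x \<in> H" for x
    using m[of x "inv x"] one that Hc subgroup.m_inv_closed[OF assms(2)] by simp
  show "x \<in> H \<Longrightarrow> \<psi> (inv x) = - \<psi> x" "x \<in> H \<Longrightarrow> y \<in> H \<Longrightarrow> \<psi> (x \<otimes> y) = \<psi> x + \<psi> y"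
    using i m by auto
  show "subgroup {x\<in>H. \<psi> x = 0} G"
  proof (rule subgroupI)
    show "{x\<in>H. \<psi> x = 0} \<subseteq> carrier G" using Hc by auto
    show "{x\<in>H. \<psi> x = 0} \<noteq> {}" using one subgroup.one_closed[OF assms(2)] by blast
    show "\<And>x. x \<in> {x\<in>H. \<psi> x = 0} \<Longrightarrow> inv x \<in> {x\<in>H. \<psi> x = 0}"
      using i subgroup.m_inv_closed[OF assms(2)] by simp
    show "\<And>x y. x \<in> {x\<in>H. \<psi> x = 0} \<Longrightarrow> y \<in> {x\<in>H. \<psi> x = 0} \<Longrightarrow> x \<otimes> y \<in> {x\<in>H. \<psi> x = 0}"
      using m subgroup.m_closed[OF assms(2)] by simp
  qed
  show "\<psi> (x [^] (i::int)) = i * \<psi> x" if x: "x \<in> H"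
  proof -
    have n: "x [^] (n::nat) \<in> H \<and> \<psi> (x [^] n) = int n * \<psi> x" for n
    proof (induction n)
      case 0 then show ?case using one subgroup.one_closed[OF assms(2)] by simp
    next
      case (Suc n)
      then show ?case using m[of "x [^] n" x] x subgroup.m_closed[OF assms(2), of "x [^] n" x]
        by (simp add: distrib_right)
    qed
    obtain k where "i = int k \<or> i = - int k" using int_cases2 by metis
    then show ?thesis
    proof
      assume "i = int k" then show ?thesis using n[of k] by (simp add: int_pow_int)
    next
      assume "i = - int k"
      then show ?thesis using n[of k] i[of "x [^] k"] Hc[OF x] by (simp add: int_pow_neg_int)
    qed
  qed
qed

text \<open>Generators are added one at a time. With \<open>K\<close> already reached, the group
  generated by \<open>K\<close> and \<open>a\<close> consists of the products \<open>k a^i\<close>,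
  because commutators lie in \<open>N\<close> and so \<open>a\<close> normalises \<open>K\<close>.
  Either a positive power of \<open>a\<close> lies in \<open>K\<close>, which gives a finite-index
  step, or the exponent \<open>i\<close> is well defined and is a map onto the integers.\<close>

lemma pc_abelian:
  assumes "finite A" "subgroup N G" "A \<subseteq> carrier G"
    "\<And>x y. x \<in> generate G (N \<union> A) \<Longrightarrow> y \<in> generate G (N \<union> A) \<Longrightarrow> x \<otimes> y \<otimes> inv x \<otimes> inv y \<in> N"
  shows "pc G N (generate G (N \<union> A))"
  using assms(1,3,4)
proof (induction A)
  case empty
  have "generate G N = N" using generate_subgroup_incl[of N N] assms(2) by (auto intro: generate.incl)
  then show ?case using pc.refl[OF assms(2)] by simp
next
  case (insert a A)
  define H where "H = generate G (N \<union> insert a A)"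
  define K where "K = generate G (N \<union> A)"
  have Nc: "N \<subseteq> carrier G" using subgroup.subset[OF assms(2)] .
  have Hs: "subgroup H G" and Ks: "subgroup K G"
    using Nc insert by (auto simp: H_def K_def intro!: generate_is_subgroup)
  have KH: "K \<subseteq> H" unfolding H_def K_def by (rule mono_generate) auto
  have NK: "N \<subseteq> K" unfolding K_def by (auto intro: generate.incl)
  have aH: "a \<in> H" unfolding H_def by (auto intro: generate.incl)
  note Hc = subgroup.mem_carrier[OF Hs]
  have Kc: "k \<in> carrier G" if "k \<in> K" for k using subgroup.mem_carrier[OF Ks that] .
  have ac: "a \<in> carrier G" using aH Hc by auto
  have com: "x \<otimes> y \<otimes> inv x \<otimes> inv y \<in> N" if "x \<in> H" "y \<in> H" for x y
    using insert(5) that unfolding H_def by auto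
  have IH: "pc G N K" unfolding K_def
  proof (rule insert(3))
    show "A \<subseteq> carrier G" using insert by auto
    fix x y assume "x \<in> generate G (N \<union> A)" "y \<in> generate G (N \<union> A)"
    then show "x \<otimes> y \<otimes> inv x \<otimes> inv y \<in> N" using com KH unfolding K_def by blast
  qed
  have conj: "x \<otimes> k \<otimes> inv x \<in> K" if "x \<in> H" "k \<in> K" for x k
  proof -
    have "x \<otimes> k \<otimes> inv x \<otimes> inv k \<in> K"
      using com[OF that(1) subsetD[OF KH that(2)]] NK by (rule subsetD[rotated])
    then have "(x \<otimes> k \<otimes> inv x \<otimes> inv k) \<otimes> k \<in> K"
      using that(2) by (rule subgroup.m_closed[OF Ks])
    moreover have "(x \<otimes> k \<otimes> inv x \<otimes> inv k) \<otimes> k = x \<otimes> k \<otimes> inv x"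
      using Hc[OF that(1)] Kc[OF that(2)] by (simp add: m_assoc)
    ultimately show ?thesis by simp
  qed
  let ?M = "{k \<otimes> a [^] i | k i. k \<in> K \<and> i \<in> (UNIV :: int set)}"
  have mul: "(k \<otimes> a [^] i) \<otimes> (k' \<otimes> a [^] j) = (k \<otimes> (a [^] i \<otimes> k' \<otimes> inv (a [^] i))) \<otimes> a [^] (i + j)"
    if "k \<in> K" "k' \<in> K" for k k' and i j :: int
  proof -
    have c: "k \<in> carrier G" "k' \<in> carrier G" using that Kc by auto
    have "(k \<otimes> p) \<otimes> (k' \<otimes> q) = (k \<otimes> (p \<otimes> k' \<otimes> inv p)) \<otimes> (p \<otimes> q)"
      if "p \<in> carrier G" "q \<in> carrier G" for p q
      using that c by (simp add: group_assoc_simps)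
    from this[of "a [^] i" "a [^] j"] show ?thesis using ac by (simp add: int_pow_mult)
  qed
  have conja: "a [^] i \<otimes> k \<otimes> inv (a [^] i) \<in> K" if "k \<in> K" for k and i :: int
    using conj[OF subgroup_int_pow_closed[OF Hs aH] that] .
  have M: "\<exists>k\<in>K. \<exists>i::int. h = k \<otimes> a [^] i" if "h \<in> H" for h
  proof -
    have "subgroup ?M G"
    proof (rule subgroupI)
      show "?M \<subseteq> carrier G" using Kc ac by auto
      show "?M \<noteq> {}" using subgroup.one_closed[OF Ks] by auto
      fix x assume "x \<in> ?M"
      then obtain k i where x: "k \<in> K" "x = k \<otimes> a [^] (i::int)" by auto
      have "inv x = (a [^] (-i) \<otimes> inv k \<otimes> inv (a [^] (-i))) \<otimes> a [^] (-i)"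
      proof -
        have "k \<in> carrier G" using x Kc by auto
        then show ?thesis using x ac by (simp add: group_assoc_simps int_pow_neg)
      qed
      moreover have "a [^] (-i) \<otimes> inv k \<otimes> inv (a [^] (-i)) \<in> K"
        by (rule conja[OF subgroup.m_inv_closed[OF Ks x(1)]])
      ultimately show "inv x \<in> ?M" by blast
    next
      fix x y assume "x \<in> ?M" "y \<in> ?M"
      then obtain k i k' j where x: "k \<in> K" "x = k \<otimes> a [^] (i::int)" "k' \<in> K" "y = k' \<otimes> a [^] (j::int)" by auto
      have "k \<otimes> (a [^] i \<otimes> k' \<otimes> inv (a [^] i)) \<in> K"
        by (rule subgroup.m_closed[OF Ks x(1) conja[OF x(3)]])
      then show "x \<otimes> y \<in> ?M" using mul[of k k' i j] x by blast
    qed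
    moreover have "N \<union> insert a A \<subseteq> ?M"
    proof
      fix x assume "x \<in> N \<union> insert a A"
      then consider "x = a" | "x \<in> K" unfolding K_def by (auto intro: generate.incl)
      then show "x \<in> ?M"
      proof cases
        case 1
        then have "x = \<one> \<otimes> a [^] (1::int)" using ac by simp
        then show ?thesis using subgroup.one_closed[OF Ks] by blast
      next
        case 2
        then have "x = x \<otimes> a [^] (0::int)" using Kc[of x] by simp
        then show ?thesis using 2 by blast
      qed
    qed
    ultimately have "H \<subseteq> ?M" unfolding H_def by (intro generate_subgroup_incl) auto
    then show ?thesis using that by blast
  qed
  then obtain kk ii where ki: "\<And>h. h \<in> H \<Longrightarrow> kk h \<in> K \<and> h = kk h \<otimes> a [^] (ii h :: int)" by metis
  have diff: "a [^] (i - j) \<in> K" if "k \<in> K" "k' \<in> K" "k \<otimes> a [^] i = k' \<otimes> a [^] j" for k k' and i j :: int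
  proof -
    have c: "k \<in> carrier G" "k' \<in> carrier G" "a \<in> carrier G" using that(1,2) Kc ac by auto
    have "a [^] i = inv k \<otimes> (k' \<otimes> a [^] j)" using c that by (simp add: inv_solve_left)
    then have "a [^] (i - j) = inv k \<otimes> (k' \<otimes> a [^] j) \<otimes> inv (a [^] j)" using c by (simp add: int_pow_diff)
    also have "\<dots> = inv k \<otimes> k'" using c by (simp add: m_assoc)
    finally show ?thesis using subgroup.m_closed[OF Ks subgroup.m_inv_closed[OF Ks that(1)] that(2)] by simp
  qed
  show ?case
  proof (cases "\<exists>m>0. a [^] (m::nat) \<in> K")
    case True
    then obtain m where m: "m > 0" "a [^] (m::nat) \<in> K" by auto
    have "findex G K H"
    \<comment> \<open>Equal residues make the exponents differ by a multiple of \<open>m\<close>,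
      and powers of \<open>a^m\<close> lie in \<open>K\<close>.\<close>
    proof (rule findexI[of "\<lambda>h. ii h mod int m"])
      have "(\<lambda>h. ii h mod int m) ` H \<subseteq> {0..<int m}" using m by auto
      then show "finite ((\<lambda>h. ii h mod int m) ` H)" using finite_subset by blast
      fix h h' assume h: "h \<in> H" "h' \<in> H" "ii h mod int m = ii h' mod int m"
      then obtain q where q: "ii h - ii h' = int m * q" by (metis mod_eq_dvd_iff dvd_def)
      have c: "kk h \<in> carrier G" "kk h' \<in> carrier G" "a \<in> carrier G" using ki[OF h(1)] ki[OF h(2)] Kc ac by auto
      have "h \<otimes> inv h' = (kk h \<otimes> a [^] ii h) \<otimes> inv (kk h' \<otimes> a [^] ii h')"
        using ki[OF h(1)] ki[OF h(2)] by presburger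
      also have "\<dots> = kk h \<otimes> a [^] (ii h - ii h') \<otimes> inv (kk h')"
        using c by (simp add: group_assoc_simps int_pow_diff)
      also have "a [^] (ii h - ii h') = (a [^] m) [^] q" using c unfolding q
        by (metis int_pow_int int_pow_pow)
      finally have e: "h \<otimes> inv h' = kk h \<otimes> (a [^] m) [^] q \<otimes> inv (kk h')" .
      show "h \<otimes> inv h' \<in> K" unfolding e using ki[OF h(1)] ki[OF h(2)] m(2)
        by (intro subgroup.m_closed[OF Ks] subgroup.m_inv_closed[OF Ks] subgroup_int_pow_closed[OF Ks]) auto
    qed
    then show ?thesis using pc.fin[OF IH Hs KH] unfolding H_def by blast
  next
    case False
    have un: "i = j" if "k \<in> K" "k' \<in> K" "k \<otimes> a [^] i = k' \<otimes> a [^] j" for k k' and i j :: int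
    proof (rule ccontr)
      assume "i \<noteq> j"
      have "a [^] (i - j) \<in> K" "a [^] (j - i) \<in> K" using diff[OF that] diff[OF that(2,1) that(3)[symmetric]] by auto
      then have "a [^] (int (nat \<bar>i - j\<bar>)) \<in> K" by (cases "i \<ge> j") auto
      then have "a [^] (nat \<bar>i - j\<bar>) \<in> K" unfolding int_pow_int .
      moreover have "nat \<bar>i - j\<bar> > 0" using \<open>i \<noteq> j\<close> by simp
      ultimately show False using False by blast
    qed
    have "zhom G H ii" unfolding zhom_def
    proof (intro conjI ballI)
      fix x y assume xy: "x \<in> H" "y \<in> H"
      let ?k = "kk x \<otimes> (a [^] ii x \<otimes> kk y \<otimes> inv (a [^] ii x))"
      have k: "?k \<in> K"
        by (rule subgroup.m_closed[OF Ks ki[OF xy(1), THEN conjunct1] conja[OF ki[OF xy(2), THEN conjunct1]]])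
      have e: "x \<otimes> y = ?k \<otimes> a [^] (ii x + ii y)"
        by (rule trans[OF arg_cong2[of _ _ _ _ "(\<otimes>)", OF conjunct2[OF ki[OF xy(1)]] conjunct2[OF ki[OF xy(2)]]]
              mul[OF conjunct1[OF ki[OF xy(1)]] conjunct1[OF ki[OF xy(2)]]]])
      have k2: "kk (x \<otimes> y) \<in> K \<and> x \<otimes> y = kk (x \<otimes> y) \<otimes> a [^] ii (x \<otimes> y)"
        by (rule ki[OF subgroup.m_closed[OF Hs xy]])
      show "ii (x \<otimes> y) = ii x + ii y"
        by (rule un[OF conjunct1[OF k2] k trans[OF conjunct2[OF k2, symmetric] e]])
    next
      have "kk a \<in> K" "a = kk a \<otimes> a [^] ii a" using ki aH by auto
      moreover have "a = \<one> \<otimes> a [^] (1::int)" using ac by simp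
      ultimately have "ii a = 1" using un[of "kk a" \<one> "ii a" 1] subgroup.one_closed[OF Ks] by presburger
      then show "\<exists>t\<in>H. ii t = 1" using aH by auto
    qed
    moreover have "K = {x\<in>H. ii x = 0}"
    proof (intro subset_antisym subsetI)
      fix x assume x: "x \<in> K"
      then have "kk x \<in> K \<and> x = kk x \<otimes> a [^] ii x" "x = x \<otimes> a [^] (0::int)" using ki[of x] KH Kc[of x] by auto
      then have "ii x = 0" using un[of "kk x" x "ii x" 0] x by presburger
      then show "x \<in> {x\<in>H. ii x = 0}" using x KH by auto
    next
      fix x assume x: "x \<in> {x\<in>H. ii x = 0}"
      then have "x = kk x \<otimes> \<one> \<and> kk x \<in> K" using ki[of x] by auto
      then have "x = kk x" "kk x \<in> K" using Kc[of "kk x"] by auto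
      then show "x \<in> K" by metis
    qed
    ultimately show ?thesis using pc.zstep[OF IH Hs] unfolding H_def by blast
  qed
qed

lemma pc_abelian_quotient:
  assumes "sgen G S H" "subgroup N G" "N \<subseteq> H"
    "\<And>x y. x \<in> H \<Longrightarrow> y \<in> H \<Longrightarrow> x \<otimes> y \<otimes> inv x \<otimes> inv y \<in> N"
  shows "pc G N H"
proof -
  have Hs: "subgroup H G" using sgen_subgroup assms by auto
  have s: "finite S" "S \<subseteq> carrier G" "S \<subseteq> H" using assms sgen_subset by (auto simp: sgen_def symgen_def)
  have "generate G (N \<union> S) = H"
  proof
    show "generate G (N \<union> S) \<subseteq> H" using s assms Hs by (intro generate_subgroup_incl) auto
    have "generate G S \<subseteq> generate G (N \<union> S)" by (rule mono_generate) auto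
    then show "H \<subseteq> generate G (N \<union> S)" using sgen_generate_iff[OF assms(1)] by simp
  qed
  then show ?thesis using pc_abelian[OF s(1) assms(2) s(2)] assms(4) by auto
qed

text \<open>From the top of the chain downwards, finite-index steps are skipped until the first
  integer step; without one the whole chain would have finite index.\<close>

lemma pc_infinite_zhom:
  assumes "pc G N H" "\<not> findex G N H"
  shows "\<exists>K \<psi>. subgroup K G \<and> K \<subseteq> H \<and> findex G K H \<and> zhom G K \<psi>"
  using assms
proof (induction rule: pc.induct)
  case (refl N) then show ?case using findex_refl by auto
next
  case (fin N K H)
  have s: "subgroup N G" "subgroup K G" using pc_subgroups fin by auto
  then have "\<not> findex G N K" using fin findex_trans by blast
  then obtain L \<psi> where "subgroup L G" "L \<subseteq> K" "findex G L K" "zhom G L \<psi>" using fin by blast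
  then show ?case using findex_trans[of L K H] s fin by blast
next
  case (zstep N K H \<psi>)
  then show ?case using findex_refl by auto
qed

end

section \<open>Milnor's lemma\<close>

text \<open>The word \<open>a^e1 t a^e2 t ...\<close> with exponents 0 or 1. There are
  \<open>2^m\<close> of them with \<open>m\<close> bits, and Milnor's pigeonhole argument plays this
  number against the size of a ball.\<close>

primrec bitword :: "('a, 'b) monoid_scheme \<Rightarrow> 'a \<Rightarrow> 'a \<Rightarrow> bool list \<Rightarrow> 'a" where
  "bitword G a t [] = \<one>\<^bsub>G\<^esub>"
| "bitword G a t (b # bs) = (if b then a else \<one>\<^bsub>G\<^esub>) \<otimes>\<^bsub>G\<^esub> (t \<otimes>\<^bsub>G\<^esub> bitword G a t bs)"

context group
begin

definition cj :: "'a \<Rightarrow> int \<Rightarrow> 'a \<Rightarrow> 'a" where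
  "cj t i x = t [^] i \<otimes> x \<otimes> t [^] (- i)"

lemma cj_closed [simp]: "t \<in> carrier G \<Longrightarrow> x \<in> carrier G \<Longrightarrow> cj t i x \<in> carrier G"
  by (simp add: cj_def)

lemma cj_0 [simp]: "t \<in> carrier G \<Longrightarrow> x \<in> carrier G \<Longrightarrow> cj t 0 x = x"
  by (simp add: cj_def)

lemma cj_mult: "t \<in> carrier G \<Longrightarrow> x \<in> carrier G \<Longrightarrow> y \<in> carrier G \<Longrightarrow> cj t i (x \<otimes> y) = cj t i x \<otimes> cj t i y"
  by (simp add: cj_def group_assoc_simps int_pow_neg)

lemma cj_inv: "t \<in> carrier G \<Longrightarrow> x \<in> carrier G \<Longrightarrow> cj t i (inv x) = inv (cj t i x)"
  by (simp add: cj_def group_assoc_simps int_pow_neg)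

lemma cj_one: "t \<in> carrier G \<Longrightarrow> cj t i \<one> = \<one>"
  by (simp add: cj_def group_assoc_simps int_pow_neg)

lemma cj_add:
  assumes "t \<in> carrier G" "x \<in> carrier G" shows "cj t i (cj t j x) = cj t (i + j) x"
proof -
  have "p \<otimes> (q \<otimes> x \<otimes> inv q) \<otimes> inv p = (p \<otimes> q) \<otimes> x \<otimes> inv (p \<otimes> q)" if "p \<in> carrier G" "q \<in> carrier G" for p q
    using that assms by (simp add: group_assoc_simps)
  moreover have "t [^] (- (i + j)) = inv (t [^] i \<otimes> t [^] j)"
    using assms by (simp only: int_pow_neg int_pow_mult)
  ultimately show ?thesis
    using assms unfolding cj_def by (simp only: int_pow_mult int_pow_neg int_pow_closed)
qed

lemma cj_inv_base: "t \<in> carrier G \<Longrightarrow> cj (inv t) i x = cj t (- i) x"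
  by (simp add: cj_def int_pow_inv int_pow_neg)

lemma cj_generate:
  assumes "t \<in> carrier G" "B \<subseteq> carrier G" "subgroup L G" "\<And>x. x \<in> B \<Longrightarrow> cj t i x \<in> L" "y \<in> generate G B"
  shows "cj t i y \<in> L"
  using assms(5)
proof (induction rule: generate.induct)
  case one then show ?case using cj_one assms by (simp add: subgroup.one_closed)
next
  case (incl h) then show ?case using assms by auto
next
  case (inv h)
  then show ?case using assms cj_inv[of t h i] subgroup.m_inv_closed[OF assms(3)] by auto
next
  case (eng h1 h2)
  then have "h1 \<in> carrier G" "h2 \<in> carrier G" using generate_in_carrier[OF assms(2)] by auto
  then show ?case using eng assms cj_mult[of t h1 h2 i] subgroup.m_closed[OF assms(3)] by auto
qed

lemma bitword_closed: "a \<in> carrier G \<Longrightarrow> t \<in> carrier G \<Longrightarrow> bitword G a t bs \<in> carrier G"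
  by (induction bs) auto

lemma bitword_wball:
  assumes "symgen G S" "a \<in> wball G S c" "t \<in> wball G S c"
  shows "bitword G a t bs \<in> wball G S (2 * c * length bs)"
proof (induction bs)
  case Nil then show ?case by simp
next
  case (Cons b bs)
  have S: "S \<subseteq> carrier G" using assms by (auto simp: symgen_def)
  have "(if b then a else \<one>) \<in> wball G S c" using assms one_in_wball by auto
  then have "bitword G a t (b # bs) \<in> wball G S (c + (c + 2 * c * length bs))"
    unfolding bitword.simps by (intro wball_add S assms(3) Cons)
  then show ?case by (simp add: algebra_simps)
qed

text \<open>The common prefix cancels. At the first differing bit one side has \<open>a\<close> and
  the other does not; \<open>u\<close> and \<open>v\<close> are the tails after it, ordered so that
  the extra \<open>a\<close> stands on the left.\<close>

lemma bitword_diff: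
  assumes "a \<in> carrier G" "t \<in> carrier G"
  shows "length x = length y \<Longrightarrow> x \<noteq> y \<Longrightarrow> bitword G a t x = bitword G a t y \<Longrightarrow>
    \<exists>u v. length u = length v \<and> a \<otimes> (t \<otimes> bitword G a t u) = t \<otimes> bitword G a t v"
proof (induction x y rule: list_induct2)
  case Nil then show ?case by simp
next
  case (Cons b x b' y)
  have c: "bitword G a t x \<in> carrier G" "bitword G a t y \<in> carrier G" using bitword_closed assms by auto
  show ?case
  proof (cases "b = b'")
    case True
    then have "x \<noteq> y" using Cons by auto
    moreover have "bitword G a t x = bitword G a t y"
      using Cons(4) True assms c by (auto split: if_splits)
    ultimately show ?thesis using Cons by auto
  next
    case False
    then have "a \<otimes> (t \<otimes> bitword G a t x) = t \<otimes> bitword G a t y \<or> a \<otimes> (t \<otimes> bitword G a t y) = t \<otimes> bitword G a t x"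
      using Cons(4) assms c by (cases b) auto
    then show ?thesis using Cons(1) by metis
  qed
qed

text \<open>Moving every \<open>t\<close> to the right turns the word into a product of conjugates
  \<open>t^i a t^-i\<close>, with \<open>i\<close> below its length, followed by a power of
  \<open>t\<close>.\<close>

lemma bitword_normal:
  assumes "a \<in> carrier G" "t \<in> carrier G"
  shows "\<exists>g \<in> generate G ((\<lambda>i. cj t (int i) a) ` {..<length u}). bitword G a t u = g \<otimes> t [^] int (length u)"
proof (induction u)
  case Nil show ?case using generate.one by (auto intro!: bexI[of _ \<one>])
next
  case (Cons b u)
  let ?X = "\<lambda>n. (\<lambda>i. cj t (int i) a) ` {..<n}"
  have Xc: "?X n \<subseteq> carrier G" for n using assms by auto
  obtain g where g: "g \<in> generate G (?X (length u))" "bitword G a t u = g \<otimes> t [^] int (length u)" using Cons by auto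
  have gc: "g \<in> carrier G" using generate_in_carrier[OF Xc g(1)] .
  let ?L = "generate G (?X (Suc (length u)))"
  have Ls: "subgroup ?L G" by (rule generate_is_subgroup[OF Xc])
  have 1: "cj t 1 g \<in> ?L"
  proof (rule cj_generate[OF assms(2) Xc Ls _ g(1)])
    fix x assume "x \<in> ?X (length u)"
    then obtain i where i: "i < length u" "x = cj t (int i) a" by auto
    then have "cj t 1 x = cj t (int (Suc i)) a" using cj_add assms by simp
    then show "cj t 1 x \<in> ?L" using i by (intro generate.incl) blast
  qed
  have "a \<in> ?X (Suc (length u))" using assms by (intro image_eqI[of _ _ 0]) auto
  then have a: "(if b then a else \<one>) \<in> ?L" by (simp add: generate.incl generate.one)
  have "bitword G a t (b # u) = ((if b then a else \<one>) \<otimes> cj t 1 g) \<otimes> t [^] int (length (b # u))"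
  proof -
    have "t [^] (int (length (b # u))) = t \<otimes> t [^] int (length u)"
      using assms int_pow_mult[of t 1 "int (length u)"] by simp
    then show ?thesis using gc assms g(2) by (simp add: cj_def group_assoc_simps int_pow_neg)
  qed
  then show ?case using generate.eng[OF a 1] by (intro bexI[of _ "(if b then a else \<one>) \<otimes> cj t 1 g"]) auto
qed

text \<open>A coincidence of two words expresses \<open>t^-1 a t\<close> through the conjugates of
  \<open>a\<close> by \<open>t^i\<close> with \<open>0 <= i < l\<close>. The subgroup generated by
  these is then mapped into itself by conjugation with \<open>t^-1\<close>, so it contains all the
  negative conjugates.\<close>

lemma milnor_conjugates:
  assumes "sgen G S H" "subexp G S" "a \<in> H" "t \<in> H"
  shows "\<exists>l. \<forall>j\<ge>1. cj t (- int j) a \<in> generate G ((\<lambda>i. cj t (int i) a) ` {..<l})"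
proof -
  have s: "symgen G S" and Hs: "subgroup H G" using assms sgen_subgroup by (auto simp: sgen_def)
  have c: "a \<in> carrier G" "t \<in> carrier G" using assms subgroup.mem_carrier[OF Hs] by auto
  obtain d where d: "{a, t} \<subseteq> wball G S d" using sgen_finite_subset[OF assms(1), of "{a,t}"] assms by auto
  obtain m where m: "card (wball G S (2 * d * m)) < 2 ^ m" using assms(2) by (auto simp: subexp_def)
  let ?L = "{bs :: bool list. length bs = m}"
  have cL: "card ?L = 2 ^ m" "finite ?L" using card_lists_length_eq[of "UNIV :: bool set" m] finite_lists_length_eq[of "UNIV :: bool set" m] by auto
  have "bitword G a t ` ?L \<subseteq> wball G S (2 * d * m)" using bitword_wball[OF s] d by auto
  then have "card (bitword G a t ` ?L) \<le> card (wball G S (2 * d * m))"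
    using s by (intro card_mono finite_wball) (auto simp: symgen_def)
  then have "\<not> inj_on (bitword G a t) ?L" using m cL card_image by fastforce
  then obtain x y where "length x = m" "length y = m" "x \<noteq> y" "bitword G a t x = bitword G a t y"
    by (auto simp: inj_on_def)
  then obtain u v where uv: "length u = length v" "a \<otimes> (t \<otimes> bitword G a t u) = t \<otimes> bitword G a t v"
    using bitword_diff[OF c] by metis
  define l where "l = length u"
  let ?X = "(\<lambda>i. cj t (int i) a) ` {..<l}"
  have Xc: "?X \<subseteq> carrier G" using c by auto
  have Ls: "subgroup (generate G ?X) G" by (rule generate_is_subgroup[OF Xc])
  obtain g h where gh: "g \<in> generate G ?X" "h \<in> generate G ?X"
    "bitword G a t u = g \<otimes> t [^] int l" "bitword G a t v = h \<otimes> t [^] int l"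
    using bitword_normal[OF c, of u] bitword_normal[OF c, of v] uv unfolding l_def by auto
  have ghc: "g \<in> carrier G" "h \<in> carrier G" using generate_in_carrier[OF Xc] gh by auto
  have "(a \<otimes> (t \<otimes> g)) \<otimes> t [^] int l = (t \<otimes> h) \<otimes> t [^] int l" using uv(2) gh ghc c by (simp add: m_assoc)
  then have "a \<otimes> (t \<otimes> g) = t \<otimes> h" using ghc c by (subst (asm) right_cancel) auto
  then have "(inv t \<otimes> a \<otimes> t) \<otimes> g = h" using ghc c by (simp add: m_assoc)
  then have "inv t \<otimes> a \<otimes> t = h \<otimes> inv g" using ghc c by (metis inv_solve_right m_closed inv_closed)
  then have 1: "cj t (-1) a \<in> generate G ?X"
    using c gh subgroup.m_closed[OF Ls] subgroup.m_inv_closed[OF Ls] by (simp add: cj_def int_pow_neg)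
  \<comment> \<open>Conjugation by \<open>t^-1\<close> lowers the index of each generator by one; at
    index 0 it produces the element that was just expressed.\<close>
  have step: "cj t (-1) x \<in> generate G ?X" if "x \<in> generate G ?X" for x
  proof (rule cj_generate[OF c(2) Xc Ls _ that])
    fix y assume "y \<in> ?X"
    then obtain i where i: "i < l" "y = cj t (int i) a" by auto
    show "cj t (-1) y \<in> generate G ?X"
    proof (cases i)
      case 0 then show ?thesis using 1 i c by simp
    next
      case (Suc i')
      then have "cj t (-1) y = cj t (int i') a" using i c cj_add by simp
      then show ?thesis using i Suc by (auto intro!: generate.incl)
    qed
  qed
  have "cj t (- int (Suc j)) a \<in> generate G ?X" for j
  proof (induction j)
    case 0 then show ?case using 1 by simp
  next
    case (Suc j)
    have "cj t (- int (Suc (Suc j))) a = cj t (-1) (cj t (- int (Suc j)) a)" using cj_add[OF c(2,1), of "-1" "- int (Suc j)"] by simp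
    then show ?case using step[OF Suc] by simp
  qed
  then have "cj t (- int j) a \<in> generate G ?X" if "j \<ge> 1" for j using that by (cases j) auto
  then show ?thesis by blast
qed

text \<open>The kernel is generated by the conjugates, under all powers of \<open>t\<close>, of the
  generators \<open>s\<close> corrected by \<open>t\<close> to the power \<open>- \<psi> s\<close>.
  The conjugation lemma for \<open>t\<close> reduces the negative powers to finitely many
  conjugates, and for \<open>inv t\<close> the positive ones.\<close>

lemma milnor_kernel:
  assumes "sgen G S H" "subexp G S" "zhom G H \<psi>"
  shows "\<exists>T. sgen G T {x\<in>H. \<psi> x = 0}"
proof -
  let ?K = "{x\<in>H. \<psi> x = 0}"
  have s: "symgen G S" and Hs: "subgroup H G" using assms sgen_subgroup by (auto simp: sgen_def)
  note z = zhom_facts[OF assms(3) Hs]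
  have Hc: "x \<in> carrier G" if "x \<in> H" for x using subgroup.mem_carrier[OF Hs that] .
  obtain t where t: "t \<in> H" "\<psi> t = 1" using assms(3) by (auto simp: zhom_def)
  have tc: "t \<in> carrier G" using t Hc by auto
  have tp: "t [^] (i::int) \<in> H" for i using subgroup_int_pow_closed[OF Hs t(1)] .
  define A where "A = (\<lambda>s. s \<otimes> t [^] (- \<psi> s)) ` S"
  have SH: "S \<subseteq> H" using sgen_subset assms by auto
  have AK: "A \<subseteq> ?K"
  proof
    fix x assume "x \<in> A"
    then obtain r where r: "r \<in> S" "x = r \<otimes> t [^] (- \<psi> r)" by (auto simp: A_def)
    then have "x \<in> H" "\<psi> x = \<psi> r + - \<psi> r * \<psi> t"
      using SH subgroup.m_closed[OF Hs _ tp] z(3)[OF _ tp] z(4)[OF t(1)] by auto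
    then show "x \<in> ?K" using t by simp
  qed
  have Ac: "A \<subseteq> carrier G" "finite A" using AK Hc s by (auto simp: A_def symgen_def)
  have cjK: "cj t i x \<in> ?K" if "x \<in> ?K" for x i
  proof -
    have "cj t i x \<in> H" unfolding cj_def using that t Hs subgroup_conj_int by auto
    moreover have "\<psi> (cj t i x) = i + \<psi> x + - i"
      unfolding cj_def using that tp subgroup.m_closed[OF Hs] z(3) z(4)[OF t(1)] t(2) by simp
    ultimately show ?thesis using that by auto
  qed
  have "\<exists>l1 l2. \<forall>j\<ge>1. cj t (- int j) a \<in> generate G ((\<lambda>i. cj t (int i) a) ` {..<l1}) \<and>
     cj t (int j) a \<in> generate G ((\<lambda>i. cj t (- int i) a) ` {..<l2})" if "a \<in> A" for a
  proof -
    have a: "a \<in> H" using that AK by auto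
    obtain l1 where "\<forall>j\<ge>1. cj t (- int j) a \<in> generate G ((\<lambda>i. cj t (int i) a) ` {..<l1})"
      using milnor_conjugates[OF assms(1,2) a t(1)] by auto
    moreover obtain l2 where "\<forall>j\<ge>1. cj (inv t) (- int j) a \<in> generate G ((\<lambda>i. cj (inv t) (int i) a) ` {..<l2})"
      using milnor_conjugates[OF assms(1,2) a subgroup.m_inv_closed[OF Hs t(1)]] by auto
    ultimately show ?thesis using tc by (simp add: cj_inv_base) blast
  qed
  then obtain l1 l2 where l: "\<And>a j. a \<in> A \<Longrightarrow> j \<ge> 1 \<Longrightarrow>
     cj t (- int j) a \<in> generate G ((\<lambda>i. cj t (int i) a) ` {..<l1 a}) \<and>
     cj t (int j) a \<in> generate G ((\<lambda>i. cj t (- int i) a) ` {..<l2 a})" by metis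
  define Y where "Y = (\<Union>a\<in>A. insert a ((\<lambda>i. cj t (int i) a) ` {..<l1 a} \<union> (\<lambda>i. cj t (- int i) a) ` {..<l2 a}))"
  have YK: "Y \<subseteq> ?K" "finite Y" using AK cjK Ac by (auto simp: Y_def)
  have Yc: "Y \<subseteq> carrier G" using YK Hc by auto
  have cjY: "cj t i a \<in> generate G Y" if "a \<in> A" for i a
  proof -
    have m1: "generate G ((\<lambda>i. cj t (int i) a) ` {..<l1 a}) \<subseteq> generate G Y"
      using that by (intro mono_generate) (auto simp: Y_def)
    have m2: "generate G ((\<lambda>i. cj t (- int i) a) ` {..<l2 a}) \<subseteq> generate G Y"
      using that by (intro mono_generate) (auto simp: Y_def)
    consider "i = 0" | "i = int (nat i)" "nat i \<ge> 1" | "i = - int (nat (- i))" "nat (-i) \<ge> 1" by linarith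
    then show ?thesis
    proof cases
      case 1
      moreover have "cj t 0 a = a" using that Ac tc by auto
      moreover have "a \<in> Y" using that by (auto simp: Y_def)
      ultimately show ?thesis by (simp add: generate.incl)
    next
      case 2 then show ?thesis using l[OF that 2(2)] m2 by auto
    next
      case 3 then show ?thesis using l[OF that 3(2)] m1 by auto
    qed
  qed
  \<comment> \<open>Appending a letter \<open>r\<close> to \<open>y\<close> multiplies the corrected
    \<open>y\<close> by a conjugate of the corrected \<open>r\<close> under \<open>t\<close> to the
    power \<open>\<psi> y\<close>.\<close>
  have main: "x \<otimes> t [^] (- \<psi> x) \<in> generate G Y" if "x \<in> wball G S n" for x n
    using that
  proof (induction n arbitrary: x)
    case 0 then show ?case using z(1) generate.one by auto
  next
    case (Suc n)
    then obtain y r where yr: "y \<in> wball G S n" "r \<in> S" "x = y \<otimes> r"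
      using Suc.prems unfolding wball_Suc2[OF s] by blast
    have H: "y \<in> H" "r \<in> H" using yr SH wball_subgroup[OF Hs SH] by auto
    have c: "y \<in> carrier G" "r \<in> carrier G" using H Hc by auto
    have 1: "y \<otimes> t [^] (- \<psi> y) \<in> generate G Y" using Suc yr by auto
    have 2: "cj t (\<psi> y) (r \<otimes> t [^] (- \<psi> r)) \<in> generate G Y" using cjY yr by (auto simp: A_def)
    have "x \<otimes> t [^] (- \<psi> x) = (y \<otimes> t [^] (- \<psi> y)) \<otimes> cj t (\<psi> y) (r \<otimes> t [^] (- \<psi> r))"
    proof -
      have "y \<otimes> r \<otimes> inv (p \<otimes> q) = (y \<otimes> inv p) \<otimes> (p \<otimes> (r \<otimes> inv q) \<otimes> inv p)"
        if "p \<in> carrier G" "q \<in> carrier G" for p q using that c by (simp add: group_assoc_simps)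
      moreover have "t [^] (- \<psi> x) = inv (t [^] \<psi> y \<otimes> t [^] \<psi> r)"
        unfolding yr(3) z(3)[OF H] using tc by (simp only: int_pow_neg int_pow_mult)
      ultimately show ?thesis
        using yr(3) tc by (simp only: cj_def int_pow_neg int_pow_closed)
    qed
    then show ?case using generate.eng[OF 1 2] by simp
  qed
  have "generate G Y = ?K"
  proof
    show "generate G Y \<subseteq> ?K" using generate_subgroup_incl[OF YK(1) z(5)] .
    show "?K \<subseteq> generate G Y"
    proof
      fix x assume x: "x \<in> ?K"
      then obtain n where "x \<in> wball G S n" using assms(1) by (auto simp: sgen_def)
      then show "x \<in> generate G Y" using main[of x n] x Hc by auto
    qed
  qed
  then show ?thesis using sgen_generate[OF YK(2) Yc] by auto
qed

text \<open>Schreier's lemma passes finite generation down a finite-index step and Milnor's lemma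
  down an integer step; weak subexponential growth is inherited by each subgroup reached.\<close>

lemma pc_fg:
  assumes "pc G N H" "sgen G S H" "subexp G S"
  shows "\<exists>T. sgen G T N \<and> subexp G T"
  using assms
proof (induction arbitrary: S rule: pc.induct)
  case (refl N) then show ?case by auto
next
  case (fin N K H)
  then obtain T where T: "sgen G T K" using schreier[of S H K] pc_subgroups by blast
  then show ?case using fin subexp_subset by blast
next
  case (zstep N K H \<psi>)
  then obtain T where T: "sgen G T K" using milnor_kernel by blast
  then have "subexp G T" using zstep subexp_subset[of S H T K] by blast
  then show ?case using zstep T by blast
qed

end

section \<open>Finite-index subgroups of the base of an extension\<close>

text \<open>A numerical bound on the index, preserved by conjugation, which makes the subgroups
  below it countable in finite number.\<close>

definition index_le :: "('a, 'b) monoid_scheme \<Rightarrow> 'a set \<Rightarrow> 'a set \<Rightarrow> nat \<Rightarrow> bool" where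
  "index_le G K H n \<longleftrightarrow> (\<exists>F. finite F \<and> card F \<le> n \<and> F \<subseteq> H \<and> (\<forall>h\<in>H. \<exists>f\<in>F. h \<otimes>\<^bsub>G\<^esub> inv\<^bsub>G\<^esub> f \<in> K))"

context group
begin

lemma index_le_findex: "index_le G K H n \<Longrightarrow> findex G K H"
  unfolding index_le_def findex_def by blast

lemma findex_index_le: "findex G K H \<Longrightarrow> \<exists>n. index_le G K H n"
  unfolding index_le_def findex_def by blast

text \<open>A subgroup of index at most \<open>n\<close> is determined by the action of the generators on its numbered
  cosets; this is why a finitely generated group has finitely many of them.\<close>

lemma coset_table:
  assumes "sgen G S H" "subgroup L G" "L \<subseteq> H" "index_le G L H n"
  shows "\<exists>cl \<tau>. \<tau> \<in> ({..n} \<times> S) \<rightarrow>\<^sub>E {..n} \<and> cl \<one> = 0 \<and> (\<forall>y\<in>H. \<forall>s\<in>S. cl (y \<otimes> s) = \<tau> (cl y, s)) \<and>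
    (\<forall>h\<in>H. h \<in> L \<longleftrightarrow> cl h = (0::nat))"
proof -
  have s: "symgen G S" and Hs: "subgroup H G" using assms sgen_subgroup by (auto simp: sgen_def)
  have Hc: "x \<in> carrier G" if "x \<in> H" for x using subgroup.mem_carrier[OF Hs that] .
  have SH: "S \<subseteq> H" using sgen_subset assms by auto
  obtain F where F: "finite F" "card F \<le> n" "F \<subseteq> H" "\<forall>h\<in>H. \<exists>f\<in>F. h \<otimes> inv f \<in> L"
    using assms by (auto simp: index_le_def)
  obtain r0 where r0: "bij_betw r0 {0..<card F} F" using ex_bij_betw_nat_finite[OF F(1)] by auto
  \<comment> \<open>Number 0 is reserved for the identity, so that class 0 is \<open>L\<close>
    itself; the members of \<open>F\<close> follow as 1 to \<open>card F\<close>. Taking the least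
    applicable number makes the class depend on the coset alone.\<close>
  define r where "r i = (if i = 0 \<or> i > card F then \<one> else r0 (i - 1))" for i
  have rH: "r i \<in> H" for i
    using bij_betwE[OF r0] F(3) subgroup.one_closed[OF Hs] by (auto simp: r_def)
  have ex: "\<exists>i\<le>n. h \<otimes> inv (r i) \<in> L" if h: "h \<in> H" for h
  proof -
    obtain f where f: "f \<in> F" "h \<otimes> inv f \<in> L" using F(4) h by auto
    then have "f \<in> r0 ` {0..<card F}" using r0 by (simp add: bij_betw_def)
    then obtain j where "j < card F" "f = r0 j" by auto
    then have "r (Suc j) = f" "Suc j \<le> n" using F(2) by (auto simp: r_def)
    then show ?thesis using f by metis
  qed
  define cl where "cl h = (LEAST i. h \<otimes> inv (r i) \<in> L)" for h
  have cl: "h \<otimes> inv (r (cl h)) \<in> L" if "h \<in> H" for h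
    unfolding cl_def using ex[OF that] by (metis (mono_tags, lifting) LeastI)
  have cln: "cl h \<le> n" if h: "h \<in> H" for h
  proof -
    obtain i where "i \<le> n" "h \<otimes> inv (r i) \<in> L" using ex[OF h] by auto
    then show ?thesis unfolding cl_def using Least_le[of "\<lambda>i. h \<otimes> inv (r i) \<in> L" i] by simp
  qed
  have cleq: "cl x = cl y" if "x \<in> H" "y \<in> H" "x \<otimes> inv y \<in> L" for x y
  proof -
    have c: "x \<in> carrier G" "y \<in> carrier G" "r i \<in> carrier G" for i using that rH Hc by auto
    have "x \<otimes> inv (r i) \<in> L \<longleftrightarrow> y \<otimes> inv (r i) \<in> L" for i
    proof
      assume "y \<otimes> inv (r i) \<in> L"
      then have "(x \<otimes> inv y) \<otimes> (y \<otimes> inv (r i)) \<in> L" by (rule subgroup.m_closed[OF assms(2) that(3)])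
      then show "x \<otimes> inv (r i) \<in> L" using c by (simp add: group_assoc_simps)
    next
      assume "x \<otimes> inv (r i) \<in> L"
      then have "inv (x \<otimes> inv y) \<otimes> (x \<otimes> inv (r i)) \<in> L"
        by (rule subgroup.m_closed[OF assms(2) subgroup.m_inv_closed[OF assms(2) that(3)]])
      then show "y \<otimes> inv (r i) \<in> L" using c by (simp add: group_assoc_simps)
    qed
    then show ?thesis by (simp add: cl_def)
  qed
  define \<tau> where "\<tau> = (\<lambda>(i,s)\<in>{..n} \<times> S. cl (r i \<otimes> s))"
  show ?thesis
  proof (intro exI[of _ cl] exI[of _ \<tau>] conjI ballI)
    have "r i \<otimes> s \<in> H" if "s \<in> S" for i s using subgroup.m_closed[OF Hs rH] SH that by auto
    then show "\<tau> \<in> ({..n} \<times> S) \<rightarrow>\<^sub>E {..n}" using cln by (auto simp: \<tau>_def)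
    have "\<one> \<otimes> inv (r 0) \<in> L" using subgroup.one_closed[OF assms(2)] by (simp add: r_def)
    then show c1: "cl \<one> = 0" unfolding cl_def by (simp add: Least_eq_0)
    fix h assume h: "h \<in> H"
    show "h \<in> L \<longleftrightarrow> cl h = 0"
    proof
      assume "h \<in> L"
      then have "h \<otimes> inv (r 0) \<in> L" using Hc h by (simp add: r_def)
      then show "cl h = 0" unfolding cl_def by (simp add: Least_eq_0)
    next
      assume "cl h = 0"
      then show "h \<in> L" using cl[OF h] Hc h by (simp add: r_def)
    qed
  next
    fix y s assume ys: "y \<in> H" "s \<in> S"
    have c: "y \<in> carrier G" "s \<in> carrier G" "r (cl y) \<in> carrier G" using ys SH rH Hc by auto
    have "(y \<otimes> s) \<otimes> inv (r (cl y) \<otimes> s) = y \<otimes> inv (r (cl y))" using c by (simp add: group_assoc_simps)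
    then have "cl (y \<otimes> s) = cl (r (cl y) \<otimes> s)"
      using cl[OF ys(1)] subgroup.m_closed[OF Hs] ys SH rH by (intro cleq) auto
    then show "cl (y \<otimes> s) = \<tau> (cl y, s)" using cln ys by (simp add: \<tau>_def)
  qed
qed

lemma finite_bounded_index:
  assumes "sgen G S H"
  shows "finite {L. subgroup L G \<and> L \<subseteq> H \<and> index_le G L H n}" (is "finite ?\<L>")
proof -
  have s: "symgen G S" using assms by (auto simp: sgen_def)
  have "\<forall>L\<in>?\<L>. \<exists>cl \<tau>. \<tau> \<in> ({..n} \<times> S) \<rightarrow>\<^sub>E {..n} \<and> cl \<one> = 0 \<and> (\<forall>y\<in>H. \<forall>s\<in>S. cl (y \<otimes> s) = \<tau> (cl y, s)) \<and>
    (\<forall>h\<in>H. h \<in> L \<longleftrightarrow> cl h = (0::nat))" using coset_table[OF assms] by blast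
  then have "\<forall>L\<in>?\<L>. \<exists>p. snd p \<in> ({..n} \<times> S) \<rightarrow>\<^sub>E {..n} \<and> fst p \<one> = 0 \<and> (\<forall>y\<in>H. \<forall>s\<in>S. fst p (y \<otimes> s) = snd p (fst p y, s)) \<and>
    (\<forall>h\<in>H. h \<in> L \<longleftrightarrow> fst p h = (0::nat))" unfolding split_paired_Ex fst_conv snd_conv .
  from bchoice[OF this] obtain ct where ct: "\<forall>L\<in>?\<L>. snd (ct L) \<in> ({..n} \<times> S) \<rightarrow>\<^sub>E {..n} \<and> fst (ct L) \<one> = 0 \<and>
    (\<forall>y\<in>H. \<forall>s\<in>S. fst (ct L) (y \<otimes> s) = snd (ct L) (fst (ct L) y, s)) \<and> (\<forall>h\<in>H. h \<in> L \<longleftrightarrow> fst (ct L) h = (0::nat))" ..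
  define cl where "cl L = fst (ct L)" for L
  define \<tau> where "\<tau> L = snd (ct L)" for L
  have t: "\<forall>L\<in>?\<L>. \<tau> L \<in> ({..n} \<times> S) \<rightarrow>\<^sub>E {..n} \<and> cl L \<one> = 0 \<and>
    (\<forall>y\<in>H. \<forall>s\<in>S. cl L (y \<otimes> s) = \<tau> L (cl L y, s)) \<and> (\<forall>h\<in>H. h \<in> L \<longleftrightarrow> cl L h = (0::nat))"
    using ct unfolding cl_def \<tau>_def .
  have "inj_on \<tau> ?\<L>"
  proof (rule inj_onI)
    fix L M assume LM: "L \<in> ?\<L>" "M \<in> ?\<L>" "\<tau> L = \<tau> M"
    note tL = bspec[OF t LM(1)] and tM = bspec[OF t LM(2)]
    have "cl L x = cl M x" if "x \<in> wball G S k" for x k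
      using that
    proof (induction k arbitrary: x)
      case 0 then show ?case using tL tM by auto
    next
      case (Suc k)
      then obtain y r where yr: "y \<in> wball G S k" "r \<in> S" "x = y \<otimes> r"
        using Suc.prems unfolding wball_Suc2[OF s] by blast
      have "y \<in> H" using yr assms by (auto simp: sgen_def)
      then show ?case using tL tM yr Suc.IH[OF yr(1)] LM(3) by simp
    qed
    then have "\<forall>x\<in>H. x \<in> L \<longleftrightarrow> x \<in> M" using tL tM assms by (auto simp: sgen_def)
    then show "L = M" using LM by blast
  qed
  moreover have "finite (\<tau> ` ?\<L>)"
  proof (rule finite_subset)
    show "\<tau> ` ?\<L> \<subseteq> ({..n} \<times> S) \<rightarrow>\<^sub>E {..n}" using t by blast
    show "finite (({..n} \<times> S) \<rightarrow>\<^sub>E {..n})" using s by (intro finite_PiE) (auto simp: symgen_def)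
  qed
  ultimately show ?thesis by (rule finite_imageD[rotated])
qed

text \<open>Only finitely many subgroups of \<open>K\<close> stay below a given index, and an
  automorphism of \<open>K\<close> permutes them, so their intersection is invariant and still of
  finite index. Conjugation by any \<open>t\<close> that preserves \<open>K\<close> is such an
  automorphism.\<close>

lemma invariant_findex:
  assumes "sgen G S K" "subgroup L G" "L \<subseteq> K" "findex G L K"
  shows "\<exists>M. subgroup M G \<and> M \<subseteq> L \<and> findex G M K \<and>
    (\<forall>t\<in>carrier G. (\<forall>x\<in>K. \<forall>i. cj t i x \<in> K) \<longrightarrow> (\<forall>x\<in>M. \<forall>i. cj t i x \<in> M))"
proof -
  have Ks: "subgroup K G" using assms sgen_subgroup by auto
  have Kc: "x \<in> carrier G" if "x \<in> K" for x using subgroup.mem_carrier[OF Ks that] .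
  obtain n where n: "index_le G L K n" using findex_index_le[OF assms(4)] by auto
  let ?\<L> = "{L. subgroup L G \<and> L \<subseteq> K \<and> index_le G L K n}"
  have Lin: "L \<in> ?\<L>" using assms n by auto
  have fin: "finite ?\<L>" by (rule finite_bounded_index[OF assms(1)])
  show ?thesis
  proof (intro exI[of _ "\<Inter>?\<L>"] conjI ballI impI allI)
    show "subgroup (\<Inter>?\<L>) G" using Lin by (intro subgroups_Inter) auto
    show "\<Inter>?\<L> \<subseteq> L" using Lin by blast
    show "findex G (\<Inter>?\<L>) K" using fin Lin Ks by (intro findex_Inter) (auto intro: index_le_findex)
    fix t x i assume t: "t \<in> carrier G" "\<forall>x\<in>K. \<forall>i. cj t i x \<in> K" and x: "x \<in> \<Inter>?\<L>"
    show "cj t i x \<in> \<Inter>?\<L>"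
    proof
      fix M assume M: "M \<in> ?\<L>"
      then have Ms: "subgroup M G" "M \<subseteq> K" by auto
      let ?M' = "{x\<in>K. cj t i x \<in> M}"
      have "subgroup ?M' G"
      proof (rule subgroupI)
        show "?M' \<subseteq> carrier G" using Kc by auto
        have "\<one> \<in> ?M'" using subgroup.one_closed Ks Ms(1) cj_one[OF t(1)] by auto
        then show "?M' \<noteq> {}" by blast
        show "inv a \<in> ?M'" if "a \<in> ?M'" for a
          using that Kc cj_inv[OF t(1), of a i] subgroup.m_inv_closed[OF Ks] subgroup.m_inv_closed[OF Ms(1)] by auto
        show "a \<otimes> b \<in> ?M'" if "a \<in> ?M'" "b \<in> ?M'" for a b
          using that Kc cj_mult[OF t(1), of a b i] subgroup.m_closed[OF Ks] subgroup.m_closed[OF Ms(1)] by auto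
      qed
      moreover have "index_le G ?M' K n"
      proof -
        obtain F where F: "finite F" "card F \<le> n" "F \<subseteq> K" "\<forall>h\<in>K. \<exists>f\<in>F. h \<otimes> inv f \<in> M"
          using M by (auto simp: index_le_def)
        show ?thesis unfolding index_le_def
        proof (intro exI[of _ "cj t (-i) ` F"] conjI ballI)
          show "finite (cj t (-i) ` F)" using F by auto
          show "card (cj t (-i) ` F) \<le> n" using F card_image_le order_trans by blast
          show "cj t (-i) ` F \<subseteq> K" using t F by auto
          fix h assume h: "h \<in> K"
          then obtain f where f: "f \<in> F" "cj t i h \<otimes> inv f \<in> M" using F t by blast
          have c: "h \<in> carrier G" "f \<in> carrier G" "t \<in> carrier G" using h f F t Kc by auto
          have "cj t i (h \<otimes> inv (cj t (-i) f)) = cj t i h \<otimes> inv f"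
            using c cj_add[of t f i "-i"] by (simp add: cj_mult cj_inv)
          moreover have "h \<otimes> inv (cj t (-i) f) \<in> K"
            using h f F t by (intro subgroup.m_closed[OF Ks] subgroup.m_inv_closed[OF Ks]) auto
          ultimately show "\<exists>f\<in>cj t (-i) ` F. h \<otimes> inv f \<in> ?M'" using f by auto
        qed
      qed
      ultimately have "?M' \<in> ?\<L>" by auto
      then show "cj t i x \<in> M" using x by blast
    qed
  qed
qed

text \<open>For \<open>M\<close> inside \<open>L\<close> and invariant under conjugation by the lift
  \<open>t\<close>, the products of elements of \<open>M\<close> with powers of \<open>t\<close>
  form the subgroup \<open>L'\<close>. It meets the kernel in \<open>M\<close>, and its cosets in
  \<open>H\<close> are controlled by those of \<open>M\<close> in the kernel.\<close>

lemma zstep_separate: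
  assumes "subgroup H G" "zhom G H \<psi>" "sgen G T {x\<in>H. \<psi> x = 0}"
    "subgroup L G" "L \<subseteq> {x\<in>H. \<psi> x = 0}" "findex G L {x\<in>H. \<psi> x = 0}"
  shows "\<exists>L'. subgroup L' G \<and> L' \<subseteq> H \<and> findex G L' H \<and> L' \<inter> {x\<in>H. \<psi> x = 0} \<subseteq> L"
proof -
  let ?K = "{x\<in>H. \<psi> x = 0}"
  note z = zhom_facts[OF assms(2,1)]
  have Hc: "x \<in> carrier G" if "x \<in> H" for x using subgroup.mem_carrier[OF assms(1) that] .
  obtain t where t: "t \<in> H" "\<psi> t = 1" using assms(2) by (auto simp: zhom_def)
  have tc: "t \<in> carrier G" using t Hc by auto
  have tp: "t [^] (i::int) \<in> H" for i using subgroup_int_pow_closed[OF assms(1) t(1)] .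
  have cjH: "cj t i x \<in> H" if "x \<in> H" for i x
    unfolding cj_def using that t assms(1) subgroup_conj_int by auto
  have cjpsi: "\<psi> (cj t i x) = \<psi> x" if "x \<in> H" for i x
  proof -
    have "\<psi> (cj t i x) = i + \<psi> x + - i"
      unfolding cj_def using that tp subgroup.m_closed[OF assms(1)] z(3) z(4)[OF t(1)] t(2) by simp
    then show ?thesis by simp
  qed
  obtain M where M0: "subgroup M G \<and> M \<subseteq> L \<and> findex G M ?K \<and>
    (\<forall>t\<in>carrier G. (\<forall>x\<in>?K. \<forall>i. cj t i x \<in> ?K) \<longrightarrow> (\<forall>x\<in>M. \<forall>i. cj t i x \<in> M))"
    using invariant_findex[OF assms(3-6)] by (rule exE)
  have M: "subgroup M G" "M \<subseteq> L" "findex G M ?K"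
    "(\<forall>x\<in>?K. \<forall>i. cj t i x \<in> ?K) \<longrightarrow> (\<forall>x\<in>M. \<forall>i. cj t i x \<in> M)"
    using M0 tc by simp_all
  then have Mcj: "cj t i x \<in> M" if "x \<in> M" for x i using that cjH cjpsi by auto
  define L' where "L' = {x\<in>H. x \<otimes> t [^] (- \<psi> x) \<in> M}"
  have L's: "subgroup L' G"
  proof (rule subgroupI)
    show "L' \<subseteq> carrier G" using Hc by (auto simp: L'_def)
    have "\<one> \<in> L'" using subgroup.one_closed assms(1) M(1) z(1) by (auto simp: L'_def)
    then show "L' \<noteq> {}" by blast
    show "inv x \<in> L'" if "x \<in> L'" for x
    proof -
      have x: "x \<in> H" "x \<otimes> t [^] (- \<psi> x) \<in> M" using that by (auto simp: L'_def)
      have "inv x \<otimes> q = inv q \<otimes> inv (x \<otimes> inv q) \<otimes> q" if "q \<in> carrier G" for q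
        using that Hc[OF x(1)] by (simp add: group_assoc_simps)
      from this[of "t [^] \<psi> x"]
      have e: "inv x \<otimes> t [^] (\<psi> x) = cj t (- \<psi> x) (inv (x \<otimes> t [^] (- \<psi> x)))"
        using tc by (simp add: cj_def int_pow_neg)
      have "inv (x \<otimes> t [^] (- \<psi> x)) \<in> M" using x(2) by (rule subgroup.m_inv_closed[OF M(1)])
      then have "inv x \<otimes> t [^] (\<psi> x) \<in> M" unfolding e by (rule Mcj)
      then show ?thesis using x z(2)[OF x(1)] subgroup.m_inv_closed[OF assms(1)] by (auto simp: L'_def)
    qed
    show "x \<otimes> y \<in> L'" if "x \<in> L'" "y \<in> L'" for x y
    proof -
      have x: "x \<in> H" "x \<otimes> t [^] (- \<psi> x) \<in> M" "y \<in> H" "y \<otimes> t [^] (- \<psi> y) \<in> M" using that by (auto simp: L'_def)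
      have c: "x \<in> carrier G" "y \<in> carrier G" using x Hc by auto
      have "x \<otimes> y \<otimes> inv (p \<otimes> q) = (x \<otimes> inv p) \<otimes> (p \<otimes> (y \<otimes> inv q) \<otimes> inv p)"
        if "p \<in> carrier G" "q \<in> carrier G" for p q using that c by (simp add: group_assoc_simps)
      moreover have "t [^] (- \<psi> (x \<otimes> y)) = inv (t [^] \<psi> x \<otimes> t [^] \<psi> y)"
        unfolding z(3)[OF x(1,3)] using tc by (simp only: int_pow_neg int_pow_mult)
      ultimately have e: "x \<otimes> y \<otimes> t [^] (- \<psi> (x \<otimes> y)) = (x \<otimes> t [^] (- \<psi> x)) \<otimes> cj t (\<psi> x) (y \<otimes> t [^] (- \<psi> y))"
        using tc by (simp only: cj_def int_pow_neg int_pow_closed)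
      have "x \<otimes> y \<otimes> t [^] (- \<psi> (x \<otimes> y)) \<in> M" unfolding e by (rule subgroup.m_closed[OF M(1) x(2) Mcj[OF x(4)]])
      then show ?thesis using subgroup.m_closed[OF assms(1) x(1,3)] by (auto simp: L'_def)
    qed
  qed
  have Ks: "subgroup ?K G" by (rule z(5))
  obtain c where c: "finite (c ` ?K)" "c ` ?K \<subseteq> ?K" "\<And>h h'. h \<in> ?K \<Longrightarrow> h' \<in> ?K \<Longrightarrow> c h = c h' \<Longrightarrow> h \<otimes> inv h' \<in> M"
      "\<And>h. h \<in> ?K \<Longrightarrow> h \<otimes> inv (c h) \<in> M" by (rule findexE[OF M(3) M(1) Ks]) blast
  have hK: "t [^] (- \<psi> h) \<otimes> h \<in> ?K" if "h \<in> H" for h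
    using that tp subgroup.m_closed[OF assms(1)] z(3) z(4)[OF t(1)] t(2) by simp
  have "findex G L' H"
  \<comment> \<open>Unlike in \<open>L'\<close>, the power of \<open>t\<close> is removed on the
    left. Conjugating the resulting quotient by \<open>t\<close> to the power
    \<open>\<psi> h\<close> then gives \<open>h inv h'\<close> with its correcting power of
    \<open>t\<close> on the right.\<close>
  proof (rule findexI[of "\<lambda>h. c (t [^] (- \<psi> h) \<otimes> h)"])
    show "finite ((\<lambda>h. c (t [^] (- \<psi> h) \<otimes> h)) ` H)"
      by (rule finite_subset[OF _ c(1)]) (use hK in blast)
    fix h h' assume h: "h \<in> H" "h' \<in> H" "c (t [^] (- \<psi> h) \<otimes> h) = c (t [^] (- \<psi> h') \<otimes> h')"
    have hc: "h \<in> carrier G" "h' \<in> carrier G" using h Hc by auto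
    have m: "(t [^] (- \<psi> h) \<otimes> h) \<otimes> inv (t [^] (- \<psi> h') \<otimes> h') \<in> M" by (rule c(3)[OF hK hK h(3)]) (use h in auto)
    have psi: "\<psi> (h \<otimes> inv h') = \<psi> h - \<psi> h'" using z(3)[OF h(1) subgroup.m_inv_closed[OF assms(1) h(2)]] z(2)[OF h(2)] by simp
    have "p \<otimes> ((inv p \<otimes> h) \<otimes> inv (inv q \<otimes> h')) \<otimes> inv p = h \<otimes> inv h' \<otimes> (q \<otimes> inv p)"
      if "p \<in> carrier G" "q \<in> carrier G" for p q using that hc by (simp add: group_assoc_simps)
    moreover have "t [^] (- (\<psi> h - \<psi> h')) = t [^] \<psi> h' \<otimes> inv (t [^] \<psi> h)"
      using tc by (simp add: int_pow_diff)
    ultimately have "cj t (\<psi> h) ((t [^] (- \<psi> h) \<otimes> h) \<otimes> inv (t [^] (- \<psi> h') \<otimes> h')) = h \<otimes> inv h' \<otimes> t [^] (- (\<psi> h - \<psi> h'))"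
      using tc by (simp only: cj_def int_pow_neg int_pow_closed)
    then have "h \<otimes> inv h' \<otimes> t [^] (- \<psi> (h \<otimes> inv h')) \<in> M" using Mcj[OF m, of "\<psi> h"] unfolding psi by simp
    then show "h \<otimes> inv h' \<in> L'" using subgroup.m_closed[OF assms(1) h(1) subgroup.m_inv_closed[OF assms(1) h(2)]]
      by (simp add: L'_def)
  qed
  moreover have "L' \<inter> ?K \<subseteq> L"
  proof
    fix x assume "x \<in> L' \<inter> ?K"
    then have "x \<otimes> t [^] (- 0 :: int) \<in> M" "x \<in> carrier G" using Hc unfolding L'_def by auto
    then show "x \<in> L" using M(2) by auto
  qed
  ultimately show ?thesis using L's by (intro exI[of _ L']) (auto simp: L'_def)
qed

text \<open>Separation is carried up the chain one step at a time; across a finite-index step the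
  separating subgroup is kept as it is.\<close>

lemma pc_separate:
  assumes "pc G N H" "sgen G S H" "subexp G S" "subgroup L G" "L \<subseteq> N" "findex G L N"
  shows "\<exists>L'. subgroup L' G \<and> L' \<subseteq> H \<and> findex G L' H \<and> L' \<inter> N \<subseteq> L"
  using assms
proof (induction arbitrary: S rule: pc.induct)
  case (refl N) then show ?case by blast
next
  case (fin N K H)
  have Ks: "subgroup K G" "N \<subseteq> K" using pc_subgroups fin by auto
  then obtain T where T: "sgen G T K" using schreier[of S H K] fin by blast
  then have "subexp G T" using fin subexp_subset by blast
  then obtain L' where "subgroup L' G" "L' \<subseteq> K" "findex G L' K" "L' \<inter> N \<subseteq> L" using fin T by blast
  then show ?case using findex_trans[of L' K H] fin Ks by blast
next
  case (zstep N K H \<psi>)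
  have NK: "N \<subseteq> K" using pc_subgroups zstep by auto
  obtain T where T: "sgen G T K" using milnor_kernel zstep by blast
  then have "subexp G T" using zstep subexp_subset[of S H T K] by blast
  then obtain L1 where L1: "subgroup L1 G" "L1 \<subseteq> K" "findex G L1 K" "L1 \<inter> N \<subseteq> L" using zstep T by blast
  obtain L' where "subgroup L' G" "L' \<subseteq> H" "findex G L' H" "L' \<inter> K \<subseteq> L1"
  proof -
    have "\<exists>L'. subgroup L' G \<and> L' \<subseteq> H \<and> findex G L' H \<and> L' \<inter> K \<subseteq> L1"
      using zstep_separate[OF zstep(2,3), of T L1] T L1(1-3) unfolding zstep(4) by simp
    then show ?thesis using that by blast
  qed
  then show ?case using NK L1(4) by blast
qed

text \<open>The core consists of the elements all of whose conjugates lie in \<open>L\<close>. As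
  \<open>L\<close> is closed under its own conjugations, conjugating by representatives in
  \<open>F\<close> decides this, so the cosets of the finitely many \<open>f h\<close> determine
  that of \<open>h\<close>.\<close>

lemma normal_core:
  assumes "subgroup L G" "findex G L (carrier G)"
  shows "\<exists>N. N \<lhd> G \<and> N \<subseteq> L \<and> findex G N (carrier G)"
proof -
  let ?N = "{x\<in>carrier G. \<forall>g\<in>carrier G. g \<otimes> x \<otimes> inv g \<in> L}"
  obtain F where F: "finite F" "F \<subseteq> carrier G" "\<forall>h\<in>carrier G. \<exists>f\<in>F. h \<otimes> inv f \<in> L"
    using assms by (auto simp: findex_def)
  obtain c where c: "finite (c ` carrier G)" "c ` carrier G \<subseteq> carrier G" "\<And>h h'. h \<in> carrier G \<Longrightarrow> h' \<in> carrier G \<Longrightarrow> c h = c h' \<Longrightarrow> h \<otimes> inv h' \<in> L"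
      "\<And>h. h \<in> carrier G \<Longrightarrow> h \<otimes> inv (c h) \<in> L" by (rule findexE[OF assms(2,1) subgroup_self]) blast
  have "subgroup ?N G"
  proof (rule subgroupI)
    show "?N \<subseteq> carrier G" by auto
    have "\<one> \<in> ?N" using subgroup.one_closed[OF assms(1)] by auto
    then show "?N \<noteq> {}" by blast
    show "inv x \<in> ?N" if x: "x \<in> ?N" for x
    proof -
      have "g \<otimes> inv x \<otimes> inv g = inv (g \<otimes> x \<otimes> inv g)" if "g \<in> carrier G" for g using x that by (simp add: group_assoc_simps)
      then show ?thesis using x subgroup.m_inv_closed[OF assms(1)] by simp
    qed
    show "x \<otimes> y \<in> ?N" if x: "x \<in> ?N" "y \<in> ?N" for x y
    proof -
      have "g \<otimes> (x \<otimes> y) \<otimes> inv g = (g \<otimes> x \<otimes> inv g) \<otimes> (g \<otimes> y \<otimes> inv g)" if "g \<in> carrier G" for g using x that by (simp add: group_assoc_simps)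
      then show ?thesis using x subgroup.m_closed[OF assms(1)] by simp
    qed
  qed
  then have "?N \<lhd> G"
  proof (rule normal_invI)
    fix g x assume gx: "g \<in> carrier G" "x \<in> ?N"
    have "g' \<otimes> (g \<otimes> x \<otimes> inv g) \<otimes> inv g' \<in> L" if "g' \<in> carrier G" for g'
    proof -
      have "(g' \<otimes> g) \<otimes> x \<otimes> inv (g' \<otimes> g) \<in> L" using gx that by auto
      moreover have "(g' \<otimes> g) \<otimes> x \<otimes> inv (g' \<otimes> g) = g' \<otimes> (g \<otimes> x \<otimes> inv g) \<otimes> inv g'" using gx that by (simp add: group_assoc_simps)
      ultimately show ?thesis by simp
    qed
    then show "g \<otimes> x \<otimes> inv g \<in> ?N" using gx by auto
  qed
  moreover have "?N \<subseteq> L"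
  proof
    fix x assume "x \<in> ?N"
    then have "\<one> \<otimes> x \<otimes> inv \<one> \<in> L" and x: "x \<in> carrier G" using one_closed by blast+
    moreover have "\<one> \<otimes> x \<otimes> inv \<one> = x" using x by simp
    ultimately show "x \<in> L" by metis
  qed
  moreover have "findex G ?N (carrier G)"
  proof (rule findexI[of "\<lambda>h. \<lambda>f\<in>F. c (f \<otimes> h)"])
    show "finite ((\<lambda>h. \<lambda>f\<in>F. c (f \<otimes> h)) ` carrier G)"
    proof (rule finite_subset)
      show "(\<lambda>h. \<lambda>f\<in>F. c (f \<otimes> h)) ` carrier G \<subseteq> (\<Pi>\<^sub>E f\<in>F. c ` carrier G)" using F(2) by auto
      show "finite (\<Pi>\<^sub>E f\<in>F. c ` carrier G)" using F(1) c(1) by (intro finite_PiE) auto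
    qed
    fix h h' assume h: "h \<in> carrier G" "h' \<in> carrier G" "(\<lambda>f\<in>F. c (f \<otimes> h)) = (\<lambda>f\<in>F. c (f \<otimes> h'))"
    have "g \<otimes> (h \<otimes> inv h') \<otimes> inv g \<in> L" if g: "g \<in> carrier G" for g
    proof -
      obtain f where f: "f \<in> F" "g \<otimes> inv f \<in> L" using F(3) g by blast
      have fc: "f \<in> carrier G" using f F by auto
      have "c (f \<otimes> h) = c (f \<otimes> h')" using fun_cong[OF h(3), of f] f(1) by simp
      then have a: "(f \<otimes> h) \<otimes> inv (f \<otimes> h') \<in> L" using fc h by (intro c(3)) auto
      have "(g \<otimes> inv f) \<otimes> ((f \<otimes> h) \<otimes> inv (f \<otimes> h')) \<otimes> inv (g \<otimes> inv f) \<in> L"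
        by (rule subgroup.m_closed[OF assms(1) subgroup.m_closed[OF assms(1) f(2) a] subgroup.m_inv_closed[OF assms(1) f(2)]])
      moreover have "(g \<otimes> inv f) \<otimes> ((f \<otimes> h) \<otimes> inv (f \<otimes> h')) \<otimes> inv (g \<otimes> inv f) = g \<otimes> (h \<otimes> inv h') \<otimes> inv g"
        using h g fc by (simp add: group_assoc_simps)
      ultimately show ?thesis by simp
    qed
    then show "h \<otimes> inv h' \<in> ?N" using h by auto
  qed
  ultimately show ?thesis by blast
qed

section \<open>Restriction, pullback and quotients\<close>

lemma pc_restrict:
  assumes "subgroup K G" "pc (G\<lparr>carrier := K\<rparr>) N H"
  shows "pc G N H"
  using assms(2)
proof (induction rule: pc.induct)
  case (refl N) then show ?case using incl_subgroup[OF assms(1)] by (auto intro: pc.refl)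
next
  case (fin N L H)
  have HK: "H \<subseteq> K" using subgroup.subset[OF fin(2)] by simp
  obtain F where F: "finite F" "F \<subseteq> H" "\<forall>h\<in>H. \<exists>f\<in>F. h \<otimes> inv\<^bsub>G\<lparr>carrier := K\<rparr>\<^esub> f \<in> L" using fin by (auto simp: findex_def)
  have "inv\<^bsub>G\<lparr>carrier := K\<rparr>\<^esub> f = inv f" if "f \<in> F" for f using m_inv_consistent[OF assms(1)] F HK that by blast
  then have "findex G L H" using F unfolding findex_def by (intro exI[of _ F]) simp
  then show ?case using fin incl_subgroup[OF assms(1)] by (auto intro: pc.fin)
next
  case (zstep N L H \<psi>)
  then show ?case using incl_subgroup[OF assms(1)] by (intro pc.zstep[of G N L H \<psi>]) (auto simp: zhom_def)
qed

lemma pc_pullback: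
  assumes "group_hom G Q f" "f ` carrier G = carrier Q" "pc Q N H"
  shows "pc G {x\<in>carrier G. f x \<in> N} {x\<in>carrier G. f x \<in> H}"
proof -
  interpret f: group_hom G Q f by fact
  have sub: "subgroup {x\<in>carrier G. f x \<in> L} G" if "subgroup L Q" for L
    using that subgroup.one_closed[OF that]
    by (intro subgroupI) (auto simp: subgroup.m_closed subgroup.m_inv_closed)
  show ?thesis using assms(3)
  proof (induction rule: pc.induct)
    case (refl N) then show ?case using sub by (auto intro: pc.refl)
  next
    case (fin N L H)
    have s: "subgroup L Q" using f.H.pc_subgroups[OF fin(1)] by auto
    obtain c where c: "finite (c ` H)" "c ` H \<subseteq> H" "\<And>h h'. h \<in> H \<Longrightarrow> h' \<in> H \<Longrightarrow> c h = c h' \<Longrightarrow> h \<otimes>\<^bsub>Q\<^esub> inv\<^bsub>Q\<^esub> h' \<in> L"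
      "\<And>h. h \<in> H \<Longrightarrow> h \<otimes>\<^bsub>Q\<^esub> inv\<^bsub>Q\<^esub> (c h) \<in> L" by (rule f.H.findexE[OF fin(4) s fin(2)]) blast
    have "findex G {x\<in>carrier G. f x \<in> L} {x\<in>carrier G. f x \<in> H}"
    proof (rule findexI[of "\<lambda>x. c (f x)"])
      show "finite ((\<lambda>x. c (f x)) ` {x \<in> carrier G. f x \<in> H})"
        by (rule finite_subset[OF _ c(1)]) auto
      fix h h' assume h: "h \<in> {x \<in> carrier G. f x \<in> H}" "h' \<in> {x \<in> carrier G. f x \<in> H}" "c (f h) = c (f h')"
      have "f h \<otimes>\<^bsub>Q\<^esub> inv\<^bsub>Q\<^esub> f h' \<in> L" by (rule c(3)) (use h in auto)
      then show "h \<otimes> inv h' \<in> {x\<in>carrier G. f x \<in> L}" using h by auto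
    qed
    then show ?case by (intro pc.fin[OF fin.IH sub[OF fin(2)]]) (use fin(3) in auto)
  next
    case (zstep N L H \<psi>)
    have "zhom G {x\<in>carrier G. f x \<in> H} (\<lambda>x. \<psi> (f x))"
    proof -
      obtain t where t: "t \<in> H" "\<psi> t = 1" using zstep by (auto simp: zhom_def)
      then obtain u where "u \<in> carrier G" "t = f u" using assms(2) subgroup.mem_carrier[OF zstep(2)] by (metis imageE)
      then show ?thesis using zstep t by (auto simp: zhom_def)
    qed
    then show ?case by (intro pc.zstep[OF zstep.IH sub[OF zstep(2)]]) (use zstep(4) in auto)
  qed
qed

text \<open>Finite generation makes the set of cosets countable, so the quotient can be coded on
  \<open>nat\<close>, the element type of the hypotheses.\<close>

lemma nat_quotient:
  assumes "sgen G S (carrier G)" "N \<lhd> G"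
  shows "\<exists>(Q::nat monoid) f. group_hom G Q f \<and> f ` carrier G = carrier Q \<and> (\<forall>x\<in>carrier G. f x = \<one>\<^bsub>Q\<^esub> \<longleftrightarrow> x \<in> N)"
proof -
  interpret N: normal N G by fact
  have "countable (carrier G)"
  proof -
    have "finite S" using assms by (auto simp: sgen_def symgen_def)
    then have "countable (\<Union>n. wball G S n)" using finite_wball countable_finite by (intro countable_UN) blast+
    then show ?thesis using assms by (simp add: sgen_def)
  qed
  then have cc: "countable ((\<lambda>x. N #> x) ` carrier G)" by auto
  define f where "f x = to_nat_on ((\<lambda>x. N #> x) ` carrier G) (N #> x)" for x
  have eq: "f x = f y \<longleftrightarrow> x \<otimes> inv y \<in> N" if "x \<in> carrier G" "y \<in> carrier G" for x y
  proof -
    have "f x = f y \<longleftrightarrow> N #> x = N #> y"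
      unfolding f_def using to_nat_on_inj[OF cc] that by auto
    also have "\<dots> \<longleftrightarrow> x \<otimes> inv y \<in> N"
    proof
      assume "N #> x = N #> y"
      then show "x \<otimes> inv y \<in> N"
        using subgroup.rcos_module_imp[OF N.subgroup_axioms group_axioms] rcos_self[OF that(1) N.subgroup_axioms] that by auto
    next
      assume "x \<otimes> inv y \<in> N"
      then have "x \<in> N #> y" using subgroup.rcos_module_rev[OF N.subgroup_axioms group_axioms] that by auto
      then show "N #> x = N #> y" using repr_independence[OF _ that(2) N.subgroup_axioms] by blast
    qed
    finally show ?thesis .
  qed
  have w: "weak_group_morphism f N G"
    by (rule weak_group_morphism.intro) (auto simp: assms(2) eq intro!: weak_group_morphism_axioms.intro)
  have "group_hom G (image_group f G) f" by (rule weak_group_morphism_group_hom[OF w])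
  moreover have "f x = \<one>\<^bsub>image_group f G\<^esub> \<longleftrightarrow> x \<in> N" if "x \<in> carrier G" for x
    using eq[OF that, of \<one>] that by (simp add: image_group_one)
  ultimately show ?thesis by (intro exI[of _ "image_group f G"] exI[of _ f]) (auto simp: image_group_carrier)
qed

end

section \<open>Random walks and a harmonic function\<close>

declare wball.simps(2) [simp del]

locale walk = group G for G (structure) +
  fixes S :: "'a set"
  assumes sgenS: "sgen G S (carrier G)"
begin

lemma symS: "symgen G S" using sgenS by (simp add: sgen_def)
lemma finS: "finite S" using symS by (simp add: symgen_def)
lemma Sc: "s \<in> S \<Longrightarrow> s \<in> carrier G" using symS by (auto simp: symgen_def)
lemma invS: "s \<in> S \<Longrightarrow> inv s \<in> S" using symS by (auto simp: symgen_def)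
lemma oneS: "\<one> \<in> S" using symS by (auto simp: symgen_def)

abbreviation B :: "nat \<Rightarrow> 'a set" where "B n \<equiv> wball G S n"

lemma finB: "finite (B n)" using finite_wball finS by auto
lemma Bc: "x \<in> B n \<Longrightarrow> x \<in> carrier G" using wball_carrier[of S n] Sc by auto
lemma carrier_B: "carrier G = (\<Union>n. B n)" using sgenS by (simp add: sgen_def)
lemma Bmono: "m \<le> n \<Longrightarrow> x \<in> B m \<Longrightarrow> x \<in> B n" using wball_mono[OF symS] by blast

definition q :: real where "q = real (card S)"

lemma q_pos: "q > 0" using oneS finS by (auto simp: q_def card_gt_0_iff)

section \<open>Markov operator and step distributions\<close>

definition P :: "('a \<Rightarrow> real) \<Rightarrow> 'a \<Rightarrow> real" where
  "P \<phi> x = (\<Sum>s\<in>S. \<phi> (x \<otimes> s)) / q"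

text \<open>The distribution after \<open>n\<close> steps of the walk from the identity, by
  conditioning on the first step. Accordingly \<open>avg n\<close> is the expectation after
  \<open>n\<close> steps, which is the \<open>n\<close>-th power of \<open>P\<close>.\<close>

primrec mu :: "nat \<Rightarrow> 'a \<Rightarrow> real" where
  "mu 0 z = (if z = \<one> then 1 else 0)"
| "mu (Suc n) z = (\<Sum>s\<in>S. mu n (inv s \<otimes> z)) / q"

declare mu.simps(2) [simp del]

definition avg :: "nat \<Rightarrow> ('a \<Rightarrow> real) \<Rightarrow> 'a \<Rightarrow> real" where
  "avg n \<phi> x = (\<Sum>y\<in>B n. mu n y * \<phi> (x \<otimes> y))"

lemma mu_nonneg: "mu n z \<ge> 0"
  using q_pos by (induction n arbitrary: z) (auto simp: mu.simps(2) intro!: divide_nonneg_pos sum_nonneg)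

lemma mu_supp: "z \<in> carrier G \<Longrightarrow> mu n z \<noteq> 0 \<Longrightarrow> z \<in> B n"
proof (induction n arbitrary: z)
  case 0 then show ?case by (auto split: if_splits)
next
  case (Suc n)
  then have "(\<Sum>s\<in>S. mu n (inv s \<otimes> z)) \<noteq> 0" by (auto simp: mu.simps(2))
  then obtain s where s: "s \<in> S" "mu n (inv s \<otimes> z) \<noteq> 0" by (meson sum.not_neutral_contains_not_neutral)
  then have "inv s \<otimes> z \<in> B n" using Suc Sc by auto
  moreover have "z = s \<otimes> (inv s \<otimes> z)" using s Suc Sc by auto
  ultimately show ?case using s unfolding wball.simps(2) by blast
qed

text \<open>The substitution \<open>z = g y\<close> under the sum. The kernel \<open>k\<close> sees
  both variables and vanishes where \<open>mu n\<close> does, so the range \<open>U\<close> may be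
  any finite set containing the translated ball.\<close>

lemma sum_shift:
  assumes "g \<in> carrier G" "finite U" "U \<subseteq> carrier G" "\<And>y. y \<in> B n \<Longrightarrow> g \<otimes> y \<in> U"
    "\<And>y z. y \<in> carrier G \<Longrightarrow> mu n y = 0 \<Longrightarrow> k y z = (0::real)"
  shows "(\<Sum>z\<in>U. k (inv g \<otimes> z) z) = (\<Sum>y\<in>B n. k y (g \<otimes> y))"
proof -
  let ?V = "(\<lambda>y. g \<otimes> y) ` B n"
  have VU: "?V \<subseteq> U" using assms(4) by auto
  have "(\<Sum>z\<in>U. k (inv g \<otimes> z) z) = (\<Sum>z\<in>?V. k (inv g \<otimes> z) z)"
  proof (rule sum.mono_neutral_right[OF assms(2) VU], rule ballI)
    fix z assume z: "z \<in> U - ?V"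
    then have zc: "z \<in> carrier G" using assms(3) by auto
    have "inv g \<otimes> z \<notin> B n"
    proof
      assume "inv g \<otimes> z \<in> B n"
      then have "g \<otimes> (inv g \<otimes> z) \<in> ?V" by blast
      then show False using z zc assms(1) by simp
    qed
    then have "mu n (inv g \<otimes> z) = 0" using mu_supp[of "inv g \<otimes> z" n] zc assms(1) by auto
    then show "k (inv g \<otimes> z) z = 0" using assms(5) zc assms(1) by simp
  qed
  also have "\<dots> = (\<Sum>y\<in>B n. k (inv g \<otimes> (g \<otimes> y)) (g \<otimes> y))"
    by (rule sum.reindex_cong[of "\<lambda>y. g \<otimes> y"]) (use assms(1) Bc in \<open>auto intro!: inj_onI\<close>)
  also have "\<dots> = (\<Sum>y\<in>B n. k y (g \<otimes> y))" using assms(1) Bc by (intro sum.cong) auto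
  finally show ?thesis .
qed

lemma sum_shift_gen:
  assumes "s \<in> S" "\<And>y z. y \<in> carrier G \<Longrightarrow> mu n y = 0 \<Longrightarrow> k y z = (0::real)"
  shows "(\<Sum>z\<in>B (Suc n). k (inv s \<otimes> z) z) = (\<Sum>y\<in>B n. k y (s \<otimes> y))"
proof (rule sum_shift[OF Sc[OF assms(1)] finB])
  show "B (Suc n) \<subseteq> carrier G" using Bc by blast
  show "\<And>y. y \<in> B n \<Longrightarrow> s \<otimes> y \<in> B (Suc n)" using assms(1) by (auto simp: wball.simps(2))
qed (rule assms(2))

lemma sum_superset:
  assumes "finite U" "U \<subseteq> carrier G" "B n \<subseteq> U" "\<And>y. y \<in> carrier G \<Longrightarrow> mu n y = 0 \<Longrightarrow> k y = (0::real)"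
  shows "(\<Sum>z\<in>U. k z) = (\<Sum>y\<in>B n. k y)"
  by (rule sum.mono_neutral_right[OF assms(1,3)]) (use assms(2,4) mu_supp in blast)

lemma avg_0 [simp]: "x \<in> carrier G \<Longrightarrow> avg 0 \<phi> x = \<phi> x"
  by (simp add: avg_def)

lemma avg_Suc: assumes x: "x \<in> carrier G" shows "avg (Suc n) \<phi> x = P (avg n \<phi>) x"
proof -
  have "avg (Suc n) \<phi> x = (\<Sum>z\<in>B (Suc n). \<Sum>s\<in>S. mu n (inv s \<otimes> z) * \<phi> (x \<otimes> z) / q)"
    unfolding avg_def mu.simps(2) by (simp add: sum_distrib_right sum_divide_distrib)
  also have "\<dots> = (\<Sum>s\<in>S. \<Sum>z\<in>B (Suc n). mu n (inv s \<otimes> z) * \<phi> (x \<otimes> z) / q)"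
    by (rule sum.swap)
  also have "\<dots> = (\<Sum>s\<in>S. \<Sum>y\<in>B n. mu n y * \<phi> (x \<otimes> (s \<otimes> y)) / q)"
  proof (rule sum.cong[OF HOL.refl])
    fix s assume s: "s \<in> S"
    show "(\<Sum>z\<in>B (Suc n). mu n (inv s \<otimes> z) * \<phi> (x \<otimes> z) / q) = (\<Sum>y\<in>B n. mu n y * \<phi> (x \<otimes> (s \<otimes> y)) / q)"
      by (rule sum_shift[where k="\<lambda>y z. mu n y * \<phi> (x \<otimes> z) / q"]) (use s Sc finB Bc finS in \<open>auto simp: wball.simps(2)\<close>)
  qed
  also have "\<dots> = (\<Sum>s\<in>S. avg n \<phi> (x \<otimes> s) / q)"
    unfolding avg_def sum_divide_distrib
    by (intro sum.cong HOL.refl) (use x Sc Bc in \<open>simp add: m_assoc\<close>)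
  finally show ?thesis by (simp add: P_def sum_divide_distrib)
qed

lemma P_cong: "x \<in> carrier G \<Longrightarrow> (\<And>y. y \<in> carrier G \<Longrightarrow> \<phi> y = \<psi> y) \<Longrightarrow> P \<phi> x = P \<psi> x"
  unfolding P_def using Sc by (intro arg_cong2[where f="(/)"] sum.cong) auto

lemma avg_cong: "x \<in> carrier G \<Longrightarrow> (\<And>y. y \<in> carrier G \<Longrightarrow> \<phi> y = \<psi> y) \<Longrightarrow> avg n \<phi> x = avg n \<psi> x"
  unfolding avg_def using Bc by (intro sum.cong) auto

lemma avg_P: "x \<in> carrier G \<Longrightarrow> avg n (P \<phi>) x = P (avg n \<phi>) x"
proof (induction n arbitrary: x)
  case 0 then show ?case using P_cong[of x "avg 0 \<phi>" \<phi>] by simp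
next
  case (Suc n)
  have "avg (Suc n) (P \<phi>) x = P (avg n (P \<phi>)) x" using avg_Suc Suc by auto
  also have "\<dots> = P (P (avg n \<phi>)) x" by (rule P_cong) (use Suc in auto)
  also have "\<dots> = P (avg (Suc n) \<phi>) x" by (rule P_cong) (use Suc avg_Suc in auto)
  finally show ?case .
qed

lemma avg_Suc2: "x \<in> carrier G \<Longrightarrow> avg (Suc n) \<phi> x = avg n (P \<phi>) x"
  using avg_Suc avg_P by auto

lemma avg_add: "avg n (\<lambda>y. \<phi> y + \<psi> y) x = avg n \<phi> x + avg n \<psi> x"
  by (simp add: avg_def algebra_simps sum.distrib)
lemma avg_cmult: "avg n (\<lambda>y. c * \<phi> y) x = c * avg n \<phi> x"
  by (simp add: avg_def algebra_simps sum_distrib_left)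
lemma avg_sum: "avg n (\<lambda>y. \<Sum>i\<in>I. f i y) x = (\<Sum>i\<in>I. avg n (f i) x)"
  unfolding avg_def by (simp add: sum_distrib_left) (rule sum.swap)
lemma avg_mono: "x \<in> carrier G \<Longrightarrow> (\<And>y. y \<in> carrier G \<Longrightarrow> \<phi> y \<le> \<psi> y) \<Longrightarrow> avg n \<phi> x \<le> avg n \<psi> x"
  unfolding avg_def using Bc mu_nonneg by (intro sum_mono mult_left_mono) auto

lemma avg_const [simp]: assumes "x \<in> carrier G" shows "avg n (\<lambda>_. c) x = c"
  using assms
proof (induction n arbitrary: x)
  case (Suc n)
  have "avg (Suc n) (\<lambda>_. c) x = P (avg n (\<lambda>_. c)) x" using avg_Suc Suc by auto
  also have "\<dots> = P (\<lambda>_. c) x" by (rule P_cong) (use Suc in auto)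
  also have "\<dots> = c" using q_pos by (simp add: P_def q_def)
  finally show ?case .
qed simp

lemma avg_nonneg: "x \<in> carrier G \<Longrightarrow> (\<And>y. y \<in> carrier G \<Longrightarrow> 0 \<le> \<phi> y) \<Longrightarrow> 0 \<le> avg n \<phi> x"
  using avg_mono[of x "\<lambda>_. 0" \<phi> n] by simp

lemma mu_total: "(\<Sum>y\<in>B n. mu n y) = 1"
  using avg_const[of \<one> n 1] by (simp add: avg_def)

lemma mu_le_sum: assumes "finite U" "U \<subseteq> carrier G" shows "(\<Sum>y\<in>U. mu n y) \<le> 1"
proof -
  have "(\<Sum>y\<in>U. mu n y) \<le> (\<Sum>y\<in>U \<union> B n. mu n y)"
    using assms finB mu_nonneg by (intro sum_mono2) auto
  also have "\<dots> = (\<Sum>y\<in>B n. mu n y)" using assms finB Bc by (intro sum_superset) auto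
  finally show ?thesis using mu_total by simp
qed

lemma mu_right: "z \<in> carrier G \<Longrightarrow> mu (Suc n) z = (\<Sum>s\<in>S. mu n (z \<otimes> s)) / q"
proof (induction n arbitrary: z)
  case 0
  have "(\<Sum>s\<in>S. mu 0 (inv s \<otimes> z)) = (\<Sum>s\<in>S. mu 0 (z \<otimes> s))"
  proof (rule sum.reindex_bij_witness[of S "\<lambda>s. inv s" "\<lambda>s. inv s"])
    fix s assume s: "s \<in> S"
    then have "z \<otimes> inv s = \<one> \<longleftrightarrow> inv s \<otimes> z = \<one>" using 0 Sc by (metis inv_closed inv_comm)
    then show "mu 0 (z \<otimes> inv s) = mu 0 (inv s \<otimes> z)" by simp
  qed (use Sc invS in auto)
  then show ?case by (simp only: mu.simps(2))
next
  case (Suc n)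
  have "mu (Suc (Suc n)) z = (\<Sum>s\<in>S. mu (Suc n) (inv s \<otimes> z)) / q" by (simp only: mu.simps(2))
  also have "\<dots> = (\<Sum>s\<in>S. \<Sum>t\<in>S. mu n (inv s \<otimes> z \<otimes> t)) / q / q"
    using Suc Sc by (simp add: sum_divide_distrib)
  also have "\<dots> = (\<Sum>t\<in>S. \<Sum>s\<in>S. mu n (inv s \<otimes> z \<otimes> t)) / q / q" by (subst sum.swap) simp
  also have "\<dots> = (\<Sum>t\<in>S. mu (Suc n) (z \<otimes> t)) / q"
    using Suc(2) Sc by (simp add: sum_divide_distrib m_assoc mu.simps(2))
  finally show ?case .
qed

lemma mu_sym: "z \<in> carrier G \<Longrightarrow> mu n (inv z) = mu n z"
proof (induction n arbitrary: z)
  case 0 then show ?case by (metis inv_inv inv_one mu.simps(1))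
next
  case (Suc n)
  have "mu (Suc n) (inv z) = (\<Sum>s\<in>S. mu n (inv s \<otimes> inv z)) / q" by (simp add: mu.simps(2))
  also have "(\<Sum>s\<in>S. mu n (inv s \<otimes> inv z)) = (\<Sum>s\<in>S. mu n (z \<otimes> s))"
  proof (rule sum.cong[OF HOL.refl])
    fix s assume "s \<in> S"
    then show "mu n (inv s \<otimes> inv z) = mu n (z \<otimes> s)" using Suc Sc by (metis inv_mult_group m_closed)
  qed
  finally show ?case using mu_right[OF Suc(2), of n] by simp
qed

lemma mu_conv: "w \<in> carrier G \<Longrightarrow> mu (m + n) w = (\<Sum>y\<in>B m. mu m y * mu n (inv y \<otimes> w))"
proof (induction m arbitrary: w)
  case 0 then show ?case by simp
next
  case (Suc m)
  have "(\<Sum>y\<in>B (Suc m). mu (Suc m) y * mu n (inv y \<otimes> w)) = avg (Suc m) (\<lambda>y. mu n (inv y \<otimes> w)) \<one>"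
    unfolding avg_def by (intro sum.cong HOL.refl) (use Bc[of _ "Suc m"] in simp)
  also have "\<dots> = (\<Sum>s\<in>S. avg m (\<lambda>y. mu n (inv y \<otimes> w)) s) / q"
    using avg_Suc[of \<one>] Sc by (simp add: P_def)
  also have "\<dots> = (\<Sum>s\<in>S. mu (m + n) (inv s \<otimes> w)) / q"
  proof (intro arg_cong2[where f="(/)"] sum.cong HOL.refl)
    fix s assume s: "s \<in> S"
    have "avg m (\<lambda>y. mu n (inv y \<otimes> w)) s = (\<Sum>y\<in>B m. mu m y * mu n (inv y \<otimes> (inv s \<otimes> w)))"
      unfolding avg_def by (intro sum.cong HOL.refl) (use Bc s Sc Suc in \<open>simp add: group_assoc_simps\<close>)
    then show "avg m (\<lambda>y. mu n (inv y \<otimes> w)) s = mu (m + n) (inv s \<otimes> w)"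
      using Suc s Sc by simp
  qed
  finally show ?case by (simp add: mu.simps(2))
qed

text \<open>The inner product of two left translates of step distributions is a single value of a
  longer walk, by convolution and the symmetry of \<open>mu\<close>. Finite sums over a large
  \<open>U\<close> stand for the inner product of square-summable functions, through which the
  estimates below are computed.\<close>

lemma mu_inner:
  assumes "x \<in> carrier G" "z \<in> carrier G" "finite U" "U \<subseteq> carrier G" "\<And>y. y \<in> B k \<Longrightarrow> x \<otimes> y \<in> U"
  shows "(\<Sum>w\<in>U. mu k (inv x \<otimes> w) * mu m (inv z \<otimes> w)) = mu (k + m) (inv x \<otimes> z)"
proof -
  have "(\<Sum>w\<in>U. mu k (inv x \<otimes> w) * mu m (inv z \<otimes> w)) = (\<Sum>y\<in>B k. mu k y * mu m (inv z \<otimes> (x \<otimes> y)))"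
    by (rule sum_shift[where k="\<lambda>y w. mu k y * mu m (inv z \<otimes> w)"]) (use assms in auto)
  also have "\<dots> = (\<Sum>y\<in>B k. mu k y * mu m (inv y \<otimes> (inv x \<otimes> z)))"
  proof (rule sum.cong[OF HOL.refl])
    fix y assume "y \<in> B k"
    then have yc: "y \<in> carrier G" using Bc by auto
    have "inv z \<otimes> (x \<otimes> y) = inv (inv y \<otimes> (inv x \<otimes> z))" using yc assms by (simp add: group_assoc_simps)
    then show "mu k y * mu m (inv z \<otimes> (x \<otimes> y)) = mu k y * mu m (inv y \<otimes> (inv x \<otimes> z))"
      using mu_sym yc assms by simp
  qed
  also have "\<dots> = mu (k + m) (inv x \<otimes> z)" using mu_conv assms by simp
  finally show ?thesis .
qed

section \<open>Squared distances between translates of the walk\<close>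

lemma two_times: "k + k = 2 * k" "Suc k + k = Suc (2 * k)" "k + Suc k = Suc (2 * k)" "Suc k + Suc k = Suc (Suc (2 * k))" for k :: nat
  by simp_all

lemma finite_translate_superset:
  assumes "finite F" "F \<subseteq> carrier G"
  obtains U where "finite U" "U \<subseteq> carrier G" "\<And>x j y. x \<in> F \<Longrightarrow> j \<le> m \<Longrightarrow> y \<in> B j \<Longrightarrow> x \<otimes> y \<in> U"
proof
  let ?U = "(\<lambda>(x,y). x \<otimes> y) ` (F \<times> B m)"
  show "finite ?U" using assms finB by auto
  show "?U \<subseteq> carrier G" using assms Bc by auto
  show "\<And>x j y. x \<in> F \<Longrightarrow> j \<le> m \<Longrightarrow> y \<in> B j \<Longrightarrow> x \<otimes> y \<in> ?U" using Bmono by blast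
qed

text \<open>\<open>energy\<close> and \<open>defect\<close> are the Dirichlet energy of \<open>\<mu>\<^sup>k\<close> and the squared norm of its Laplacian, written
  through the return kernel \<open>\<mu>\<^sup>2\<^sup>k\<close>.\<close>

definition gap where "gap k y = mu (2*k) \<one> - mu (2*k) y"
definition energy where "energy k = mu (2*k) \<one> - mu (Suc (2*k)) \<one>"
definition defect where "defect k = mu (2*k) \<one> - 2 * mu (Suc (2*k)) \<one> + mu (Suc (Suc (2*k))) \<one>"

text \<open>Thus \<open>gap k y\<close> is half the squared distance between \<open>mu k\<close> and
  its translate by \<open>y\<close>; its nonnegativity and its weak triangle inequality are read off
  from this.\<close>

lemma mu_diff_sq:
  assumes "x \<in> carrier G" "z \<in> carrier G" "finite U" "U \<subseteq> carrier G"
    "\<And>y. y \<in> B k \<Longrightarrow> x \<otimes> y \<in> U" "\<And>y. y \<in> B k \<Longrightarrow> z \<otimes> y \<in> U"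
  shows "(\<Sum>w\<in>U. (mu k (inv x \<otimes> w) - mu k (inv z \<otimes> w))\<^sup>2) = 2 * gap k (inv x \<otimes> z)"
proof -
  have "(\<Sum>w\<in>U. (mu k (inv x \<otimes> w) - mu k (inv z \<otimes> w))\<^sup>2) =
    (\<Sum>w\<in>U. mu k (inv x \<otimes> w) * mu k (inv x \<otimes> w)) + (\<Sum>w\<in>U. mu k (inv z \<otimes> w) * mu k (inv z \<otimes> w))
     - 2 * (\<Sum>w\<in>U. mu k (inv x \<otimes> w) * mu k (inv z \<otimes> w))"
    by (simp add: sum.distrib sum_subtractf sum_distrib_left power2_eq_square algebra_simps)
  then show ?thesis using mu_inner[where k=k and m=k, OF assms(1,1,3,4,5)] mu_inner[where k=k and m=k, OF assms(2,2,3,4,6)]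
      mu_inner[where k=k and m=k, OF assms(1,2,3,4,5)]
    unfolding two_times by (simp add: gap_def assms(1,2))
qed

lemma gap_nonneg: assumes "y \<in> carrier G" shows "gap k y \<ge> 0"
proof -
  obtain U where U: "finite U" "U \<subseteq> carrier G" "\<And>x j y'. x \<in> {\<one>,y} \<Longrightarrow> j \<le> k \<Longrightarrow> y' \<in> B j \<Longrightarrow> x \<otimes> y' \<in> U"
    using finite_translate_superset[of "{\<one>,y}" k] assms by auto
  have "2 * gap k (inv \<one> \<otimes> y) \<ge> 0"
    by (subst mu_diff_sq[symmetric, of \<one> y U k]) (use U assms in \<open>auto intro!: sum_nonneg\<close>)
  then show ?thesis using assms by simp
qed

lemma gap_mult: assumes "x \<in> carrier G" "y \<in> carrier G" shows "gap k (x \<otimes> y) \<le> 2 * gap k x + 2 * gap k y"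
proof -
  obtain U where U: "finite U" "U \<subseteq> carrier G" "\<And>x' j y'. x' \<in> {\<one>,x, x \<otimes> y} \<Longrightarrow> j \<le> k \<Longrightarrow> y' \<in> B j \<Longrightarrow> x' \<otimes> y' \<in> U"
    using finite_translate_superset[of "{\<one>, x, x \<otimes> y}" k] assms by auto
  have "2 * gap k (inv \<one> \<otimes> (x \<otimes> y)) = (\<Sum>w\<in>U. (mu k (inv \<one> \<otimes> w) - mu k (inv (x \<otimes> y) \<otimes> w))\<^sup>2)"
    by (subst mu_diff_sq) (use U assms in auto)
  also have "\<dots> \<le> (\<Sum>w\<in>U. 2 * (mu k (inv \<one> \<otimes> w) - mu k (inv x \<otimes> w))\<^sup>2 + 2 * (mu k (inv x \<otimes> w) - mu k (inv (x \<otimes> y) \<otimes> w))\<^sup>2)"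
  proof (rule sum_mono)
    fix w
    have "(a - c)\<^sup>2 \<le> 2 * (a - b)\<^sup>2 + 2 * (b - c)\<^sup>2" for a b c :: real
      using zero_le_power2[of "a - 2 * b + c"] by (simp add: power2_eq_square algebra_simps)
    then show "(mu k (inv \<one> \<otimes> w) - mu k (inv (x \<otimes> y) \<otimes> w))\<^sup>2 \<le>
      2 * (mu k (inv \<one> \<otimes> w) - mu k (inv x \<otimes> w))\<^sup>2 + 2 * (mu k (inv x \<otimes> w) - mu k (inv (x \<otimes> y) \<otimes> w))\<^sup>2" .
  qed
  also have "\<dots> = 2 * (2 * gap k (inv \<one> \<otimes> x)) + 2 * (2 * gap k (inv x \<otimes> (x \<otimes> y)))"
    unfolding sum.distrib sum_distrib_left[symmetric]
    by (subst mu_diff_sq, use U assms in auto)+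
  finally show ?thesis using assms by simp
qed

lemma energy_gap: "energy k = (\<Sum>s\<in>S. gap k s) / q"
proof -
  have "mu (Suc (2*k)) \<one> = (\<Sum>s\<in>S. mu (2*k) s) / q" using mu_right[of \<one>] Sc by (simp add: Sc)
  then show ?thesis using q_pos unfolding energy_def gap_def
    by (simp add: sum_subtractf diff_divide_distrib q_def)
qed

lemma energy_nonneg: "energy k \<ge> 0"
  unfolding energy_gap using gap_nonneg Sc q_pos by (intro divide_nonneg_pos sum_nonneg) auto

lemma gap_le_energy: assumes "s \<in> S" shows "gap k s \<le> q * energy k"
proof -
  have "gap k s \<le> (\<Sum>s\<in>S. gap k s)" using assms finS gap_nonneg Sc by (intro member_le_sum) auto
  then show ?thesis using q_pos by (simp add: energy_gap)
qed

lemma gap_ball: "y \<in> B n \<Longrightarrow> gap k y \<le> 4 ^ n * q * energy k"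
proof (induction n arbitrary: y)
  case 0 then show ?case using q_pos energy_nonneg[of k] by (simp add: gap_def)
next
  case (Suc n)
  then obtain s z where sz: "s \<in> S" "z \<in> B n" "y = s \<otimes> z" by (auto simp: wball.simps(2))
  have "gap k y \<le> 2 * gap k s + 2 * gap k z" unfolding sz(3) using sz Sc Bc by (intro gap_mult) auto
  also have "\<dots> \<le> 2 * (q * energy k) + 2 * (4 ^ n * q * energy k)"
    using gap_le_energy[OF sz(1), of k] Suc.IH[OF sz(2)] by simp
  also have "2 * (q * energy k) \<le> 2 * 4 ^ n * q * energy k"
    using q_pos energy_nonneg[of k] mult_right_mono[of 1 "4 ^ n :: real" "2 * (q * energy k)"] by (simp add: algebra_simps)
  finally show ?case by (simp add: algebra_simps)
qed

lemma defect_sq: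
  assumes "x \<in> carrier G" "finite U" "U \<subseteq> carrier G" "\<And>j y. j \<le> Suc k \<Longrightarrow> y \<in> B j \<Longrightarrow> x \<otimes> y \<in> U"
  shows "(\<Sum>w\<in>U. (mu (Suc k) (inv x \<otimes> w) - mu k (inv x \<otimes> w))\<^sup>2) = defect k"
proof -
  have "(\<Sum>w\<in>U. (mu (Suc k) (inv x \<otimes> w) - mu k (inv x \<otimes> w))\<^sup>2) =
    (\<Sum>w\<in>U. mu (Suc k) (inv x \<otimes> w) * mu (Suc k) (inv x \<otimes> w)) + (\<Sum>w\<in>U. mu k (inv x \<otimes> w) * mu k (inv x \<otimes> w))
     - 2 * (\<Sum>w\<in>U. mu k (inv x \<otimes> w) * mu (Suc k) (inv x \<otimes> w))"
    by (simp add: sum.distrib sum_subtractf sum_distrib_left power2_eq_square algebra_simps)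
  also have "\<dots> = mu (Suc k + Suc k) \<one> + mu (k + k) \<one> - 2 * mu (k + Suc k) \<one>"
    using mu_inner[where k="Suc k" and m="Suc k", OF assms(1,1,2,3) assms(4)[OF le_refl]]
      mu_inner[where k=k and m=k, OF assms(1,1,2,3) assms(4)[OF le_SucI[OF le_refl]]]
      mu_inner[where k=k and m="Suc k", OF assms(1,1,2,3) assms(4)[OF le_SucI[OF le_refl]]] assms(1) by simp
  also have "\<dots> = defect k" unfolding defect_def two_times by simp
  finally show ?thesis .
qed

lemma defect_nonneg: "defect k \<ge> 0"
proof -
  obtain U where U: "finite U" "U \<subseteq> carrier G" "\<And>x' j y'. x' \<in> {\<one>} \<Longrightarrow> j \<le> Suc k \<Longrightarrow> y' \<in> B j \<Longrightarrow> x' \<otimes> y' \<in> U"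
    using finite_translate_superset[of "{\<one>}" "Suc k"] by auto
  show ?thesis by (subst defect_sq[symmetric, of \<one> U k]) (use U in \<open>auto intro!: sum_nonneg\<close>)
qed

text \<open>With \<open>u = P (mu k) - mu k\<close>, the drop of the energy is the inner product of
  \<open>u\<close> and \<open>(1 + P) u\<close>. The identity has weight \<open>1 / q\<close> in
  \<open>P\<close>, so the spectrum of \<open>P\<close> lies above \<open>2 / q - 1\<close>, and the
  drop is at least \<open>2 / q\<close> times the squared norm of \<open>u\<close>, the defect. In
  elementary terms, among the squared norms of \<open>u\<close> plus its translate by
  \<open>s\<close> only the term for the identity is kept; it is 4 times the defect.\<close>

lemma energy_decay: "energy (Suc k) \<le> energy k - 2 / q * defect k"
proof -
  obtain U where U: "finite U" "U \<subseteq> carrier G" "\<And>x' j y'. x' \<in> insert \<one> S \<Longrightarrow> j \<le> Suc k \<Longrightarrow> y' \<in> B j \<Longrightarrow> x' \<otimes> y' \<in> U"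
    using finite_translate_superset[of "insert \<one> S" "Suc k"] finS Sc by auto
  define u where "u x w = mu (Suc k) (inv x \<otimes> w) - mu k (inv x \<otimes> w)" for x w
  define D where "D s = (\<Sum>w\<in>U. (u \<one> w + u s w)\<^sup>2)" for s
  have D: "D s = 2 * defect k + 2 * (mu (2*k) s - 2 * mu (Suc (2*k)) s + mu (Suc (Suc (2*k))) s)" if s: "s \<in> S" for s
  proof -
    have I: "(\<Sum>w\<in>U. mu i (inv \<one> \<otimes> w) * mu j (inv s \<otimes> w)) = mu (i + j) (inv \<one> \<otimes> s)" if "i \<le> Suc k" for i j
      by (rule mu_inner[OF one_closed Sc[OF s] U(1,2)]) (rule U(3)[OF _ that], auto)
    have "D s = (\<Sum>w\<in>U. (u \<one> w)\<^sup>2) + (\<Sum>w\<in>U. (u s w)\<^sup>2) + 2 * (\<Sum>w\<in>U. u \<one> w * u s w)"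
      unfolding D_def by (simp add: sum.distrib sum_distrib_left power2_sum algebra_simps)
    also have "(\<Sum>w\<in>U. (u \<one> w)\<^sup>2) = defect k" unfolding u_def by (rule defect_sq) (use U in auto)
    also have "(\<Sum>w\<in>U. (u s w)\<^sup>2) = defect k" unfolding u_def by (rule defect_sq) (use U s Sc in auto)
    also have "(\<Sum>w\<in>U. u \<one> w * u s w) = (\<Sum>w\<in>U. mu (Suc k) (inv \<one> \<otimes> w) * mu (Suc k) (inv s \<otimes> w))
       - (\<Sum>w\<in>U. mu (Suc k) (inv \<one> \<otimes> w) * mu k (inv s \<otimes> w)) - (\<Sum>w\<in>U. mu k (inv \<one> \<otimes> w) * mu (Suc k) (inv s \<otimes> w))
       + (\<Sum>w\<in>U. mu k (inv \<one> \<otimes> w) * mu k (inv s \<otimes> w))"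
      unfolding u_def by (simp add: sum.distrib sum_subtractf algebra_simps)
    also have "\<dots> = mu (Suc k + Suc k) (inv \<one> \<otimes> s) - mu (Suc k + k) (inv \<one> \<otimes> s) - mu (k + Suc k) (inv \<one> \<otimes> s) + mu (k + k) (inv \<one> \<otimes> s)"
      unfolding I[OF le_refl] I[OF le_SucI[OF le_refl]] ..
    finally show ?thesis using s Sc unfolding two_times by simp
  qed
  have Dn: "D s \<ge> 0" for s unfolding D_def by (rule sum_nonneg) auto
  have Smu: "(\<Sum>s\<in>S. mu n s) = q * mu (Suc n) \<one>" for n
    using mu_right[of \<one> n] q_pos Sc by simp
  have "D \<one> = 4 * defect k" unfolding D[OF oneS] by (simp add: defect_def)
  then have "4 * defect k \<le> (\<Sum>s\<in>S. D s)" using member_le_sum[OF oneS, of D] Dn finS by auto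
  also have "\<dots> = (\<Sum>s\<in>S. 2 * defect k + 2 * (mu (2*k) s - 2 * mu (Suc (2*k)) s + mu (Suc (Suc (2*k))) s))"
    using D by (intro sum.cong) auto
  also have "\<dots> = q * (2 * defect k) + 2 * ((\<Sum>s\<in>S. mu (2*k) s) - 2 * (\<Sum>s\<in>S. mu (Suc (2*k)) s) + (\<Sum>s\<in>S. mu (Suc (Suc (2*k))) s))"
    by (simp add: sum.distrib sum_subtractf sum_distrib_left q_def algebra_simps)
  also have "\<dots> = q * (2 * (defect k + mu (Suc (2*k)) \<one> - 2 * mu (Suc (Suc (2*k))) \<one> + mu (Suc (Suc (Suc (2*k)))) \<one>))"
    unfolding Smu by (simp add: algebra_simps)
  also have "defect k + mu (Suc (2*k)) \<one> - 2 * mu (Suc (Suc (2*k))) \<one> + mu (Suc (Suc (Suc (2*k)))) \<one> = energy k - energy (Suc k)"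
    by (simp add: defect_def energy_def)
  finally have "4 * defect k \<le> q * (2 * (energy k - energy (Suc k)))" .
  then show ?thesis using q_pos by (simp add: field_simps)
qed

text \<open>Cauchy-Schwarz applied to the total mass 1, which sits on a ball.\<close>

lemma mu_return_lower: "1 \<le> real (card (B k)) * mu (2*k) \<one>"
proof -
  have "1 = (\<Sum>y\<in>B k. 1 * mu k y)\<^sup>2" using mu_total by simp
  also have "\<dots> \<le> (\<Sum>y\<in>B k. 1\<^sup>2) * (\<Sum>y\<in>B k. (mu k y)\<^sup>2)" by (rule Cauchy_Schwarz_ineq_sum)
  also have "(\<Sum>y\<in>B k. (mu k y)\<^sup>2) = mu (k + k) (inv \<one> \<otimes> \<one>)"
    by (subst mu_inner[symmetric, of \<one> \<one> "B k"]) (use finB Bc in \<open>auto simp: power2_eq_square intro!: sum.cong\<close>)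
  finally show ?thesis unfolding two_times by simp
qed

end

section \<open>Random walks under polynomial growth\<close>

locale poly_walk = walk +
  fixes C :: real and d :: nat
  assumes inf: "infinite (carrier G)"
    and poly: "n \<ge> 1 \<Longrightarrow> real (card (wball G S n)) \<le> C * real n ^ d"
begin

lemma B_large: "\<exists>n. card (B n) > N"
proof (rule ccontr)
  assume "\<not> ?thesis"
  then have le: "card (B n) \<le> N" for n by (meson not_less)
  obtain F where F: "F \<subseteq> carrier G" "finite F" "card F = Suc N" using infinite_arbitrarily_large[OF inf] by metis
  obtain c where "F \<subseteq> B c" using sgen_finite_subset[OF sgenS F(2,1)] by auto
  then have "Suc N \<le> card (B c)" using card_mono[OF finB] F by metis
  then show False using le[of c] by simp
qed

lemma C_pos: "C > 0"
proof -
  have "\<one> \<in> B 1" using one_in_wball[OF symS] .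
  then have "card (B 1) \<noteq> 0" using finB by auto
  then have "real (card (B 1)) > 0" by simp
  then show ?thesis using poly[of 1] by simp
qed

text \<open>Otherwise the energy, hence the return probability, would decay exponentially, against
  polynomial growth.\<close>

lemma almost_harmonic: assumes "\<eta> > 0" shows "\<exists>k. energy k > 0 \<and> defect k \<le> \<eta> * energy k"
proof (rule ccontr)
  assume "\<not> ?thesis"
  then have no: "energy k > 0 \<Longrightarrow> defect k > \<eta> * energy k" for k by (meson not_less)
  \<comment> \<open>The maximum with 1/2 keeps the ratio positive when \<open>\<eta>\<close> is
    large.\<close>
  define \<rho> where "\<rho> = max (1/2) (1 - 2 * \<eta> / q)"
  have \<rho>: "0 < \<rho>" "\<rho> < 1" using assms q_pos by (auto simp: \<rho>_def)
  have step: "energy (Suc k) \<le> \<rho> * energy k" for k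
  proof (cases "energy k > 0")
    case True
    have "2 / q * (\<eta> * energy k) \<le> 2 / q * defect k" using no[OF True] q_pos by (intro mult_left_mono) auto
    then have "energy (Suc k) \<le> (1 - 2 * \<eta> / q) * energy k" using energy_decay[of k] by (simp add: algebra_simps)
    also have "\<dots> \<le> \<rho> * energy k" using True by (intro mult_right_mono) (auto simp: \<rho>_def)
    finally show ?thesis .
  next
    case False
    then have "energy k = 0" using energy_nonneg[of k] by simp
    moreover have "0 \<le> 2 / q * defect k" using defect_nonneg[of k] q_pos by simp
    ultimately show ?thesis using energy_decay[of k] by simp
  qed
  have energy: "energy k \<le> \<rho> ^ k * energy 0" for k
  proof (induction k)
    case (Suc k)
    have "\<rho> * energy k \<le> \<rho> * (\<rho> ^ k * energy 0)" using Suc \<rho> by (intro mult_left_mono) auto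
    then show ?case using step[of k] by simp
  qed simp
  define A where "A k = mu (2*k) \<one>" for k
  have A0: "A k \<ge> 0" for k by (simp add: A_def mu_nonneg)
  have Astep: "A k - A (Suc k) \<le> 2 * \<rho> ^ k * energy 0" "A (Suc k) \<le> A k" for k
  proof -
    have e: "A k - A (Suc k) = 2 * energy k - defect k" by (simp add: A_def energy_def defect_def)
    then show "A k - A (Suc k) \<le> 2 * \<rho> ^ k * energy 0" using energy[of k] defect_nonneg[of k] by simp
    have "A k - A (Suc k) \<ge> 0"
    proof -
      obtain U where U: "finite U" "U \<subseteq> carrier G" "\<And>x' j y'. x' \<in> {\<one>} \<Longrightarrow> j \<le> Suc k \<Longrightarrow> y' \<in> B j \<Longrightarrow> x' \<otimes> y' \<in> U"
        using finite_translate_superset[of "{\<one>}" "Suc k"] by auto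
      have a: "(\<Sum>w\<in>U. (mu k w)\<^sup>2) = A k" "(\<Sum>w\<in>U. (mu (Suc k) w)\<^sup>2) = A (Suc k)"
      proof -
        have "(\<Sum>w\<in>U. (mu j w)\<^sup>2) = mu (j + j) \<one>" if "j \<le> Suc k" for j
        proof -
          have "(\<Sum>w\<in>U. mu j (inv \<one> \<otimes> w) * mu j (inv \<one> \<otimes> w)) = mu (j + j) (inv \<one> \<otimes> \<one>)"
            by (rule mu_inner) (use U that in auto)
          moreover have "(\<Sum>w\<in>U. mu j (inv \<one> \<otimes> w) * mu j (inv \<one> \<otimes> w)) = (\<Sum>w\<in>U. (mu j w)\<^sup>2)"
            using U(2) by (intro sum.cong) (auto simp: power2_eq_square)
          ultimately show ?thesis by simp
        qed
        from this[of k] this[of "Suc k"] show "(\<Sum>w\<in>U. (mu k w)\<^sup>2) = A k" "(\<Sum>w\<in>U. (mu (Suc k) w)\<^sup>2) = A (Suc k)"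
          unfolding A_def two_times by simp_all
      qed
      have "(mu (Suc k) w)\<^sup>2 \<le> (\<Sum>s\<in>S. (mu k (inv s \<otimes> w))\<^sup>2) / q" for w
      proof -
        have "(mu (Suc k) w)\<^sup>2 = (\<Sum>s\<in>S. 1 * mu k (inv s \<otimes> w))\<^sup>2 / q\<^sup>2" by (simp add: mu.simps(2) power_divide)
        also have "\<dots> \<le> ((\<Sum>s\<in>S. 1\<^sup>2) * (\<Sum>s\<in>S. (mu k (inv s \<otimes> w))\<^sup>2)) / q\<^sup>2"
          by (intro divide_right_mono Cauchy_Schwarz_ineq_sum) auto
        also have "\<dots> = (\<Sum>s\<in>S. (mu k (inv s \<otimes> w))\<^sup>2) / q"
          using q_pos by (simp add: q_def power2_eq_square)
        finally show ?thesis .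
      qed
      then have "A (Suc k) \<le> (\<Sum>w\<in>B (Suc k). (\<Sum>s\<in>S. (mu k (inv s \<otimes> w))\<^sup>2) / q)"
        unfolding a(2)[symmetric]
        by (subst sum_superset[OF U(1,2), of "Suc k"]) (use U(3)[of \<one> "Suc k"] Bc in \<open>auto intro!: sum_mono\<close>)
      also have "\<dots> = (\<Sum>s\<in>S. \<Sum>w\<in>B (Suc k). (mu k (inv s \<otimes> w))\<^sup>2) / q"
        by (subst sum.swap) (simp add: sum_divide_distrib)
      also have "\<dots> = (\<Sum>s\<in>S. \<Sum>y\<in>B k. (mu k y)\<^sup>2) / q"
      proof (rule arg_cong2[where f="(/)"], rule sum.cong[OF HOL.refl])
        fix s assume s: "s \<in> S"
        show "(\<Sum>w\<in>B (Suc k). (mu k (inv s \<otimes> w))\<^sup>2) = (\<Sum>y\<in>B k. (mu k y)\<^sup>2)"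
          by (rule sum_shift_gen[OF s, where k="\<lambda>y z. (mu k y)\<^sup>2"]) simp
      qed (rule HOL.refl)
      also have "\<dots> = (\<Sum>y\<in>B k. (mu k y)\<^sup>2)" using q_pos by (simp add: q_def)
      also have "\<dots> = A k" unfolding a(1)[symmetric]
        by (rule sum_superset[symmetric, OF U(1,2)]) (use U(3)[of \<one> k] Bc in auto)
      finally show ?thesis by simp
    qed
    then show "A (Suc k) \<le> A k" by simp
  qed
  have Adec: "decseq A" using Astep(2) by (intro decseq_SucI)
  obtain c where c: "A \<longlonglongrightarrow> c" "\<And>k. c \<le> A k" using decseq_convergent[OF Adec, of 0] A0 by auto
  have c0: "c \<ge> 0" using LIMSEQ_le_const[OF c(1), of 0] A0 by auto
  have e0: "energy 0 \<ge> 0" by (rule energy_nonneg)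
  have pw: "(\<lambda>k. \<rho> ^ k) \<longlonglongrightarrow> 0" using \<rho> by (intro LIMSEQ_realpow_zero) auto
  \<comment> \<open>A positive limit is impossible in an infinite group: once the energy is tiny,
    \<open>gap_ball\<close> makes \<open>mu (2*j)\<close> at least \<open>c / 2\<close> on a ball
    with more than \<open>2 / c\<close> elements, so the total mass would exceed 1.\<close>
  have "c = 0"
  proof (rule ccontr)
    assume "c \<noteq> 0"
    then have cp: "c > 0" using c0 by simp
    obtain n where n: "card (B n) > nat \<lceil>2 / c\<rceil>" using B_large by blast
    then have n2: "real (card (B n)) > 2 / c" by linarith
    have "(\<lambda>j. 4 ^ n * q * (\<rho> ^ j * energy 0)) \<longlonglongrightarrow> 4 ^ n * q * (0 * energy 0)" by (intro tendsto_intros pw)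
    then have "eventually (\<lambda>j. 4 ^ n * q * (\<rho> ^ j * energy 0) < c / 2) sequentially"
      using cp by (intro order_tendstoD(2)[where y=0]) auto
    then obtain j where j: "4 ^ n * q * (\<rho> ^ j * energy 0) < c / 2" by (auto simp: eventually_sequentially)
    have "c / 2 \<le> mu (2*j) y" if "y \<in> B n" for y
    proof -
      have "gap j y \<le> 4 ^ n * q * (\<rho> ^ j * energy 0)"
        by (rule order_trans[OF gap_ball[OF that, of j]], rule mult_left_mono[OF energy[of j]]) (use q_pos in simp)
      then show ?thesis using j c(2)[of j] by (simp add: gap_def A_def)
    qed
    then have "(\<Sum>y\<in>B n. c / 2) \<le> (\<Sum>y\<in>B n. mu (2*j) y)" by (rule sum_mono)
    also have "\<dots> \<le> 1" using mu_le_sum finB Bc by blast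
    finally have "real (card (B n)) * (c / 2) \<le> 1" by simp
    then show False using n2 cp by (simp add: field_simps)
  qed
  have Adiff: "A k - A (k + j) \<le> (\<Sum>i<j. 2 * \<rho> ^ (k + i) * energy 0)" for k j
  proof (induction j)
    case (Suc j) then show ?case using Astep(1)[of "k + j"] by simp
  qed simp
  have sumb: "(\<Sum>i<j. 2 * \<rho> ^ (k + i) * energy 0) \<le> 2 * \<rho> ^ k * energy 0 / (1 - \<rho>)" for k j
  proof -
    have "(\<Sum>i<j. 2 * \<rho> ^ (k + i) * energy 0) = 2 * \<rho> ^ k * energy 0 * (\<Sum>i<j. \<rho> ^ i)"
      by (simp add: sum_distrib_left power_add mult_ac)
    also have "\<dots> \<le> 2 * \<rho> ^ k * energy 0 * (1 / (1 - \<rho>))"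
    proof (rule mult_left_mono)
      show "(\<Sum>i<j. \<rho> ^ i) \<le> 1 / (1 - \<rho>)" using \<rho> by (simp add: geometric_sum divide_le_cancel field_simps)
      show "0 \<le> 2 * \<rho> ^ k * energy 0" using \<rho> e0 by simp
    qed
    finally show ?thesis by simp
  qed
  have Ab: "A k \<le> 2 * \<rho> ^ k * energy 0 / (1 - \<rho>)" for k
  proof -
    have "(\<lambda>j. A k - A (j + k)) \<longlonglongrightarrow> A k - 0"
      using c(1) \<open>c = 0\<close> LIMSEQ_ignore_initial_segment[of A 0 k] by (intro tendsto_diff tendsto_const) auto
    moreover have "A k - A (j + k) \<le> 2 * \<rho> ^ k * energy 0 / (1 - \<rho>)" for j
      using Adiff[of k j] sumb[where k=k and j=j] by (simp add: add.commute)
    ultimately show ?thesis using LIMSEQ_le_const2 by fastforce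
  qed
  have "1 \<le> C * real k ^ d * (2 * \<rho> ^ k * energy 0 / (1 - \<rho>))" if "k \<ge> 1" for k
  proof -
    have "1 \<le> real (card (B k)) * A k" using mu_return_lower by (simp add: A_def)
    also have "\<dots> \<le> C * real k ^ d * (2 * \<rho> ^ k * energy 0 / (1 - \<rho>))"
      using poly[OF that] Ab[of k] A0 by (intro mult_mono) (auto intro: order_trans)
    finally show ?thesis .
  qed
  moreover have "(\<lambda>k. C * real k ^ d * (2 * \<rho> ^ k * energy 0 / (1 - \<rho>))) \<longlonglongrightarrow> 0"
  proof -
    have "(\<lambda>k. real k ^ d * \<rho> ^ k) \<longlonglongrightarrow> 0" using \<rho> by real_asymp
    then have "(\<lambda>k. C * 2 * energy 0 / (1 - \<rho>) * (real k ^ d * \<rho> ^ k)) \<longlonglongrightarrow> C * 2 * energy 0 / (1 - \<rho>) * 0"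
      by (intro tendsto_mult tendsto_const)
    then show ?thesis by (simp add: mult_ac)
  qed
  ultimately have "(1::real) \<le> 0" by (intro LIMSEQ_le_const[where a=1]) auto
  then show False by simp
qed

text \<open>The kernel \<open>\<mu>\<^sup>2\<^sup>k\<close>, differenced at \<open>s\<close> and normalised to vanish at the identity.\<close>

definition kernel_diff where
  "kernel_diff k s x = (mu (2*k) \<one> - mu (2*k) x - mu (2*k) s + mu (2*k) (inv x \<otimes> s)) / energy k"

text \<open>Up to the factor \<open>1 / energy k\<close>, the increment is the inner product of two
  differences of translates of \<open>mu k\<close>, one from \<open>x\<close> to \<open>x t\<close>
  and one from the identity to \<open>s\<close>. Each has squared norm at most
  \<open>2 q energy k\<close>.\<close>

lemma kernel_diff_Lipschitz:
  assumes "energy k > 0" "s \<in> S" "t \<in> S" "x \<in> carrier G"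
  shows "\<bar>kernel_diff k s (x \<otimes> t) - kernel_diff k s x\<bar> \<le> 2 * q"
proof -
  have c: "s \<in> carrier G" "t \<in> carrier G" using assms Sc by auto
  obtain U where U: "finite U" "U \<subseteq> carrier G" "\<And>x' j y'. x' \<in> {\<one>,s,x,x\<otimes>t} \<Longrightarrow> j \<le> k \<Longrightarrow> y' \<in> B j \<Longrightarrow> x' \<otimes> y' \<in> U"
    using finite_translate_superset[of "{\<one>,s,x,x\<otimes>t}" "k"] c assms(4) by auto
  have I: "(\<Sum>w\<in>U. mu k (inv a \<otimes> w) * mu k (inv b \<otimes> w)) = mu (2*k) (inv a \<otimes> b)" if "a \<in> {\<one>,s,x,x\<otimes>t}" "b \<in> carrier G" for a b
    unfolding two_times[symmetric] using that c assms(4) U by (intro mu_inner[OF _ _ U(1,2)]) auto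
  let ?N = "\<Sum>w\<in>U. (mu k (inv (x \<otimes> t) \<otimes> w) - mu k (inv x \<otimes> w)) * (mu k (inv s \<otimes> w) - mu k (inv \<one> \<otimes> w))"
  have "?N = (\<Sum>w\<in>U. mu k (inv (x \<otimes> t) \<otimes> w) * mu k (inv s \<otimes> w)) - (\<Sum>w\<in>U. mu k (inv (x \<otimes> t) \<otimes> w) * mu k (inv \<one> \<otimes> w))
      - (\<Sum>w\<in>U. mu k (inv x \<otimes> w) * mu k (inv s \<otimes> w)) + (\<Sum>w\<in>U. mu k (inv x \<otimes> w) * mu k (inv \<one> \<otimes> w))"
    by (simp add: sum.distrib sum_subtractf algebra_simps)
  also have "\<dots> = mu (2*k) (inv (x \<otimes> t) \<otimes> s) - mu (2*k) (inv (x \<otimes> t) \<otimes> \<one>) - mu (2*k) (inv x \<otimes> s) + mu (2*k) (inv x \<otimes> \<one>)"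
    using I c(1) by (simp del: inv_one)
  also have "\<dots> = mu (2*k) (inv (x \<otimes> t) \<otimes> s) - mu (2*k) (x \<otimes> t) - mu (2*k) (inv x \<otimes> s) + mu (2*k) x"
    using mu_sym[of "x \<otimes> t" "2*k"] mu_sym[of x "2*k"] c assms(4) by (simp add: inv_mult_group)
  finally have N: "kernel_diff k s (x \<otimes> t) - kernel_diff k s x = ?N / energy k"
    unfolding kernel_diff_def by (simp add: diff_divide_distrib[symmetric])
  have "?N\<^sup>2 \<le> (\<Sum>w\<in>U. (mu k (inv (x \<otimes> t) \<otimes> w) - mu k (inv x \<otimes> w))\<^sup>2) * (\<Sum>w\<in>U. (mu k (inv s \<otimes> w) - mu k (inv \<one> \<otimes> w))\<^sup>2)"
    by (rule Cauchy_Schwarz_ineq_sum)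
  also have "\<dots> = (2 * gap k (inv (x \<otimes> t) \<otimes> x)) * (2 * gap k (inv s \<otimes> \<one>))"
    using U c assms(4) by (intro arg_cong2[where f="(*)"] mu_diff_sq) auto
  also have "\<dots> = (2 * gap k t) * (2 * gap k s)"
    using mu_sym c assms(4) by (simp add: gap_def group_assoc_simps)
  also have "\<dots> \<le> (2 * (q * energy k)) * (2 * (q * energy k))"
    using gap_le_energy[OF assms(2), of k] gap_le_energy[OF assms(3), of k] gap_nonneg c q_pos assms(1) by (intro mult_mono) auto
  finally have "?N\<^sup>2 \<le> (2 * q * energy k)\<^sup>2" by (simp add: power2_eq_square mult_ac)
  then have "\<bar>?N\<bar> \<le> 2 * q * energy k" using q_pos assms(1) by (simp add: abs_le_square_iff[symmetric])
  then show ?thesis unfolding N using assms(1) by (simp add: abs_divide field_simps)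
qed

text \<open>The same inner product, with the first factor replaced by the translate to
  \<open>x\<close> of \<open>P (mu k) - mu k\<close>. Its squared norm is the defect, so the failure
  of harmonicity is of the order of the root of \<open>\<eta>\<close>.\<close>

lemma kernel_diff_harmonic:
  assumes "energy k > 0" "defect k \<le> \<eta> * energy k" "s \<in> S" "x \<in> carrier G" "\<eta> > 0"
  shows "\<bar>P (kernel_diff k s) x - kernel_diff k s x\<bar> \<le> sqrt (2 * q * \<eta>)"
proof -
  have c: "s \<in> carrier G" using assms Sc by auto
  obtain U where U: "finite U" "U \<subseteq> carrier G" "\<And>x' j y'. x' \<in> {\<one>,s,x} \<Longrightarrow> j \<le> Suc k \<Longrightarrow> y' \<in> B j \<Longrightarrow> x' \<otimes> y' \<in> U"
    using finite_translate_superset[of "{\<one>,s,x}" "Suc k"] c assms(4) by auto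
  have I: "(\<Sum>w\<in>U. mu j (inv a \<otimes> w) * mu k (inv b \<otimes> w)) = mu (j + k) (inv a \<otimes> b)" if "j \<le> Suc k" "a \<in> {\<one>,s,x}" "b \<in> carrier G" for a b j
    using that c assms(4) U by (intro mu_inner[OF _ _ U(1,2)]) auto
  let ?N = "\<Sum>w\<in>U. (mu (Suc k) (inv x \<otimes> w) - mu k (inv x \<otimes> w)) * (mu k (inv s \<otimes> w) - mu k (inv \<one> \<otimes> w))"
  have "?N = (\<Sum>w\<in>U. mu (Suc k) (inv x \<otimes> w) * mu k (inv s \<otimes> w)) - (\<Sum>w\<in>U. mu (Suc k) (inv x \<otimes> w) * mu k (inv \<one> \<otimes> w))
      - (\<Sum>w\<in>U. mu k (inv x \<otimes> w) * mu k (inv s \<otimes> w)) + (\<Sum>w\<in>U. mu k (inv x \<otimes> w) * mu k (inv \<one> \<otimes> w))"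
    by (simp add: sum.distrib sum_subtractf algebra_simps)
  also have "\<dots> = mu (Suc (2*k)) (inv x \<otimes> s) - mu (Suc (2*k)) (inv x \<otimes> \<one>) - mu (2*k) (inv x \<otimes> s) + mu (2*k) (inv x \<otimes> \<one>)"
    using I[of "Suc k" x] I[of k x] c unfolding two_times by (simp del: inv_one)
  also have "\<dots> = mu (Suc (2*k)) (inv x \<otimes> s) - mu (Suc (2*k)) x - mu (2*k) (inv x \<otimes> s) + mu (2*k) x"
    using mu_sym[of x] assms(4) by simp
  finally have N: "P (kernel_diff k s) x - kernel_diff k s x = ?N / energy k"
  proof -
    assume e: "?N = mu (Suc (2*k)) (inv x \<otimes> s) - mu (Suc (2*k)) x - mu (2*k) (inv x \<otimes> s) + mu (2*k) x"
    have 1: "(\<Sum>t\<in>S. mu (2*k) (x \<otimes> t)) = q * mu (Suc (2*k)) x"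
      using mu_right[OF assms(4), of "2*k"] q_pos by simp
    have "(\<Sum>t\<in>S. mu (2*k) (inv (x \<otimes> t) \<otimes> s)) = (\<Sum>t\<in>S. mu (2*k) (inv t \<otimes> (inv x \<otimes> s)))"
      using Sc assms(4) c by (intro sum.cong) (auto simp: group_assoc_simps)
    then have 2: "(\<Sum>t\<in>S. mu (2*k) (inv (x \<otimes> t) \<otimes> s)) = q * mu (Suc (2*k)) (inv x \<otimes> s)"
      using q_pos by (simp add: mu.simps(2))
    have "P (kernel_diff k s) x = (q * (mu (2*k) \<one> - mu (2*k) s) - (\<Sum>t\<in>S. mu (2*k) (x \<otimes> t)) + (\<Sum>t\<in>S. mu (2*k) (inv (x \<otimes> t) \<otimes> s))) / energy k / q"
      unfolding P_def kernel_diff_def by (simp add: sum_divide_distrib[symmetric] sum.distrib sum_subtractf q_def algebra_simps)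
    also have "\<dots> = (mu (2*k) \<one> - mu (2*k) s - mu (Suc (2*k)) x + mu (Suc (2*k)) (inv x \<otimes> s)) / energy k"
    proof -
      have "q * a - q * b + q * c = q * (a - b + c)" for a b c by (simp add: algebra_simps)
      then show ?thesis unfolding 1 2 using q_pos by simp
    qed
    finally show ?thesis unfolding e kernel_diff_def by (simp add: diff_divide_distrib add_divide_distrib)
  qed
  have "?N\<^sup>2 \<le> (\<Sum>w\<in>U. (mu (Suc k) (inv x \<otimes> w) - mu k (inv x \<otimes> w))\<^sup>2) * (\<Sum>w\<in>U. (mu k (inv s \<otimes> w) - mu k (inv \<one> \<otimes> w))\<^sup>2)"
    by (rule Cauchy_Schwarz_ineq_sum)
  also have "\<dots> = defect k * (2 * gap k (inv s \<otimes> \<one>))"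
    using U U(3)[of _ k] c assms(4) by (intro arg_cong2[where f="(*)"] mu_diff_sq defect_sq) auto
  also have "\<dots> = defect k * (2 * gap k s)"
    using mu_sym c assms(4) by (simp add: gap_def)
  also have "\<dots> \<le> (\<eta> * energy k) * (2 * (q * energy k))"
    using gap_le_energy[OF assms(3), of k] gap_nonneg c q_pos assms by (intro mult_mono) auto
  finally have "?N\<^sup>2 \<le> 2 * q * \<eta> * (energy k)\<^sup>2" by (simp add: power2_eq_square mult_ac)
  then have "(?N / energy k)\<^sup>2 \<le> 2 * q * \<eta>" using assms(1) by (simp add: power_divide field_simps)
  then have "\<bar>?N / energy k\<bar>\<^sup>2 \<le> 2 * q * \<eta>" by (simp only: power2_abs)
  then show ?thesis unfolding N by (rule real_le_rsqrt)
qed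

text \<open>Along times of ever smaller relative defect, the functions \<open>kernel_diff\<close>
  are uniformly Lipschitz and vanish at the identity, so a subsequence converges pointwise. The
  direction \<open>s j\<close> is chosen with gap at least the mean \<open>energy (k j)\<close>,
  which keeps the value at \<open>s j\<close> at least 2.\<close>

lemma exists_harmonic:
  "\<exists>\<phi> L. (\<forall>x\<in>carrier G. P \<phi> x = \<phi> x) \<and> \<phi> \<one> = 0 \<and> L > 0 \<and>
     (\<forall>x\<in>carrier G. \<forall>s\<in>S. \<bar>\<phi> (x \<otimes> s) - \<phi> x\<bar> \<le> L) \<and> (\<exists>s\<in>S. \<phi> s \<noteq> 0)"
proof -
  have "\<exists>k. energy k > 0 \<and> defect k \<le> 1 / real (Suc j) * energy k" for j by (rule almost_harmonic) simp
  then obtain k where k: "\<And>j. energy (k j) > 0" "\<And>j. defect (k j) \<le> 1 / real (Suc j) * energy (k j)" by metis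
  have "\<exists>s\<in>S. gap (k j) s \<ge> energy (k j)" for j
  proof (rule ccontr)
    assume "\<not> ?thesis"
    then have "(\<Sum>s\<in>S. gap (k j) s) < (\<Sum>s\<in>S. energy (k j))"
      using finS oneS by (intro sum_strict_mono) auto
    then show False using energy_gap[of "k j"] q_pos by (simp add: q_def field_simps)
  qed
  then obtain s where s: "\<And>j. s j \<in> S" "\<And>j. gap (k j) (s j) \<ge> energy (k j)" by metis
  define f where "f j = kernel_diff (k j) (s j)" for j
  have f1: "f j \<one> = 0" for j using s Sc by (simp add: f_def kernel_diff_def)
  have fs: "f j (s j) \<ge> 2" for j
    using s(1)[of j] s(2)[of j] k(1)[of j] Sc by (simp add: f_def kernel_diff_def gap_def field_simps)
  have fL: "\<bar>f j (x \<otimes> t) - f j x\<bar> \<le> 2 * q" if "x \<in> carrier G" "t \<in> S" for j x t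
    unfolding f_def by (rule kernel_diff_Lipschitz) (use k s that in auto)
  have fb: "\<bar>f j x\<bar> \<le> 2 * q * real n" if "x \<in> B n" for j x n
    using that
  proof (induction n arbitrary: x)
    case 0 then show ?case using f1 by simp
  next
    case (Suc n)
    then obtain y t where yt: "y \<in> B n" "t \<in> S" "x = y \<otimes> t"
      using Suc.prems unfolding wball_Suc2[OF symS] by blast
    then have "\<bar>f j x - f j y\<bar> \<le> 2 * q" using fL Bc by auto
    then show ?case using Suc.IH[OF yt(1)] by (simp add: algebra_simps)
  qed
  define len where "len x = (LEAST n. x \<in> B n)" for x
  have len: "x \<in> B (len x)" if "x \<in> carrier G" for x
    unfolding len_def using that carrier_B by (auto intro: LeastI_ex)
  \<comment> \<open>Dividing by the Lipschitz bound at \<open>x\<close> gives the uniform bound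
    under which a pointwise convergent subsequence is extracted; the added 1 keeps the divisor
    positive.\<close>
  define b where "b x = 2 * q * real (len x) + 1" for x
  have b: "b x > 0" for x using q_pos by (simp add: b_def add_nonneg_pos)
  have "countable (carrier G)" unfolding carrier_B using finB by (intro countable_UN) (auto intro: countable_finite)
  moreover have "norm (f j x / b x) \<le> 1" if "x \<in> carrier G" for j x
    using fb[OF len[OF that], of j] b[of x] by (simp add: b_def abs_divide)
  ultimately obtain r where r: "strict_mono (r :: nat \<Rightarrow> nat)" "\<And>x. x \<in> carrier G \<Longrightarrow> \<exists>l. (\<lambda>j. f (r j) x / b x) \<longlonglongrightarrow> l"
    by (rule function_convergent_subsequence[of "carrier G" "\<lambda>j x. f j x / b x" 1]) auto
  have "\<exists>l. (\<lambda>j. f (r j) x) \<longlonglongrightarrow> l" if x: "x \<in> carrier G" for x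
  proof -
    obtain l where "(\<lambda>j. f (r j) x / b x) \<longlonglongrightarrow> l" using r(2)[OF x] by (rule exE)
    then have "(\<lambda>j. b x * (f (r j) x / b x)) \<longlonglongrightarrow> b x * l" by (intro tendsto_mult tendsto_const)
    then show ?thesis using b[of x] by auto
  qed
  then obtain \<phi> where \<phi>: "\<And>x. x \<in> carrier G \<Longrightarrow> (\<lambda>j. f (r j) x) \<longlonglongrightarrow> \<phi> x" by metis
  show ?thesis
  proof (intro exI[of _ \<phi>] exI[of _ "2 * q"] conjI ballI)
    show "2 * q > 0" using q_pos by simp
    have "(\<lambda>j. f (r j) \<one>) \<longlonglongrightarrow> 0" by (simp add: f1)
    then show "\<phi> \<one> = 0" using \<phi>[OF one_closed] LIMSEQ_unique by blast
    show "\<bar>\<phi> (x \<otimes> t) - \<phi> x\<bar> \<le> 2 * q" if "x \<in> carrier G" "t \<in> S" for x t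
    proof (rule LIMSEQ_le_const2)
      show "(\<lambda>j. \<bar>f (r j) (x \<otimes> t) - f (r j) x\<bar>) \<longlonglongrightarrow> \<bar>\<phi> (x \<otimes> t) - \<phi> x\<bar>"
        using that Sc by (intro tendsto_rabs tendsto_diff \<phi>) auto
    qed (use fL that in auto)
    show "P \<phi> x = \<phi> x" if x: "x \<in> carrier G" for x
    proof -
      have l1: "(\<lambda>j. P (f (r j)) x - f (r j) x) \<longlonglongrightarrow> P \<phi> x - \<phi> x"
        unfolding P_def using x Sc q_pos by (intro tendsto_intros \<phi>) auto
      have "(\<lambda>j. P (f (r j)) x - f (r j) x) \<longlonglongrightarrow> 0"
      proof (rule Lim_null_comparison)
        show "\<forall>\<^sub>F j in sequentially. norm (P (f (r j)) x - f (r j) x) \<le> sqrt (2 * q * (1 / real (Suc (r j))))"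
          unfolding f_def using kernel_diff_harmonic[OF k(1) k(2) s(1) x] by (intro always_eventually) auto
        have "(\<lambda>j. sqrt (2 * q * (1 / real (Suc j)))) \<longlonglongrightarrow> sqrt (2 * q * 0)"
          by (intro tendsto_real_sqrt tendsto_mult tendsto_const LIMSEQ_inverse_real_of_nat[unfolded inverse_eq_divide])
        then show "(\<lambda>j. sqrt (2 * q * (1 / real (Suc (r j))))) \<longlonglongrightarrow> 0"
          using LIMSEQ_subseq_LIMSEQ[OF _ r(1)] by (force simp: o_def)
      qed
      then show ?thesis using l1 LIMSEQ_unique by fastforce
    qed
    \<comment> \<open>The direction varies with \<open>j\<close>, but \<open>S\<close> is finite: if
      the limit vanished on \<open>S\<close>, all values on \<open>S\<close> would eventually be
      below 2.\<close>
    show "\<exists>s\<in>S. \<phi> s \<noteq> 0"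
    proof (rule ccontr)
      assume "\<not> ?thesis"
      then have "\<forall>t\<in>S. (\<lambda>j. f (r j) t) \<longlonglongrightarrow> 0" using \<phi> Sc by force
      then have "\<forall>t\<in>S. \<forall>\<^sub>F j in sequentially. f (r j) t < 2"
        using order_tendstoD(2) by fastforce
      then have "\<forall>\<^sub>F j in sequentially. \<forall>t\<in>S. f (r j) t < 2"
        by (simp add: eventually_ball_finite[OF finS])
      then obtain j where "\<forall>t\<in>S. f (r j) t < 2" by (auto simp: eventually_sequentially)
      then show False using fs[of "r j"] s(1)[of "r j"] by auto
    qed
  qed
qed

end

section \<open>Entropy and almost invariance of the walk\<close>

text \<open>Pointwise form of the bound of the squared Hellinger distance by relative entropy, from
  \<open>ln r <= r - 1\<close> at \<open>r = sqrt b / sqrt a\<close>. The summand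
  \<open>a - b\<close> cancels when both range over probability distributions.\<close>

lemma hellinger_le_relative_entropy:
  assumes "a \<ge> 0" "b \<ge> 0" "b = 0 \<Longrightarrow> a = (0::real)"
  shows "(sqrt a - sqrt b)\<^sup>2 + a - b \<le> a * ln a - a * ln b"
proof (cases "a = 0")
  case True then show ?thesis using assms by simp
next
  case False
  then have "b \<noteq> 0" using assms(3) by blast
  then have p: "a > 0" "b > 0" using assms False by auto
  define r where "r = sqrt b / sqrt a"
  have "ln r \<le> r - 1" using p by (intro ln_le_minus_one) (auto simp: r_def)
  moreover have "ln r = (ln b - ln a) / 2" using p by (simp add: r_def ln_div ln_sqrt diff_divide_distrib)
  ultimately have "ln b - ln a \<le> 2 * (r - 1)" by simp
  then have "a * (ln b - ln a) \<le> a * (2 * (r - 1))" using p by (intro mult_left_mono) auto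
  also have "\<dots> = 2 * (sqrt a * sqrt b) - 2 * a"
  proof -
    have "a * r = sqrt a * sqrt b" unfolding r_def using p by (metis real_div_sqrt times_divide_eq_left times_divide_eq_right order_less_imp_le mult.commute)
    then show ?thesis by (simp add: algebra_simps)
  qed
  finally show ?thesis using p by (simp add: power2_diff algebra_simps)
qed

context walk
begin

definition entropy where "entropy n = (\<Sum>y\<in>B n. - (mu n y * ln (mu n y)))"

lemma mu_le_1: "y \<in> carrier G \<Longrightarrow> mu n y \<le> 1"
  using mu_le_sum[of "{y}" n] by simp

lemma entropy_nonneg: "entropy n \<ge> 0"
  unfolding entropy_def
proof (rule sum_nonneg)
  fix y assume "y \<in> B n"
  then have "ln (mu n y) \<le> 0 \<or> mu n y = 0" using mu_le_1[of y n] mu_nonneg[of n y] Bc by (cases "mu n y = 0") auto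
  then show "0 \<le> - (mu n y * ln (mu n y))" using mu_nonneg[of n y] by (auto simp: mult_nonneg_nonpos)
qed

lemma entropy_upper: "entropy n \<le> ln (real (card (B n)))"
proof -
  define N where "N = real (card (B n))"
  have "B n \<noteq> {}" using one_in_wball[OF symS] by blast
  then have N: "N > 0" using finB by (auto simp: N_def card_gt_0_iff)
  have "- (mu n y * ln (mu n y)) \<le> mu n y * ln N + 1 / N - mu n y" for y
  proof (cases "mu n y = 0")
    case False
    then have p: "mu n y > 0" using mu_nonneg[of n y] by simp
    have "ln (1 / (mu n y * N)) \<le> 1 / (mu n y * N) - 1" using p N by (intro ln_le_minus_one) auto
    then have h1: "mu n y * ln (1 / (mu n y * N)) \<le> mu n y * (1 / (mu n y * N) - 1)" using p by (intro mult_left_mono) auto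
    have h2: "mu n y * (1 / (mu n y * N) - 1) = 1 / N - mu n y" using p N by (simp add: field_simps)
    have h3: "ln (1 / (mu n y * N)) = - ln (mu n y) - ln N" using p N by (simp add: ln_div ln_mult)
    from h1 show ?thesis unfolding h2 h3 by (simp add: algebra_simps)
  qed (use N in auto)
  then have "entropy n \<le> (\<Sum>y\<in>B n. mu n y * ln N + 1 / N - mu n y)" unfolding entropy_def by (rule sum_mono)
  also have "\<dots> = ln N"
    using mu_total[of n] N by (simp add: sum.distrib sum_subtractf sum_distrib_right[symmetric] N_def[symmetric])
  finally show ?thesis by (simp add: N_def)
qed

text \<open>The increment is the mean over \<open>s\<close> of the relative entropy of the translate
  of \<open>mu n\<close> by \<open>s\<close> with respect to \<open>mu (Suc n)\<close>: the
  information about the first step that the position after \<open>n + 1\<close> steps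
  retains.\<close>

lemma entropy_increment:
  "(\<Sum>s\<in>S. \<Sum>x\<in>B (Suc n). (sqrt (mu n (inv s \<otimes> x)) - sqrt (mu (Suc n) x))\<^sup>2) / q \<le> entropy (Suc n) - entropy n"
proof -
  have e1: "entropy (Suc n) = (\<Sum>s\<in>S. \<Sum>x\<in>B (Suc n). - (mu n (inv s \<otimes> x) * ln (mu (Suc n) x))) / q"
  proof -
    have "entropy (Suc n) = (\<Sum>x\<in>B (Suc n). (\<Sum>s\<in>S. - (mu n (inv s \<otimes> x) * ln (mu (Suc n) x))) / q)"
      unfolding entropy_def by (intro sum.cong HOL.refl) (subst mu.simps(2), simp add: sum_distrib_right sum_negf)
    then show ?thesis by (simp add: sum_divide_distrib[symmetric] sum.swap[of _ S])
  qed
  have sh: "(\<Sum>x\<in>B (Suc n). k (mu n (inv s \<otimes> x))) = (\<Sum>y\<in>B n. k (mu n y))" if "s \<in> S" "k 0 = 0" for s and k :: "real \<Rightarrow> real"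
    by (rule sum_shift_gen[OF that(1), where k="\<lambda>y z. k (mu n y)"]) (use that in simp)
  have e2: "entropy n = (\<Sum>s\<in>S. \<Sum>x\<in>B (Suc n). - (mu n (inv s \<otimes> x) * ln (mu n (inv s \<otimes> x)))) / q"
    using sh[of _ "\<lambda>t. - (t * ln t)"] q_pos by (simp add: entropy_def q_def)
  have "(\<Sum>x\<in>B (Suc n). (sqrt (mu n (inv s \<otimes> x)) - sqrt (mu (Suc n) x))\<^sup>2)
     \<le> (\<Sum>x\<in>B (Suc n). - (mu n (inv s \<otimes> x) * ln (mu (Suc n) x))) - (\<Sum>x\<in>B (Suc n). - (mu n (inv s \<otimes> x) * ln (mu n (inv s \<otimes> x))))"
    if s: "s \<in> S" for s
  proof -
    have "(\<Sum>x\<in>B (Suc n). (sqrt (mu n (inv s \<otimes> x)) - sqrt (mu (Suc n) x))\<^sup>2 + mu n (inv s \<otimes> x) - mu (Suc n) x)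
      \<le> (\<Sum>x\<in>B (Suc n). mu n (inv s \<otimes> x) * ln (mu n (inv s \<otimes> x)) - mu n (inv s \<otimes> x) * ln (mu (Suc n) x))"
    proof (rule sum_mono, rule hellinger_le_relative_entropy)
      fix x
      show "0 \<le> mu n (inv s \<otimes> x)" "0 \<le> mu (Suc n) x" by (rule mu_nonneg)+
      assume "mu (Suc n) x = 0"
      then have "(\<Sum>s\<in>S. mu n (inv s \<otimes> x)) = 0" using q_pos by (simp add: mu.simps(2))
      then show "mu n (inv s \<otimes> x) = 0" using finS mu_nonneg s by (simp add: sum_nonneg_eq_0_iff)
    qed
    moreover have "(\<Sum>x\<in>B (Suc n). mu n (inv s \<otimes> x)) = 1" using sh[OF s, of "\<lambda>t. t"] mu_total by simp
    ultimately show ?thesis using mu_total[of "Suc n"] by (simp add: sum.distrib sum_subtractf sum_negf)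
  qed
  then have "(\<Sum>s\<in>S. \<Sum>x\<in>B (Suc n). (sqrt (mu n (inv s \<otimes> x)) - sqrt (mu (Suc n) x))\<^sup>2) \<le>
    (\<Sum>s\<in>S. (\<Sum>x\<in>B (Suc n). - (mu n (inv s \<otimes> x) * ln (mu (Suc n) x))) - (\<Sum>x\<in>B (Suc n). - (mu n (inv s \<otimes> x) * ln (mu n (inv s \<otimes> x)))))"
    by (rule sum_mono)
  then show ?thesis unfolding e1 e2 using q_pos by (simp add: sum_subtractf diff_divide_distrib[symmetric] divide_right_mono)
qed

definition hellinger where "hellinger n s = (\<Sum>x\<in>B (Suc n). (sqrt (mu n (inv s \<otimes> x)) - sqrt (mu n x))\<^sup>2)"

text \<open>Both the translate by \<open>s\<close> and \<open>mu n\<close> itself, which is the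
  translate by the identity in \<open>S\<close>, are close to \<open>mu (Suc n)\<close>. Each costs
  a factor 2 from squaring a sum and a factor \<open>q\<close> from the mean, whence
  \<open>4 * q\<close>.\<close>

lemma hellinger_le: assumes "s \<in> S" shows "hellinger n s \<le> 4 * q * (entropy (Suc n) - entropy n)"
proof -
  define h where "h s = (\<Sum>x\<in>B (Suc n). (sqrt (mu n (inv s \<otimes> x)) - sqrt (mu (Suc n) x))\<^sup>2)" for s
  have h0: "h t \<ge> 0" for t unfolding h_def by (rule sum_nonneg) auto
  have h: "h t \<le> q * (entropy (Suc n) - entropy n)" if "t \<in> S" for t
  proof -
    have "h t \<le> (\<Sum>s\<in>S. h s)" using that finS h0 by (intro member_le_sum) auto
    also have "\<dots> \<le> q * (entropy (Suc n) - entropy n)" using entropy_increment[of n] q_pos by (simp add: h_def field_simps)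
    finally show ?thesis .
  qed
  have "hellinger n s \<le> (\<Sum>x\<in>B (Suc n). 2 * (sqrt (mu n (inv s \<otimes> x)) - sqrt (mu (Suc n) x))\<^sup>2 + 2 * (sqrt (mu n (inv \<one> \<otimes> x)) - sqrt (mu (Suc n) x))\<^sup>2)"
    unfolding hellinger_def
  proof (rule sum_mono)
    fix x assume "x \<in> B (Suc n)"
    then have x: "inv \<one> \<otimes> x = x" using Bc by simp
    have "(a - c)\<^sup>2 \<le> 2 * (a - b)\<^sup>2 + 2 * (c - b)\<^sup>2" for a b c :: real
      using zero_le_power2[of "a - 2 * b + c"] by (simp add: power2_eq_square algebra_simps)
    then show "(sqrt (mu n (inv s \<otimes> x)) - sqrt (mu n x))\<^sup>2 \<le> 2 * (sqrt (mu n (inv s \<otimes> x)) - sqrt (mu (Suc n) x))\<^sup>2 + 2 * (sqrt (mu n (inv \<one> \<otimes> x)) - sqrt (mu (Suc n) x))\<^sup>2"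
      unfolding x .
  qed
  also have "\<dots> = 2 * h s + 2 * h \<one>" by (simp add: h_def sum.distrib sum_distrib_left)
  finally show ?thesis using h[OF assms] h[OF oneS] by simp
qed

text \<open>A difference of densities is the difference times the sum of their square roots.
  Cauchy-Schwarz puts the Hellinger distance on the first factor and second moments of
  \<open>f\<close> on the other.\<close>

lemma avg_compare:
  assumes s: "s \<in> S"
  shows "(avg n f s - avg n f \<one>)\<^sup>2 \<le> 2 * hellinger n s * (avg n (\<lambda>x. (f x)\<^sup>2) s + avg n (\<lambda>x. (f x)\<^sup>2) \<one>)"
proof -
  let ?U = "B (Suc n)"
  have sh: "avg n g s = (\<Sum>x\<in>?U. mu n (inv s \<otimes> x) * g x)" for g
    unfolding avg_def
    by (rule sum_shift_gen[OF s, where k="\<lambda>y z. mu n y * g z", symmetric]) simp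
  have s1: "avg n g \<one> = (\<Sum>x\<in>?U. mu n x * g x)" for g
  proof -
    have "avg n g \<one> = (\<Sum>x\<in>B n. mu n x * g x)" unfolding avg_def using Bc by (intro sum.cong) auto
    also have "\<dots> = (\<Sum>x\<in>?U. mu n x * g x)"
      by (rule sum_superset[symmetric]) (use finB Bc Bmono[of n "Suc n"] in auto)
    finally show ?thesis .
  qed
  let ?a = "\<lambda>x. sqrt (mu n (inv s \<otimes> x))" let ?b = "\<lambda>x. sqrt (mu n x)"
  have ab: "(?a x)\<^sup>2 = mu n (inv s \<otimes> x)" "(?b x)\<^sup>2 = mu n x" for x using mu_nonneg by simp_all
  have "avg n f s - avg n f \<one> = (\<Sum>x\<in>?U. ((?a x)\<^sup>2 - (?b x)\<^sup>2) * f x)"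
    unfolding sh s1 ab by (simp add: sum_subtractf left_diff_distrib)
  also have "\<dots> = (\<Sum>x\<in>?U. (?a x - ?b x) * ((?a x + ?b x) * f x))"
    by (intro sum.cong) (auto simp: power2_eq_square algebra_simps)
  finally have "(avg n f s - avg n f \<one>)\<^sup>2 = (\<Sum>x\<in>?U. (?a x - ?b x) * ((?a x + ?b x) * f x))\<^sup>2" by simp
  also have "\<dots> \<le> hellinger n s * (\<Sum>x\<in>?U. ((?a x + ?b x) * f x)\<^sup>2)"
    unfolding hellinger_def by (rule Cauchy_Schwarz_ineq_sum)
  also have "\<dots> \<le> hellinger n s * (\<Sum>x\<in>?U. 2 * (mu n (inv s \<otimes> x) + mu n x) * (f x)\<^sup>2)"
  proof (intro mult_left_mono sum_mono)
    show "hellinger n s \<ge> 0" unfolding hellinger_def by (rule sum_nonneg) auto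
    fix x
    have "(?a x + ?b x)\<^sup>2 \<le> 2 * ((?a x)\<^sup>2 + (?b x)\<^sup>2)"
      using zero_le_power2[of "?a x - ?b x"] unfolding power2_diff power2_sum by argo
    then have "(?a x + ?b x)\<^sup>2 * (f x)\<^sup>2 \<le> 2 * ((?a x)\<^sup>2 + (?b x)\<^sup>2) * (f x)\<^sup>2" by (rule mult_right_mono) simp
    then show "((?a x + ?b x) * f x)\<^sup>2 \<le> 2 * (mu n (inv s \<otimes> x) + mu n x) * (f x)\<^sup>2" unfolding ab power_mult_distrib .
  qed
  also have "(\<Sum>x\<in>?U. 2 * (mu n (inv s \<otimes> x) + mu n x) * (f x)\<^sup>2) = 2 * (avg n (\<lambda>x. (f x)\<^sup>2) s + avg n (\<lambda>x. (f x)\<^sup>2) \<one>)"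
    unfolding sh s1 by (simp add: sum.distrib sum_distrib_left algebra_simps)
  finally show ?thesis by (simp add: algebra_simps)
qed

section \<open>Moments of Lipschitz harmonic functions\<close>

definition lip_harmonic :: "real \<Rightarrow> ('a \<Rightarrow> real) \<Rightarrow> bool" where
  "lip_harmonic L \<phi> \<longleftrightarrow> L \<ge> 0 \<and> (\<forall>x\<in>carrier G. P \<phi> x = \<phi> x) \<and> \<phi> \<one> = 0 \<and> (\<forall>x\<in>carrier G. \<forall>s\<in>S. \<bar>\<phi> (x \<otimes> s) - \<phi> x\<bar> \<le> L)"

definition grad2 where "grad2 \<phi> x = (\<Sum>s\<in>S. (\<phi> (x \<otimes> s) - \<phi> x)\<^sup>2) / q"

lemma lip_harmonic_sum0: assumes "lip_harmonic L \<phi>" "x \<in> carrier G" shows "(\<Sum>s\<in>S. \<phi> (x \<otimes> s) - \<phi> x) = 0"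
proof -
  have "P \<phi> x = \<phi> x" using assms by (auto simp: lip_harmonic_def)
  then show ?thesis using q_pos by (simp add: P_def sum_subtractf q_def field_simps)
qed

lemma avg_harmonic: assumes "lip_harmonic L \<phi>" shows "x \<in> carrier G \<Longrightarrow> avg n \<phi> x = \<phi> x"
proof (induction n arbitrary: x)
  case (Suc n)
  have "avg (Suc n) \<phi> x = P (avg n \<phi>) x" using avg_Suc Suc by auto
  also have "\<dots> = P \<phi> x" by (rule P_cong) (use Suc in auto)
  finally show ?case using assms Suc by (auto simp: lip_harmonic_def)
qed simp

text \<open>The cross term vanishes by harmonicity: along the walk \<open>\<phi>\<close> is a
  martingale, and its second moment grows at each step by the mean of \<open>grad2\<close>.\<close>

lemma P_square: assumes "lip_harmonic L \<phi>" "x \<in> carrier G" shows "P (\<lambda>y. (\<phi> y)\<^sup>2) x = (\<phi> x)\<^sup>2 + grad2 \<phi> x"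
proof -
  have "(\<Sum>s\<in>S. (\<phi> (x \<otimes> s))\<^sup>2) = (\<Sum>s\<in>S. (\<phi> x)\<^sup>2 + 2 * \<phi> x * (\<phi> (x \<otimes> s) - \<phi> x) + (\<phi> (x \<otimes> s) - \<phi> x)\<^sup>2)"
    by (intro sum.cong HOL.refl) (simp add: power2_eq_square algebra_simps)
  also have "\<dots> = q * (\<phi> x)\<^sup>2 + 2 * \<phi> x * (\<Sum>s\<in>S. \<phi> (x \<otimes> s) - \<phi> x) + (\<Sum>s\<in>S. (\<phi> (x \<otimes> s) - \<phi> x)\<^sup>2)"
    by (simp add: sum.distrib sum_distrib_left q_def)
  finally show ?thesis using lip_harmonic_sum0[OF assms] q_pos by (simp add: P_def grad2_def field_simps)
qed

lemma grad2_le: assumes "lip_harmonic L \<phi>" "x \<in> carrier G" shows "grad2 \<phi> x \<le> L\<^sup>2"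
proof -
  have "(\<Sum>s\<in>S. (\<phi> (x \<otimes> s) - \<phi> x)\<^sup>2) \<le> (\<Sum>s\<in>S. L\<^sup>2)"
  proof (rule sum_mono)
    fix s assume "s \<in> S"
    then have "\<bar>\<phi> (x \<otimes> s) - \<phi> x\<bar> \<le> \<bar>L\<bar>" using assms by (auto simp: lip_harmonic_def)
    then show "(\<phi> (x \<otimes> s) - \<phi> x)\<^sup>2 \<le> L\<^sup>2" by (simp add: abs_le_square_iff)
  qed
  then show ?thesis using q_pos by (simp add: grad2_def q_def field_simps)
qed

lemma avg_square_Suc: assumes "lip_harmonic L \<phi>" "x \<in> carrier G"
  shows "avg (Suc n) (\<lambda>y. (\<phi> y)\<^sup>2) x = avg n (\<lambda>y. (\<phi> y)\<^sup>2) x + avg n (grad2 \<phi>) x"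
proof -
  have "avg (Suc n) (\<lambda>y. (\<phi> y)\<^sup>2) x = avg n (\<lambda>y. (\<phi> y)\<^sup>2 + grad2 \<phi> y) x"
    unfolding avg_Suc2[OF assms(2)] by (rule avg_cong[OF assms(2)]) (rule P_square[OF assms(1)])
  then show ?thesis by (simp add: avg_add)
qed

lemma avg_square_le: assumes "lip_harmonic L \<phi>" "x \<in> carrier G"
  shows "avg n (\<lambda>y. (\<phi> y)\<^sup>2) x \<le> (\<phi> x)\<^sup>2 + real n * L\<^sup>2"
proof (induction n)
  case 0 then show ?case using assms by simp
next
  case (Suc n)
  have "avg n (grad2 \<phi>) x \<le> avg n (\<lambda>_. L\<^sup>2) x" by (rule avg_mono) (use assms grad2_le in auto)
  then show ?case using Suc avg_square_Suc[OF assms, of n] assms by (simp add: algebra_simps)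
qed

text \<open>In the expansion of the fourth power the linear term cancels by harmonicity and the
  cubic one is absorbed by its neighbours, whence 8 = 6 + 2 and 3 = 1 + 2. Fourth moments then grow
  like \<open>n^2\<close>; \<open>avg_compare\<close> asks for them when it is applied to
  squares.\<close>

lemma P_fourth: assumes "lip_harmonic L \<phi>" "x \<in> carrier G"
  shows "P (\<lambda>y. ((\<phi> y)\<^sup>2)\<^sup>2) x \<le> ((\<phi> x)\<^sup>2)\<^sup>2 + (8 * L\<^sup>2 * (\<phi> x)\<^sup>2 + 3 * (L\<^sup>2)\<^sup>2)"
proof -
  define v where "v = \<phi> x"
  define e where "e s = \<phi> (x \<otimes> s) - \<phi> x" for s
  have L: "L \<ge> 0" using assms by (simp add: lip_harmonic_def)
  have "(\<Sum>s\<in>S. ((\<phi> (x \<otimes> s))\<^sup>2)\<^sup>2) \<le> (\<Sum>s\<in>S. (v\<^sup>2)\<^sup>2 + 4 * v ^ 3 * e s + (8 * L\<^sup>2 * v\<^sup>2 + 3 * (L\<^sup>2)\<^sup>2))"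
  proof (rule sum_mono)
    fix s assume "s \<in> S"
    then have e: "\<bar>e s\<bar> \<le> L" using assms by (auto simp: lip_harmonic_def e_def)
    have e2: "(e s)\<^sup>2 \<le> L\<^sup>2" using power_mono[OF e abs_ge_zero, of 2] by simp
    have e4: "((e s)\<^sup>2)\<^sup>2 \<le> (L\<^sup>2)\<^sup>2" using power_mono[OF e2 zero_le_power2, of 2] by simp
    have "4 * v * e s ^ 3 \<le> 2 * (v\<^sup>2 * (e s)\<^sup>2) + 2 * ((e s)\<^sup>2)\<^sup>2"
    proof -
      have "0 \<le> 2 * (e s)\<^sup>2 * (v - e s)\<^sup>2" by simp
      then show ?thesis by (simp add: power2_eq_square power3_eq_cube algebra_simps)
    qed
    moreover have "v\<^sup>2 * (e s)\<^sup>2 \<le> v\<^sup>2 * L\<^sup>2" using e2 by (intro mult_left_mono) auto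
    moreover have "((\<phi> (x \<otimes> s))\<^sup>2)\<^sup>2 = (v\<^sup>2)\<^sup>2 + 4 * v ^ 3 * e s + 6 * (v\<^sup>2 * (e s)\<^sup>2) + 4 * v * e s ^ 3 + ((e s)\<^sup>2)\<^sup>2"
      by (simp add: v_def e_def power2_eq_square power3_eq_cube algebra_simps)
    ultimately show "((\<phi> (x \<otimes> s))\<^sup>2)\<^sup>2 \<le> (v\<^sup>2)\<^sup>2 + 4 * v ^ 3 * e s + (8 * L\<^sup>2 * v\<^sup>2 + 3 * (L\<^sup>2)\<^sup>2)"
      using e4 by (simp add: algebra_simps)
  qed
  also have "\<dots> = q * ((v\<^sup>2)\<^sup>2 + (8 * L\<^sup>2 * v\<^sup>2 + 3 * (L\<^sup>2)\<^sup>2)) + 4 * v ^ 3 * (\<Sum>s\<in>S. e s)"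
    by (simp add: sum.distrib sum_distrib_left[symmetric] q_def distrib_left)
  also have "(\<Sum>s\<in>S. e s) = 0" unfolding e_def by (rule lip_harmonic_sum0[OF assms])
  finally show ?thesis using q_pos by (simp add: P_def v_def field_simps)
qed

lemma avg_fourth_le: assumes "lip_harmonic L \<phi>" "x \<in> carrier G"
  shows "avg n (\<lambda>y. ((\<phi> y)\<^sup>2)\<^sup>2) x \<le> ((\<phi> x)\<^sup>2)\<^sup>2 + real n * (8 * L\<^sup>2 * ((\<phi> x)\<^sup>2 + real n * L\<^sup>2) + 3 * (L\<^sup>2)\<^sup>2)"
proof (induction n)
  case 0 then show ?case using assms by simp
next
  case (Suc n)
  let ?c = "\<lambda>n. 8 * L\<^sup>2 * ((\<phi> x)\<^sup>2 + real n * L\<^sup>2) + 3 * (L\<^sup>2)\<^sup>2"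
  have "avg (Suc n) (\<lambda>y. ((\<phi> y)\<^sup>2)\<^sup>2) x \<le> avg n (\<lambda>y. ((\<phi> y)\<^sup>2)\<^sup>2 + (8 * L\<^sup>2 * (\<phi> y)\<^sup>2 + 3 * (L\<^sup>2)\<^sup>2)) x"
    unfolding avg_Suc2[OF assms(2)] by (rule avg_mono[OF assms(2)]) (rule P_fourth[OF assms(1)])
  also have "\<dots> = avg n (\<lambda>y. ((\<phi> y)\<^sup>2)\<^sup>2) x + (8 * L\<^sup>2 * avg n (\<lambda>y. (\<phi> y)\<^sup>2) x + 3 * (L\<^sup>2)\<^sup>2)"
    using assms by (simp add: avg_add avg_cmult)
  also have "8 * L\<^sup>2 * avg n (\<lambda>y. (\<phi> y)\<^sup>2) x \<le> 8 * L\<^sup>2 * ((\<phi> x)\<^sup>2 + real n * L\<^sup>2)"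
    using avg_square_le[OF assms] by (intro mult_left_mono) auto
  finally have "avg (Suc n) (\<lambda>y. ((\<phi> y)\<^sup>2)\<^sup>2) x \<le> ((\<phi> x)\<^sup>2)\<^sup>2 + real n * ?c n + ?c n" using Suc by simp
  also have "\<dots> \<le> ((\<phi> x)\<^sup>2)\<^sup>2 + real (Suc n) * ?c (Suc n)"
  proof -
    have "?c n \<le> ?c (Suc n)" by (simp add: algebra_simps)
    then have "real (Suc n) * ?c n \<le> real (Suc n) * ?c (Suc n)" by (intro mult_left_mono) auto
    then show ?thesis by (simp add: algebra_simps)
  qed
  finally show ?case .
qed

end

context poly_walk
begin

text \<open>The entropy is at most \<open>d log n + O(1)\<close>, so its increments cannot all exceed \<open>(d + 1) / n\<close>.\<close>

lemma good_times:
  "\<exists>K>0. \<forall>N. \<exists>n\<ge>N. n \<ge> 1 \<and> (\<forall>s\<in>S. hellinger n s \<le> K / real n)"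
proof -
  let ?K0 = "real d + 1"
  have "\<exists>n\<ge>N. n \<ge> 1 \<and> entropy (Suc n) - entropy n \<le> ?K0 / real n" for N
  proof (rule ccontr)
    assume neg: "\<not> ?thesis"
    define N1 where "N1 = max N 1"
    have N1: "N1 \<ge> 1" "N1 \<ge> N" by (auto simp: N1_def)
    have st: "entropy (Suc n) - entropy n > ?K0 / real n" if "n \<ge> N1" for n
      using neg that N1 by (meson le_trans not_less)
    have "?K0 * (ln (real (N1 + m)) - ln (real N1)) \<le> entropy (N1 + m)" for m
    proof (induction m)
      case 0 then show ?case using entropy_nonneg by simp
    next
      case (Suc m)
      let ?n = "N1 + m"
      have n: "?n \<ge> 1" using N1 by simp
      have "ln (real (Suc ?n)) - ln (real ?n) = ln (1 + 1 / real ?n)"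
      proof -
        have "real (Suc ?n) = real ?n * (1 + 1 / real ?n)" using n by (simp add: field_simps)
        moreover have "1 + 1 / real ?n > 0" "real ?n > 0" using n by (simp_all add: add_pos_nonneg)
        ultimately show ?thesis using ln_mult[of "real ?n" "1 + 1 / real ?n"] by simp
      qed
      also have "\<dots> \<le> 1 / real ?n" using n by (intro ln_add_one_self_le_self) auto
      finally have "?K0 * (ln (real (Suc ?n)) - ln (real ?n)) \<le> ?K0 * (1 / real ?n)" by (intro mult_left_mono) auto
      also have "\<dots> \<le> entropy (Suc ?n) - entropy ?n" using st[of ?n] by simp
      finally show ?case using Suc by (simp add: algebra_simps)
    qed
    moreover have "entropy n \<le> ln C + real d * ln (real n)" if "n \<ge> 1" for n
    proof -
      have "B n \<noteq> {}" using one_in_wball[OF symS] by blast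
      then have "real (card (B n)) > 0" using finB by (auto simp: card_gt_0_iff)
      then have "ln (real (card (B n))) \<le> ln (C * real n ^ d)" using poly[OF that] by simp
      also have "\<dots> = ln C + real d * ln (real n)" using C_pos that by (simp add: ln_mult ln_realpow)
      finally show ?thesis using entropy_upper[of n] by simp
    qed
    ultimately have bb: "?K0 * (ln (real (N1 + m)) - ln (real N1)) \<le> ln C + real d * ln (real (N1 + m))" for m
      using N1 by (meson order_trans trans_le_add1)
    have b: "ln (real (N1 + m)) \<le> ln C + ?K0 * ln (real N1)" for m using bb[of m] by (simp add: algebra_simps)
    obtain m :: nat where m: "real m > exp (ln C + ?K0 * ln (real N1))" using reals_Archimedean2 by blast
    have "ln C + ?K0 * ln (real N1) < ln (real m)" using m by (metis exp_gt_zero exp_ln less_trans ln_exp ln_less_cancel_iff)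
    also have "\<dots> \<le> ln (real (N1 + m))" using m exp_gt_zero[of "ln C + ?K0 * ln (real N1)"] by (subst ln_le_cancel_iff) linarith+
    finally show False using b[of m] by simp
  qed
  then have *: "\<exists>n\<ge>N. n \<ge> 1 \<and> (\<forall>s\<in>S. hellinger n s \<le> (4 * q * ?K0) / real n)" for N
  proof -
    obtain n where n: "n \<ge> N" "n \<ge> 1" "entropy (Suc n) - entropy n \<le> ?K0 / real n"
      using \<open>\<And>N. \<exists>n\<ge>N. n \<ge> 1 \<and> entropy (Suc n) - entropy n \<le> ?K0 / real n\<close> by blast
    have "hellinger n s \<le> (4 * q * ?K0) / real n" if "s \<in> S" for s
      using hellinger_le[OF that, of n] mult_left_mono[OF n(3), of "4 * q"] q_pos by simp
    then show ?thesis using n by blast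
  qed
  then show ?thesis using q_pos by (intro exI[of _ "4 * q * ?K0"]) auto
qed

end

section \<open>The invariant inner product on the translates of a harmonic function\<close>

text \<open>The times \<open>nn\<close> have Hellinger distances at most \<open>K / n\<close> and
  are thinned out so that the normalised correlations of all translates of \<open>\<phi>0\<close>
  converge. With convergence as an assumption the form \<open>M\<close> is a genuine limit; the
  thinning is done when the locale is instantiated.\<close>

locale harmonic_limit = poly_walk +
  fixes \<phi>0 :: "'a \<Rightarrow> real" and L0 K :: real and nn :: "nat \<Rightarrow> nat"
  assumes \<phi>0: "lip_harmonic L0 \<phi>0" "\<exists>s\<in>S. \<phi>0 s \<noteq> 0"
    and K: "K > 0" "\<And>j s. s \<in> S \<Longrightarrow> hellinger (nn j) s \<le> K / real (nn j)"
    and nn: "\<And>j. nn j \<ge> Suc j"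
    and conv: "\<And>g h. g \<in> carrier G \<Longrightarrow> h \<in> carrier G \<Longrightarrow>
      convergent (\<lambda>j. avg (nn j) (\<lambda>x. (\<phi>0 (g \<otimes> x) - \<phi>0 g) * (\<phi>0 (h \<otimes> x) - \<phi>0 h)) \<one> / real (nn j))"
begin

text \<open>Translation, renormalised to vanish at the identity. It is a right action:
  \<open>T g\<close> after \<open>T h\<close> is \<open>T (h \<otimes> g)\<close>. The value 0 off
  the carrier makes equality of functions mean equality on the group.\<close>

definition T :: "'a \<Rightarrow> ('a \<Rightarrow> real) \<Rightarrow> 'a \<Rightarrow> real" where
  "T g \<psi> = (\<lambda>x. if x \<in> carrier G then \<psi> (g \<otimes> x) - \<psi> g else 0)"

inductive_set W :: "('a \<Rightarrow> real) set" where
  base: "g \<in> carrier G \<Longrightarrow> T g \<phi>0 \<in> W"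
| lin: "\<psi> \<in> W \<Longrightarrow> \<theta> \<in> W \<Longrightarrow> (\<lambda>x. a * \<psi> x + b * \<theta> x) \<in> W"

text \<open>Second moments grow at most linearly along the walk, hence the division by the
  time.\<close>

definition Q :: "nat \<Rightarrow> ('a \<Rightarrow> real) \<Rightarrow> ('a \<Rightarrow> real) \<Rightarrow> real" where
  "Q j \<psi> \<theta> = avg (nn j) (\<lambda>x. \<psi> x * \<theta> x) \<one> / real (nn j)"

definition M where "M \<psi> \<theta> = lim (\<lambda>j. Q j \<psi> \<theta>)"

lemma nn_pos: "nn j \<ge> 1" "real (nn j) > 0" using nn[of j] by linarith+

lemma inv_nn: "(\<lambda>j. c / real (nn j)) \<longlonglongrightarrow> 0"
proof (rule Lim_null_comparison)
  show "\<forall>\<^sub>F j in sequentially. norm (c / real (nn j)) \<le> \<bar>c\<bar> * inverse (real (Suc j))"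
  proof (intro always_eventually allI)
    fix j
    have "real (Suc j) \<le> real (nn j)" using nn[of j] by linarith
    then have "\<bar>c\<bar> / real (nn j) \<le> \<bar>c\<bar> / real (Suc j)" by (intro divide_left_mono) auto
    then show "norm (c / real (nn j)) \<le> \<bar>c\<bar> * inverse (real (Suc j))" by (simp add: field_simps)
  qed
  show "(\<lambda>j. \<bar>c\<bar> * inverse (real (Suc j))) \<longlonglongrightarrow> 0"
    using tendsto_mult[OF tendsto_const LIMSEQ_inverse_real_of_nat, of "\<bar>c\<bar>"] by simp
qed

lemma T_mult: assumes "g \<in> carrier G" "h \<in> carrier G" shows "T g (T h \<psi>) = T (h \<otimes> g) \<psi>"
  using assms by (auto simp: T_def fun_eq_iff m_assoc)

lemma T_lin: "g \<in> carrier G \<Longrightarrow> T g (\<lambda>x. a * \<psi> x + b * \<theta> x) = (\<lambda>x. a * T g \<psi> x + b * T g \<theta> x)"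
  by (auto simp: T_def fun_eq_iff algebra_simps)

lemma T_one: assumes "\<And>x. x \<notin> carrier G \<Longrightarrow> \<psi> x = 0" "\<psi> \<one> = 0" shows "T \<one> \<psi> = \<psi>"
  using assms by (auto simp: T_def fun_eq_iff)

lemma lip_harmonic_T: assumes "lip_harmonic L \<psi>" "g \<in> carrier G" shows "lip_harmonic L (T g \<psi>)"
  unfolding lip_harmonic_def
proof (intro conjI ballI)
  show "L \<ge> 0" "T g \<psi> \<one> = 0" using assms by (auto simp: lip_harmonic_def T_def)
  fix x assume x: "x \<in> carrier G"
  have "P (T g \<psi>) x = (\<Sum>s\<in>S. \<psi> (g \<otimes> x \<otimes> s) - \<psi> g) / q"
    unfolding P_def using x assms(2) Sc by (intro arg_cong2[where f="(/)"] sum.cong) (auto simp: T_def m_assoc)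
  also have "\<dots> = P \<psi> (g \<otimes> x) - \<psi> g" using q_pos by (simp add: P_def sum_subtractf q_def diff_divide_distrib)
  also have "\<dots> = T g \<psi> x" using assms x by (auto simp: lip_harmonic_def T_def)
  finally show "P (T g \<psi>) x = T g \<psi> x" .
  fix s assume s: "s \<in> S"
  have "T g \<psi> (x \<otimes> s) - T g \<psi> x = \<psi> (g \<otimes> x \<otimes> s) - \<psi> (g \<otimes> x)" using x assms(2) s Sc by (simp add: T_def m_assoc)
  then show "\<bar>T g \<psi> (x \<otimes> s) - T g \<psi> x\<bar> \<le> L" using assms x s by (simp add: lip_harmonic_def)
qed

lemma lip_harmonic_lin: assumes "lip_harmonic L \<psi>" "lip_harmonic L' \<theta>" shows "lip_harmonic (\<bar>a\<bar> * L + \<bar>b\<bar> * L') (\<lambda>x. a * \<psi> x + b * \<theta> x)"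
  unfolding lip_harmonic_def
proof (intro conjI ballI)
  show "0 \<le> \<bar>a\<bar> * L + \<bar>b\<bar> * L'" "a * \<psi> \<one> + b * \<theta> \<one> = 0" using assms by (auto simp: lip_harmonic_def)
  fix x assume x: "x \<in> carrier G"
  have "P (\<lambda>x. a * \<psi> x + b * \<theta> x) x = a * P \<psi> x + b * P \<theta> x"
    by (simp add: P_def sum.distrib sum_distrib_left add_divide_distrib)
  then show "P (\<lambda>x. a * \<psi> x + b * \<theta> x) x = a * \<psi> x + b * \<theta> x" using assms x by (auto simp: lip_harmonic_def)
  fix s assume s: "s \<in> S"
  have "\<bar>a * \<psi> (x \<otimes> s) + b * \<theta> (x \<otimes> s) - (a * \<psi> x + b * \<theta> x)\<bar> = \<bar>a * (\<psi> (x \<otimes> s) - \<psi> x) + b * (\<theta> (x \<otimes> s) - \<theta> x)\<bar>"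
    by (simp add: algebra_simps)
  also have "\<dots> \<le> \<bar>a\<bar> * \<bar>\<psi> (x \<otimes> s) - \<psi> x\<bar> + \<bar>b\<bar> * \<bar>\<theta> (x \<otimes> s) - \<theta> x\<bar>"
    by (metis abs_triangle_ineq abs_mult)
  also have "\<dots> \<le> \<bar>a\<bar> * L + \<bar>b\<bar> * L'" using assms x s by (intro add_mono mult_left_mono) (auto simp: lip_harmonic_def)
  finally show "\<bar>a * \<psi> (x \<otimes> s) + b * \<theta> (x \<otimes> s) - (a * \<psi> x + b * \<theta> x)\<bar> \<le> \<bar>a\<bar> * L + \<bar>b\<bar> * L'" .
qed

lemma W_lharm: "\<psi> \<in> W \<Longrightarrow> \<exists>L. lip_harmonic L \<psi>"
  by (induction rule: W.induct) (blast intro: lip_harmonic_T \<phi>0 lip_harmonic_lin)+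

lemma W_off: "\<psi> \<in> W \<Longrightarrow> x \<notin> carrier G \<Longrightarrow> \<psi> x = 0"
  by (induction rule: W.induct) (auto simp: T_def)

lemma W_one: "\<psi> \<in> W \<Longrightarrow> \<psi> \<one> = 0"
  using W_lharm by (auto simp: lip_harmonic_def)

lemma W_T: "\<psi> \<in> W \<Longrightarrow> g \<in> carrier G \<Longrightarrow> T g \<psi> \<in> W"
  by (induction rule: W.induct) (auto simp: T_mult T_lin intro: W.intros)

lemma W_T_one: "\<psi> \<in> W \<Longrightarrow> T \<one> \<psi> = \<psi>"
  by (rule T_one) (auto intro: W_off W_one)

lemma W_zero: "(\<lambda>x. 0) \<in> W"
  using W.lin[OF W.base[OF one_closed] W.base[OF one_closed], of 0 0] by simp

lemma W_add: "\<psi> \<in> W \<Longrightarrow> \<theta> \<in> W \<Longrightarrow> (\<lambda>x. \<psi> x + \<theta> x) \<in> W"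
  using W.lin[of \<psi> \<theta> 1 1] by simp
lemma W_diff: "\<psi> \<in> W \<Longrightarrow> \<theta> \<in> W \<Longrightarrow> (\<lambda>x. \<psi> x - \<theta> x) \<in> W"
  using W.lin[of \<psi> \<theta> 1 "-1"] by simp
lemma W_scale: "\<psi> \<in> W \<Longrightarrow> (\<lambda>x. a * \<psi> x) \<in> W"
  using W.lin[of \<psi> \<psi> a 0] by simp
lemma W_sum: "finite I \<Longrightarrow> (\<And>i. i \<in> I \<Longrightarrow> f i \<in> W) \<Longrightarrow> (\<lambda>x. \<Sum>i\<in>I. c i * f i x) \<in> W"
proof (induction I rule: finite_induct)
  case empty then show ?case using W_zero by simp
next
  case (insert i I)
  then have "(\<lambda>x. c i * f i x + 1 * (\<Sum>i\<in>I. c i * f i x)) \<in> W" by (intro W.lin) auto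
  then show ?case using insert by simp
qed

section \<open>The limit form and its invariance\<close>

lemma Q_lin: "Q j (\<lambda>x. a * \<psi> x + b * \<theta> x) \<xi> = a * Q j \<psi> \<xi> + b * Q j \<theta> \<xi>"
proof -
  have "(\<lambda>x. (a * \<psi> x + b * \<theta> x) * \<xi> x) = (\<lambda>x. a * (\<psi> x * \<xi> x) + b * (\<theta> x * \<xi> x))" by (simp add: algebra_simps)
  then show ?thesis by (simp add: Q_def avg_add avg_cmult add_divide_distrib)
qed

lemma Q_sym: "Q j \<psi> \<theta> = Q j \<theta> \<psi>" by (simp add: Q_def mult.commute)

lemma Q_conv: assumes "\<psi> \<in> W" "\<theta> \<in> W" shows "convergent (\<lambda>j. Q j \<psi> \<theta>)"
proof -
  have step: "convergent (\<lambda>j. Q j (\<lambda>x. a * \<psi> x + b * \<theta> x) \<xi>)"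
    if "convergent (\<lambda>j. Q j \<psi> \<xi>)" "convergent (\<lambda>j. Q j \<theta> \<xi>)" for a b \<psi> \<theta> \<xi>
    unfolding Q_lin using that by (intro convergent_add) (auto simp: convergent_mult_const_iff intro: convergent_mult convergent_const)
  have base: "convergent (\<lambda>j. Q j (T g \<phi>0) \<theta>)" if g: "g \<in> carrier G" for g
    using assms(2)
  proof (induction rule: W.induct)
    case (base h)
    have "Q j (T g \<phi>0) (T h \<phi>0) = avg (nn j) (\<lambda>x. (\<phi>0 (g \<otimes> x) - \<phi>0 g) * (\<phi>0 (h \<otimes> x) - \<phi>0 h)) \<one> / real (nn j)" for j
      unfolding Q_def by (intro arg_cong2[where f="(/)"] avg_cong) (auto simp: T_def)
    then show ?case using conv[OF g base] by simp
  next
    case (lin \<psi> \<theta> a b)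
    then show ?case using step[of \<psi> "T g \<phi>0" \<theta> a b] by (simp add: Q_sym)
  qed
  show ?thesis using assms(1) by (induction rule: W.induct) (auto intro: base step)
qed

lemma M_lim: "\<psi> \<in> W \<Longrightarrow> \<theta> \<in> W \<Longrightarrow> (\<lambda>j. Q j \<psi> \<theta>) \<longlonglongrightarrow> M \<psi> \<theta>"
  unfolding M_def using Q_conv convergent_LIMSEQ_iff by blast

lemma M_eqI: "\<psi> \<in> W \<Longrightarrow> \<theta> \<in> W \<Longrightarrow> (\<lambda>j. Q j \<psi> \<theta>) \<longlonglongrightarrow> l \<Longrightarrow> M \<psi> \<theta> = l"
  using M_lim LIMSEQ_unique by blast

lemma M_sym: "M \<psi> \<theta> = M \<theta> \<psi>" by (simp add: M_def Q_sym)

lemma M_lin: assumes "\<psi> \<in> W" "\<theta> \<in> W" "\<xi> \<in> W"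
  shows "M (\<lambda>x. a * \<psi> x + b * \<theta> x) \<xi> = a * M \<psi> \<xi> + b * M \<theta> \<xi>"
  by (rule M_eqI) (use assms in \<open>auto simp: Q_lin intro!: W.lin tendsto_intros M_lim\<close>)

lemma M_diff: assumes "\<psi> \<in> W" "\<theta> \<in> W" "\<xi> \<in> W" shows "M (\<lambda>x. \<psi> x - \<theta> x) \<xi> = M \<psi> \<xi> - M \<theta> \<xi>"
  using M_lin[OF assms, of 1 "-1"] by simp

lemma M_sum: "finite I \<Longrightarrow> (\<And>i. i \<in> I \<Longrightarrow> f i \<in> W) \<Longrightarrow> \<xi> \<in> W \<Longrightarrow> M (\<lambda>x. \<Sum>i\<in>I. c i * f i x) \<xi> = (\<Sum>i\<in>I. c i * M (f i) \<xi>)"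
proof (induction I rule: finite_induct)
  case empty
  then show ?case using M_lin[OF empty(2,2,2), of 0 0] by simp
next
  case (insert i I)
  have "M (\<lambda>x. c i * f i x + 1 * (\<Sum>i\<in>I. c i * f i x)) \<xi> = c i * M (f i) \<xi> + 1 * M (\<lambda>x. \<Sum>i\<in>I. c i * f i x) \<xi>"
    by (rule M_lin[OF _ W_sum]) (use insert in auto)
  then show ?case using insert by simp
qed

lemma M_nonneg: assumes "\<psi> \<in> W" shows "M \<psi> \<psi> \<ge> 0"
proof (rule LIMSEQ_le_const[OF M_lim[OF assms assms]])
  have "Q j \<psi> \<psi> \<ge> 0" for j unfolding Q_def using nn_pos by (intro divide_nonneg_pos avg_nonneg) auto
  then show "\<exists>N. \<forall>n\<ge>N. 0 \<le> Q n \<psi> \<psi>" by auto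
qed

lemma M_CS: assumes "\<psi> \<in> W" "\<theta> \<in> W" shows "(M \<psi> \<theta>)\<^sup>2 \<le> M \<psi> \<psi> * M \<theta> \<theta>"
proof (rule LIMSEQ_le)
  show "(\<lambda>j. (Q j \<psi> \<theta>)\<^sup>2) \<longlonglongrightarrow> (M \<psi> \<theta>)\<^sup>2" by (intro tendsto_intros M_lim assms)
  show "(\<lambda>j. Q j \<psi> \<psi> * Q j \<theta> \<theta>) \<longlonglongrightarrow> M \<psi> \<psi> * M \<theta> \<theta>" by (intro tendsto_intros M_lim assms)
  have "(Q j \<psi> \<theta>)\<^sup>2 \<le> Q j \<psi> \<psi> * Q j \<theta> \<theta>" for j
  proof -
    have e: "avg n (\<lambda>x. f x * g x) \<one> = (\<Sum>y\<in>B n. (sqrt (mu n y) * f y) * (sqrt (mu n y) * g y))" for n f g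
      unfolding avg_def
    proof (rule sum.cong[OF HOL.refl])
      fix y assume "y \<in> B n"
      then have "\<one> \<otimes> y = y" using Bc by auto
      moreover have "sqrt (mu n y) * sqrt (mu n y) = mu n y" using mu_nonneg by simp
      ultimately show "mu n y * (f (\<one> \<otimes> y) * g (\<one> \<otimes> y)) = (sqrt (mu n y) * f y) * (sqrt (mu n y) * g y)" by (metis mult.assoc mult.commute)
    qed
    have "(avg (nn j) (\<lambda>x. \<psi> x * \<theta> x) \<one>)\<^sup>2 \<le> avg (nn j) (\<lambda>x. \<psi> x * \<psi> x) \<one> * avg (nn j) (\<lambda>x. \<theta> x * \<theta> x) \<one>"
      unfolding e using Cauchy_Schwarz_ineq_sum[of "\<lambda>y. sqrt (mu (nn j) y) * \<psi> y" "\<lambda>y. sqrt (mu (nn j) y) * \<theta> y" "B (nn j)"]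
      by (simp add: power2_eq_square)
    then show ?thesis unfolding Q_def power_divide using nn_pos[of j] by (simp add: power2_eq_square divide_right_mono)
  qed
  then show "\<exists>N. \<forall>n\<ge>N. (Q n \<psi> \<theta>)\<^sup>2 \<le> Q n \<psi> \<psi> * Q n \<theta> \<theta>" by auto
qed

text \<open>The squared difference of the averages is at most a multiple of the Hellinger distance,
  of order \<open>1 / n\<close>, times fourth moments of order \<open>n^2\<close>; division by
  \<open>n^2\<close> leaves order \<open>1 / n\<close>.\<close>

lemma avg_square_compare:
  assumes "\<psi> \<in> W" "s \<in> S"
  shows "(\<lambda>j. (avg (nn j) (\<lambda>x. (\<psi> x)\<^sup>2) s - avg (nn j) (\<lambda>x. (\<psi> x)\<^sup>2) \<one>) / real (nn j)) \<longlonglongrightarrow> 0"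
proof -
  obtain L where L: "lip_harmonic L \<psi>" using W_lharm assms by auto
  define c where "c x = ((\<psi> x)\<^sup>2)\<^sup>2 + (8 * L\<^sup>2 * ((\<psi> x)\<^sup>2 + L\<^sup>2) + 3 * (L\<^sup>2)\<^sup>2)" for x
  have c: "avg n (\<lambda>y. ((\<psi> y)\<^sup>2)\<^sup>2) x \<le> c x * (real n)\<^sup>2" if "x \<in> carrier G" "n \<ge> 1" for n x
  proof -
    have n: "1 \<le> real n" "real n \<le> (real n)\<^sup>2" using that(2) by (auto simp: power2_eq_square)
    have "avg n (\<lambda>y. ((\<psi> y)\<^sup>2)\<^sup>2) x \<le> ((\<psi> x)\<^sup>2)\<^sup>2 + real n * (8 * L\<^sup>2 * ((\<psi> x)\<^sup>2 + real n * L\<^sup>2) + 3 * (L\<^sup>2)\<^sup>2)"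
      by (rule avg_fourth_le[OF L that(1)])
    also have "\<dots> = ((\<psi> x)\<^sup>2)\<^sup>2 * 1 + 8 * L\<^sup>2 * (\<psi> x)\<^sup>2 * real n + 8 * L\<^sup>2 * L\<^sup>2 * (real n)\<^sup>2 + 3 * (L\<^sup>2)\<^sup>2 * real n"
      by (simp add: algebra_simps power2_eq_square)
    also have "\<dots> \<le> ((\<psi> x)\<^sup>2)\<^sup>2 * (real n)\<^sup>2 + 8 * L\<^sup>2 * (\<psi> x)\<^sup>2 * (real n)\<^sup>2 + 8 * L\<^sup>2 * L\<^sup>2 * (real n)\<^sup>2 + 3 * (L\<^sup>2)\<^sup>2 * (real n)\<^sup>2"
      using n by (intro add_mono mult_left_mono) auto
    also have "\<dots> = c x * (real n)\<^sup>2" by (simp add: c_def algebra_simps)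
    finally show ?thesis .
  qed
  define k where "k = 2 * K * (c s + c \<one>)"
  have sq: "((avg (nn j) (\<lambda>x. (\<psi> x)\<^sup>2) s - avg (nn j) (\<lambda>x. (\<psi> x)\<^sup>2) \<one>) / real (nn j))\<^sup>2 \<le> k / real (nn j)" for j
  proof -
    let ?n = "nn j"
    let ?X = "avg ?n (\<lambda>x. ((\<psi> x)\<^sup>2)\<^sup>2) s + avg ?n (\<lambda>x. ((\<psi> x)\<^sup>2)\<^sup>2) \<one>"
    have h0: "hellinger ?n s \<ge> 0" unfolding hellinger_def by (rule sum_nonneg) auto
    have X0: "?X \<ge> 0" using assms Sc by (intro add_nonneg_nonneg avg_nonneg) auto
    have "(avg ?n (\<lambda>x. (\<psi> x)\<^sup>2) s - avg ?n (\<lambda>x. (\<psi> x)\<^sup>2) \<one>)\<^sup>2 \<le> 2 * hellinger ?n s * ?X"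
      by (rule avg_compare[OF assms(2)])
    also have "\<dots> \<le> 2 * (K / real ?n) * ((c s + c \<one>) * (real ?n)\<^sup>2)"
      using K(2)[OF assms(2), of j] h0 X0 c[of s ?n] c[of \<one> ?n] Sc[OF assms(2)] nn_pos[of j] K(1)
      by (intro mult_mono) (auto simp: algebra_simps)
    also have "\<dots> = k / real ?n * (real ?n)\<^sup>2" by (simp add: k_def)
    finally show ?thesis using nn_pos[of j] by (simp add: power_divide pos_divide_le_eq)
  qed
  have "(\<lambda>j. ((avg (nn j) (\<lambda>x. (\<psi> x)\<^sup>2) s - avg (nn j) (\<lambda>x. (\<psi> x)\<^sup>2) \<one>) / real (nn j))\<^sup>2) \<longlonglongrightarrow> 0"
    by (rule Lim_null_comparison[OF _ inv_nn[of k]]) (use sq in auto)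
  from tendsto_real_sqrt[OF this] show ?thesis
    unfolding real_sqrt_abs real_sqrt_zero by (rule tendsto_rabs_zero_cancel)
qed

lemma M_square_lim: assumes "\<psi> \<in> W" shows "(\<lambda>j. avg (nn j) (\<lambda>x. (\<psi> x)\<^sup>2) \<one> / real (nn j)) \<longlonglongrightarrow> M \<psi> \<psi>"
  using M_lim[OF assms assms] by (simp add: Q_def power2_eq_square)

text \<open>Translating by \<open>s\<close> moves the starting point of the walk from the identity
  to \<open>s\<close>, which changes nothing in the limit by the previous estimate. Subtracting the
  value \<open>\<psi> s\<close> contributes, by harmonicity, minus its square, which vanishes after
  division by the time.\<close>

lemma M_T_gen: assumes "\<psi> \<in> W" "s \<in> S" shows "M (T s \<psi>) (T s \<psi>) = M \<psi> \<psi>"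
proof -
  have s: "s \<in> carrier G" using assms Sc by auto
  obtain L where L: "lip_harmonic L \<psi>" using W_lharm assms by auto
  have e: "Q j (T s \<psi>) (T s \<psi>) = avg (nn j) (\<lambda>x. (\<psi> x)\<^sup>2) \<one> / real (nn j)
     + (avg (nn j) (\<lambda>x. (\<psi> x)\<^sup>2) s - avg (nn j) (\<lambda>x. (\<psi> x)\<^sup>2) \<one>) / real (nn j) - (\<psi> s)\<^sup>2 / real (nn j)" for j
  proof -
    let ?n = "nn j"
    have "avg ?n (\<lambda>x. T s \<psi> x * T s \<psi> x) \<one> = avg ?n (\<lambda>x. (\<psi> x)\<^sup>2 + (- 2 * \<psi> s) * \<psi> x + (\<psi> s)\<^sup>2) s"
      unfolding avg_def by (intro sum.cong HOL.refl) (use s Bc in \<open>auto simp: T_def power2_eq_square algebra_simps\<close>)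
    also have "\<dots> = avg ?n (\<lambda>x. (\<psi> x)\<^sup>2) s + (- 2 * \<psi> s) * \<psi> s + (\<psi> s)\<^sup>2"
      unfolding avg_add avg_cmult avg_const[OF s] avg_harmonic[OF L s] ..
    finally show ?thesis unfolding Q_def by (simp add: power2_eq_square add_divide_distrib diff_divide_distrib)
  qed
  have "(\<lambda>j. avg (nn j) (\<lambda>x. (\<psi> x)\<^sup>2) \<one> / real (nn j)
     + (avg (nn j) (\<lambda>x. (\<psi> x)\<^sup>2) s - avg (nn j) (\<lambda>x. (\<psi> x)\<^sup>2) \<one>) / real (nn j) - (\<psi> s)\<^sup>2 / real (nn j)) \<longlonglongrightarrow> M \<psi> \<psi> + 0 - 0"
    by (intro tendsto_intros M_square_lim avg_square_compare inv_nn assms)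
  then show ?thesis using M_eqI[OF W_T W_T, OF assms(1) s assms(1) s] e by simp
qed

lemma M_T: assumes "\<psi> \<in> W" "g \<in> carrier G" shows "M (T g \<psi>) (T g \<psi>) = M \<psi> \<psi>"
proof -
  have "M (T g \<psi>) (T g \<psi>) = M \<psi> \<psi>" if "g \<in> B n" for n
    using that
  proof (induction n arbitrary: g)
    case 0 then show ?case using W_T_one[OF assms(1)] by simp
  next
    case (Suc n)
    then obtain y r where yr: "y \<in> B n" "r \<in> S" "g = y \<otimes> r"
      using Suc.prems unfolding wball_Suc2[OF symS] by blast
    have "T g \<psi> = T r (T y \<psi>)" using T_mult[of r y \<psi>] yr Sc Bc by auto
    then show ?case using M_T_gen[OF W_T[OF assms(1) Bc[OF yr(1)]] yr(2)] Suc.IH[OF yr(1)] by simp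
  qed
  then show ?thesis using assms(2) carrier_B by auto
qed

text \<open>Harmonicity writes \<open>\<psi> s\<close> as a difference of two averages at every
  time. The Hellinger bound \<open>K / n\<close> balances the normalisation of the second moments,
  and what remains in the limit is \<open>2 K\<close> times two copies of
  \<open>M \<psi> \<psi>\<close>.\<close>

lemma M_grad_one: assumes "\<psi> \<in> W" "s \<in> S" shows "(\<psi> s)\<^sup>2 \<le> 4 * K * M \<psi> \<psi>"
proof -
  have s: "s \<in> carrier G" using assms Sc by auto
  obtain L where L: "lip_harmonic L \<psi>" using W_lharm assms by auto
  let ?D = "\<lambda>j. (avg (nn j) (\<lambda>x. (\<psi> x)\<^sup>2) s - avg (nn j) (\<lambda>x. (\<psi> x)\<^sup>2) \<one>) / real (nn j)"
  let ?A = "\<lambda>j. avg (nn j) (\<lambda>x. (\<psi> x)\<^sup>2) \<one> / real (nn j)"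
  have "(\<psi> s)\<^sup>2 \<le> 2 * K * (?D j + 2 * ?A j)" for j
  proof -
    let ?n = "nn j"
    have "(\<psi> s)\<^sup>2 = (avg ?n \<psi> s - avg ?n \<psi> \<one>)\<^sup>2"
      using avg_harmonic[OF L s] avg_harmonic[OF L one_closed] W_one[OF assms(1)] by simp
    also have "\<dots> \<le> 2 * hellinger ?n s * (avg ?n (\<lambda>x. (\<psi> x)\<^sup>2) s + avg ?n (\<lambda>x. (\<psi> x)\<^sup>2) \<one>)"
      by (rule avg_compare[OF assms(2)])
    also have "\<dots> \<le> 2 * (K / real ?n) * (avg ?n (\<lambda>x. (\<psi> x)\<^sup>2) s + avg ?n (\<lambda>x. (\<psi> x)\<^sup>2) \<one>)"
      using K(2)[OF assms(2), of j] s by (intro mult_right_mono add_nonneg_nonneg avg_nonneg) auto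
    also have "\<dots> = 2 * K * (?D j + 2 * ?A j)" using nn_pos[of j] by (simp add: field_simps)
    finally show ?thesis .
  qed
  moreover have "(\<lambda>j. 2 * K * (?D j + 2 * ?A j)) \<longlonglongrightarrow> 2 * K * (0 + 2 * M \<psi> \<psi>)"
    by (intro tendsto_intros M_square_lim avg_square_compare assms)
  ultimately have "(\<psi> s)\<^sup>2 \<le> 2 * K * (0 + 2 * M \<psi> \<psi>)" by (intro LIMSEQ_le_const) auto
  then show ?thesis by simp
qed

lemma M_grad: assumes "\<psi> \<in> W" "s \<in> S" "x \<in> carrier G" shows "(\<psi> (x \<otimes> s) - \<psi> x)\<^sup>2 \<le> 4 * K * M \<psi> \<psi>"
  using M_grad_one[OF W_T[OF assms(1,3)] assms(2)] M_T[OF assms(1,3)] Sc[OF assms(2)] by (simp add: T_def)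

text \<open>The gradient bound turns a zero of the form into a function without increments; so
  \<open>M\<close> is an inner product on \<open>W\<close>, not merely semidefinite.\<close>

lemma M_definite: assumes "\<psi> \<in> W" "M \<psi> \<psi> = 0" shows "\<psi> = (\<lambda>x. 0)"
proof
  fix x
  have "\<psi> x = 0" if "x \<in> B n" for n
    using that
  proof (induction n arbitrary: x)
    case 0 then show ?case using W_one[OF assms(1)] by simp
  next
    case (Suc n)
    then obtain y r where yr: "y \<in> B n" "r \<in> S" "x = y \<otimes> r"
      using Suc.prems unfolding wball_Suc2[OF symS] by blast
    have "(\<psi> (y \<otimes> r) - \<psi> y)\<^sup>2 \<le> 4 * K * 0" using M_grad[OF assms(1) yr(2), of y] yr Bc assms(2) by auto
    then show ?case using Suc.IH[OF yr(1)] yr by simp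
  qed
  then show "\<psi> x = 0" using carrier_B W_off[OF assms(1), of x] by blast
qed

section \<open>Finite dimension of the span\<close>

definition orthonormal where
  "orthonormal I f \<longleftrightarrow> finite I \<and> (\<forall>i\<in>I. f i \<in> W) \<and> (\<forall>i\<in>I. \<forall>j\<in>I. M (f i) (f j) = (if i = j then 1 else 0))"

lemma M_orthonormal_sum: assumes "orthonormal I f"
  shows "M (\<lambda>x. \<Sum>i\<in>I. c i * f i x) (\<lambda>x. \<Sum>i\<in>I. c i * f i x) = (\<Sum>i\<in>I. (c i)\<^sup>2)"
proof -
  have I: "finite I" "\<And>i. i \<in> I \<Longrightarrow> f i \<in> W" using assms by (auto simp: orthonormal_def)
  have 1: "M (f j) (\<lambda>x. \<Sum>i\<in>I. c i * f i x) = c j" if j: "j \<in> I" for j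
  proof -
    have "M (f j) (\<lambda>x. \<Sum>i\<in>I. c i * f i x) = (\<Sum>i\<in>I. c i * M (f i) (f j))"
      by (rule trans[OF M_sym M_sum[OF I I(2)[OF j]]])
    also have "\<dots> = (\<Sum>i\<in>I. if i = j then c i else 0)" using assms j by (intro sum.cong) (auto simp: orthonormal_def)
    finally show ?thesis using I(1) j by simp
  qed
  have "M (\<lambda>x. \<Sum>i\<in>I. c i * f i x) (\<lambda>x. \<Sum>i\<in>I. c i * f i x) = (\<Sum>i\<in>I. c i * M (f i) (\<lambda>x. \<Sum>i\<in>I. c i * f i x))"
    by (rule M_sum[OF I W_sum[OF I]])
  then show ?thesis using 1 by (simp add: power2_eq_square)
qed

text \<open>The gradient of \<open>\<psi>\<close> is bounded pointwise by \<open>4 K M(\<psi>, \<psi>)\<close>, while \<open>M(\<psi>, \<psi>)\<close> is an average of squared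
  gradients; summing over an orthonormal system bounds its size.\<close>

lemma orthonormal_card: assumes "orthonormal I f" shows "real (card I) \<le> 4 * K"
proof -
  have I: "finite I" "\<And>i. i \<in> I \<Longrightarrow> f i \<in> W" using assms by (auto simp: orthonormal_def)
  have pt: "(\<Sum>i\<in>I. (f i (x \<otimes> s) - f i x)\<^sup>2) \<le> 4 * K" if "x \<in> carrier G" "s \<in> S" for x s
  proof -
    \<comment> \<open>The combination with these very increments as coefficients has increment
      \<open>Y\<close> and squared norm \<open>Y\<close>, so the gradient bound reads
      \<open>Y^2 <= 4 K Y\<close>.\<close>
    define c where "c i = f i (x \<otimes> s) - f i x" for i
    define Y where "Y = (\<Sum>i\<in>I. (c i)\<^sup>2)"
    have Y0: "Y \<ge> 0" unfolding Y_def by (rule sum_nonneg) auto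
    have "((\<Sum>i\<in>I. c i * f i (x \<otimes> s)) - (\<Sum>i\<in>I. c i * f i x))\<^sup>2 \<le> 4 * K * (\<Sum>i\<in>I. (c i)\<^sup>2)"
    proof -
      have "(\<lambda>x. \<Sum>i\<in>I. c i * f i x) \<in> W" using I by (rule W_sum)
      from M_grad[OF this that(2,1)] show ?thesis unfolding M_orthonormal_sum[OF assms, of c] .
    qed
    also have "(\<Sum>i\<in>I. c i * f i (x \<otimes> s)) - (\<Sum>i\<in>I. c i * f i x) = Y"
      unfolding Y_def by (simp add: sum_subtractf[symmetric] c_def power2_eq_square algebra_simps)
    finally have "Y * Y \<le> 4 * K * Y" by (simp add: power2_eq_square Y_def)
    then have "Y \<le> 4 * K" using Y0 K(1) by (cases "Y = 0") auto
    then show ?thesis by (simp add: Y_def c_def)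
  qed
  have g: "(\<Sum>i\<in>I. grad2 (f i) x) \<le> 4 * K" if "x \<in> carrier G" for x
  proof -
    have "(\<Sum>i\<in>I. grad2 (f i) x) = (\<Sum>s\<in>S. \<Sum>i\<in>I. (f i (x \<otimes> s) - f i x)\<^sup>2) / q"
      unfolding grad2_def by (simp add: sum_divide_distrib[symmetric] sum.swap[of _ S])
    also have "\<dots> \<le> (\<Sum>s\<in>S. 4 * K) / q" using pt that q_pos by (intro divide_right_mono sum_mono) auto
    finally show ?thesis using q_pos by (simp add: q_def)
  qed
  have "(\<Sum>i\<in>I. avg n (\<lambda>x. (f i x)\<^sup>2) \<one>) \<le> real n * (4 * K)" for n
  proof (induction n)
    case 0
    have "f i \<one> = 0" if "i \<in> I" for i using W_one I that by auto
    then show ?case by simp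
  next
    case (Suc n)
    have "(\<Sum>i\<in>I. avg (Suc n) (\<lambda>x. (f i x)\<^sup>2) \<one>) = (\<Sum>i\<in>I. avg n (\<lambda>x. (f i x)\<^sup>2) \<one> + avg n (grad2 (f i)) \<one>)"
    proof (rule sum.cong[OF HOL.refl])
      fix i assume "i \<in> I"
      then obtain L where "lip_harmonic L (f i)" using W_lharm I by blast
      then show "avg (Suc n) (\<lambda>x. (f i x)\<^sup>2) \<one> = avg n (\<lambda>x. (f i x)\<^sup>2) \<one> + avg n (grad2 (f i)) \<one>"
        by (rule avg_square_Suc) simp
    qed
    also have "\<dots> = (\<Sum>i\<in>I. avg n (\<lambda>x. (f i x)\<^sup>2) \<one>) + avg n (\<lambda>x. \<Sum>i\<in>I. grad2 (f i) x) \<one>"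
      by (simp add: sum.distrib avg_sum)
    also have "avg n (\<lambda>x. \<Sum>i\<in>I. grad2 (f i) x) \<one> \<le> avg n (\<lambda>x. 4 * K) \<one>" by (rule avg_mono) (use g in auto)
    finally show ?case using Suc by (simp add: algebra_simps)
  qed
  then have "(\<Sum>i\<in>I. avg (nn j) (\<lambda>x. (f i x)\<^sup>2) \<one> / real (nn j)) \<le> 4 * K" for j
    using nn_pos[of j] by (simp add: sum_divide_distrib[symmetric] pos_divide_le_eq mult.commute)
  moreover have "(\<lambda>j. \<Sum>i\<in>I. avg (nn j) (\<lambda>x. (f i x)\<^sup>2) \<one> / real (nn j)) \<longlonglongrightarrow> (\<Sum>i\<in>I. M (f i) (f i))"
    by (intro tendsto_sum M_square_lim I)
  ultimately have "(\<Sum>i\<in>I. M (f i) (f i)) \<le> 4 * K" by (intro LIMSEQ_le_const2) auto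
  moreover have "(\<Sum>i\<in>I. M (f i) (f i)) = (\<Sum>i\<in>I. 1)" using assms by (intro sum.cong) (auto simp: orthonormal_def)
  ultimately show ?thesis by simp
qed

text \<open>An orthonormal system of maximal size spans \<open>W\<close>: a nonzero remainder after
  projection could be normalised, since \<open>M\<close> is definite, and added to the
  system.\<close>

lemma finite_basis: "\<exists>n f. orthonormal {..<n::nat} f \<and> (\<forall>\<psi>\<in>W. \<psi> = (\<lambda>x. \<Sum>i<n. M \<psi> (f i) * f i x))"
proof -
  define \<O> where "\<O> = {n. \<exists>f. orthonormal {..<n::nat} f}"
  have "orthonormal {..<0::nat} (\<lambda>_ _. 0)" by (simp add: orthonormal_def)
  then have "0 \<in> \<O>" unfolding \<O>_def by blast
  then have ne: "\<O> \<noteq> {}" by blast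
  have "n \<le> nat \<lfloor>4 * K\<rfloor>" if "n \<in> \<O>" for n
    using that orthonormal_card[of "{..<n}"] by (auto simp: \<O>_def le_nat_floor)
  then have fin: "finite \<O>" by (meson finite_nat_set_iff_bounded_le)
  define n where "n = Max \<O>"
  have "n \<in> \<O>" unfolding n_def using fin ne by (rule Max_in)
  then obtain f where f: "orthonormal {..<n} f" by (auto simp: \<O>_def)
  have fW: "\<And>i. i \<in> {..<n} \<Longrightarrow> f i \<in> W" using f by (auto simp: orthonormal_def)
  have "\<psi> = (\<lambda>x. \<Sum>i<n. M \<psi> (f i) * f i x)" if \<psi>: "\<psi> \<in> W" for \<psi>
  proof (rule ccontr)
    assume ne: "\<psi> \<noteq> (\<lambda>x. \<Sum>i<n. M \<psi> (f i) * f i x)"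
    let ?s = "\<lambda>x. \<Sum>i<n. M \<psi> (f i) * f i x"
    define \<theta> where "\<theta> = (\<lambda>x. \<psi> x - ?s x)"
    have sW: "?s \<in> W" by (rule W_sum) (use fW in auto)
    have \<theta>: "\<theta> \<in> W" unfolding \<theta>_def by (rule W_diff[OF \<psi> sW])
    have orth: "M \<theta> (f k) = 0" if k: "k < n" for k
    proof -
      have "M \<theta> (f k) = M \<psi> (f k) - (\<Sum>i<n. M \<psi> (f i) * M (f i) (f k))"
        unfolding \<theta>_def using M_diff[OF \<psi> sW fW[of k]] M_sum[of "{..<n}" f "f k" "\<lambda>i. M \<psi> (f i)"] fW k by simp
      also have "(\<Sum>i<n. M \<psi> (f i) * M (f i) (f k)) = (\<Sum>i<n. if i = k then M \<psi> (f i) else 0)"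
        using f k by (intro sum.cong) (auto simp: orthonormal_def)
      finally show ?thesis using k by simp
    qed
    have "M \<theta> \<theta> \<noteq> 0"
    proof
      assume "M \<theta> \<theta> = 0"
      then have "\<theta> = (\<lambda>x. 0)" by (rule M_definite[OF \<theta>])
      then show False using ne unfolding \<theta>_def fun_eq_iff by simp
    qed
    then have pos: "M \<theta> \<theta> > 0" using M_nonneg[OF \<theta>] by simp
    define a where "a = 1 / sqrt (M \<theta> \<theta>)"
    define \<xi> where "\<xi> = (\<lambda>x. a * \<theta> x)"
    have \<xi>: "\<xi> \<in> W" unfolding \<xi>_def by (rule W_scale[OF \<theta>])
    have sc: "M \<xi> \<zeta> = a * M \<theta> \<zeta>" if "\<zeta> \<in> W" for \<zeta>
      unfolding \<xi>_def using M_lin[OF \<theta> \<theta> that, of a 0] by simp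
    have "M \<xi> \<xi> = a * (a * M \<theta> \<theta>)" using sc[OF \<xi>] sc[OF \<theta>] M_sym[of \<theta> \<xi>] by simp
    then have 1: "M \<xi> \<xi> = 1" using pos by (simp add: a_def)
    have 0: "M \<xi> (f k) = 0" "M (f k) \<xi> = 0" if "k < n" for k
      using sc[OF fW[of k]] orth[OF that] that M_sym[of "f k" \<xi>] by auto
    have "orthonormal {..<Suc n} (f(n := \<xi>))"
      unfolding orthonormal_def using f \<xi> 0 1 by (auto simp: orthonormal_def less_Suc_eq)
    then have "Suc n \<in> \<O>" by (auto simp: \<O>_def)
    then have "Suc n \<le> n" unfolding n_def using fin by (rule Max_ge[rotated])
    then show False by simp
  qed
  then show ?thesis using f by blast
qed

definition nrm where "nrm \<psi> = sqrt (M \<psi> \<psi>)"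

lemma nrm_nonneg: "\<psi> \<in> W \<Longrightarrow> nrm \<psi> \<ge> 0" by (simp add: nrm_def M_nonneg)

lemma nrm_triangle: assumes "\<psi> \<in> W" "\<theta> \<in> W" shows "nrm (\<lambda>x. \<psi> x + \<theta> x) \<le> nrm \<psi> + nrm \<theta>"
proof -
  have W: "(\<lambda>x. \<psi> x + \<theta> x) \<in> W" by (rule W_add[OF assms])
  have lin: "M (\<lambda>x. \<psi> x + \<theta> x) \<xi> = M \<psi> \<xi> + M \<theta> \<xi>" if "\<xi> \<in> W" for \<xi> using M_lin[OF assms that, of 1 1] by simp
  have "M (\<lambda>x. \<psi> x + \<theta> x) (\<lambda>x. \<psi> x + \<theta> x) = M \<psi> \<psi> + 2 * M \<psi> \<theta> + M \<theta> \<theta>"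
    using lin[OF W] lin[OF assms(1)] lin[OF assms(2)] M_sym[of \<psi> \<theta>]
      M_sym[of \<psi> "\<lambda>x. \<psi> x + \<theta> x"] M_sym[of \<theta> "\<lambda>x. \<psi> x + \<theta> x"] by linarith
  also have "M \<psi> \<theta> \<le> nrm \<psi> * nrm \<theta>"
    unfolding nrm_def real_sqrt_mult[symmetric] using M_CS[OF assms] by (rule real_le_rsqrt)
  finally have "M (\<lambda>x. \<psi> x + \<theta> x) (\<lambda>x. \<psi> x + \<theta> x) \<le> (nrm \<psi> + nrm \<theta>)\<^sup>2"
    using M_nonneg assms by (simp add: nrm_def power2_sum)
  then show ?thesis unfolding nrm_def[of "\<lambda>x. \<psi> x + \<theta> x"] using nrm_nonneg assms by (intro real_le_lsqrt) auto
qed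

lemma nrm_scale: assumes "\<psi> \<in> W" shows "nrm (\<lambda>x. a * \<psi> x) = \<bar>a\<bar> * nrm \<psi>"
proof -
  have sc: "M (\<lambda>x. a * \<psi> x) \<zeta> = a * M \<psi> \<zeta>" if "\<zeta> \<in> W" for \<zeta>
    using M_lin[OF assms assms that, of a 0] by simp
  have "M (\<lambda>x. a * \<psi> x) (\<lambda>x. a * \<psi> x) = a\<^sup>2 * M \<psi> \<psi>"
    using sc[OF W_scale[OF assms]] sc[OF assms] M_sym[of \<psi> "\<lambda>x. a * \<psi> x"] by (simp add: power2_eq_square)
  then show ?thesis by (simp add: nrm_def real_sqrt_mult)
qed

lemma nrm_diff: assumes "\<psi> \<in> W" "\<theta> \<in> W" shows "nrm (\<lambda>x. \<psi> x - \<theta> x) \<le> nrm \<psi> + nrm \<theta>"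
  using nrm_triangle[OF assms(1) W_scale[OF assms(2), of "-1"]] nrm_scale[OF assms(2), of "-1"] by simp

lemma nrm_T: "\<psi> \<in> W \<Longrightarrow> g \<in> carrier G \<Longrightarrow> nrm (T g \<psi>) = nrm \<psi>"
  by (simp add: nrm_def M_T)

lemma nrm_sum: "finite I \<Longrightarrow> (\<And>i. i \<in> I \<Longrightarrow> f i \<in> W) \<Longrightarrow> nrm (\<lambda>x. \<Sum>i\<in>I. c i * f i x) \<le> (\<Sum>i\<in>I. \<bar>c i\<bar> * nrm (f i))"
proof (induction I rule: finite_induct)
  case empty
  then show ?case using M_lin[OF W_zero W_zero W_zero, of 0 0] by (simp add: nrm_def)
next
  case (insert i I)
  have "nrm (\<lambda>x. c i * f i x + (\<Sum>i\<in>I. c i * f i x)) \<le> nrm (\<lambda>x. c i * f i x) + nrm (\<lambda>x. \<Sum>i\<in>I. c i * f i x)"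
    by (rule nrm_triangle[OF W_scale W_sum]) (use insert in auto)
  then show ?case using insert nrm_scale[of "f i" "c i"] by simp
qed

end

section \<open>Groups with a contracting length function\<close>

text \<open>An expansion with digits \<open>n\<close>, in which the elements \<open>h k\<close>,
  \<open>h (k + 1)\<close>, and so on play the role of the powers of a base.\<close>

primrec digits :: "('a, 'b) monoid_scheme \<Rightarrow> (nat \<Rightarrow> 'a) \<Rightarrow> nat \<Rightarrow> nat list \<Rightarrow> 'a" where
  "digits G h k [] = \<one>\<^bsub>G\<^esub>"
| "digits G h k (n # ns) = h k [^]\<^bsub>G\<^esub> n \<otimes>\<^bsub>G\<^esub> digits G h (Suc k) ns"

text \<open>Membership in a generated subgroup involves finitely many generators. This lets a
  finitely generated group be generated by finitely many members of a prescribed, possibly infinite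
  generating set.\<close>

lemma (in group) finite_generate_subset:
  assumes "finite Y" "E \<subseteq> carrier G" "Y \<subseteq> generate G E"
  shows "\<exists>T. finite T \<and> T \<subseteq> E \<and> Y \<subseteq> generate G T"
proof -
  have one: "\<exists>T. finite T \<and> T \<subseteq> E \<and> y \<in> generate G T" if "y \<in> generate G E" for y
    using that
  proof (induction rule: generate.induct)
    case one then show ?case by (intro exI[of _ "{}"]) (auto intro: generate.one)
  next
    case (incl h) then show ?case by (intro exI[of _ "{h}"]) (auto intro: generate.incl)
  next
    case (inv h) then show ?case by (intro exI[of _ "{h}"]) (auto intro: generate.inv)
  next
    case (eng h1 h2)
    then obtain T1 T2 where "finite T1" "T1 \<subseteq> E" "h1 \<in> generate G T1" "finite T2" "T2 \<subseteq> E" "h2 \<in> generate G T2" by blast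
    then show ?case
      using mono_generate[of T1 "T1 \<union> T2"] mono_generate[of T2 "T1 \<union> T2"]
      by (intro exI[of _ "T1 \<union> T2"]) (auto intro!: generate.eng)
  qed
  show ?thesis using assms(1,3)
  proof (induction Y rule: finite_induct)
    case empty then show ?case by blast
  next
    case (insert y Y)
    then obtain T where T: "finite T" "T \<subseteq> E" "Y \<subseteq> generate G T" by auto
    have "y \<in> generate G E" using insert.prems by simp
    from one[OF this] obtain T' where T': "finite T'" "T' \<subseteq> E" "y \<in> generate G T'" by blast
    then show ?case
      using T mono_generate[of T "T \<union> T'"] mono_generate[of T' "T \<union> T'"]
      by (intro exI[of _ "T \<union> T'"]) auto
  qed
qed

text \<open>The model is the distance to the identity in the operator norm, pulled back from a group of
  isometries.\<close>

locale length_group = group G for G (structure) +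
  fixes \<delta> :: "'a \<Rightarrow> real"
  assumes nonneg: "x \<in> carrier G \<Longrightarrow> \<delta> x \<ge> 0"
    and d_one: "\<delta> \<one> = 0"
    and d_mult: "x \<in> carrier G \<Longrightarrow> y \<in> carrier G \<Longrightarrow> \<delta> (x \<otimes> y) \<le> \<delta> x + \<delta> y"
    and d_inv: "x \<in> carrier G \<Longrightarrow> \<delta> (inv x) = \<delta> x"
    and d_conj: "x \<in> carrier G \<Longrightarrow> y \<in> carrier G \<Longrightarrow> \<delta> (y \<otimes> x \<otimes> inv y) = \<delta> x"
    and d_com: "x \<in> carrier G \<Longrightarrow> y \<in> carrier G \<Longrightarrow> \<delta> (x \<otimes> y \<otimes> inv x \<otimes> inv y) \<le> 2 * \<delta> x * \<delta> y"
    and d_pow: "x \<in> carrier G \<Longrightarrow> real n * \<delta> x \<le> 1 \<Longrightarrow> real n * \<delta> x \<le> 2 * \<delta> (x [^] n)"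
begin

text \<open>Equality up to elements of length zero. It is a congruence, so arguments about the image
  among the isometries can be carried out in \<open>G\<close> without forming a quotient.\<close>

definition E where "E x y \<longleftrightarrow> \<delta> (x \<otimes> inv y) = 0"

lemma E_refl: "x \<in> carrier G \<Longrightarrow> E x x" by (simp add: E_def d_one)

lemma E_eq: assumes "x \<in> carrier G" "y \<in> carrier G" "E x y" shows "\<delta> x = \<delta> y"
proof -
  have "\<delta> x \<le> \<delta> (x \<otimes> inv y) + \<delta> y" using d_mult[of "x \<otimes> inv y" y] assms by (simp add: m_assoc)
  moreover have "\<delta> y \<le> \<delta> (inv (x \<otimes> inv y)) + \<delta> x" using d_mult[of "inv (x \<otimes> inv y)" x] assms by (simp add: group_assoc_simps)
  ultimately show ?thesis using assms d_inv[of "x \<otimes> inv y"] by (simp add: E_def)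
qed

lemma E_trans: assumes "x \<in> carrier G" "y \<in> carrier G" "z \<in> carrier G" "E x y" "E y z" shows "E x z"
proof -
  have "\<delta> (x \<otimes> inv z) \<le> \<delta> (x \<otimes> inv y) + \<delta> (y \<otimes> inv z)"
    using d_mult[of "x \<otimes> inv y" "y \<otimes> inv z"] assms by (simp add: m_assoc)
  then show ?thesis using assms nonneg[of "x \<otimes> inv z"] by (simp add: E_def)
qed

lemma E_mult: assumes "x \<in> carrier G" "y \<in> carrier G" "x' \<in> carrier G" "y' \<in> carrier G" "E x x'" "E y y'"
  shows "E (x \<otimes> y) (x' \<otimes> y')"
proof -
  have "\<delta> ((x \<otimes> y) \<otimes> inv (x' \<otimes> y')) \<le> \<delta> (x \<otimes> (y \<otimes> inv y') \<otimes> inv x) + \<delta> (x \<otimes> inv x')"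
    using d_mult[of "x \<otimes> (y \<otimes> inv y') \<otimes> inv x" "x \<otimes> inv x'"] assms by (simp add: group_assoc_simps)
  also have "\<dots> = 0" using assms d_conj[of "y \<otimes> inv y'" x] by (simp add: E_def)
  finally show ?thesis using nonneg[of "(x \<otimes> y) \<otimes> inv (x' \<otimes> y')"] assms by (simp add: E_def)
qed

lemma E_left: "E y y' \<Longrightarrow> x \<in> carrier G \<Longrightarrow> y \<in> carrier G \<Longrightarrow> y' \<in> carrier G \<Longrightarrow> E (x \<otimes> y) (x \<otimes> y')"
  by (rule E_mult) (auto intro: E_refl)

definition commutes where "commutes x y \<longleftrightarrow> E (x \<otimes> y) (y \<otimes> x)"

lemma commutes_iff: "x \<in> carrier G \<Longrightarrow> y \<in> carrier G \<Longrightarrow> commutes x y \<longleftrightarrow> \<delta> (x \<otimes> y \<otimes> inv x \<otimes> inv y) = 0"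
  by (simp add: commutes_def E_def group_assoc_simps)

lemma commutes_sym: assumes "x \<in> carrier G" "y \<in> carrier G" "commutes x y" shows "commutes y x"
proof -
  have "\<delta> (inv (x \<otimes> y \<otimes> inv (y \<otimes> x))) = \<delta> (x \<otimes> y \<otimes> inv (y \<otimes> x))" using assms by (intro d_inv) auto
  moreover have "inv (x \<otimes> y \<otimes> inv (y \<otimes> x)) = y \<otimes> x \<otimes> inv (x \<otimes> y)" using assms by (simp add: group_assoc_simps)
  ultimately show ?thesis using assms by (simp add: commutes_def E_def)
qed

lemma commutes_subgroup: assumes x: "x \<in> carrier G" shows "subgroup {y\<in>carrier G. commutes x y} G"
proof (rule subgroupI)
  show "{y\<in>carrier G. commutes x y} \<subseteq> carrier G" by auto
  show "{y\<in>carrier G. commutes x y} \<noteq> {}" using x E_refl by (auto simp: commutes_def intro!: exI[of _ \<one>])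
  fix y assume y: "y \<in> {y\<in>carrier G. commutes x y}"
  then have yc: "y \<in> carrier G" "E (y \<otimes> x) (x \<otimes> y)" using commutes_sym x by (auto simp: commutes_def)
  have "E ((y \<otimes> x) \<otimes> inv y) ((x \<otimes> y) \<otimes> inv y)"
    by (rule E_mult[OF _ _ _ _ yc(2) E_refl]) (use yc x in auto)
  then have "E (inv y \<otimes> ((y \<otimes> x) \<otimes> inv y)) (inv y \<otimes> ((x \<otimes> y) \<otimes> inv y))"
    by (rule E_left) (use yc x in auto)
  then show "inv y \<in> {y\<in>carrier G. commutes x y}" using yc x by (simp add: commutes_def m_assoc)
  fix z assume z: "z \<in> {y\<in>carrier G. commutes x y}"
  have yz: "E (x \<otimes> y) (y \<otimes> x)" "E (x \<otimes> z) (z \<otimes> x)" "y \<in> carrier G" "z \<in> carrier G"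
    using y z by (auto simp: commutes_def)
  have "E ((x \<otimes> y) \<otimes> z) ((y \<otimes> x) \<otimes> z)" by (rule E_mult[OF _ _ _ _ yz(1) E_refl]) (use yz x in auto)
  moreover have "(y \<otimes> x) \<otimes> z = y \<otimes> (x \<otimes> z)" using yz x by (simp add: m_assoc)
  ultimately have 1: "E ((x \<otimes> y) \<otimes> z) (y \<otimes> (x \<otimes> z))" by simp
  have 2: "E (y \<otimes> (x \<otimes> z)) (y \<otimes> (z \<otimes> x))" by (rule E_left[OF yz(2)]) (use yz x in auto)
  have "E ((x \<otimes> y) \<otimes> z) (y \<otimes> (z \<otimes> x))" by (rule E_trans[OF _ _ _ 1 2]) (use yz x in auto)
  then show "y \<otimes> z \<in> {y\<in>carrier G. commutes x y}" using yz x by (simp add: commutes_def m_assoc)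
qed

lemma commutes_generate:
  assumes "x \<in> carrier G" "T \<subseteq> carrier G" "\<And>t. t \<in> T \<Longrightarrow> commutes x t" "y \<in> generate G T" shows "commutes x y"
  using generate_subgroup_incl[OF _ commutes_subgroup[OF assms(1)], of T] assms by auto

lemma d_pow_le: "x \<in> carrier G \<Longrightarrow> \<delta> (x [^] n) \<le> real n * \<delta> x"
proof (induction n)
  case 0 then show ?case by (simp add: d_one)
next
  case (Suc n)
  then show ?case using d_mult[of "x [^] n" x] by (simp add: algebra_simps)
qed

text \<open>If \<open>h = [x, g]\<close> commutes with \<open>x\<close>, then \<open>h\<^sup>n g\<close> is conjugate to \<open>g\<close> for all \<open>n\<close>, so the powers of \<open>h\<close> stay
  small, which \<open>d_pow\<close> allows only for \<open>\<delta> h = 0\<close>.\<close>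

lemma central_commutator_trivial:
  assumes "x \<in> carrier G" "g \<in> carrier G" "\<delta> g \<le> 1/16" "\<delta> x \<le> 1" "commutes x (x \<otimes> g \<otimes> inv x \<otimes> inv g)"
  shows "\<delta> (x \<otimes> g \<otimes> inv x \<otimes> inv g) = 0"
proof (rule ccontr)
  define h where "h = x \<otimes> g \<otimes> inv x \<otimes> inv g"
  assume "\<delta> (x \<otimes> g \<otimes> inv x \<otimes> inv g) \<noteq> 0"
  then have pos: "\<delta> h > 0" using nonneg[of h] assms by (simp add: h_def)
  have h: "h \<in> carrier G" using assms by (simp add: h_def)
  have hg: "x \<otimes> g \<otimes> inv x = h \<otimes> g" using assms by (simp add: h_def m_assoc)
  have sub: "subgroup {y\<in>carrier G. commutes x y} G" by (rule commutes_subgroup[OF assms(1)])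
  have hn: "commutes x (h [^] n)" for n :: nat
  proof (induction n)
    case 0 then show ?case using subgroup.one_closed[OF sub] by simp
  next
    case (Suc n)
    then show ?case using subgroup.m_closed[OF sub, of "h [^] n" h] assms(5) h by (simp add: h_def[symmetric])
  qed
  have ind: "E (x [^] n \<otimes> g \<otimes> inv (x [^] n)) (h [^] n \<otimes> g)" for n :: nat
  proof (induction n)
    case 0 then show ?case using assms E_refl by simp
  next
    case (Suc n)
    have c: "x [^] n \<in> carrier G" "h [^] n \<in> carrier G" using assms h by auto
    have "E ((x [^] n \<otimes> g \<otimes> inv (x [^] n)) \<otimes> inv x) ((h [^] n \<otimes> g) \<otimes> inv x)"
      by (rule E_mult[OF _ _ _ _ Suc E_refl]) (use c assms in auto)
    then have 1: "E (x \<otimes> ((x [^] n \<otimes> g \<otimes> inv (x [^] n)) \<otimes> inv x)) (x \<otimes> ((h [^] n \<otimes> g) \<otimes> inv x))"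
      by (rule E_left) (use c h assms in auto)
    have "E ((x \<otimes> h [^] n) \<otimes> (g \<otimes> inv x)) ((h [^] n \<otimes> x) \<otimes> (g \<otimes> inv x))"
      by (rule E_mult[OF _ _ _ _ hn[of n, unfolded commutes_def] E_refl]) (use c assms in auto)
    then have 2: "E (x \<otimes> ((h [^] n \<otimes> g) \<otimes> inv x)) (h [^] n \<otimes> (x \<otimes> g \<otimes> inv x))"
      using c assms by (simp add: m_assoc)
    have "E (x \<otimes> ((x [^] n \<otimes> g \<otimes> inv (x [^] n)) \<otimes> inv x)) (h [^] n \<otimes> (x \<otimes> g \<otimes> inv x))"
      by (rule E_trans[OF _ _ _ 1 2]) (use c assms in auto)
    moreover have "x \<otimes> ((x [^] n \<otimes> g \<otimes> inv (x [^] n)) \<otimes> inv x) = x [^] (Suc n) \<otimes> g \<otimes> inv (x [^] (Suc n))"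
      using c assms nat_pow_Suc2[of x n] by (simp add: group_assoc_simps del: nat_pow_Suc)
    ultimately show ?case unfolding hg using c h assms by (simp add: m_assoc)
  qed
  have b: "\<delta> (h [^] n) \<le> 1/8" for n :: nat
  proof -
    have c: "x [^] n \<in> carrier G" "h [^] n \<in> carrier G" using assms h by auto
    have "\<delta> (h [^] n) \<le> \<delta> (h [^] n \<otimes> g) + \<delta> (inv g)" using d_mult[of "h [^] n \<otimes> g" "inv g"] c assms by (simp add: m_assoc)
    also have "\<delta> (h [^] n \<otimes> g) = \<delta> (x [^] n \<otimes> g \<otimes> inv (x [^] n))" using E_eq[OF _ _ ind[of n]] c assms by simp
    also have "\<dots> = \<delta> g" using d_conj c assms by simp
    finally show ?thesis using d_inv assms by simp
  qed
  have h8: "\<delta> h \<le> 1/8" using b[of 1] h by simp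
  \<comment> \<open>The largest \<open>m\<close> with \<open>m\<close> times
    \<open>\<delta> h\<close> at most 1. The power \<open>h^m\<close> then has length above
    \<open>(1 - \<delta> h) / 2\<close>, hence above 7/16, against the bound 1/8.\<close>
  define m where "m = nat \<lfloor>1 / \<delta> h\<rfloor>"
  have "1 / \<delta> h \<ge> 0" using pos by simp
  then have m: "real m \<le> 1 / \<delta> h" "real m > 1 / \<delta> h - 1" unfolding m_def by linarith+
  have "real m * \<delta> h \<le> 1" using m(1) pos by (simp add: field_simps)
  then have "real m * \<delta> h \<le> 2 * \<delta> (h [^] m)" by (rule d_pow[OF h])
  moreover have "real m * \<delta> h > (1 / \<delta> h - 1) * \<delta> h" using m(2) pos by (intro mult_strict_right_mono) auto
  ultimately show False using b[of m] h8 pos by (simp add: algebra_simps)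
qed

text \<open>Otherwise iterated commutators \<open>h\<^sub>k\<close> with short generators never become trivial, have word length
  \<open>O(4\<^sup>k)\<close> and shrink by the factor \<open>2\<epsilon>\<close>. The products of powers of \<open>h\<^sub>0, h\<^sub>1, \<dots>\<close> with
  exponents below \<open>N\<close> are then distinct, as
  for expansions in a base, and \<open>N = 4\<^sup>d\<^sup>+\<^sup>1\<close> is too many of them for growth of degree \<open>d\<close>.\<close>

lemma almost_abelian:
  assumes sgenS: "sgen G S (carrier G)"
    and poly: "\<And>n. n \<ge> 1 \<Longrightarrow> real (card (wball G S n)) \<le> C * real n ^ d"
    and tb: "\<And>\<epsilon>. \<epsilon> > 0 \<Longrightarrow> \<exists>F. finite F \<and> F \<subseteq> carrier G \<and> (\<forall>g\<in>carrier G. \<exists>f\<in>F. \<delta> (g \<otimes> inv f) \<le> \<epsilon>)"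
  shows "\<exists>H. subgroup H G \<and> findex G H (carrier G) \<and> (\<forall>x\<in>H. \<forall>y\<in>H. \<delta> (x \<otimes> y \<otimes> inv x \<otimes> inv y) = 0)"
proof -
  \<comment> \<open>With \<open>N\<close> digits per place, the number of expansions outgrows degree
    \<open>d\<close> although the word length of a place grows by the factor 4. The choice of
    \<open>\<epsilon>\<close> gives \<open>2 N \<epsilon> = 1/20\<close>, so the tails of two
    expansions after place \<open>k\<close> together weigh at most a tenth of
    \<open>\<delta> (h k)\<close>.\<close>
  define N :: nat where "N = 4 ^ (d + 1)"
  define \<epsilon> :: real where "\<epsilon> = 1 / (40 * real N)"
  have N: "N \<ge> 1" by (simp add: N_def)
  have \<epsilon>: "\<epsilon> > 0" "\<epsilon> \<le> 1/40" "2 * real N * \<epsilon> = 1/20" using N by (auto simp: \<epsilon>_def field_simps)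
  define Y where "Y = {x\<in>carrier G. \<delta> x \<le> \<epsilon>}"
  define H where "H = generate G Y"
  have Yc: "Y \<subseteq> carrier G" by (auto simp: Y_def)
  have Hs: "subgroup H G" unfolding H_def by (rule generate_is_subgroup[OF Yc])
  have Hc: "x \<in> carrier G" if "x \<in> H" for x using subgroup.mem_carrier[OF Hs that] .
  have fi: "findex G H (carrier G)"
  proof -
    obtain F where F: "finite F" "F \<subseteq> carrier G" "\<forall>g\<in>carrier G. \<exists>f\<in>F. \<delta> (g \<otimes> inv f) \<le> \<epsilon>" using tb[OF \<epsilon>(1)] by blast
    have "\<exists>f\<in>F. g \<otimes> inv f \<in> H" if g: "g \<in> carrier G" for g
    proof -
      obtain f where f: "f \<in> F" "\<delta> (g \<otimes> inv f) \<le> \<epsilon>" using F(3) g by blast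
      then have "g \<otimes> inv f \<in> Y" using g F(2) by (auto simp: Y_def)
      then show ?thesis using f(1) unfolding H_def by (blast intro: generate.incl)
    qed
    then show ?thesis using F unfolding findex_def by blast
  qed
  \<comment> \<open>The small elements \<open>Y\<close> generate \<open>H\<close> but may be
    infinite in number. Schreier's lemma makes \<open>H\<close> finitely generated, hence generated
    by finitely many of them.\<close>
  obtain T where T: "finite T" "T \<subseteq> Y" "generate G T = H"
  proof -
    obtain R where R: "sgen G R H" using schreier[OF sgenS Hs _ fi] Hc by blast
    have Rf: "finite R" "R \<subseteq> generate G Y" using R sgen_subset[OF R] by (auto simp: sgen_def symgen_def H_def)
    obtain T where T: "finite T" "T \<subseteq> Y" "R \<subseteq> generate G T" using finite_generate_subset[OF Rf(1) Yc Rf(2)] by blast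
    have Ts: "subgroup (generate G T) G" using T Yc by (intro generate_is_subgroup) auto
    have "H \<subseteq> generate G T" using generate_subgroup_incl[OF T(3) Ts] sgen_generate_iff[OF R] by simp
    moreover have "generate G T \<subseteq> H" unfolding H_def by (rule mono_generate[OF T(2)])
    ultimately show thesis using T that by blast
  qed
  have Tc: "t \<in> carrier G" "\<delta> t \<le> \<epsilon>" "t \<in> H" if "t \<in> T" for t
    using T that by (auto simp: Y_def H_def intro: generate.incl)
  have Tsub: "T \<subseteq> carrier G" using Tc by blast
  define good where "good x \<longleftrightarrow> x \<in> H \<and> (\<exists>y\<in>H. \<not> commutes x y)" for x
  have "\<not> (\<exists>x. good x)"
  proof
    assume "\<exists>x. good x"
    then obtain x1 where x1: "x1 \<in> H" "\<exists>y\<in>H. \<not> commutes x1 y" by (auto simp: good_def)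
    have "\<exists>x0\<in>T. good x0"
    proof (rule ccontr)
      assume "\<not> ?thesis"
      then have ng: "\<And>t. t \<in> T \<Longrightarrow> \<not> good t" by blast
      have ty: "commutes y t" if t: "t \<in> T" and y: "y \<in> H" for t y
      proof -
        have "commutes t y" using ng[OF t] Tc(3)[OF t] y unfolding good_def by blast
        then show ?thesis by (rule commutes_sym[OF Tc(1)[OF t] Hc[OF y]])
      qed
      have "commutes x1 y" if "y \<in> H" for y
        using commutes_generate[OF Hc[OF x1(1)] Tsub ty[OF _ x1(1)]] that T(3) by simp
      then show False using x1 by blast
    qed
    then obtain x0 where x0: "x0 \<in> T" "good x0" by blast
    have step: "\<exists>g\<in>T. good (x \<otimes> g \<otimes> inv x \<otimes> inv g)" if "good x" "\<delta> x \<le> 1" for x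
    proof -
      have x: "x \<in> H" "x \<in> carrier G" using that Hc by (auto simp: good_def)
      have "\<exists>g\<in>T. \<not> commutes x g"
      proof (rule ccontr)
        assume "\<not> ?thesis"
        then have all: "\<And>t. t \<in> T \<Longrightarrow> commutes x t" by blast
        have "commutes x y" if "y \<in> H" for y
          using commutes_generate[OF x(2) Tsub all] that T(3) by simp
        then show False using that(1) unfolding good_def by blast
      qed
      then obtain g where g: "g \<in> T" "\<not> commutes x g" by blast
      let ?h = "x \<otimes> g \<otimes> inv x \<otimes> inv g"
      have gc: "g \<in> carrier G" "g \<in> H" "\<delta> g \<le> 1/16" using Tc[OF g(1)] \<epsilon>(2) by auto
      have hH: "?h \<in> H" using x gc Hs by (intro subgroup.m_closed subgroup.m_inv_closed) auto
      have "\<delta> ?h \<noteq> 0" using g commutes_iff[OF x(2) gc(1)] by simp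
      \<comment> \<open>If \<open>?h\<close> commuted with \<open>x\<close>, it would have length
        zero, and \<open>x\<close> would commute with \<open>g\<close>.\<close>
      then have "\<not> commutes x ?h" using central_commutator_trivial[OF x(2) gc(1,3) that(2)] by blast
      then have "\<not> commutes ?h x" using commutes_sym[OF Hc[OF hH] x(2)] by blast
      then have "good ?h" using hH x by (auto simp: good_def)
      then show ?thesis using g by blast
    qed
    define ch where "ch x = (SOME g. g \<in> T \<and> good (x \<otimes> g \<otimes> inv x \<otimes> inv g))" for x
    define nx where "nx x = x \<otimes> ch x \<otimes> inv x \<otimes> inv (ch x)" for x
    have nx: "\<exists>g\<in>T. nx x = x \<otimes> g \<otimes> inv x \<otimes> inv g \<and> good (nx x)" if "good x" "\<delta> x \<le> 1" for x
    proof -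
      have ex: "\<exists>g. g \<in> T \<and> good (x \<otimes> g \<otimes> inv x \<otimes> inv g)" using step[OF that] by blast
      have "ch x \<in> T \<and> good (x \<otimes> ch x \<otimes> inv x \<otimes> inv (ch x))" unfolding ch_def by (rule someI_ex[OF ex])
      then show ?thesis unfolding nx_def by (intro bexI[of _ "ch x"]) simp_all
    qed
    define h where "h k = (nx ^^ k) x0" for k
    have h0: "h 0 = x0" and hS: "h (Suc k) = nx (h k)" for k by (simp_all add: h_def)
    have hg: "good (h k) \<and> \<delta> (h k) \<le> \<epsilon>" for k
    proof (induction k)
      case 0 then show ?case using x0 Tc h0 by simp
    next
      case (Suc k)
      then have "\<delta> (h k) \<le> 1" using \<epsilon> by linarith
      then obtain g where g: "g \<in> T" "nx (h k) = h k \<otimes> g \<otimes> inv (h k) \<otimes> inv g" "good (nx (h k))"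
        using nx[of "h k"] Suc by blast
      have hc: "h k \<in> carrier G" using Suc Hc by (simp add: good_def)
      have "\<delta> (nx (h k)) \<le> 2 * \<delta> (h k) * \<delta> g" unfolding g(2) by (rule d_com[OF hc Tc(1)[OF g(1)]])
      also have "\<dots> \<le> 2 * \<epsilon> * \<epsilon>" using Suc Tc[OF g(1)] \<epsilon> nonneg[OF hc] nonneg[OF Tc(1)[OF g(1)]] by (intro mult_mono) auto
      also have "\<dots> \<le> 1 * \<epsilon>" using \<epsilon> by (intro mult_right_mono) auto
      finally show ?case using g(3) hS by simp
    qed
    then have hH: "h k \<in> H" for k by (simp add: good_def)
    have hc: "h k \<in> carrier G" for k by (rule Hc[OF hH])
    have hle: "\<delta> (h k) \<le> 1" for k using hg[of k] \<epsilon>(2) by linarith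
    have hnext: "\<exists>g\<in>T. h (Suc k) = h k \<otimes> g \<otimes> inv (h k) \<otimes> inv g" for k
      using nx[of "h k"] hg[of k] hle[of k] hS by auto
    have hpos: "\<delta> (h k) > 0" for k
    proof -
      obtain y where y: "y \<in> H" "\<not> commutes (h k) y" using hg[of k] by (auto simp: good_def)
      then have "\<delta> (h k \<otimes> y \<otimes> inv (h k) \<otimes> inv y) \<noteq> 0" using commutes_iff[OF hc Hc[OF y(1)]] by blast
      then have "\<delta> (h k) \<noteq> 0" using d_com[OF hc Hc[OF y(1)], of k] nonneg[of "h k \<otimes> y \<otimes> inv (h k) \<otimes> inv y"] hc Hc[OF y(1)] by auto
      then show ?thesis using nonneg[OF hc, of k] by simp
    qed
    have hdec: "\<delta> (h (Suc k)) \<le> 2 * \<epsilon> * \<delta> (h k)" for k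
    proof -
      obtain g where g: "g \<in> T" "h (Suc k) = h k \<otimes> g \<otimes> inv (h k) \<otimes> inv g" using hnext by blast
      have "\<delta> (h (Suc k)) \<le> 2 * \<delta> (h k) * \<delta> g" unfolding g(2) by (rule d_com[OF hc Tc(1)[OF g(1)]])
      also have "\<dots> \<le> 2 * \<delta> (h k) * \<epsilon>" using Tc[OF g(1)] nonneg[OF hc] by (intro mult_left_mono) auto
      finally show ?thesis by (simp add: mult_ac)
    qed
    have s: "symgen G S" using sgenS by (simp add: sgen_def)
    obtain l where l: "l \<ge> 1" "T \<subseteq> wball G S l" using sgen_finite_subset[OF sgenS T(1) Tsub] by blast
    have wadd: "x \<otimes> y \<in> wball G S (m + n)" if "x \<in> wball G S m" "y \<in> wball G S n" for x y m n
      using wball_add that s by (auto simp: symgen_def)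
    \<comment> \<open>A commutator contains \<open>h k\<close> and \<open>g\<close>, or their
      inverses, twice each, and \<open>l\<close> is at most the length bound
      \<open>l * 4 ^ k\<close>; hence the factor 4.\<close>
    have hb: "h k \<in> wball G S (l * 4 ^ k)" for k
    proof (induction k)
      case 0 then show ?case using x0 l h0 by auto
    next
      case (Suc k)
      obtain g where g: "g \<in> T" "h (Suc k) = h k \<otimes> g \<otimes> inv (h k) \<otimes> inv g" using hnext by blast
      have "g \<in> wball G S l" using g l by auto
      then have "h (Suc k) \<in> wball G S (l * 4 ^ k + l + l * 4 ^ k + l)"
        unfolding g(2) using Suc by (intro wadd wball_inv[OF s]) auto
      moreover have "l \<le> l * 4 ^ k" by simp
      then have "l * 4 ^ k + l + l * 4 ^ k + l \<le> 4 * (l * 4 ^ k)" by linarith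
      then have "l * 4 ^ k + l + l * 4 ^ k + l \<le> l * 4 ^ Suc k" by simp
      ultimately show ?case using wball_mono[OF s] by blast
    qed
    have dc: "digits G h k ns \<in> carrier G" for k ns by (induction ns arbitrary: k) (auto simp: hc)
    have dd: "set ns \<subseteq> {..<N} \<Longrightarrow> \<delta> (digits G h k ns) \<le> real N * \<delta> (h k)" for k ns
    proof (induction ns arbitrary: k)
      case Nil then show ?case using hpos[of k] by (simp add: d_one)
    next
      case (Cons n ns)
      have "\<delta> (digits G h k (n # ns)) \<le> \<delta> (h k [^] n) + \<delta> (digits G h (Suc k) ns)"
        using d_mult hc dc by simp
      also have "\<delta> (h k [^] n) \<le> real n * \<delta> (h k)" by (rule d_pow_le[OF hc])
      also have "\<delta> (digits G h (Suc k) ns) \<le> real N * \<delta> (h (Suc k))" using Cons by simp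
      also have "real N * \<delta> (h (Suc k)) \<le> real N * (2 * \<epsilon> * \<delta> (h k))" using hdec by (intro mult_left_mono) auto
      also have "\<dots> = 1/20 * \<delta> (h k)" using \<epsilon>(3) by (metis mult.assoc mult.commute)
      also have "real n * \<delta> (h k) \<le> (real N - 1) * \<delta> (h k)" using Cons hpos[of k] by (intro mult_right_mono) auto
      finally show ?case using hpos[of k] by (simp add: algebra_simps)
    qed
    have strict: "ns \<noteq> ms \<Longrightarrow> length ns = length ms \<Longrightarrow> set ns \<subseteq> {..<N} \<Longrightarrow> set ms \<subseteq> {..<N} \<Longrightarrow> digits G h k ns \<noteq> digits G h k ms" for ns ms k
    proof (induction ns arbitrary: ms k)
      case Nil then show ?case by simp
    next
      case (Cons n ns)
      then obtain m ms' where ms: "ms = m # ms'" by (cases ms) auto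
      \<comment> \<open>At the first differing digit the quotient is a positive power of
        \<open>h k\<close> with exponent below \<open>N\<close>. By \<open>d_pow\<close> its length
        is at least half of \<open>\<delta> (h k)\<close>, while the two tails allow only a
        tenth.\<close>
      have lt: False if nm: "m' < n'" "n' < N" and sets: "set u \<subseteq> {..<N}" "set v \<subseteq> {..<N}"
        and eq: "h k [^] n' \<otimes> digits G h (Suc k) u = h k [^] m' \<otimes> digits G h (Suc k) v" for n' m' u v
      proof -
        let ?u = "digits G h (Suc k) u" let ?v = "digits G h (Suc k) v"
        have "h k [^] n' = h k [^] m' \<otimes> h k [^] (n' - m')" using nm hc by (simp add: nat_pow_mult)
        then have "h k [^] m' \<otimes> (h k [^] (n' - m') \<otimes> ?u) = h k [^] m' \<otimes> ?v" using eq hc dc by (simp add: m_assoc)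
        then have "h k [^] (n' - m') \<otimes> ?u = ?v" using hc dc by (subst (asm) l_cancel) auto
        then have e: "h k [^] (n' - m') = ?v \<otimes> inv ?u" using hc dc by (metis inv_solve_right m_closed nat_pow_closed)
        have "\<delta> (h k [^] (n' - m')) \<le> \<delta> ?v + \<delta> ?u" unfolding e using d_mult[of ?v "inv ?u"] d_inv dc by simp
        also have "\<dots> \<le> real N * \<delta> (h (Suc k)) + real N * \<delta> (h (Suc k))" using dd sets by (intro add_mono) auto
        also have "\<dots> \<le> 2 * (real N * (2 * \<epsilon> * \<delta> (h k)))" using mult_left_mono[OF hdec[of k], of "real N"] by linarith
        also have "\<dots> = 1/10 * \<delta> (h k)" using \<epsilon>(3) by (simp add: field_simps)
        finally have up: "\<delta> (h k [^] (n' - m')) \<le> 1/10 * \<delta> (h k)" .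
        have "real (n' - m') * \<delta> (h k) \<le> real N * \<epsilon>" using hg[of k] nm hpos[of k] by (intro mult_mono) auto
        then have "real (n' - m') * \<delta> (h k) \<le> 1" using \<epsilon>(3) by simp
        then have "real (n' - m') * \<delta> (h k) \<le> 2 * \<delta> (h k [^] (n' - m'))" by (rule d_pow[OF hc])
        moreover have "1 * \<delta> (h k) \<le> real (n' - m') * \<delta> (h k)" using nm hpos[of k] by (intro mult_right_mono) auto
        ultimately show False using up hpos[of k] by linarith
      qed
      show ?case
      proof
        assume eq: "digits G h k (n # ns) = digits G h k ms"
        show False
        proof (cases "n = m")
          case True
          then have "digits G h (Suc k) ns = digits G h (Suc k) ms'" using eq ms hc dc by simp
          then show False using Cons.IH[of ms' "Suc k"] Cons.prems ms True by simp
        next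
          case False
          then consider "m < n" | "n < m" by linarith
          then show False
          proof cases
            case 1 then show False using lt[of m n ns ms'] eq ms Cons.prems by simp
          next
            case 2 then show False using lt[of n m ms' ns] eq ms Cons.prems by simp
          qed
        qed
      qed
    qed
    \<comment> \<open>The word lengths sum to a geometric series of ratio 4. The summand with
      \<open>4 ^ k\<close> on the left lets the induction telescope without subtraction of
      naturals.\<close>
    have db: "set ns \<subseteq> {..<N} \<Longrightarrow> \<exists>n. digits G h k ns \<in> wball G S n \<and> n + N * l * 4 ^ k \<le> N * l * 4 ^ (k + length ns)" for ns k
    proof (induction ns arbitrary: k)
      case Nil then show ?case by (intro exI[of _ 0]) auto
    next
      case (Cons a ns)
      then obtain n where n: "digits G h (Suc k) ns \<in> wball G S n" "n + N * l * 4 ^ Suc k \<le> N * l * 4 ^ (Suc k + length ns)"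
        by (metis insert_subset list.simps(15))
      have pw: "h k [^] a \<in> wball G S (a * (l * 4 ^ k))" for a :: nat
      proof (induction a)
        case (Suc a) then show ?case using wadd[OF Suc hb[of k]] by (simp add: add.commute)
      qed simp
      have "digits G h k (a # ns) \<in> wball G S (a * (l * 4 ^ k) + n)" using wadd[OF pw n(1)] by simp
      moreover have "a * (l * 4 ^ k) + n + N * l * 4 ^ k \<le> N * l * 4 ^ (k + length (a # ns))"
      proof -
        have "a \<le> N" using Cons by simp
        then have "a * (l * 4 ^ k) \<le> N * (l * 4 ^ k)" by (rule mult_right_mono) simp
        moreover have "N * (l * 4 ^ k) = N * l * 4 ^ k" by simp
        moreover have "n + 4 * (N * l * 4 ^ k) \<le> N * l * 4 ^ (k + length (a # ns))" using n(2) by (simp add: algebra_simps)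
        ultimately show ?thesis by linarith
      qed
      ultimately show ?case by blast
    qed
    have count: "real N ^ m \<le> C * real (N * l * 4 ^ m) ^ d" for m
    proof -
      let ?D = "{ns. set ns \<subseteq> {..<N} \<and> length ns = m}"
      have "inj_on (digits G h 0) ?D"
      proof (rule inj_onI, rule ccontr)
        fix u v assume "u \<in> ?D" "v \<in> ?D" "digits G h 0 u = digits G h 0 v" "u \<noteq> v"
        then show False using strict[of u v 0] by simp
      qed
      then have "card (digits G h 0 ` ?D) = N ^ m" using card_lists_length_eq[of "{..<N}" m] by (simp add: card_image)
      moreover have "digits G h 0 ` ?D \<subseteq> wball G S (N * l * 4 ^ m)"
      proof
        fix y assume "y \<in> digits G h 0 ` ?D"
        then obtain ns where ns: "set ns \<subseteq> {..<N}" "length ns = m" "y = digits G h 0 ns" by auto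
        then obtain n where "y \<in> wball G S n" "n \<le> N * l * 4 ^ m" using db[of ns 0] by auto
        then show "y \<in> wball G S (N * l * 4 ^ m)" using wball_mono[OF s] by blast
      qed
      moreover have "finite (wball G S (N * l * 4 ^ m))" using s by (intro finite_wball) (simp add: symgen_def)
      ultimately have "N ^ m \<le> card (wball G S (N * l * 4 ^ m))"
        using card_mono[of "wball G S (N * l * 4 ^ m)" "digits G h 0 ` ?D"] by simp
      then have "real (N ^ m) \<le> real (card (wball G S (N * l * 4 ^ m)))" by (simp only: of_nat_le_iff)
      also have "\<dots> \<le> C * real (N * l * 4 ^ m) ^ d" using N l by (intro poly) simp
      finally show ?thesis by simp
    qed
    \<comment> \<open>\<open>N^m\<close> equals \<open>4^(d m)\<close> times \<open>4^m\<close>. The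
      first factor is used up by the growth bound of degree \<open>d\<close>, and what remains
      bounds \<open>4^m\<close> independently of \<open>m\<close>.\<close>
    have c4: "4 ^ m \<le> C * real (N * l) ^ d" for m
    proof -
      have r: "real N = 4 ^ (d + 1)" by (simp add: N_def)
      have ex: "m * d + m = (d + 1) * m" by simp
      have "(4 ^ m) ^ d * 4 ^ m = real N ^ m"
        unfolding r power_mult[symmetric] power_add[symmetric] ex ..
      also have "\<dots> \<le> (4 ^ m) ^ d * (C * real (N * l) ^ d)"
        using count[of m] unfolding of_nat_mult of_nat_power of_nat_numeral power_mult_distrib by (simp only: mult_ac)
      finally show ?thesis by (rule mult_left_le_imp_le) simp
    qed
    obtain m where "C * real (N * l) ^ d < 4 ^ m" using real_arch_pow[of 4 "C * real (N * l) ^ d"] by auto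
    then show False using c4[of m] by simp
  qed
  then have "commutes x y" if "x \<in> H" "y \<in> H" for x y using that by (auto simp: good_def)
  then show ?thesis using Hs fi commutes_iff Hc by blast
qed

end

section \<open>A finite-index subgroup mapping onto the integers\<close>

context harmonic_limit
begin

definition D where "D g \<psi> = (\<lambda>x. T g \<psi> x - \<psi> x)"

lemma D_W: "\<psi> \<in> W \<Longrightarrow> g \<in> carrier G \<Longrightarrow> D g \<psi> \<in> W"
  unfolding D_def by (rule W_diff[OF W_T]) auto

lemma T_diff: "g \<in> carrier G \<Longrightarrow> T g (\<lambda>x. \<psi> x - \<theta> x) = (\<lambda>x. T g \<psi> x - T g \<theta> x)"
  using T_lin[of g 1 \<psi> "-1" \<theta>] by simp

lemma nrm_zero [simp]: "nrm (\<lambda>x. 0) = 0"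
  using nrm_scale[OF W_zero, of 0] by simp

lemma nrm_minus: assumes "\<psi> \<in> W" "\<theta> \<in> W" shows "nrm (\<lambda>x. \<psi> x - \<theta> x) = nrm (\<lambda>x. \<theta> x - \<psi> x)"
  using nrm_scale[OF W_diff[OF assms], of "-1"] by simp

text \<open>\<open>del g\<close> is the operator norm of \<open>T g - 1\<close> on \<open>W\<close>.\<close>

definition op_le where "op_le g c \<longleftrightarrow> c \<ge> 0 \<and> (\<forall>\<psi>\<in>W. nrm (D g \<psi>) \<le> c * nrm \<psi>)"

definition del where "del g = Inf {c. op_le g c}"

lemma op_le_2: assumes "g \<in> carrier G" shows "op_le g 2"
  unfolding op_le_def
proof (intro conjI ballI)
  fix \<psi> assume \<psi>: "\<psi> \<in> W"
  show "nrm (D g \<psi>) \<le> 2 * nrm \<psi>"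
    unfolding D_def using nrm_diff[OF W_T[OF \<psi> assms] \<psi>] nrm_T[OF \<psi> assms] by simp
qed simp

lemma op_bdd: "bdd_below {c. op_le g c}" by (rule bdd_belowI[of _ 0]) (auto simp: op_le_def)

lemma del_le: "op_le g c \<Longrightarrow> del g \<le> c"
  unfolding del_def by (rule cInf_lower[OF _ op_bdd]) simp

lemma del_nonneg: assumes "g \<in> carrier G" shows "del g \<ge> 0"
  unfolding del_def
proof (rule cInf_greatest)
  show "{c. op_le g c} \<noteq> {}" using op_le_2[OF assms] by blast
qed (simp add: op_le_def)

lemma del_op: assumes "g \<in> carrier G" "\<psi> \<in> W" shows "nrm (D g \<psi>) \<le> del g * nrm \<psi>"
proof (cases "nrm \<psi> = 0")
  case True
  have "nrm (D g \<psi>) \<le> 2 * nrm \<psi>" using op_le_2[OF assms(1)] assms(2) by (simp add: op_le_def)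
  then show ?thesis using True by simp
next
  case False
  then have p: "nrm \<psi> > 0" using nrm_nonneg[OF assms(2)] by simp
  have "nrm (D g \<psi>) / nrm \<psi> \<le> del g" unfolding del_def
  proof (rule cInf_greatest)
    show "{c. op_le g c} \<noteq> {}" using op_le_2[OF assms(1)] by auto
    fix c assume "c \<in> {c. op_le g c}"
    then show "nrm (D g \<psi>) / nrm \<psi> \<le> c" using assms(2) p by (simp add: op_le_def pos_divide_le_eq)
  qed
  then show ?thesis using p by (simp add: pos_divide_le_eq)
qed

lemma del_leI: "c \<ge> 0 \<Longrightarrow> (\<And>\<psi>. \<psi> \<in> W \<Longrightarrow> nrm (D g \<psi>) \<le> c * nrm \<psi>) \<Longrightarrow> del g \<le> c"
  by (rule del_le) (simp add: op_le_def)

lemma del_one: "del \<one> = 0"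
proof -
  have "del \<one> \<le> 0" by (rule del_leI) (auto simp: D_def W_T_one)
  then show ?thesis using del_nonneg[of \<one>] by simp
qed

lemma del_mult: assumes "x \<in> carrier G" "y \<in> carrier G" shows "del (x \<otimes> y) \<le> del x + del y"
proof (rule del_leI)
  show "0 \<le> del x + del y" using del_nonneg assms by simp
  fix \<psi> assume \<psi>: "\<psi> \<in> W"
  have "D (x \<otimes> y) \<psi> = (\<lambda>z. D y (T x \<psi>) z + D x \<psi> z)"
    using T_mult[of y x \<psi>] assms by (simp add: D_def)
  then have "nrm (D (x \<otimes> y) \<psi>) \<le> nrm (D y (T x \<psi>)) + nrm (D x \<psi>)"
    using nrm_triangle[OF D_W[OF W_T[OF \<psi>]] D_W[OF \<psi>]] assms by simp
  also have "\<dots> \<le> del y * nrm \<psi> + del x * nrm \<psi>"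
    using del_op[OF assms(2) W_T[OF \<psi> assms(1)]] del_op[OF assms(1) \<psi>] nrm_T[OF \<psi> assms(1)] by simp
  finally show "nrm (D (x \<otimes> y) \<psi>) \<le> (del x + del y) * nrm \<psi>" by (simp add: algebra_simps)
qed

lemma T_inv: assumes "\<psi> \<in> W" "x \<in> carrier G" shows "T x (T (inv x) \<psi>) = \<psi>" "T (inv x) (T x \<psi>) = \<psi>"
  using T_mult[of x "inv x" \<psi>] T_mult[of "inv x" x \<psi>] assms W_T_one[OF assms(1)] by simp_all

lemma del_inv_le: assumes "x \<in> carrier G" shows "del (inv x) \<le> del x"
proof (rule del_leI)
  show "0 \<le> del x" using del_nonneg assms by simp
  fix \<psi> assume \<psi>: "\<psi> \<in> W"
  let ?\<theta> = "T (inv x) \<psi>"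
  have \<theta>: "?\<theta> \<in> W" using W_T \<psi> assms by simp
  have "nrm (D (inv x) \<psi>) = nrm (D x ?\<theta>)"
    unfolding D_def T_inv(1)[OF \<psi> assms] by (rule nrm_minus[OF \<theta> \<psi>])
  also have "\<dots> \<le> del x * nrm \<psi>" using del_op[OF assms \<theta>] nrm_T[OF \<psi>] assms by simp
  finally show "nrm (D (inv x) \<psi>) \<le> del x * nrm \<psi>" .
qed

lemma del_inv: assumes "x \<in> carrier G" shows "del (inv x) = del x"
  using del_inv_le[OF assms] del_inv_le[of "inv x"] assms by simp

lemma del_conj_le: assumes "x \<in> carrier G" "y \<in> carrier G" shows "del (y \<otimes> x \<otimes> inv y) \<le> del x"
proof (rule del_leI)
  show "0 \<le> del x" using del_nonneg assms by simp
  fix \<psi> assume \<psi>: "\<psi> \<in> W"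
  have \<theta>: "T y \<psi> \<in> W" using W_T \<psi> assms by simp
  have "T (y \<otimes> x \<otimes> inv y) \<psi> = T (inv y) (T x (T y \<psi>))" using T_mult assms by simp
  then have "D (y \<otimes> x \<otimes> inv y) \<psi> = T (inv y) (D x (T y \<psi>))"
    using T_diff[of "inv y" "T x (T y \<psi>)" "T y \<psi>"] T_inv(2)[OF \<psi> assms(2)] assms by (simp add: D_def)
  then have "nrm (D (y \<otimes> x \<otimes> inv y) \<psi>) = nrm (D x (T y \<psi>))" using nrm_T[OF D_W[OF \<theta> assms(1)], of "inv y"] assms by simp
  also have "\<dots> \<le> del x * nrm \<psi>" using del_op[OF assms(1) \<theta>] nrm_T[OF \<psi> assms(2)] by simp
  finally show "nrm (D (y \<otimes> x \<otimes> inv y) \<psi>) \<le> del x * nrm \<psi>" .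
qed

lemma del_conj: assumes "x \<in> carrier G" "y \<in> carrier G" shows "del (y \<otimes> x \<otimes> inv y) = del x"
proof -
  have "inv y \<otimes> (y \<otimes> x \<otimes> inv y) \<otimes> inv (inv y) = x" using assms by (simp add: m_assoc)
  then have "del x \<le> del (y \<otimes> x \<otimes> inv y)" using del_conj_le[of "y \<otimes> x \<otimes> inv y" "inv y"] assms by simp
  then show ?thesis using del_conj_le[OF assms] by simp
qed

text \<open>Up to isometries, \<open>T\<close> of the commutator minus the identity is
  \<open>T y T x - T x T y\<close>. This is also the commutator of \<open>D y\<close> and
  \<open>D x\<close>, since the identity operator commutes with everything, and both of its products
  are small of second order.\<close>

lemma del_com: assumes "x \<in> carrier G" "y \<in> carrier G" shows "del (x \<otimes> y \<otimes> inv x \<otimes> inv y) \<le> 2 * del x * del y"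
proof (rule del_leI)
  show "0 \<le> 2 * del x * del y" using del_nonneg assms by simp
  fix \<psi> assume \<psi>: "\<psi> \<in> W"
  have Tx: "T x \<psi> \<in> W" and Ty: "T y \<psi> \<in> W" using W_T \<psi> assms by auto
  let ?R = "\<lambda>z. T y (T x \<psi>) z - T x (T y \<psi>) z"
  have RW: "?R \<in> W" using W_diff W_T Tx Ty assms by auto
  have e1: "T (x \<otimes> y \<otimes> inv x \<otimes> inv y) \<psi> = T (inv y) (T (inv x) (T y (T x \<psi>)))" using T_mult assms by simp
  have e2: "\<psi> = T (inv y) (T (inv x) (T x (T y \<psi>)))" using T_inv(2)[OF Ty assms(1)] T_inv(2)[OF \<psi> assms(2)] by simp
  have "D (x \<otimes> y \<otimes> inv x \<otimes> inv y) \<psi> = T (inv y) (T (inv x) ?R)"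
    unfolding D_def using e1 e2 T_diff[of "inv x" "T y (T x \<psi>)" "T x (T y \<psi>)"] assms
      T_diff[of "inv y" "T (inv x) (T y (T x \<psi>))" "T (inv x) (T x (T y \<psi>))"] by simp
  then have "nrm (D (x \<otimes> y \<otimes> inv x \<otimes> inv y) \<psi>) = nrm ?R"
    using nrm_T[OF W_T[OF RW], of "inv x" "inv y"] nrm_T[OF RW, of "inv x"] assms by simp
  also have "?R = (\<lambda>z. D y (D x \<psi>) z - D x (D y \<psi>) z)"
    unfolding D_def using T_diff[OF assms(2), of "T x \<psi>" \<psi>] T_diff[OF assms(1), of "T y \<psi>" \<psi>] by (simp add: algebra_simps)
  also have "nrm \<dots> \<le> nrm (D y (D x \<psi>)) + nrm (D x (D y \<psi>))"
    by (rule nrm_diff) (use D_W \<psi> assms in auto)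
  also have "\<dots> \<le> del y * (del x * nrm \<psi>) + del x * (del y * nrm \<psi>)"
  proof (rule add_mono)
    show "nrm (D y (D x \<psi>)) \<le> del y * (del x * nrm \<psi>)"
      by (rule order_trans[OF del_op[OF assms(2) D_W[OF \<psi> assms(1)]]], rule mult_left_mono[OF del_op[OF assms(1) \<psi>] del_nonneg[OF assms(2)]])
    show "nrm (D x (D y \<psi>)) \<le> del x * (del y * nrm \<psi>)"
      by (rule order_trans[OF del_op[OF assms(1) D_W[OF \<psi> assms(2)]]], rule mult_left_mono[OF del_op[OF assms(2) \<psi>] del_nonneg[OF assms(1)]])
  qed
  finally show "nrm (D (x \<otimes> y \<otimes> inv x \<otimes> inv y) \<psi>) \<le> 2 * del x * del y * nrm \<psi>" by (simp add: algebra_simps)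
qed

lemma del_pow_le: "x \<in> carrier G \<Longrightarrow> del (x [^] n) \<le> real n * del x"
proof (induction n)
  case 0 then show ?case by (simp add: del_one)
next
  case (Suc n)
  then show ?case using del_mult[of "x [^] n" x] by (simp add: algebra_simps)
qed

text \<open>The linear term of \<open>T^n - 1\<close> near \<open>T = 1\<close> is
  \<open>n (T - 1)\<close>. The errors accumulate with weights \<open>0 + 1 + ... + (n - 1)\<close>,
  a sum of at most \<open>n^2 / 2\<close>.\<close>

lemma D_pow:
  assumes "x \<in> carrier G" "\<psi> \<in> W"
  shows "nrm (\<lambda>z. D (x [^] n) \<psi> z - real n * D x \<psi> z) \<le> (real n)\<^sup>2 / 2 * del x * nrm (D x \<psi>)"
proof (induction n)
  case 0 then show ?case using W_T_one[OF assms(2)] by (simp add: D_def)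
next
  case (Suc n)
  let ?A = "nrm (D x \<psi>)"
  have xn: "x [^] n \<in> carrier G" using assms by simp
  have W1: "D x \<psi> \<in> W" "D (x [^] n) (D x \<psi>) \<in> W" "D (x [^] n) \<psi> \<in> W" using D_W assms xn by auto
  have "T (x [^] Suc n) \<psi> = T (x [^] n) (T x \<psi>)" using T_mult[OF xn assms(1), of \<psi>] nat_pow_Suc2[OF assms(1), of n] by simp
  then have "D (x [^] Suc n) \<psi> = (\<lambda>z. D (x [^] n) (D x \<psi>) z + D x \<psi> z + D (x [^] n) \<psi> z)"
    unfolding D_def using T_diff[OF xn, of "T x \<psi>" \<psi>] by (simp add: algebra_simps)
  then have "(\<lambda>z. D (x [^] Suc n) \<psi> z - real (Suc n) * D x \<psi> z) = (\<lambda>z. (D (x [^] n) \<psi> z - real n * D x \<psi> z) + D (x [^] n) (D x \<psi>) z)"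
    by (simp add: algebra_simps)
  then have "nrm (\<lambda>z. D (x [^] Suc n) \<psi> z - real (Suc n) * D x \<psi> z) \<le> nrm (\<lambda>z. D (x [^] n) \<psi> z - real n * D x \<psi> z) + nrm (D (x [^] n) (D x \<psi>))"
    using nrm_triangle[OF W_diff[OF W1(3) W_scale[OF W1(1), of "real n"]] W1(2)] by simp
  also have "\<dots> \<le> (real n)\<^sup>2 / 2 * del x * ?A + real n * del x * ?A"
  proof (rule add_mono[OF Suc])
    have "nrm (D (x [^] n) (D x \<psi>)) \<le> del (x [^] n) * ?A" by (rule del_op[OF xn W1(1)])
    also have "\<dots> \<le> real n * del x * ?A" using del_pow_le[OF assms(1)] nrm_nonneg[OF W1(1)] by (rule mult_right_mono)
    finally show "nrm (D (x [^] n) (D x \<psi>)) \<le> real n * del x * ?A" .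
  qed
  also have "\<dots> \<le> (real (Suc n))\<^sup>2 / 2 * (del x * ?A)"
  proof -
    have "((real n)\<^sup>2 / 2 + real n) * (del x * ?A) \<le> (real (Suc n))\<^sup>2 / 2 * (del x * ?A)"
      using del_nonneg[OF assms(1)] nrm_nonneg[OF W1(1)] by (intro mult_right_mono) (auto simp: power2_eq_square algebra_simps)
    then show ?thesis by (simp add: algebra_simps)
  qed
  finally show ?case by (simp add: mult_ac)
qed

text \<open>In the range where \<open>n\<close> times \<open>del x\<close> is at most 1, the error
  in \<open>D_pow\<close> is at most half of the linear term, and the other half remains as a lower
  bound.\<close>

lemma del_pow: assumes "x \<in> carrier G" "real n * del x \<le> 1" shows "real n * del x \<le> 2 * del (x [^] n)"
proof (cases "n = 0")
  case True then show ?thesis using del_nonneg[of "x [^] n"] assms by simp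
next
  case False
  have xn: "x [^] n \<in> carrier G" using assms by simp
  have "del x \<le> 2 * del (x [^] n) / real n"
  proof (rule del_leI)
    show "0 \<le> 2 * del (x [^] n) / real n" using del_nonneg[OF xn] by simp
    fix \<psi> assume \<psi>: "\<psi> \<in> W"
    let ?A = "nrm (D x \<psi>)"
    have W1: "D x \<psi> \<in> W" "D (x [^] n) \<psi> \<in> W" using D_W assms xn \<psi> by auto
    have W2: "(\<lambda>z. real n * D x \<psi> z) \<in> W" by (rule W_scale[OF W1(1)])
    have A0: "?A \<ge> 0" by (rule nrm_nonneg[OF W1(1)])
    have "real n * ?A = nrm (\<lambda>z. real n * D x \<psi> z)" using nrm_scale[OF W1(1)] by simp
    also have "\<dots> = nrm (\<lambda>z. D (x [^] n) \<psi> z - (D (x [^] n) \<psi> z - real n * D x \<psi> z))" by simp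
    also have "\<dots> \<le> nrm (D (x [^] n) \<psi>) + nrm (\<lambda>z. D (x [^] n) \<psi> z - real n * D x \<psi> z)"
      by (rule nrm_diff[OF W1(2) W_diff[OF W1(2) W2]])
    also have "\<dots> \<le> del (x [^] n) * nrm \<psi> + (real n)\<^sup>2 / 2 * del x * ?A"
      using D_pow[OF assms(1) \<psi>] del_op[OF xn \<psi>] by (rule add_mono[rotated])
    also have "(real n)\<^sup>2 / 2 * del x * ?A = (real n * del x) * (real n / 2 * ?A)" by (simp add: power2_eq_square)
    also have "\<dots> \<le> 1 * (real n / 2 * ?A)" using assms(2) A0 by (intro mult_right_mono) auto
    finally have "real n * ?A \<le> 2 * del (x [^] n) * nrm \<psi>" by simp
    then show "?A \<le> 2 * del (x [^] n) / real n * nrm \<psi>" using False by (simp add: field_simps)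
  qed
  then show ?thesis using False by (simp add: field_simps)
qed

lemma T_sum: "g \<in> carrier G \<Longrightarrow> T g (\<lambda>x. \<Sum>i\<in>I. c i * f i x) = (\<lambda>x. \<Sum>i\<in>I. c i * T g (f i) x)"
  by (auto simp: T_def fun_eq_iff sum_subtractf[symmetric] right_diff_distrib intro!: sum.neutral)

text \<open>In an orthonormal basis the matrix entries of \<open>T g\<close> lie between -1 and 1.
  Rounding them to multiples of \<open>\<eta>\<close> leaves finitely many codes, and equal codes
  mean operators at distance at most \<open>m^2 \<eta>\<close>.\<close>

lemma del_totally_bounded:
  assumes "\<epsilon> > 0"
  shows "\<exists>F. finite F \<and> F \<subseteq> carrier G \<and> (\<forall>g\<in>carrier G. \<exists>f\<in>F. del (g \<otimes> inv f) \<le> \<epsilon>)"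
proof -
  obtain m :: nat and f where f: "orthonormal {..<m} f" "\<forall>\<psi>\<in>W. \<psi> = (\<lambda>x. \<Sum>i<m. M \<psi> (f i) * f i x)"
    using finite_basis by blast
  have fW: "f i \<in> W" and fn: "M (f i) (f i) = 1" if "i < m" for i using f(1) that by (auto simp: orthonormal_def)
  have nf: "nrm (f i) = 1" if "i < m" for i using fn[OF that] by (simp add: nrm_def)
  have Mb: "\<bar>M \<psi> (f i)\<bar> \<le> nrm \<psi>" if "\<psi> \<in> W" "i < m" for \<psi> i
    using M_CS[OF that(1) fW[OF that(2)]] fn[OF that(2)] unfolding nrm_def by (intro real_le_rsqrt) simp
  \<comment> \<open>The summand 1 in the denominator covers an empty basis.\<close>
  define \<eta> where "\<eta> = \<epsilon> / (real m * real m + 1)"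
  have m1: "real m * real m + 1 > 0" by (simp add: add_nonneg_pos)
  have \<eta>: "\<eta> > 0" "real m * real m * \<eta> \<le> \<epsilon>" using assms m1 by (auto simp: \<eta>_def field_simps)
  define a where "a g i j = M (T g (f i)) (f j)" for g i j
  have ab: "\<bar>a g i j\<bar> \<le> 1" if "g \<in> carrier G" "i < m" "j < m" for g i j
    using Mb[OF W_T[OF fW[OF that(2)] that(1)] that(3)] nrm_T[OF fW[OF that(2)] that(1)] nf[OF that(2)] by (simp add: a_def)
  define code where "code g = (\<lambda>(i,j)\<in>{..<m} \<times> {..<m}. \<lfloor>a g i j / \<eta>\<rfloor>)" for g
  have "finite (code ` carrier G)"
  proof (rule finite_subset)
    show "code ` carrier G \<subseteq> ({..<m} \<times> {..<m}) \<rightarrow>\<^sub>E {\<lfloor>- 1 / \<eta>\<rfloor>..\<lfloor>1 / \<eta>\<rfloor>}"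
    proof
      fix u assume "u \<in> code ` carrier G"
      then obtain g where g: "g \<in> carrier G" "u = code g" by auto
      have "\<lfloor>a g i j / \<eta>\<rfloor> \<in> {\<lfloor>- 1 / \<eta>\<rfloor>..\<lfloor>1 / \<eta>\<rfloor>}" if "i < m" "j < m" for i j
      proof -
        have "- 1 / \<eta> \<le> a g i j / \<eta>" "a g i j / \<eta> \<le> 1 / \<eta>"
          using ab[OF g(1) that] \<eta>(1) by (intro divide_right_mono; simp)+
        then show ?thesis by (auto intro!: floor_mono)
      qed
      then show "u \<in> ({..<m} \<times> {..<m}) \<rightarrow>\<^sub>E {\<lfloor>- 1 / \<eta>\<rfloor>..\<lfloor>1 / \<eta>\<rfloor>}" unfolding g(2) code_def by auto
    qed
    show "finite (({..<m} \<times> {..<m}) \<rightarrow>\<^sub>E {\<lfloor>- 1 / \<eta>\<rfloor>..\<lfloor>1 / \<eta>\<rfloor>})" by (intro finite_PiE) auto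
  qed
  then obtain F where F: "F \<subseteq> carrier G" "finite F" "code ` carrier G = code ` F"
    by (meson finite_subset_image order_refl)
  have "\<exists>h\<in>F. del (g \<otimes> inv h) \<le> \<epsilon>" if g: "g \<in> carrier G" for g
  proof -
    have "code g \<in> code ` F" using g F(3) by blast
    then obtain h where h: "h \<in> F" "code g = code h" by auto
    have hc: "h \<in> carrier G" using h F by auto
    have close: "\<bar>a g i j - a h i j\<bar> \<le> \<eta>" if "i < m" "j < m" for i j
    proof -
      have "\<lfloor>a g i j / \<eta>\<rfloor> = \<lfloor>a h i j / \<eta>\<rfloor>" using fun_cong[OF h(2), of "(i,j)"] that by (simp add: code_def)
      then have "\<bar>a g i j / \<eta> - a h i j / \<eta>\<bar> \<le> 1" by linarith
      then have "\<bar>(a g i j - a h i j) / \<eta>\<bar> \<le> 1" by (simp add: diff_divide_distrib)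
      then show ?thesis using \<eta>(1) by (simp add: abs_divide)
    qed
    have "del (g \<otimes> inv h) \<le> \<epsilon>"
    proof (rule del_leI)
      show "0 \<le> \<epsilon>" using assms by simp
      fix \<psi> assume \<psi>: "\<psi> \<in> W"
      have rep: "\<psi> = (\<lambda>x. \<Sum>i<m. M \<psi> (f i) * f i x)" using f(2) \<psi> by blast
      define E where "E i = (\<lambda>x. T g (f i) x - T h (f i) x)" for i
      have EW: "E i \<in> W" if "i < m" for i unfolding E_def using W_diff W_T fW that g hc by auto
      have En: "nrm (E i) \<le> real m * \<eta>" if i: "i < m" for i
      proof -
        have "E i = (\<lambda>x. \<Sum>j<m. M (E i) (f j) * f j x)" using f(2) EW[OF i] by blast
        then have "nrm (E i) = nrm (\<lambda>x. \<Sum>j<m. M (E i) (f j) * f j x)" by (rule arg_cong)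
        also have "\<dots> \<le> (\<Sum>j<m. \<bar>M (E i) (f j)\<bar> * nrm (f j))" by (rule nrm_sum) (use fW in auto)
        also have "\<dots> \<le> (\<Sum>j<m. \<eta>)"
        proof (rule sum_mono)
          fix j assume j: "j \<in> {..<m}"
          have "M (E i) (f j) = a g i j - a h i j"
            unfolding E_def a_def by (rule M_diff) (use W_T fW i j g hc in auto)
          then show "\<bar>M (E i) (f j)\<bar> * nrm (f j) \<le> \<eta>" using close i j nf by simp
        qed
        finally show ?thesis by simp
      qed
      have "T g \<psi> = (\<lambda>x. \<Sum>i<m. M \<psi> (f i) * T g (f i) x)" "T h \<psi> = (\<lambda>x. \<Sum>i<m. M \<psi> (f i) * T h (f i) x)"
        by (subst rep, rule T_sum, rule g) (subst rep, rule T_sum, rule hc)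
      then have e: "(\<lambda>x. T g \<psi> x - T h \<psi> x) = (\<lambda>x. \<Sum>i<m. M \<psi> (f i) * E i x)"
        by (simp add: E_def sum_subtractf right_diff_distrib)
      have "D (g \<otimes> inv h) \<psi> = T (inv h) (\<lambda>x. T g \<psi> x - T h \<psi> x)"
        unfolding D_def using T_mult[of "inv h" g \<psi>] T_inv(2)[OF \<psi> hc] T_diff[of "inv h" "T g \<psi>" "T h \<psi>"] g hc by simp
      then have "nrm (D (g \<otimes> inv h) \<psi>) = nrm (\<lambda>x. T g \<psi> x - T h \<psi> x)"
        using nrm_T[OF W_diff[OF W_T[OF \<psi> g] W_T[OF \<psi> hc]], of "inv h"] hc by simp
      also have "\<dots> \<le> (\<Sum>i<m. \<bar>M \<psi> (f i)\<bar> * nrm (E i))" unfolding e by (rule nrm_sum) (use EW in auto)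
      also have "\<dots> \<le> (\<Sum>i<m. nrm \<psi> * (real m * \<eta>))"
        using Mb[OF \<psi>] En nrm_nonneg[OF EW] nrm_nonneg[OF \<psi>] by (intro sum_mono mult_mono) auto
      also have "\<dots> = (real m * real m * \<eta>) * nrm \<psi>" by simp
      also have "\<dots> \<le> \<epsilon> * nrm \<psi>" using \<eta>(2) nrm_nonneg[OF \<psi>] by (rule mult_right_mono)
      finally show "nrm (D (g \<otimes> inv h) \<psi>) \<le> \<epsilon> * nrm \<psi>" .
    qed
    then show ?thesis using h by blast
  qed
  then show ?thesis using F by blast
qed

lemma del_zero: assumes "x \<in> carrier G" "del x = 0" "\<psi> \<in> W" shows "T x \<psi> = \<psi>"
proof -
  have DW: "D x \<psi> \<in> W" using D_W assms by auto
  have "nrm (D x \<psi>) \<le> 0" using del_op[OF assms(1,3)] assms(2) by simp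
  then have "M (D x \<psi>) (D x \<psi>) = 0" using M_nonneg[OF DW] by (simp add: nrm_def)
  then have "D x \<psi> = (\<lambda>x. 0)" by (rule M_definite[OF DW])
  then show ?thesis by (auto simp: D_def fun_eq_iff)
qed

text \<open>A bounded function has bounded second moments, which the division by the time sends to
  0; definiteness of \<open>M\<close> does the rest.\<close>

lemma finite_values_zero: assumes "\<psi> \<in> W" "finite (\<psi> ` carrier G)" shows "\<psi> = (\<lambda>x. 0)"
proof -
  have "bdd_above ((\<lambda>x. (\<psi> x)\<^sup>2) ` carrier G)"
  proof -
    have "(\<lambda>x. (\<psi> x)\<^sup>2) ` carrier G = (\<lambda>y. y\<^sup>2) ` \<psi> ` carrier G" by auto
    then show ?thesis using assms(2) by (metis bdd_above_finite finite_imageI)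
  qed
  then obtain c where c: "\<And>x. x \<in> carrier G \<Longrightarrow> (\<psi> x)\<^sup>2 \<le> c" by (auto simp: bdd_above_def)
  have "(\<lambda>j. avg (nn j) (\<lambda>x. (\<psi> x)\<^sup>2) \<one> / real (nn j)) \<longlonglongrightarrow> 0"
  proof (rule Lim_null_comparison[OF _ inv_nn[of c]], intro always_eventually allI)
    fix j
    have "avg (nn j) (\<lambda>x. (\<psi> x)\<^sup>2) \<one> \<le> avg (nn j) (\<lambda>x. c) \<one>" by (rule avg_mono) (use c in auto)
    moreover have "avg (nn j) (\<lambda>x. (\<psi> x)\<^sup>2) \<one> \<ge> 0" by (rule avg_nonneg) auto
    ultimately show "norm (avg (nn j) (\<lambda>x. (\<psi> x)\<^sup>2) \<one> / real (nn j)) \<le> c / real (nn j)"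
      using nn_pos[of j] by (simp add: divide_right_mono)
  qed
  then have "M \<psi> \<psi> = 0" using M_square_lim[OF assms(1)] LIMSEQ_unique by blast
  then show ?thesis by (rule M_definite[OF assms(1)])
qed

text \<open>If the elements of \<open>H\<close> acting trivially have finite index, then \<open>\<phi>0\<close> is additive on them; it cannot
  have finite image, since a harmonic function with finitely many values vanishes.\<close>

lemma finite_index_zhom:
  "\<exists>H \<psi>. subgroup H G \<and> findex G H (carrier G) \<and> zhom G H \<psi>"
proof -
  have lg: "length_group G del"
    by unfold_locales (use del_nonneg del_one del_mult del_inv del_conj del_com del_pow in auto)
  obtain H where H: "subgroup H G" "findex G H (carrier G)" "\<And>x y. x \<in> H \<Longrightarrow> y \<in> H \<Longrightarrow> del (x \<otimes> y \<otimes> inv x \<otimes> inv y) = 0"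
    using length_group.almost_abelian[OF lg sgenS poly del_totally_bounded] by blast
  have Hc: "x \<in> carrier G" if "x \<in> H" for x using subgroup.mem_carrier[OF H(1) that] .
  obtain R where R: "sgen G R H" using schreier[OF sgenS H(1) _ H(2)] Hc by blast
  define N where "N = {x\<in>H. del x = 0}"
  have Ns: "subgroup N G"
  proof (rule subgroupI)
    show "N \<subseteq> carrier G" using Hc by (auto simp: N_def)
    show "N \<noteq> {}" using subgroup.one_closed[OF H(1)] del_one by (auto simp: N_def)
    show "inv x \<in> N" if "x \<in> N" for x using that del_inv Hc subgroup.m_inv_closed[OF H(1)] by (auto simp: N_def)
    show "x \<otimes> y \<in> N" if "x \<in> N" "y \<in> N" for x y
    proof -
      have xy: "x \<in> carrier G" "y \<in> carrier G" "x \<in> H" "y \<in> H" "del x = 0" "del y = 0" using that Hc by (auto simp: N_def)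
      have "del (x \<otimes> y) = 0" using del_mult[OF xy(1,2)] del_nonneg[of "x \<otimes> y"] xy by simp
      then show ?thesis using subgroup.m_closed[OF H(1) xy(3,4)] by (simp add: N_def)
    qed
  qed
  have pcN: "pc G N H"
  proof (rule pc_abelian_quotient[OF R Ns])
    show "N \<subseteq> H" by (auto simp: N_def)
    fix x y assume xy: "x \<in> H" "y \<in> H"
    have "x \<otimes> y \<otimes> inv x \<otimes> inv y \<in> H" using xy H(1) by (intro subgroup.m_closed subgroup.m_inv_closed) auto
    then show "x \<otimes> y \<otimes> inv x \<otimes> inv y \<in> N" using H(3)[OF xy] by (simp add: N_def)
  qed
  \<comment> \<open>Infinite index below a subgroup of finite index in \<open>G\<close> yields the
    map onto the integers at once. This is applied to the abelian quotient of \<open>H\<close> and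
    again to the additive image of \<open>N\<close>.\<close>
  have finish: ?thesis if L: "subgroup L G" "findex G L (carrier G)" "pc G L' L" "\<not> findex G L' L" for L L'
  proof -
    obtain K' \<psi> where K': "subgroup K' G" "K' \<subseteq> L" "findex G K' L" "zhom G K' \<psi>"
      using pc_infinite_zhom[OF L(3,4)] by blast
    have "findex G K' (carrier G)"
      using findex_trans[OF K'(3) L(2) K'(1) L(1) subgroup_self] subgroup.subset[OF L(1)] by blast
    then show ?thesis using K' by blast
  qed
  show ?thesis
  proof (cases "findex G N H")
    case False then show ?thesis using finish[OF H(1,2) pcN] by blast
  next
    case True
    have NG: "findex G N (carrier G)" using findex_trans[OF True H(2) Ns H(1) subgroup_self] Hc by blast
    have Nc: "x \<in> carrier G" if "x \<in> N" for x using subgroup.mem_carrier[OF Ns that] .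
    obtain R' where R': "sgen G R' N" using schreier[OF sgenS Ns _ NG] Nc by blast
    \<comment> \<open>This is \<open>\<phi>0\<close> with value 0 off the carrier, which makes it a
      member of \<open>W\<close>. For \<open>x\<close> acting trivially,
      \<open>T x \<psi> = \<psi>\<close> says that \<open>\<psi>\<close> is additive in
      \<open>x\<close>.\<close>
    define \<psi> where "\<psi> = T \<one> \<phi>0"
    have \<psi>: "\<psi> \<in> W" unfolding \<psi>_def by (rule W.base) simp
    have \<psi>x: "\<psi> x = \<phi>0 x" if "x \<in> carrier G" for x using that \<phi>0(1) by (simp add: \<psi>_def T_def lip_harmonic_def)
    have hom: "\<psi> (x \<otimes> y) = \<psi> x + \<psi> y" if "x \<in> N" "y \<in> carrier G" for x y
    proof -
      have "T x \<psi> = \<psi>" using del_zero[OF Nc[OF that(1)] _ \<psi>] that by (simp add: N_def)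
      then have "T x \<psi> y = \<psi> y" by simp
      then show ?thesis using that by (simp add: T_def)
    qed
    have h1: "\<psi> \<one> = 0" by (rule W_one[OF \<psi>])
    have hinv: "\<psi> (inv x) = - \<psi> x" if "x \<in> N" for x
      using hom[OF that, of "inv x"] h1 Nc[OF that] by simp
    define N0 where "N0 = {x\<in>N. \<psi> x = 0}"
    have N0s: "subgroup N0 G"
    proof (rule subgroupI)
      show "N0 \<subseteq> carrier G" using Nc by (auto simp: N0_def)
      show "N0 \<noteq> {}" using subgroup.one_closed[OF Ns] h1 by (auto simp: N0_def)
      show "inv x \<in> N0" if "x \<in> N0" for x using that hinv subgroup.m_inv_closed[OF Ns] by (auto simp: N0_def)
      show "x \<otimes> y \<in> N0" if "x \<in> N0" "y \<in> N0" for x y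
        using that hom[of x y] Nc[of y] subgroup.m_closed[OF Ns] by (auto simp: N0_def)
    qed
    have pc0: "pc G N0 N"
    proof (rule pc_abelian_quotient[OF R' N0s])
      show "N0 \<subseteq> N" by (auto simp: N0_def)
      fix x y assume xy: "x \<in> N" "y \<in> N"
      have c: "x \<otimes> y \<in> N" "inv x \<in> N" "inv y \<in> N" "x \<otimes> y \<otimes> inv x \<in> N" "x \<otimes> y \<otimes> inv x \<otimes> inv y \<in> N"
        using xy Ns by (auto intro!: subgroup.m_closed subgroup.m_inv_closed)
      have "\<psi> (x \<otimes> y \<otimes> inv x \<otimes> inv y) = 0"
        using hom[OF c(4) Nc[OF c(3)]] hom[OF c(1) Nc[OF c(2)]] hom[OF xy(1) Nc[OF xy(2)]] hinv xy by simp
      then show "x \<otimes> y \<otimes> inv x \<otimes> inv y \<in> N0" using c(5) by (simp add: N0_def)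
    qed
    show ?thesis
    proof (cases "findex G N0 N")
      case False then show ?thesis using finish[OF Ns NG pc0] by blast
    next
      case True
      have "findex G N0 (carrier G)" using findex_trans[OF True NG N0s Ns subgroup_self] Nc by blast
      then obtain F where F: "finite F" "F \<subseteq> carrier G" "\<forall>h\<in>carrier G. \<exists>f\<in>F. h \<otimes> inv f \<in> N0" by (auto simp: findex_def)
      \<comment> \<open>By additivity \<open>\<psi>\<close> is constant on each coset
        \<open>N0 f\<close>, so it takes its values at the finitely many representatives.\<close>
      have "\<psi> ` carrier G \<subseteq> \<psi> ` F"
      proof
        fix v assume "v \<in> \<psi> ` carrier G"
        then obtain h where h: "h \<in> carrier G" "v = \<psi> h" by auto
        then obtain f where f: "f \<in> F" "h \<otimes> inv f \<in> N0" using F(3) by blast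
        have fc: "f \<in> carrier G" using f F by auto
        have n: "h \<otimes> inv f \<in> N" "\<psi> (h \<otimes> inv f) = 0" using f(2) by (auto simp: N0_def)
        have "\<psi> ((h \<otimes> inv f) \<otimes> f) = \<psi> f" using hom[OF n(1) fc] n(2) by simp
        then have "\<psi> h = \<psi> f" using h fc by (simp add: m_assoc)
        then show "v \<in> \<psi> ` F" using h f by auto
      qed
      then have "finite (\<psi> ` carrier G)" using F(1) finite_subset by blast
      then have "\<psi> = (\<lambda>x. 0)" by (rule finite_values_zero[OF \<psi>])
      then have "\<phi>0 s = 0" if "s \<in> S" for s using \<psi>x[OF Sc[OF that]] by (simp add: fun_eq_iff)
      then show ?thesis using \<phi>0(2) by blast
    qed
  qed
qed

end

section \<open>Choice of the times and conclusion for polynomial growth\<close>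

context poly_walk
begin

lemma exists_finite_index_zhom: "\<exists>H \<psi>. subgroup H G \<and> findex G H (carrier G) \<and> zhom G H \<psi>"
proof -
  have "\<exists>\<phi> L. lip_harmonic L \<phi> \<and> (\<exists>s\<in>S. \<phi> s \<noteq> 0)"
  proof -
    obtain \<phi> L where h: "(\<forall>x\<in>carrier G. P \<phi> x = \<phi> x) \<and> \<phi> \<one> = 0 \<and> L > 0 \<and>
      (\<forall>x\<in>carrier G. \<forall>s\<in>S. \<bar>\<phi> (x \<otimes> s) - \<phi> x\<bar> \<le> L) \<and> (\<exists>s\<in>S. \<phi> s \<noteq> 0)"
      using exists_harmonic by (elim exE)
    then have "lip_harmonic L \<phi>" unfolding lip_harmonic_def by simp
    then show ?thesis using h by blast
  qed
  then obtain \<phi> L where \<phi>: "lip_harmonic L \<phi>" "\<exists>s\<in>S. \<phi> s \<noteq> 0" by blast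
  have L: "L \<ge> 0" using \<phi>(1) by (simp add: lip_harmonic_def)
  obtain K where K: "K > 0" "\<And>N. \<exists>n\<ge>N. n \<ge> 1 \<and> (\<forall>s\<in>S. hellinger n s \<le> K / real n)"
    using good_times by (elim exE conjE) blast
  have "\<forall>j. \<exists>n. n \<ge> Suc j \<and> (\<forall>s\<in>S. hellinger n s \<le> K / real n)" using K(2) by blast
  from choice[OF this] obtain n1 where n1': "\<forall>j. n1 j \<ge> Suc j \<and> (\<forall>s\<in>S. hellinger (n1 j) s \<le> K / real (n1 j))" ..
  then have n1: "\<And>j. n1 j \<ge> Suc j" "\<And>j. \<forall>s\<in>S. hellinger (n1 j) s \<le> K / real (n1 j)" by blast+
  define tr where "tr g = (\<lambda>x. \<phi> (g \<otimes> x) - \<phi> g)" for g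
  define Z where "Z j p = avg (n1 j) (\<lambda>x. tr (fst p) x * tr (snd p) x) \<one> / real (n1 j)" for j p
  have "countable (carrier G)" unfolding carrier_B using finB by (intro countable_UN) (auto intro: countable_finite)
  then have cc: "countable (carrier G \<times> carrier G)" by auto
  \<comment> \<open>Second moments of translates are at most \<open>n\<close> times
    \<open>L^2\<close>, uniformly. By the arithmetic-geometric mean inequality this bounds all
    normalised correlations, so a single subsequence serves the countably many pairs.\<close>
  have trl: "avg n (\<lambda>x. (tr g x)\<^sup>2) \<one> \<le> real n * L\<^sup>2" if g: "g \<in> carrier G" for g n
  proof -
    have lt: "lip_harmonic L (tr g)" unfolding lip_harmonic_def
    proof (intro conjI ballI)
      show "L \<ge> 0" "tr g \<one> = 0" using L g by (auto simp: tr_def)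
      fix x assume x: "x \<in> carrier G"
      have "P (tr g) x = (\<Sum>s\<in>S. \<phi> (g \<otimes> x \<otimes> s) - \<phi> g) / q"
        unfolding P_def tr_def using x g Sc by (intro arg_cong2[where f="(/)"] sum.cong) (auto simp: m_assoc)
      also have "\<dots> = P \<phi> (g \<otimes> x) - \<phi> g" using q_pos by (simp add: P_def sum_subtractf q_def diff_divide_distrib)
      also have "\<dots> = tr g x" using \<phi>(1) g x by (auto simp: lip_harmonic_def tr_def)
      finally show "P (tr g) x = tr g x" .
      fix s assume s: "s \<in> S"
      have "tr g (x \<otimes> s) - tr g x = \<phi> (g \<otimes> x \<otimes> s) - \<phi> (g \<otimes> x)" using x g s Sc by (simp add: tr_def m_assoc)
      then show "\<bar>tr g (x \<otimes> s) - tr g x\<bar> \<le> L" using \<phi>(1) g x s by (simp add: lip_harmonic_def)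
    qed
    have "tr g \<one> = 0" using g by (simp add: tr_def)
    then show ?thesis using avg_square_le[OF lt one_closed, of n] by simp
  qed
  have Zb: "norm (Z j p) \<le> L\<^sup>2" if p: "p \<in> carrier G \<times> carrier G" for j p
  proof -
    let ?n = "n1 j"
    have n: "real ?n > 0" using n1(1)[of j] by simp
    let ?u = "tr (fst p)" let ?v = "tr (snd p)"
    have pt: "u * v \<le> (1/2) * u\<^sup>2 + (1/2) * v\<^sup>2" "- (u * v) \<le> (1/2) * u\<^sup>2 + (1/2) * v\<^sup>2" for u v :: real
      using zero_le_power2[of "u - v"] zero_le_power2[of "u + v"] by (simp_all add: power2_eq_square algebra_simps)
    have b: "avg ?n (\<lambda>x. (1/2) * (?u x)\<^sup>2 + (1/2) * (?v x)\<^sup>2) \<one> \<le> real ?n * L\<^sup>2"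
      using trl[of "fst p" ?n] trl[of "snd p" ?n] p unfolding avg_add avg_cmult by (auto simp: mem_Times_iff)
    have "avg ?n (\<lambda>x. ?u x * ?v x) \<one> \<le> real ?n * L\<^sup>2"
      by (rule order_trans[OF avg_mono b]) (use pt(1) in auto)
    moreover have "avg ?n (\<lambda>x. - 1 * (?u x * ?v x)) \<one> \<le> real ?n * L\<^sup>2"
      by (rule order_trans[OF avg_mono b]) (use pt(2) in auto)
    then have "- avg ?n (\<lambda>x. ?u x * ?v x) \<one> \<le> real ?n * L\<^sup>2" unfolding avg_cmult by simp
    ultimately have "\<bar>avg ?n (\<lambda>x. ?u x * ?v x) \<one>\<bar> \<le> real ?n * L\<^sup>2" by (rule abs_leI)
    then show ?thesis using n by (simp add: Z_def abs_divide field_simps)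
  qed
  obtain r :: "nat \<Rightarrow> nat" where r: "strict_mono r" "\<And>p. p \<in> carrier G \<times> carrier G \<Longrightarrow> \<exists>l. (\<lambda>j. Z (r j) p) \<longlonglongrightarrow> l"
    by (rule function_convergent_subsequence[where f=Z, OF cc Zb]) auto
  have "harmonic_limit G S C d \<phi> L K (\<lambda>j. n1 (r j))"
  proof (unfold_locales, rule \<phi>(1), rule \<phi>(2), rule K(1))
    show "hellinger (n1 (r j)) s \<le> K / real (n1 (r j))" if "s \<in> S" for j s using n1(2) that by blast
    show "Suc j \<le> n1 (r j)" for j using n1(1)[of "r j"] seq_suble[OF r(1), of j] by linarith
    show "convergent (\<lambda>j. avg (n1 (r j)) (\<lambda>x. (\<phi> (g \<otimes> x) - \<phi> g) * (\<phi> (h \<otimes> x) - \<phi> h)) \<one> / real (n1 (r j)))"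
      if "g \<in> carrier G" "h \<in> carrier G" for g h
      using r(2)[of "(g,h)"] that unfolding Z_def tr_def by (auto simp: convergent_def)
  qed
  then show ?thesis by (rule harmonic_limit.finite_index_zhom)
qed

end

section \<open>Polynomial growth implies virtually polycyclic\<close>

lemma polynomial_subexponential:
  assumes "\<And>n. n \<ge> 1 \<Longrightarrow> real (card (wball G S n)) \<le> C * real n ^ d"
  shows "subexp G S"
  unfolding subexp_def
proof
  fix c :: nat
  show "\<exists>m. card (wball G S (c * m)) < 2 ^ m"
  proof (cases "c = 0")
    case True then show ?thesis by (intro exI[of _ 1]) simp
  next
    case False
    have "(\<lambda>m. C * (real c * real m) ^ d / 2 ^ m) \<longlonglongrightarrow> 0"
    proof -
      have "(\<lambda>m. real m ^ d / 2 ^ m) \<longlonglongrightarrow> 0" by real_asymp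
      then have "(\<lambda>m. C * real c ^ d * (real m ^ d / 2 ^ m)) \<longlonglongrightarrow> C * real c ^ d * 0" by (intro tendsto_mult tendsto_const)
      then show ?thesis by (simp add: power_mult_distrib mult_ac)
    qed
    then have "\<forall>\<^sub>F m in sequentially. C * (real c * real m) ^ d / 2 ^ m < 1 \<and> m \<ge> 1"
      by (intro eventually_conj order_tendstoD(2) eventually_ge_at_top) auto
    then obtain m where m: "C * (real c * real m) ^ d / 2 ^ m < 1" "m \<ge> 1" by (auto simp: eventually_sequentially)
    have "real (card (wball G S (c * m))) \<le> C * real (c * m) ^ d" using m(2) False by (intro assms) auto
    also have "\<dots> < 2 ^ m" using m(1) by (simp add: field_simps)
    finally have "real (card (wball G S (c * m))) < real (2 ^ m)" by simp
    then show ?thesis by (intro exI[of _ m]) (simp only: of_nat_less_iff)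
  qed
qed

lemma (in group) sgen_restrict:
  assumes "subgroup K G" "sgen G S H" "H \<subseteq> K" shows "sgen (G\<lparr>carrier := K\<rparr>) S H"
proof -
  have "S \<subseteq> H" using sgen_subset assms by auto
  then show ?thesis using assms by (auto simp: sgen_def symgen_def subset_iff)
qed

text \<open>The products \<open>k t^i\<close> with \<open>k\<close> in the ball of radius
  \<open>n\<close> and \<open>i < n\<close> are distinct, because \<open>\<psi>\<close> recovers
  \<open>i\<close>, and lie in a ball of radius \<open>2 c n\<close>. The larger group therefore has
  an extra factor \<open>n\<close> in its growth.\<close>

lemma (in group) kernel_growth:
  assumes "sgen G S H" "zhom G H \<psi>" "sgen G R {x\<in>H. \<psi> x = 0}"
    and poly: "\<And>n. n \<ge> 1 \<Longrightarrow> real (card (wball G S n)) \<le> C * real n ^ Suc d"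
  shows "\<exists>C'. \<forall>n\<ge>1. real (card (wball G R n)) \<le> C' * real n ^ d"
proof -
  let ?K = "{x\<in>H. \<psi> x = 0}"
  have s: "symgen G S" and Hs: "subgroup H G" using assms(1) sgen_subgroup by (auto simp: sgen_def)
  note z = zhom_facts[OF assms(2) Hs]
  have Hc: "x \<in> carrier G" if "x \<in> H" for x using subgroup.mem_carrier[OF Hs that] .
  obtain t where t: "t \<in> H" "\<psi> t = 1" using assms(2) by (auto simp: zhom_def)
  have tc: "t \<in> carrier G" using t Hc by auto
  have Rf: "finite (insert t R)" "insert t R \<subseteq> H" using sgen_subset[OF assms(3)] t assms(3) by (auto simp: sgen_def symgen_def)
  obtain c where c: "c \<ge> 1" "insert t R \<subseteq> wball G S c" using sgen_finite_subset[OF assms(1) Rf] by blast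
  have tn: "t [^] i \<in> wball G S (c * i)" for i :: nat
  proof (induction i)
    case (Suc i)
    have "t [^] i \<otimes> t \<in> wball G S (c * i + c)" using wball_add[OF _ Suc] c(2) s by (auto simp: symgen_def)
    then show ?case by (simp add: add.commute)
  qed simp
  have tp: "t [^] i \<in> H" "\<psi> (t [^] i) = int i" for i :: nat
    using subgroup_int_pow_closed[OF Hs t(1), of "int i"] z(4)[OF t(1), of "int i"] t(2) by (simp_all add: int_pow_int)
  have bound: "n * card (wball G R n) \<le> card (wball G S (2 * c * n))" for n
  proof -
    let ?f = "\<lambda>(k, i). k \<otimes> t [^] (i :: nat)"
    have K: "k \<in> H" "\<psi> k = 0" "k \<in> carrier G" if "k \<in> wball G R n" for k
      using that assms(3) Hc unfolding sgen_def by blast+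
    have inj: "inj_on ?f (wball G R n \<times> {..<n})"
    proof (rule inj_onI)
      fix p p' assume p: "p \<in> wball G R n \<times> {..<n}" "p' \<in> wball G R n \<times> {..<n}" "?f p = ?f p'"
      obtain k i k' i' where e: "p = (k,i)" "p' = (k',i')" by (cases p, cases p')
      have k: "k \<in> wball G R n" "k' \<in> wball G R n" using p e by auto
      have eq: "k \<otimes> t [^] i = k' \<otimes> t [^] i'" using p(3) e by simp
      have "\<psi> (k \<otimes> t [^] i) = int i" "\<psi> (k' \<otimes> t [^] i') = int i'" using z(3) K[OF k(1)] K[OF k(2)] tp by simp_all
      then have i: "i = i'" using eq by simp
      then have "k = k'" using eq K[OF k(1)] K[OF k(2)] tc by simp
      then show "p = p'" using e i by simp
    qed
    have sub: "?f ` (wball G R n \<times> {..<n}) \<subseteq> wball G S (2 * c * n)"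
    proof
      fix y assume "y \<in> ?f ` (wball G R n \<times> {..<n})"
      then obtain k i where y: "k \<in> wball G R n" "i < n" "y = k \<otimes> t [^] i" by auto
      have "k \<in> wball G S (c * n)" using wball_subst[OF s, of R c n] c(2) y(1) by auto
      then have "y \<in> wball G S (c * n + c * i)" unfolding y(3) using wball_add tn s by (auto simp: symgen_def)
      moreover have "c * n + c * i \<le> 2 * c * n" using y(2) mult_le_mono2[of i n c] by simp
      ultimately show "y \<in> wball G S (2 * c * n)" using wball_mono[OF s] by blast
    qed
    have "card (?f ` (wball G R n \<times> {..<n})) = n * card (wball G R n)" using card_image[OF inj] by (simp add: card_cartesian_product)
    then show ?thesis using card_mono[OF finite_wball sub] s by (simp add: symgen_def)
  qed
  have "real (card (wball G R n)) \<le> (C * real (2 * c) ^ Suc d) * real n ^ d" if n: "n \<ge> 1" for n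
  proof -
    have "real n * real (card (wball G R n)) \<le> real (card (wball G S (2 * c * n)))"
      using bound[of n] by (metis of_nat_le_iff of_nat_mult)
    also have "\<dots> \<le> C * real (2 * c * n) ^ Suc d" using n c by (intro poly) simp
    also have "\<dots> = real n * ((C * real (2 * c) ^ Suc d) * real n ^ d)" by (simp add: power_mult_distrib mult_ac)
    finally show ?thesis using n by (simp only: mult_le_cancel_left_pos of_nat_0_less_iff)
  qed
  then show ?thesis by blast
qed

text \<open>The induction on the degree runs over all groups, because its hypothesis is applied to
  the kernel \<open>K\<close> as a group of its own. Degree 0 bounds the balls and leaves only
  finite groups, which are one finite-index step above the trivial group.\<close>

theorem polynomial_growth_pc:
  fixes G :: "('a, 'b) monoid_scheme"
  assumes "group G" "sgen G S (carrier G)" "\<And>n. n \<ge> 1 \<Longrightarrow> real (card (wball G S n)) \<le> C * real n ^ d"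
  shows "pc G {\<one>\<^bsub>G\<^esub>} (carrier G)"
  using assms
proof (induction d arbitrary: G S C)
  have finite_case: "pc G {\<one>\<^bsub>G\<^esub>} (carrier G)" if "group G" "finite (carrier G)" for G :: "('a, 'b) monoid_scheme"
  proof -
    interpret group G by fact
    show ?thesis
      using pc.fin[OF pc.refl[OF triv_subgroup] subgroup_self _ finite_findex[OF that(2) subgroup_self triv_subgroup]] by simp
  qed
  {
    case (0 G S C)
    interpret group G by fact
    show ?case
    proof (cases "finite (carrier G)")
      case True then show ?thesis using finite_case 0 by blast
    next
      case False
      interpret poly_walk G S C 0 by unfold_locales (use 0 False in auto)
      obtain n where n: "card (B n) > nat \<lceil>C\<rceil>" using B_large by blast
      then have "real (card (B n)) > C" by linarith
      moreover have "B n \<subseteq> B (max n 1)" using Bmono[of n "max n 1"] by auto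
      then have "card (B n) \<le> card (B (max n 1))" using finB by (intro card_mono) auto
      moreover have "real (card (B (max n 1))) \<le> C" using 0(3)[of "max n 1"] by simp
      ultimately show ?thesis by linarith
    qed
  next
    case (Suc d G S C)
    interpret group G by fact
    show ?case
    proof (cases "finite (carrier G)")
      case True then show ?thesis using finite_case Suc by blast
    next
      case False
      interpret poly_walk G S C "Suc d" by unfold_locales (use Suc.prems False in auto)
      obtain H \<psi> where H: "subgroup H G" "findex G H (carrier G)" "zhom G H \<psi>"
        using exists_finite_index_zhom by blast
      have HG: "H \<subseteq> carrier G" using subgroup.subset[OF H(1)] .
      obtain SH where SH: "sgen G SH H" using schreier[OF sgenS H(1) HG H(2)] by blast
      have SHf: "finite SH" "SH \<subseteq> carrier G" using SH by (auto simp: sgen_def symgen_def)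
      obtain c where c: "c \<ge> 1" "SH \<subseteq> B c" using sgen_finite_subset[OF sgenS SHf] by blast
      have polyH: "real (card (wball G SH n)) \<le> (C * real c ^ Suc d) * real n ^ Suc d" if n: "n \<ge> 1" for n
      proof -
        have "real (card (wball G SH n)) \<le> real (card (B (c * n)))"
          using card_wball_subst[OF symS c(2)] by simp
        also have "\<dots> \<le> C * real (c * n) ^ Suc d" using n c by (intro Suc.prems(3)) simp
        finally show ?thesis by (simp add: power_mult_distrib mult_ac)
      qed
      define K where "K = {x\<in>H. \<psi> x = 0}"
      obtain R where R: "sgen G R K" using milnor_kernel[OF SH polynomial_subexponential[OF polyH] H(3)] unfolding K_def by blast
      obtain C' where C': "\<And>n. n \<ge> 1 \<Longrightarrow> real (card (wball G R n)) \<le> C' * real n ^ d"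
        using kernel_growth[OF SH H(3) R[unfolded K_def] polyH] by blast
      have Ks: "subgroup K G" using sgen_subgroup[OF R] .
      let ?K = "G\<lparr>carrier := K\<rparr>"
      have "pc ?K {\<one>\<^bsub>?K\<^esub>} (carrier ?K)"
      proof (rule Suc.IH)
        show "group ?K" by (rule subgroup_imp_group[OF Ks])
        show "sgen ?K R (carrier ?K)" using sgen_restrict[OF Ks R] by simp
        show "real (card (wball ?K R n)) \<le> C' * real n ^ d" if "n \<ge> 1" for n using C'[OF that] by simp
      qed
      then have "pc G {\<one>\<^bsub>G\<^esub>} K" using pc_restrict[OF Ks] by simp
      then have "pc G {\<one>\<^bsub>G\<^esub>} H" by (rule pc.zstep[OF _ H(1,3) K_def])
      then show ?thesis by (rule pc.fin[OF _ subgroup_self HG H(2)])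
    qed
  }
qed

section \<open>Virtually nilpotent groups\<close>

lemma (in group) lower_central_props:
  fixes H defines "L \<equiv> lower_central (G\<lparr>carrier := H\<rparr>)"
  assumes H: "subgroup H G"
  shows "subgroup (L i) G" "L i \<subseteq> H" "x \<in> L i \<Longrightarrow> y \<in> H \<Longrightarrow> x \<otimes> y \<otimes> inv x \<otimes> inv y \<in> L (Suc i)"
    "L (Suc i) \<subseteq> L i"
proof -
  define c where "c i = (\<Union>x\<in>L i. \<Union>y\<in>H. {x \<otimes> y \<otimes> inv x \<otimes> inv y})" for i
  have LH: "L i \<subseteq> H \<and> L (Suc i) = generate G (c i) \<and> c i \<subseteq> H" for i
  proof (induction i)
    have key: "L i \<subseteq> H \<Longrightarrow> L (Suc i) = generate G (c i) \<and> c i \<subseteq> H" for i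
    proof -
      assume i: "L i \<subseteq> H"
      have e: "(\<Union>x\<in>L i. \<Union>y\<in>carrier (G\<lparr>carrier := H\<rparr>). {x \<otimes>\<^bsub>G\<lparr>carrier := H\<rparr>\<^esub> y \<otimes>\<^bsub>G\<lparr>carrier := H\<rparr>\<^esub> inv\<^bsub>G\<lparr>carrier := H\<rparr>\<^esub> x \<otimes>\<^bsub>G\<lparr>carrier := H\<rparr>\<^esub> inv\<^bsub>G\<lparr>carrier := H\<rparr>\<^esub> y}) = c i"
        unfolding c_def using i m_inv_consistent[OF H] by (auto simp: subset_iff)
      have ci: "c i \<subseteq> H" unfolding c_def using i H by (auto intro!: subgroup.m_closed subgroup.m_inv_closed)
      have "L (Suc i) = generate (G\<lparr>carrier := H\<rparr>) (c i)" using e unfolding L_def by simp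
      then show ?thesis using generate_consistent[OF ci H] ci by simp
    qed
    {
      case 0
      have "L 0 \<subseteq> H" by (simp add: L_def)
      then show ?case using key by blast
    next
      case (Suc i)
      then have "L (Suc i) \<subseteq> H" using generate_subgroup_incl[OF _ H] by simp
      then show ?case using key by blast
    }
  qed
  show LsubH: "L i \<subseteq> H" for i using LH by blast
  have Lsub: "subgroup (L i) G" for i
  proof (cases i)
    case 0 then show ?thesis using H by (simp add: L_def)
  next
    case (Suc j)
    have "c j \<subseteq> carrier G" using LH[of j] subgroup.subset[OF H] by blast
    then show ?thesis using LH[of j] Suc generate_is_subgroup by simp
  qed
  then show "subgroup (L i) G" .
  show "x \<otimes> y \<otimes> inv x \<otimes> inv y \<in> L (Suc i)" if "x \<in> L i" "y \<in> H" for x y i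
  proof -
    have "x \<otimes> y \<otimes> inv x \<otimes> inv y \<in> c i" using that by (auto simp: c_def)
    then show ?thesis using LH[of i] by (auto intro: generate.incl)
  qed
  show "L (Suc i) \<subseteq> L i"
  proof (induction i)
    case 0 show ?case using LsubH[of "Suc 0"] by (simp add: L_def)
  next
    case (Suc i)
    have "c (Suc i) \<subseteq> c i" using Suc unfolding c_def by blast
    then show ?case using LH[of i] LH[of "Suc i"] mono_generate by simp
  qed
qed

text \<open>Successive quotients of the lower central series are abelian. That each term is finitely
  generated is taken from \<open>pc_fg\<close>, along the part of the chain already built; here the
  weak subexponential growth enters.\<close>

lemma (in group) virtually_nilpotent_pc:
  assumes "sgen G S (carrier G)" "subexp G S" "virtually_nilpotent G"
  shows "pc G {\<one>} (carrier G)"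
proof -
  obtain H k where H: "subgroup H G" "finite (rcosets H)" "lower_central (G\<lparr>carrier := H\<rparr>) k = {\<one>}"
    using assms(3) by (auto simp: virtually_nilpotent_def nilpotent_group_def)
  have fi: "findex G H (carrier G)" using findex_rcosets[OF H(1)] H(2) by simp
  have HG: "H \<subseteq> carrier G" using subgroup.subset[OF H(1)] .
  obtain R where R: "sgen G R H" using schreier[OF assms(1) H(1) HG fi] by blast
  have Re: "subexp G R" by (rule subexp_subset[OF assms(2,1) R HG])
  note L = lower_central_props[OF H(1)]
  have "pc G (lower_central (G\<lparr>carrier := H\<rparr>) i) H" for i
  proof (induction i)
    case 0 then show ?case using pc.refl[OF H(1)] by simp
  next
    case (Suc i)
    obtain T where T: "sgen G T (lower_central (G\<lparr>carrier := H\<rparr>) i)" using pc_fg[OF Suc R Re] by blast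
    have "pc G (lower_central (G\<lparr>carrier := H\<rparr>) (Suc i)) (lower_central (G\<lparr>carrier := H\<rparr>) i)"
      by (rule pc_abelian_quotient[OF T L(1) L(4)]) (rule L(3), assumption, rule subsetD[OF L(2)])
    then show ?case by (rule pc_trans[OF Suc])
  qed
  from this[of k] have "pc G {\<one>} H" using H(3) by simp
  then show ?thesis by (rule pc.fin[OF _ subgroup_self HG fi])
qed

lemma (in group_hom) preimage_subgroup:
  assumes "subgroup L H" shows "subgroup {x\<in>carrier G. h x \<in> L} G"
  by (rule G.subgroupI) (use subgroup.one_closed[OF assms] subgroup.m_closed[OF assms] subgroup.m_inv_closed[OF assms] in auto)

text \<open>The part \<open>N\<close> of the preimage of \<open>HQ\<close> that centralises the
  finite kernel has finite index, since conjugation acts on the kernel through finitely many maps.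
  The \<open>k\<close>-th lower central term of \<open>N\<close> falls into the kernel, so it is
  central in \<open>N\<close>, and one further commutator kills it.\<close>

lemma virtually_nilpotent_finite_kernel:
  fixes G (structure)
  assumes "group_hom G Q f" "f ` carrier G = carrier Q" "finite {x\<in>carrier G. f x = \<one>\<^bsub>Q\<^esub>}" "virtually_nilpotent Q"
  shows "virtually_nilpotent G"
proof -
  interpret group_hom G Q f by fact
  let ?R = "{x\<in>carrier G. f x = \<one>\<^bsub>Q\<^esub>}"
  obtain HQ k where HQ: "subgroup HQ Q" "finite (rcosets\<^bsub>Q\<^esub> HQ)" "lower_central (Q\<lparr>carrier := HQ\<rparr>) k = {\<one>\<^bsub>Q\<^esub>}"
    using assms(4) by (auto simp: virtually_nilpotent_def nilpotent_group_def)
  have fiQ: "findex Q HQ (carrier Q)" using H.findex_rcosets[OF HQ(1)] HQ(2) by simp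
  obtain c where c: "finite (c ` carrier Q)" "c ` carrier Q \<subseteq> carrier Q"
      "\<And>h h'. h \<in> carrier Q \<Longrightarrow> h' \<in> carrier Q \<Longrightarrow> c h = c h' \<Longrightarrow> h \<otimes>\<^bsub>Q\<^esub> inv\<^bsub>Q\<^esub> h' \<in> HQ"
      "\<And>h. h \<in> carrier Q \<Longrightarrow> h \<otimes>\<^bsub>Q\<^esub> inv\<^bsub>Q\<^esub> (c h) \<in> HQ" by (rule H.findexE[OF fiQ HQ(1) H.subgroup_self]) blast
  define N where "N = {x\<in>carrier G. f x \<in> HQ \<and> (\<forall>r\<in>?R. x \<otimes> r = r \<otimes> x)}"
  have Rn: "inv x \<otimes> r \<otimes> x \<in> ?R" if "x \<in> carrier G" "r \<in> ?R" for x r using that by simp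
  have Nsub: "subgroup N G"
  proof (rule G.subgroupI)
    show "N \<subseteq> carrier G" by (auto simp: N_def)
    have "\<one> \<in> N" using subgroup.one_closed[OF HQ(1)] by (auto simp: N_def)
    then show "N \<noteq> {}" by blast
    show "inv x \<in> N" if x: "x \<in> N" for x
    proof -
      have xc: "x \<in> carrier G" "f x \<in> HQ" using x by (auto simp: N_def)
      have "inv x \<otimes> r = r \<otimes> inv x" if r: "r \<in> ?R" for r
      proof -
        have "x \<otimes> r = r \<otimes> x" "r \<in> carrier G" using x r by (auto simp: N_def)
        then have "inv x \<otimes> (x \<otimes> r) \<otimes> inv x = inv x \<otimes> (r \<otimes> x) \<otimes> inv x" by simp
        then show ?thesis using xc \<open>r \<in> carrier G\<close> by (simp add: G.m_assoc)
      qed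
      then show ?thesis using xc subgroup.m_inv_closed[OF HQ(1)] by (simp add: N_def)
    qed
    show "x \<otimes> y \<in> N" if xy: "x \<in> N" "y \<in> N" for x y
    proof -
      have c: "x \<in> carrier G" "f x \<in> HQ" "y \<in> carrier G" "f y \<in> HQ" using xy by (auto simp: N_def)
      have "x \<otimes> y \<otimes> r = r \<otimes> (x \<otimes> y)" if r: "r \<in> ?R" for r
      proof -
        have e: "x \<otimes> r = r \<otimes> x" "y \<otimes> r = r \<otimes> y" "r \<in> carrier G" using xy r by (auto simp: N_def)
        have "x \<otimes> y \<otimes> r = x \<otimes> (r \<otimes> y)" using c e by (simp add: G.m_assoc)
        also have "\<dots> = (x \<otimes> r) \<otimes> y" using c e(3) by (simp add: G.m_assoc)
        also have "\<dots> = r \<otimes> (x \<otimes> y)" using c e(1,3) by (simp add: G.m_assoc)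
        finally show ?thesis .
      qed
      then show ?thesis using c subgroup.m_closed[OF HQ(1)] by (simp add: N_def)
    qed
  qed
  have fi: "findex G N (carrier G)"
  proof (rule G.findexI[of "\<lambda>x. (c (f x), \<lambda>r\<in>?R. inv x \<otimes> r \<otimes> x)"])
    show "finite ((\<lambda>x. (c (f x), \<lambda>r\<in>?R. inv x \<otimes> r \<otimes> x)) ` carrier G)"
    proof (rule finite_subset)
      show "(\<lambda>x. (c (f x), \<lambda>r\<in>?R. inv x \<otimes> r \<otimes> x)) ` carrier G \<subseteq> c ` carrier Q \<times> (?R \<rightarrow>\<^sub>E ?R)"
      proof (rule image_subsetI, rule SigmaI)
        fix x assume x: "x \<in> carrier G"
        then show "c (f x) \<in> c ` carrier Q" by simp
        show "(\<lambda>r\<in>?R. inv x \<otimes> r \<otimes> x) \<in> ?R \<rightarrow>\<^sub>E ?R" using Rn[OF x] by (simp only: restrict_PiE_iff) blast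
      qed
      show "finite (c ` carrier Q \<times> (?R \<rightarrow>\<^sub>E ?R))" using c(1) assms(3) by (intro finite_cartesian_product finite_PiE) auto
    qed
    fix h h' assume h: "h \<in> carrier G" "h' \<in> carrier G" "(c (f h), \<lambda>r\<in>?R. inv h \<otimes> r \<otimes> h) = (c (f h'), \<lambda>r\<in>?R. inv h' \<otimes> r \<otimes> h')"
    have e: "c (f h) = c (f h')" "(\<lambda>r\<in>?R. inv h \<otimes> r \<otimes> h) = (\<lambda>r\<in>?R. inv h' \<otimes> r \<otimes> h')" using h(3) unfolding prod.inject by blast+
    have "f h \<otimes>\<^bsub>Q\<^esub> inv\<^bsub>Q\<^esub> f h' \<in> HQ" by (rule c(3)[OF _ _ e(1)]) (use h in auto)
    then have 1: "f (h \<otimes> inv h') \<in> HQ" using h by simp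
    have "h \<otimes> inv h' \<otimes> r = r \<otimes> (h \<otimes> inv h')" if r: "r \<in> ?R" for r
    proof -
      have rc: "r \<in> carrier G" using r by simp
      have "inv h \<otimes> r \<otimes> h = inv h' \<otimes> r \<otimes> h'" using fun_cong[OF e(2), of r] r by simp
      then have "h \<otimes> (inv h \<otimes> r \<otimes> h) \<otimes> inv h' = h \<otimes> (inv h' \<otimes> r \<otimes> h') \<otimes> inv h'" by simp
      then show ?thesis using h(1,2) rc by (simp add: G.m_assoc)
    qed
    then show "h \<otimes> inv h' \<in> N" using 1 h by (simp add: N_def)
  qed
  note LN = G.lower_central_props[OF Nsub] and LQ = H.lower_central_props[OF HQ(1)]
  have lc: "lower_central (G\<lparr>carrier := N\<rparr>) i \<subseteq> {x\<in>carrier G. f x \<in> lower_central (Q\<lparr>carrier := HQ\<rparr>) i}" for i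
  proof (induction i)
    case 0 then show ?case by (auto simp: N_def)
  next
    case (Suc i)
    have sub: "subgroup ({x\<in>carrier G. f x \<in> lower_central (Q\<lparr>carrier := HQ\<rparr>) (Suc i)} \<inter> N) G"
      by (rule G.subgroups_Inter_pair[OF preimage_subgroup[OF LQ(1)] Nsub])
    have gen: "lower_central (G\<lparr>carrier := N\<rparr>) (Suc i) = generate (G\<lparr>carrier := N\<rparr>) (\<Union>x\<in>lower_central (G\<lparr>carrier := N\<rparr>) i. \<Union>y\<in>N. {x \<otimes> y \<otimes> inv\<^bsub>G\<lparr>carrier := N\<rparr>\<^esub> x \<otimes> inv\<^bsub>G\<lparr>carrier := N\<rparr>\<^esub> y})" (is "_ = generate _ ?U")
      by simp
    have U: "?U \<subseteq> {x\<in>carrier G. f x \<in> lower_central (Q\<lparr>carrier := HQ\<rparr>) (Suc i)} \<inter> N"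
    proof
      fix u assume "u \<in> ?U"
      then obtain x y where xy: "x \<in> lower_central (G\<lparr>carrier := N\<rparr>) i" "y \<in> N" "u = x \<otimes> y \<otimes> inv\<^bsub>G\<lparr>carrier := N\<rparr>\<^esub> x \<otimes> inv\<^bsub>G\<lparr>carrier := N\<rparr>\<^esub> y" by blast
      have xN: "x \<in> N" using xy LN(2) by blast
      have u: "u = x \<otimes> y \<otimes> inv x \<otimes> inv y" using xy(3) G.m_inv_consistent[OF Nsub] xN xy(2) by simp
      have uN: "u \<in> N" unfolding u using xN xy(2) Nsub by (intro subgroup.m_closed subgroup.m_inv_closed) auto
      have c: "x \<in> carrier G" "y \<in> carrier G" "f y \<in> HQ" using xN xy(2) by (auto simp: N_def)
      have fx: "f x \<in> lower_central (Q\<lparr>carrier := HQ\<rparr>) i" using Suc xy(1) by blast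
      have "f u = f x \<otimes>\<^bsub>Q\<^esub> f y \<otimes>\<^bsub>Q\<^esub> inv\<^bsub>Q\<^esub> f x \<otimes>\<^bsub>Q\<^esub> inv\<^bsub>Q\<^esub> f y" unfolding u using c by simp
      then have "f u \<in> lower_central (Q\<lparr>carrier := HQ\<rparr>) (Suc i)" using LQ(3)[OF fx c(3)] by metis
      then show "u \<in> {x\<in>carrier G. f x \<in> lower_central (Q\<lparr>carrier := HQ\<rparr>) (Suc i)} \<inter> N" using uN by (auto simp: N_def)
    qed
    have UN: "?U \<subseteq> N" using U by blast
    have "lower_central (G\<lparr>carrier := N\<rparr>) (Suc i) = generate G ?U" unfolding gen by (rule G.generate_consistent[OF UN Nsub])
    then show ?case using G.generate_subgroup_incl[OF U sub] by blast
  qed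
  have "lower_central (G\<lparr>carrier := N\<rparr>) (Suc k) = {\<one>}"
  proof -
    have LR: "x \<in> ?R" if "x \<in> lower_central (G\<lparr>carrier := N\<rparr>) k" for x using lc[of k] HQ(3) that by blast
    have one: "x \<otimes> y \<otimes> inv\<^bsub>G\<lparr>carrier := N\<rparr>\<^esub> x \<otimes> inv\<^bsub>G\<lparr>carrier := N\<rparr>\<^esub> y = \<one>" if "x \<in> lower_central (G\<lparr>carrier := N\<rparr>) k" "y \<in> N" for x y
    proof -
      have xN: "x \<in> N" using that LN(2) by blast
      have c: "x \<in> carrier G" "y \<in> carrier G" using xN that by (auto simp: N_def)
      have "y \<otimes> x = x \<otimes> y" using that LR[OF that(1)] by (auto simp: N_def)
      then have "x \<otimes> y \<otimes> inv x \<otimes> inv y = y \<otimes> x \<otimes> inv x \<otimes> inv y" by simp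
      also have "\<dots> = \<one>" using c by (simp add: G.m_assoc)
      finally show ?thesis using G.m_inv_consistent[OF Nsub] xN that(2) by simp
    qed
    have "lower_central (G\<lparr>carrier := N\<rparr>) (Suc k) \<subseteq> generate (G\<lparr>carrier := N\<rparr>) {\<one>}"
      unfolding lower_central.simps
      by (rule group.mono_generate[OF G.subgroup_imp_group[OF Nsub]]) (use one in auto)
    also have "generate (G\<lparr>carrier := N\<rparr>) {\<one>} = generate G {\<one>}"
      by (rule G.generate_consistent[OF _ Nsub]) (use subgroup.one_closed[OF Nsub] in auto)
    also have "\<dots> \<subseteq> {\<one>}" by (rule G.generate_subgroup_incl[OF _ G.triv_subgroup]) simp
    finally have "lower_central (G\<lparr>carrier := N\<rparr>) (Suc k) \<subseteq> {\<one>}" .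
    moreover have "\<one> \<in> lower_central (G\<lparr>carrier := N\<rparr>) (Suc k)" by (rule subgroup.one_closed[OF LN(1)])
    ultimately show ?thesis by blast
  qed
  then have "nilpotent_group (G\<lparr>carrier := N\<rparr>)" unfolding nilpotent_group_def by (intro exI[of _ "Suc k"]) simp
  then show ?thesis unfolding virtually_nilpotent_def using Nsub fi G.findex_rcosets[OF Nsub] by blast
qed

section \<open>The finite residual\<close>

text \<open>If all balls of radius \<open>c m\<close> had at least \<open>2^m\<close> elements, then
  \<open>exp n <= 4^n = 2^(2 n)\<close> would make the growth exponential, and so at least that of
  the exponential of the square root.\<close>

lemma growth_preceq_exp_subexp:
  assumes "group G" "fin_gen_set G A" "\<not> (\<lambda>n. exp (real n powr (1/2))) \<preceq>\<^sub>g growth G A"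
  shows "subexp G (insert \<one>\<^bsub>G\<^esub> (A \<union> (\<lambda>a. inv\<^bsub>G\<^esub> a) ` A))" (is "subexp G ?S")
  unfolding subexp_def
proof (rule allI, rule ccontr)
  interpret group G by fact
  fix c assume "\<not> (\<exists>m. card (wball G ?S (c * m)) < 2 ^ m)"
  then have big: "2 ^ m \<le> card (wball G ?S (c * m))" for m by (meson not_less)
  have s: "symgen G ?S" using assms(2) sgen_generate[of A] by (auto simp: fin_gen_set_def sgen_def)
  \<comment> \<open>Radius \<open>2 c n\<close> carries the estimate; the added 2 makes the factor
    exceed 1 for \<open>c = 0\<close> as well.\<close>
  have "exp (real n powr (1/2)) \<le> growth G A ((2 * c + 2) * n)" if n: "n \<ge> 1" for n
  proof -
    have "real n powr (1/2) \<le> real n powr 1" using n by (intro powr_mono) auto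
    then have "exp (real n powr (1/2)) \<le> exp (real n)" using n by simp
    also have "\<dots> = exp 1 ^ n" by (simp add: exp_of_nat_mult[symmetric])
    also have "\<dots> \<le> 4 ^ n" using exp_le by (intro power_mono) auto
    also have "\<dots> = real (2 ^ (2 * n))" by (simp add: power_mult)
    also have "\<dots> \<le> real (card (wball G ?S (c * (2 * n))))" using big by (simp only: of_nat_le_iff)
    also have "\<dots> \<le> real (card (wball G ?S ((2 * c + 2) * n)))"
    proof -
      have "wball G ?S (c * (2 * n)) \<subseteq> wball G ?S ((2 * c + 2) * n)" by (rule wball_mono[OF s]) simp
      moreover have "finite ?S" using s by (simp only: symgen_def)
      ultimately show ?thesis using card_mono[OF finite_wball] by (simp only: of_nat_le_iff)
    qed
    finally show ?thesis unfolding growth_eq_wball[OF assms(2)] .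
  qed
  then show False using assms(3) unfolding growth_preceq_def by (metis add_2_eq_Suc' lessI less_SucI not_less_eq zero_less_Suc One_nat_def Suc_less_eq)
qed

section \<open>Balls, normality and index under homomorphisms\<close>

lemma (in group_hom) wball_image: "S \<subseteq> carrier G \<Longrightarrow> wball H (h ` S) n = h ` wball G S n"
proof (induction n)
  case 0 then show ?case by simp
next
  case (Suc n)
  have hm: "h (s \<otimes>\<^bsub>G\<^esub> x) = h s \<otimes>\<^bsub>H\<^esub> h x" if "s \<in> S" "x \<in> wball G S n" for s x
    using that Suc(2) G.wball_carrier[OF Suc(2), of n] by (intro hom_mult) auto
  have "wball H (h ` S) (Suc n) = (\<Union>s\<in>S. (\<lambda>x. h s \<otimes>\<^bsub>H\<^esub> h x) ` wball G S n)"
    using Suc by (simp add: wball.simps(2) image_image)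
  also have "\<dots> = (\<Union>s\<in>S. (\<lambda>x. h (s \<otimes>\<^bsub>G\<^esub> x)) ` wball G S n)"
    by (intro SUP_cong HOL.refl image_cong) (simp add: hm)
  also have "\<dots> = h ` wball G S (Suc n)" by (simp add: wball.simps(2) image_UN image_image)
  finally show ?case .
qed

lemma (in group_hom) fin_gen_set_image:
  assumes "fin_gen_set G A" "h ` carrier G = carrier H" shows "fin_gen_set H (h ` A)"
  using assms generate_img[of A] unfolding fin_gen_set_def by auto

lemma (in group_hom) growth_image:
  assumes "fin_gen_set G A" "h ` carrier G = carrier H"
  shows "growth H (h ` A) n = real (card (h ` wball G (insert \<one>\<^bsub>G\<^esub> (A \<union> (\<lambda>a. inv\<^bsub>G\<^esub> a) ` A)) n))"
proof -
  have A: "A \<subseteq> carrier G" using assms by (simp add: fin_gen_set_def)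
  have "insert \<one>\<^bsub>H\<^esub> (h ` A \<union> (\<lambda>a. inv\<^bsub>H\<^esub> a) ` h ` A) = h ` (insert \<one>\<^bsub>G\<^esub> (A \<union> (\<lambda>a. inv\<^bsub>G\<^esub> a) ` A))"
  proof -
    have "(\<lambda>a. inv\<^bsub>H\<^esub> a) ` h ` A = h ` (\<lambda>a. inv\<^bsub>G\<^esub> a) ` A" unfolding image_image
      by (rule image_cong[OF HOL.refl]) (use A in auto)
    then show ?thesis by (simp add: image_Un)
  qed
  moreover have "insert \<one>\<^bsub>G\<^esub> (A \<union> (\<lambda>a. inv\<^bsub>G\<^esub> a) ` A) \<subseteq> carrier G" using A by auto
  ultimately show ?thesis using H.growth_eq_wball[OF fin_gen_set_image[OF assms], of n] by (simp only: wball_image)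
qed

lemma (in group_hom) image_normal:
  assumes "N \<lhd> G" "h ` carrier G = carrier H" shows "h ` N \<lhd> H"
proof -
  have N: "subgroup N G" "\<And>x n. x \<in> carrier G \<Longrightarrow> n \<in> N \<Longrightarrow> x \<otimes>\<^bsub>G\<^esub> n \<otimes>\<^bsub>G\<^esub> inv\<^bsub>G\<^esub> x \<in> N"
    using assms(1) by (auto simp: G.normal_inv_iff)
  have Nc: "n \<in> carrier G" if "n \<in> N" for n using subgroup.mem_carrier[OF N(1) that] .
  show ?thesis unfolding H.normal_inv_iff
  proof (intro conjI ballI)
    show "subgroup (h ` N) H" by (rule subgroup_img_is_subgroup[OF N(1)])
    fix y z assume "y \<in> carrier H" "z \<in> h ` N"
    then obtain n where n: "n \<in> N" "z = h n" by blast
    have "y \<in> h ` carrier G" using \<open>y \<in> carrier H\<close> assms(2) by simp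
    then obtain x where x: "x \<in> carrier G" "y = h x" "n \<in> N" "z = h n" using n by blast
    then have "y \<otimes>\<^bsub>H\<^esub> z \<otimes>\<^bsub>H\<^esub> inv\<^bsub>H\<^esub> y = h (x \<otimes>\<^bsub>G\<^esub> n \<otimes>\<^bsub>G\<^esub> inv\<^bsub>G\<^esub> x)" using Nc by simp
    then show "y \<otimes>\<^bsub>H\<^esub> z \<otimes>\<^bsub>H\<^esub> inv\<^bsub>H\<^esub> y \<in> h ` N" using N(2) x by simp
  qed
qed

lemma (in group_hom) preimage_normal:
  assumes "N \<lhd> H" shows "{x\<in>carrier G. h x \<in> N} \<lhd> G"
  using assms preimage_subgroup[of N] unfolding G.normal_inv_iff H.normal_inv_iff by auto

lemma (in group_hom) findex_preimage:
  assumes "findex H K (carrier H)" "subgroup K H"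
  shows "findex G {x\<in>carrier G. h x \<in> K} (carrier G)"
proof -
  obtain c where c: "finite (c ` carrier H)" "c ` carrier H \<subseteq> carrier H"
      "\<And>x y. x \<in> carrier H \<Longrightarrow> y \<in> carrier H \<Longrightarrow> c x = c y \<Longrightarrow> x \<otimes>\<^bsub>H\<^esub> inv\<^bsub>H\<^esub> y \<in> K"
      "\<And>x. x \<in> carrier H \<Longrightarrow> x \<otimes>\<^bsub>H\<^esub> inv\<^bsub>H\<^esub> (c x) \<in> K" by (rule H.findexE[OF assms H.subgroup_self]) blast
  show ?thesis
  proof (rule G.findexI[of "\<lambda>x. c (h x)"])
    show "finite ((\<lambda>x. c (h x)) ` carrier G)" by (rule finite_subset[OF _ c(1)]) auto
    fix x y assume xy: "x \<in> carrier G" "y \<in> carrier G" "c (h x) = c (h y)"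
    have "h x \<otimes>\<^bsub>H\<^esub> inv\<^bsub>H\<^esub> h y \<in> K" by (rule c(3)[OF _ _ xy(3)]) (use xy in auto)
    then show "x \<otimes>\<^bsub>G\<^esub> inv\<^bsub>G\<^esub> y \<in> {x\<in>carrier G. h x \<in> K}" using xy by simp
  qed
qed

lemma (in group_hom) findex_image:
  assumes "findex G N (carrier G)" "subgroup N G" "h ` carrier G = carrier H"
  shows "findex H (h ` N) (carrier H)"
proof -
  obtain F where F: "finite F" "F \<subseteq> carrier G" "\<forall>x\<in>carrier G. \<exists>f\<in>F. x \<otimes>\<^bsub>G\<^esub> inv\<^bsub>G\<^esub> f \<in> N" using assms by (auto simp: findex_def)
  have "\<exists>f\<in>h ` F. y \<otimes>\<^bsub>H\<^esub> inv\<^bsub>H\<^esub> f \<in> h ` N" if y: "y \<in> carrier H" for y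
  proof -
    obtain x where x: "x \<in> carrier G" "y = h x" using y assms(3) by auto
    then obtain f where f: "f \<in> F" "x \<otimes>\<^bsub>G\<^esub> inv\<^bsub>G\<^esub> f \<in> N" using F by blast
    then have "h (x \<otimes>\<^bsub>G\<^esub> inv\<^bsub>G\<^esub> f) \<in> h ` N" by blast
    moreover have "h (x \<otimes>\<^bsub>G\<^esub> inv\<^bsub>G\<^esub> f) = y \<otimes>\<^bsub>H\<^esub> inv\<^bsub>H\<^esub> h f" using x f F by auto
    ultimately show ?thesis using f by auto
  qed
  moreover have "h ` F \<subseteq> carrier H" using F(2) by auto
  ultimately show ?thesis unfolding findex_def using F(1) by blast
qed

definition finite_residual :: "('a, 'b) monoid_scheme \<Rightarrow> 'a set" where
  "finite_residual G = carrier G \<inter> \<Inter>{N. N \<lhd> G \<and> findex G N (carrier G)}"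

context group
begin

lemma finite_residual_normal: "finite_residual G \<lhd> G"
  unfolding normal_inv_iff
proof (intro conjI ballI)
  have N: "subgroup N G" "\<And>x n. x \<in> carrier G \<Longrightarrow> n \<in> N \<Longrightarrow> x \<otimes> n \<otimes> inv x \<in> N" if "N \<lhd> G" for N
    using that by (auto simp: normal_inv_iff)
  have "subgroup (\<Inter>(insert (carrier G) {N. N \<lhd> G \<and> findex G N (carrier G)})) G"
    by (rule subgroups_Inter) (use N subgroup_self in auto)
  then show "subgroup (finite_residual G) G" by (simp add: finite_residual_def)
  fix x r assume "x \<in> carrier G" "r \<in> finite_residual G"
  then show "x \<otimes> r \<otimes> inv x \<in> finite_residual G" using N(2) by (auto simp: finite_residual_def)
qed

lemma finite_residual_subset: "N \<lhd> G \<Longrightarrow> findex G N (carrier G) \<Longrightarrow> finite_residual G \<subseteq> N"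
  by (auto simp: finite_residual_def)

text \<open>A normal subgroup of finite index that misses \<open>x\<close> contains the residual,
  which is the kernel, so its image still misses the image of \<open>x\<close>.\<close>

lemma residually_finite_quotient:
  assumes "group_hom G Q f" "f ` carrier G = carrier Q"
    "\<And>x. x \<in> carrier G \<Longrightarrow> f x = \<one>\<^bsub>Q\<^esub> \<longleftrightarrow> x \<in> finite_residual G"
  shows "residually_finite Q"
  unfolding residually_finite_def
proof (intro ballI impI)
  interpret f: group_hom G Q f by fact
  fix g assume g: "g \<in> carrier Q" "g \<noteq> \<one>\<^bsub>Q\<^esub>"
  then obtain x where x: "x \<in> carrier G" "g = f x" using assms(2) by auto
  then have "x \<notin> finite_residual G" using g assms(3) by auto
  then obtain N where N: "N \<lhd> G" "findex G N (carrier G)" "x \<notin> N" using x by (auto simp: finite_residual_def)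
  have Ns: "subgroup N G" using N(1) by (simp add: normal_inv_iff)
  have nQ: "f ` N \<lhd> Q" by (rule f.image_normal[OF N(1) assms(2)])
  have "findex Q (f ` N) (carrier Q)" by (rule f.findex_image[OF N(2) Ns assms(2)])
  then have "finite (rcosets\<^bsub>Q\<^esub> (f ` N))" using f.H.findex_rcosets nQ by (simp add: f.H.normal_inv_iff)
  moreover have "g \<notin> f ` N"
  proof
    assume "g \<in> f ` N"
    then obtain y where y: "y \<in> N" "f x = f y" using x by auto
    have yc: "y \<in> carrier G" using subgroup.mem_carrier[OF Ns y(1)] .
    have "f (x \<otimes> inv y) = \<one>\<^bsub>Q\<^esub>" using x(1) yc y(2) by simp
    then have "x \<otimes> inv y \<in> N" using assms(3)[of "x \<otimes> inv y"] finite_residual_subset[OF N(1,2)] x(1) yc by auto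
    then have "(x \<otimes> inv y) \<otimes> y \<in> N" using y(1) by (rule subgroup.m_closed[OF Ns])
    then show False using N(3) x(1) yc by (simp add: m_assoc)
  qed
  ultimately show "\<exists>N. N \<lhd> Q \<and> finite (rcosets\<^bsub>Q\<^esub> N) \<and> g \<notin> N" using nQ by blast
qed

text \<open>Zorn's lemma. If the union of a chain were everything, one member would contain the
  finite set \<open>S\<close> and so be everything; hence proper normal subgroups have proper unions
  along chains.\<close>

lemma maximal_normal_subgroup:
  assumes "sgen G S (carrier G)" "carrier G \<noteq> {\<one>}"
  shows "\<exists>M. M \<lhd> G \<and> M \<noteq> carrier G \<and> (\<forall>N. N \<lhd> G \<longrightarrow> M \<subseteq> N \<longrightarrow> N = M \<or> N = carrier G)"
proof -
  let ?A = "{N. N \<lhd> G \<and> N \<noteq> carrier G}"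
  have full: "N = carrier G" if "N \<lhd> G" "S \<subseteq> N" for N
  proof -
    have "subgroup N G" using that by (simp add: normal_inv_iff)
    then have "carrier G \<subseteq> N" using wball_subgroup[OF _ that(2)] assms(1) by (auto simp: sgen_def)
    then show ?thesis using subgroup.subset[OF \<open>subgroup N G\<close>] by blast
  qed
  have "\<exists>M\<in>?A. \<forall>Y\<in>?A. M \<subseteq> Y \<longrightarrow> Y = M"
  proof (rule subset_Zorn_nonempty)
    have "{\<one>} \<lhd> G" by (auto simp: normal_inv_iff triv_subgroup)
    then show "?A \<noteq> {}" using assms(2) by blast
    fix \<C> assume C: "\<C> \<noteq> {}" "subset.chain ?A \<C>"
    have CA: "N \<lhd> G" "N \<noteq> carrier G" if "N \<in> \<C>" for N using C(2) that by (auto simp: subset_chain_def)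
    have Cs: "subgroup N G" if "N \<in> \<C>" for N using CA(1)[OF that] by (simp add: normal_inv_iff)
    have lin: "N \<subseteq> N' \<or> N' \<subseteq> N" if "N \<in> \<C>" "N' \<in> \<C>" for N N' using C(2) that by (auto simp: subset_chain_def)
    have "\<Union>\<C> \<lhd> G" unfolding normal_inv_iff
    proof (intro conjI ballI)
      show "subgroup (\<Union>\<C>) G"
      proof (rule subgroupI)
        show "\<Union>\<C> \<subseteq> carrier G" using subgroup.subset[OF Cs] by blast
        show "\<Union>\<C> \<noteq> {}" using C(1) subgroup.one_closed[OF Cs] by blast
        show "inv a \<in> \<Union>\<C>" if "a \<in> \<Union>\<C>" for a using that subgroup.m_inv_closed[OF Cs] by blast
        show "a \<otimes> b \<in> \<Union>\<C>" if ab: "a \<in> \<Union>\<C>" "b \<in> \<Union>\<C>" for a b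
        proof -
          obtain N N' where N: "N \<in> \<C>" "a \<in> N" "N' \<in> \<C>" "b \<in> N'" using ab by blast
          then have "\<exists>K\<in>\<C>. a \<in> K \<and> b \<in> K" using lin[OF N(1,3)] by blast
          then show ?thesis using subgroup.m_closed[OF Cs] by blast
        qed
      qed
      fix x n assume "x \<in> carrier G" "n \<in> \<Union>\<C>"
      then show "x \<otimes> n \<otimes> inv x \<in> \<Union>\<C>" using CA(1) unfolding normal_inv_iff by blast
    qed
    moreover have "\<Union>\<C> \<noteq> carrier G"
    proof
      assume e: "\<Union>\<C> = carrier G"
      have S: "finite S" "S \<subseteq> \<Union>\<C>" using assms(1) unfolding e by (auto simp: sgen_def symgen_def)
      obtain N where N: "N \<in> \<C>" "S \<subseteq> N"
        by (rule finite_subset_Union_chain[OF S C])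
      then show False using full[OF CA(1)[OF N(1)] N(2)] CA(2)[OF N(1)] by simp
    qed
    ultimately show "\<Union>\<C> \<in> ?A" by simp
  qed
  then obtain M where "M \<in> ?A" and M: "\<forall>Y\<in>?A. M \<subseteq> Y \<longrightarrow> Y = M" ..
  then have "M \<lhd> G \<and> M \<noteq> carrier G" by simp
  moreover have "N = M \<or> N = carrier G" if "N \<lhd> G" "M \<subseteq> N" for N
    using bspec[OF M, of N] that by auto
  ultimately show ?thesis by (intro exI[of _ M]) simp
qed

end

lemma simple_quotient:
  assumes "group_hom G Q f" "f ` carrier G = carrier Q"
    "\<And>x. x \<in> carrier G \<Longrightarrow> f x = \<one>\<^bsub>Q\<^esub> \<longleftrightarrow> x \<in> M"
    and M: "M \<lhd> G" "M \<noteq> carrier G" "\<And>N. N \<lhd> G \<Longrightarrow> M \<subseteq> N \<Longrightarrow> N = M \<or> N = carrier G"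
  shows "is_simple Q"
proof -
  interpret f: group_hom G Q f by fact
  have Mc: "M \<subseteq> carrier G" using M(1) subgroup.subset by (auto simp: f.G.normal_inv_iff)
  show ?thesis unfolding is_simple_def
  proof (intro conjI allI impI)
    show "carrier Q \<noteq> {\<one>\<^bsub>Q\<^esub>}"
    proof
      assume "carrier Q = {\<one>\<^bsub>Q\<^esub>}"
      then have "f x = \<one>\<^bsub>Q\<^esub>" if "x \<in> carrier G" for x using assms(2) that by blast
      then have "carrier G \<subseteq> M" using assms(3) by auto
      then show False using M(2) Mc by simp
    qed
    fix N assume N: "N \<lhd> Q"
    let ?N = "{x\<in>carrier G. f x \<in> N}"
    have Ns: "subgroup N Q" using N by (simp add: f.H.normal_inv_iff)
    have NN: "N = f ` ?N"
    proof
      show "N \<subseteq> f ` ?N"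
      proof
        fix y assume y: "y \<in> N"
        then have "y \<in> f ` carrier G" using subgroup.subset[OF Ns] assms(2) by auto
        then obtain x where "x \<in> carrier G" "y = f x" by (rule imageE)
        then show "y \<in> f ` ?N" using y by simp
      qed
    qed auto
    have fM: "f x = \<one>\<^bsub>Q\<^esub>" if "x \<in> M" for x
      using assms(3)[of x] subsetD[OF Mc that] that by simp
    have MN: "M \<subseteq> ?N"
    proof
      fix x assume "x \<in> M"
      then show "x \<in> ?N" using subsetD[OF Mc] fM[of x] subgroup.one_closed[OF Ns] by simp
    qed
    consider "?N = M" | "?N = carrier G" using M(3)[OF f.preimage_normal[OF N] MN] by (rule disjE)
    then show "N = carrier Q \<or> N = {\<one>\<^bsub>Q\<^esub>}"
    proof cases
      case 1
      have "N = f ` M" using NN unfolding 1 .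
      then have "N \<subseteq> {\<one>\<^bsub>Q\<^esub>}" using fM by auto
      then show ?thesis using subgroup.one_closed[OF Ns] by blast
    next
      case 2 then show ?thesis using NN assms(2) by simp
    qed
  qed
qed

text \<open>Some subgroup \<open>K\<close> of finite index maps onto the integers. Its elements of
  even value form a subgroup of finite index that is proper even when \<open>K\<close> is the whole
  group.\<close>

lemma infinite_pc_proper_findex:
  assumes "group Q" "infinite (carrier Q)" "pc Q {\<one>\<^bsub>Q\<^esub>} (carrier Q)"
  shows "\<exists>L. subgroup L Q \<and> L \<noteq> carrier Q \<and> findex Q L (carrier Q)"
proof -
  interpret group Q by fact
  have "\<not> findex Q {\<one>\<^bsub>Q\<^esub>} (carrier Q)" using findex_trivial_finite[OF _ _ subgroup_self] assms(2) by blast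
  then obtain K \<psi> where K: "subgroup K Q" "K \<subseteq> carrier Q" "findex Q K (carrier Q)" "zhom Q K \<psi>"
    using pc_infinite_zhom[OF assms(3)] by blast
  note z = zhom_facts[OF K(4,1)]
  define L where "L = {x\<in>K. even (\<psi> x)}"
  have Ls: "subgroup L Q"
  proof (rule subgroupI)
    show "L \<subseteq> carrier Q" using K(2) by (auto simp: L_def)
    show "L \<noteq> {}" using subgroup.one_closed[OF K(1)] z(1) by (auto simp: L_def)
    show "inv\<^bsub>Q\<^esub> x \<in> L" if "x \<in> L" for x using that z(2) subgroup.m_inv_closed[OF K(1)] by (auto simp: L_def)
    show "x \<otimes>\<^bsub>Q\<^esub> y \<in> L" if "x \<in> L" "y \<in> L" for x y using that z(3) subgroup.m_closed[OF K(1)] by (auto simp: L_def)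
  qed
  have "findex Q L K"
  proof (rule findexI[of "\<lambda>x. even (\<psi> x)"])
    show "finite ((\<lambda>x. even (\<psi> x)) ` K)" by simp
    fix x y assume xy: "x \<in> K" "y \<in> K" "even (\<psi> x) = even (\<psi> y)"
    have "\<psi> (x \<otimes>\<^bsub>Q\<^esub> inv\<^bsub>Q\<^esub> y) = \<psi> x - \<psi> y" using z(3)[OF xy(1) subgroup.m_inv_closed[OF K(1) xy(2)]] z(2)[OF xy(2)] by simp
    then show "x \<otimes>\<^bsub>Q\<^esub> inv\<^bsub>Q\<^esub> y \<in> L" using xy subgroup.m_closed[OF K(1) xy(1) subgroup.m_inv_closed[OF K(1) xy(2)]] by (simp add: L_def)
  qed
  then have "findex Q L (carrier Q)" using findex_trans[OF _ K(3) Ls K(1) subgroup_self K(2)] by blast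
  moreover have "L \<noteq> carrier Q"
  proof -
    obtain t where t: "t \<in> K" "\<psi> t = 1" using K(4) by (auto simp: zhom_def)
    then have "t \<notin> L" by (simp add: L_def)
    then show ?thesis using t(1) K(2) by blast
  qed
  ultimately show ?thesis using Ls by blast
qed

text \<open>The predicate \<open>\<Phi>\<close> stands for slow growth: \<open>\<Phi> h\<close> is \<open>h \<prec>\<^sub>g e\<^sup>\<surd>\<^sup>n\<close> for the first assertion and
  \<open>\<not> e\<^sup>\<surd>\<^sup>n \<preceq>\<^sub>g h\<close> for the second.\<close>

theorem finite_residual_finite:
  fixes G :: "'a monoid" and \<Phi> :: "(nat \<Rightarrow> real) \<Rightarrow> bool"
  assumes G: "group G" "infinite (carrier G)" "fin_gen_set G A" "\<Phi> (growth G A)"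
    and mono: "\<And>f h c. \<Phi> h \<Longrightarrow> c > 0 \<Longrightarrow> (\<And>n. f n \<le> h (c * n)) \<Longrightarrow> \<Phi> f"
    and sub: "\<And>h. \<Phi> h \<Longrightarrow> \<not> (\<lambda>n. exp (real n powr (1/2))) \<preceq>\<^sub>g h"
    and hyp: "\<And>(Q::nat monoid) B. group Q \<Longrightarrow> infinite (carrier Q) \<Longrightarrow> fin_gen_set Q B \<Longrightarrow>
      residually_finite Q \<or> is_simple Q \<Longrightarrow> \<Phi> (growth Q B) \<Longrightarrow> pc Q {\<one>\<^bsub>Q\<^esub>} (carrier Q)"
  shows "\<exists>(Q::nat monoid) f. group_hom G Q f \<and> f ` carrier G = carrier Q \<and> finite {x\<in>carrier G. f x = \<one>\<^bsub>Q\<^esub>} \<and>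
    residually_finite Q \<and> infinite (carrier Q) \<and> fin_gen_set Q (f ` A) \<and> \<Phi> (growth Q (f ` A))"
proof -
  interpret group G by fact
  define S where "S = insert \<one>\<^bsub>G\<^esub> (A \<union> (\<lambda>a. inv\<^bsub>G\<^esub> a) ` A)"
  have A: "finite A" "A \<subseteq> carrier G" "generate G A = carrier G" using G(3) by (auto simp: fin_gen_set_def)
  have sg: "sgen G S (carrier G)" using sgen_generate[OF A(1,2)] A(3) by (simp add: S_def)
  have Sfin: "finite S" using A(1) by (simp add: S_def)
  have se: "subexp G S" unfolding S_def by (rule growth_preceq_exp_subexp[OF G(1,3) sub[OF G(4)]])
  have gr: "growth G A n = real (card (wball G S n))" for n unfolding S_def by (rule growth_eq_wball[OF G(3)])
  define R where "R = finite_residual G"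
  have Rn: "R \<lhd> G" unfolding R_def by (rule finite_residual_normal)
  have Rs: "subgroup R G" using Rn by (simp add: normal_inv_iff)
  have Rc: "R \<subseteq> carrier G" using subgroup.subset[OF Rs] .
  obtain Q :: "nat monoid" and f where f: "group_hom G Q f" "f ` carrier G = carrier Q" "\<forall>x\<in>carrier G. f x = \<one>\<^bsub>Q\<^esub> \<longleftrightarrow> x \<in> R"
    using nat_quotient[OF sg Rn] by blast
  interpret f: group_hom G Q f by (rule f(1))
  have ker: "{x\<in>carrier G. f x = \<one>\<^bsub>Q\<^esub>} = R" using f(3) Rc by blast
  have rf: "residually_finite Q" by (rule residually_finite_quotient[OF f(1,2)]) (use f(3) R_def in auto)
  have fgQ: "fin_gen_set Q (f ` A)" by (rule f.fin_gen_set_image[OF G(3) f(2)])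
  have gQ: "growth Q (f ` A) n \<le> growth G A (1 * n)" for n
    unfolding f.growth_image[OF G(3) f(2)] gr S_def[symmetric] using card_image_le[OF finite_wball[OF Sfin], where f=f] by simp
  have \<Phi>Q: "\<Phi> (growth Q (f ` A))" by (rule mono[OF G(4) zero_less_one gQ])
  have pcR: "pc G R (carrier G)"
  \<comment> \<open>The hypotheses concern infinite groups, so a finite \<open>Q\<close> is treated
    directly; it is ruled out once \<open>R\<close> is known to be finite.\<close>
  proof (cases "finite (carrier Q)")
    case True
    have "findex G R (carrier G)"
    proof (rule findexI[of f])
      show "finite (f ` carrier G)" using True f(2) by simp
      fix x y assume xy: "x \<in> carrier G" "y \<in> carrier G" "f x = f y"
      then have "f (x \<otimes>\<^bsub>G\<^esub> inv\<^bsub>G\<^esub> y) = \<one>\<^bsub>Q\<^esub>" by simp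
      then show "x \<otimes>\<^bsub>G\<^esub> inv\<^bsub>G\<^esub> y \<in> R" using f(3) xy by blast
    qed
    then show ?thesis by (rule pc.fin[OF pc.refl[OF Rs] subgroup_self Rc])
  next
    case False
    have "pc Q {\<one>\<^bsub>Q\<^esub>} (carrier Q)" by (rule hyp[OF f.H.is_group False fgQ _ \<Phi>Q]) (use rf in simp)
    then have "pc G {x\<in>carrier G. f x \<in> {\<one>\<^bsub>Q\<^esub>}} {x\<in>carrier G. f x \<in> carrier Q}" by (rule pc_pullback[OF f(1,2)])
    moreover have "{x\<in>carrier G. f x \<in> {\<one>\<^bsub>Q\<^esub>}} = R" using ker by simp
    moreover have "{x\<in>carrier G. f x \<in> carrier Q} = carrier G" by auto
    ultimately show ?thesis by simp
  qed
  obtain T where T: "sgen G T R" "subexp G T" using pc_fg[OF pcR sg se] by blast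
  \<comment> \<open>The normal core of the separating \<open>L'\<close> has finite index in
    \<open>G\<close> and so contains the residual; hence \<open>R\<close> lies in \<open>L'\<close>
    and thereby in \<open>L\<close>.\<close>
  have noindex: "L = R" if L: "subgroup L G" "L \<subseteq> R" "findex G L R" for L
  proof -
    obtain L' where L': "subgroup L' G" "findex G L' (carrier G)" "L' \<inter> R \<subseteq> L"
      using pc_separate[OF pcR sg se L] by blast
    obtain N where N: "N \<lhd> G" "N \<subseteq> L'" "findex G N (carrier G)" using normal_core[OF L'(1,2)] by blast
    have "R \<subseteq> N" unfolding R_def by (rule finite_residual_subset[OF N(1,3)])
    then show ?thesis using N(2) L'(3) L(2) by blast
  qed
  have "finite R"
  proof (rule ccontr)
    assume inf: "infinite R"
    let ?R = "G\<lparr>carrier := R\<rparr>"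
    interpret R: group ?R by (rule subgroup_imp_group[OF Rs])
    have sgR: "sgen ?R T (carrier ?R)" using sgen_restrict[OF Rs T(1)] by simp
    have "carrier ?R \<noteq> {\<one>\<^bsub>?R\<^esub>}" using inf by auto
    then obtain M where M: "M \<lhd> ?R" "M \<noteq> carrier ?R" "\<And>N. N \<lhd> ?R \<Longrightarrow> M \<subseteq> N \<Longrightarrow> N = M \<or> N = carrier ?R"
      using R.maximal_normal_subgroup[OF sgR] by blast
    obtain Q2 :: "nat monoid" and f2 where f2: "group_hom ?R Q2 f2" "f2 ` carrier ?R = carrier Q2"
      "\<forall>x\<in>carrier ?R. f2 x = \<one>\<^bsub>Q2\<^esub> \<longleftrightarrow> x \<in> M"
      using R.nat_quotient[OF sgR M(1)] by blast
    interpret f2: group_hom ?R Q2 f2 by (rule f2(1))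
    have simple: "is_simple Q2" by (rule simple_quotient[OF f2(1,2) _ M]) (use f2(3) in auto)
    have nofin: "L = carrier Q2" if L: "subgroup L Q2" "findex Q2 L (carrier Q2)" for L
    proof -
      let ?L = "{x\<in>carrier ?R. f2 x \<in> L}"
      have "subgroup ?L ?R" by (rule f2.preimage_subgroup[OF L(1)])
      then have 1: "subgroup ?L G" by (rule incl_subgroup[OF Rs])
      have "findex ?R ?L (carrier ?R)" by (rule f2.findex_preimage[OF L(2,1)])
      have "findex G ?L R"
      proof -
        obtain F where F: "finite F" "F \<subseteq> R" "\<forall>x\<in>R. \<exists>f\<in>F. x \<otimes>\<^bsub>G\<^esub> inv\<^bsub>?R\<^esub> f \<in> ?L"
          using \<open>findex ?R ?L (carrier ?R)\<close> by (auto simp: findex_def)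
        have "inv\<^bsub>?R\<^esub> f = inv\<^bsub>G\<^esub> f" if "f \<in> F" for f using m_inv_consistent[OF Rs] F(2) that by blast
        then show ?thesis using F unfolding findex_def by (intro exI[of _ F]) simp
      qed
      then have "?L = R" by (intro noindex[OF 1]) auto
      then have "\<forall>x\<in>R. f2 x \<in> L" by blast
      then have "f2 ` carrier ?R \<subseteq> L" by auto
      then show ?thesis using subgroup.subset[OF L(1)] unfolding f2(2) by (rule subset_antisym[rotated])
    qed
    \<comment> \<open>In a finite quotient the trivial subgroup has finite index, so it would be the
      whole quotient.\<close>
    have inf2: "infinite (carrier Q2)"
    proof
      assume fin: "finite (carrier Q2)"
      have "{\<one>\<^bsub>Q2\<^esub>} = carrier Q2"
        by (rule nofin[OF f2.H.triv_subgroup f2.H.finite_findex[OF fin f2.H.subgroup_self f2.H.triv_subgroup]])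
      then show False using simple by (simp add: is_simple_def)
    qed
    have Tf: "fin_gen_set ?R T"
    proof -
      have "generate ?R T = carrier ?R" using R.sgen_generate_iff[OF sgR] .
      then show ?thesis using T(1) R.sgen_subset[OF sgR] by (simp add: fin_gen_set_def sgen_def symgen_def)
    qed
    have fg2: "fin_gen_set Q2 (f2 ` T)" by (rule f2.fin_gen_set_image[OF Tf f2(2)])
    have Tfin: "finite T" "T \<subseteq> carrier G" "T \<subseteq> R" using T(1) sgen_subset[OF T(1)] by (auto simp: sgen_def symgen_def)
    obtain c where c: "c \<ge> 1" "T \<subseteq> wball G S c" using sgen_finite_subset[OF sg Tfin(1,2)] by blast
    have "growth Q2 (f2 ` T) n \<le> growth G A (c * n)" for n
    proof -
      have "insert \<one>\<^bsub>?R\<^esub> (T \<union> (\<lambda>a. inv\<^bsub>?R\<^esub> a) ` T) = T" using sgR by (auto simp: sgen_def symgen_def)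
      then have "growth Q2 (f2 ` T) n = real (card (f2 ` wball ?R T n))" using f2.growth_image[OF Tf f2(2), of n] by metis
      also have "\<dots> \<le> real (card (wball G T n))" using card_image_le[OF finite_wball[OF Tfin(1)], of f2] by simp
      also have "\<dots> \<le> real (card (wball G S (c * n)))" using card_wball_subst[OF _ c(2)] sg by (simp add: sgen_def)
      finally show ?thesis by (simp add: gr)
    qed
    then have \<Phi>2: "\<Phi> (growth Q2 (f2 ` T))" using c(1) by (intro mono[OF G(4), of c]) auto
    have pc2: "pc Q2 {\<one>\<^bsub>Q2\<^esub>} (carrier Q2)" by (rule hyp[OF f2.H.is_group inf2 fg2 _ \<Phi>2]) (use simple in simp)
    then show False using infinite_pc_proper_findex[OF f2.H.is_group inf2 pc2] nofin by blast
  qed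
  moreover have "infinite (carrier Q)"
  proof
    assume fin: "finite (carrier Q)"
    have "findex Q {\<one>\<^bsub>Q\<^esub>} (carrier Q)" by (rule f.H.finite_findex[OF fin f.H.subgroup_self f.H.triv_subgroup])
    then have "findex G {x\<in>carrier G. f x \<in> {\<one>\<^bsub>Q\<^esub>}} (carrier G)" by (rule f.findex_preimage[OF _ f.H.triv_subgroup])
    then have "findex G R (carrier G)" using ker by simp
    then show False using findex_trivial_finite[OF _ \<open>finite R\<close> subgroup_self] G(2) by blast
  qed
  ultimately show ?thesis using f(1,2) ker rf fgQ \<Phi>Q by blast
qed

text \<open>An element of a ball is determined by its image together with the kernel element
  relating it to a preimage fixed in the same ball.\<close>

lemma (in group_hom) growth_finite_kernel:
  assumes "fin_gen_set G A" "h ` carrier G = carrier H" "finite {x\<in>carrier G. h x = \<one>\<^bsub>H\<^esub>}"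
  shows "growth G A n \<le> real (card {x\<in>carrier G. h x = \<one>\<^bsub>H\<^esub>}) * growth H (h ` A) n"
proof -
  let ?R = "{x\<in>carrier G. h x = \<one>\<^bsub>H\<^esub>}"
  define S where "S = insert \<one>\<^bsub>G\<^esub> (A \<union> (\<lambda>a. inv\<^bsub>G\<^esub> a) ` A)"
  have S: "finite S" "S \<subseteq> carrier G" using assms(1) by (auto simp: S_def fin_gen_set_def)
  let ?B = "wball G S n"
  have Bc: "x \<in> carrier G" if "x \<in> ?B" for x using G.wball_carrier[OF S(2)] that by blast
  define r where "r v = (SOME x. x \<in> ?B \<and> h x = v)" for v
  have r: "r (h x) \<in> ?B \<and> h (r (h x)) = h x" if "x \<in> ?B" for x
    unfolding r_def by (rule someI[of "\<lambda>y. y \<in> ?B \<and> h y = h x" x]) (use that in simp)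
  have "inj_on (\<lambda>x. (x \<otimes>\<^bsub>G\<^esub> inv\<^bsub>G\<^esub> r (h x), h x)) ?B"
  proof (rule inj_onI)
    fix x y assume xy: "x \<in> ?B" "y \<in> ?B" "(x \<otimes>\<^bsub>G\<^esub> inv\<^bsub>G\<^esub> r (h x), h x) = (y \<otimes>\<^bsub>G\<^esub> inv\<^bsub>G\<^esub> r (h y), h y)"
    have c: "x \<in> carrier G" "y \<in> carrier G" "r (h y) \<in> carrier G" using xy r Bc by auto
    have "x \<otimes>\<^bsub>G\<^esub> inv\<^bsub>G\<^esub> r (h y) = y \<otimes>\<^bsub>G\<^esub> inv\<^bsub>G\<^esub> r (h y)"
      using xy(3) unfolding prod.inject by (elim conjE) metis
    then show "x = y" using c by simp
  qed
  moreover have "(\<lambda>x. (x \<otimes>\<^bsub>G\<^esub> inv\<^bsub>G\<^esub> r (h x), h x)) ` ?B \<subseteq> ?R \<times> h ` ?B"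
  proof (rule image_subsetI)
    fix x assume x: "x \<in> ?B"
    have "x \<in> carrier G" "r (h x) \<in> carrier G" "h (r (h x)) = h x" using r[OF x] Bc x by auto
    then show "(x \<otimes>\<^bsub>G\<^esub> inv\<^bsub>G\<^esub> r (h x), h x) \<in> ?R \<times> h ` ?B" using x by simp
  qed
  ultimately have "card ?B \<le> card (?R \<times> h ` ?B)"
    by (rule card_inj_on_le) (intro finite_cartesian_product assms(3) finite_imageI finite_wball S(1))
  then have "card ?B \<le> card ?R * card (h ` ?B)" by (simp add: card_cartesian_product)
  then have "real (card ?B) \<le> real (card ?R) * real (card (h ` ?B))" unfolding of_nat_mult[symmetric] by (rule of_nat_mono)
  then show ?thesis using G.growth_eq_wball[OF assms(1)] growth_image[OF assms(1,2)] by (simp add: S_def)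
qed

section \<open>Stability of the growth comparisons and the two assertions\<close>

lemma growth_prec_mono:
  assumes "h \<prec>\<^sub>g E" "c > 0" "\<And>n. f n \<le> h (c * n)" shows "f \<prec>\<^sub>g E"
proof -
  obtain C where C: "C > 1" "\<And>n. n \<ge> 1 \<Longrightarrow> h n \<le> E (C * n)" using assms(1) by (auto simp: growth_prec_def growth_preceq_def)
  have "C * c > 1" using C(1) assms(2) by (metis less_1_mult less_one linorder_neqE_nat mult.right_neutral not_less_zero)
  moreover have "f n \<le> E (C * c * n)" if "n \<ge> 1" for n
    using order_trans[OF assms(3)[of n] C(2)[of "c * n"]] that assms(2) by (simp add: mult.assoc)
  ultimately have "f \<preceq>\<^sub>g E" unfolding growth_preceq_def by blast
  moreover have "\<not> E \<preceq>\<^sub>g f"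
  proof
    assume "E \<preceq>\<^sub>g f"
    then obtain C where C: "C > 1" "\<And>n. n \<ge> 1 \<Longrightarrow> E n \<le> f (C * n)" by (auto simp: growth_preceq_def)
    have "c * C > 1" using C(1) assms(2) by (metis less_1_mult less_one linorder_neqE_nat mult.left_neutral not_less_zero)
    moreover have "E n \<le> h (c * C * n)" if "n \<ge> 1" for n
      using order_trans[OF C(2)[OF that] assms(3)] by (simp add: mult.assoc)
    ultimately have "E \<preceq>\<^sub>g h" unfolding growth_preceq_def by blast
    then show False using assms(1) by (simp add: growth_prec_def)
  qed
  ultimately show ?thesis by (simp add: growth_prec_def)
qed

lemma not_growth_succeq_mono:
  assumes "\<not> E \<preceq>\<^sub>g h" "c > 0" "\<And>n. f n \<le> h (c * n)" shows "\<not> E \<preceq>\<^sub>g f"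
proof
  assume "E \<preceq>\<^sub>g f"
  then obtain C where C: "C > 1" "\<And>n. n \<ge> 1 \<Longrightarrow> E n \<le> f (C * n)" by (auto simp: growth_preceq_def)
  have "c * C > 1" using C(1) assms(2) by (metis less_1_mult less_one linorder_neqE_nat mult.left_neutral not_less_zero)
  moreover have "E n \<le> h (c * C * n)" if "n \<ge> 1" for n
    using order_trans[OF C(2)[OF that] assms(3)] by (simp add: mult.assoc)
  ultimately have "E \<preceq>\<^sub>g h" unfolding growth_preceq_def by blast
  then show False using assms(1) by simp
qed

lemma polynomially_bounded_pc:
  assumes "group G" "fin_gen_set G A" "polynomially_bounded (growth G A)"
  shows "pc G {\<one>\<^bsub>G\<^esub>} (carrier G)"
proof -
  interpret group G by fact
  define S where "S = insert \<one>\<^bsub>G\<^esub> (A \<union> (\<lambda>a. inv\<^bsub>G\<^esub> a) ` A)"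
  have A: "finite A" "A \<subseteq> carrier G" "generate G A = carrier G" using assms(2) by (auto simp: fin_gen_set_def)
  have sg: "sgen G S (carrier G)" using sgen_generate[OF A(1,2)] A(3) by (simp add: S_def)
  obtain C d :: real where C: "C > 0" "d > 0" "\<And>n. n \<ge> 1 \<Longrightarrow> growth G A n < C * real n powr d"
    using assms(3) by (auto simp: polynomially_bounded_def)
  have "real (card (wball G S n)) \<le> C * real n ^ nat \<lceil>d\<rceil>" if n: "n \<ge> 1" for n
  proof -
    have "real (card (wball G S n)) \<le> C * real n powr d" using C(3)[OF n] growth_eq_wball[OF assms(2)] by (simp add: S_def)
    also have "\<dots> \<le> C * real n powr real (nat \<lceil>d\<rceil>)" using n C(1,2) by (intro mult_left_mono powr_mono) linarith+
    also have "\<dots> = C * real n ^ nat \<lceil>d\<rceil>" using n by (simp add: powr_realpow)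
    finally show ?thesis .
  qed
  then show ?thesis by (rule polynomial_growth_pc[OF assms(1) sg])
qed

text \<open>Polynomial growth is obtained for \<open>Q\<close> from the residually finite case and
  returns to \<open>G\<close> at the cost of the constant factor \<open>?r\<close>, the order of the
  finite kernel.\<close>

lemma gap_residually_finite_simple:
  assumes rf: "gap_holds (1/2) (\<lambda>G :: nat monoid. residually_finite G)"
    and si: "gap_holds (1/2) (\<lambda>G :: nat monoid. is_simple G)"
  shows "gap_holds (1/2) (\<lambda>G :: 'a monoid. True)"
  unfolding gap_holds_def
proof (intro allI impI, elim conjE)
  fix G :: "'a monoid" and A
  assume G: "group G" "infinite (carrier G)" "fin_gen_set G A" "growth G A \<prec>\<^sub>g (\<lambda>n. exp (real n powr (1/2)))"
  have poly: "polynomially_bounded (growth Q B)"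
    if "group Q" "infinite (carrier Q)" "fin_gen_set Q B" "residually_finite Q \<or> is_simple Q"
      "growth Q B \<prec>\<^sub>g (\<lambda>n. exp (real n powr (1/2)))" for Q :: "nat monoid" and B
    using that rf si unfolding gap_holds_def by blast
  have "\<exists>(Q::nat monoid) f. group_hom G Q f \<and> f ` carrier G = carrier Q \<and> finite {x\<in>carrier G. f x = \<one>\<^bsub>Q\<^esub>} \<and>
    residually_finite Q \<and> infinite (carrier Q) \<and> fin_gen_set Q (f ` A) \<and> growth Q (f ` A) \<prec>\<^sub>g (\<lambda>n. exp (real n powr (1/2)))"
  proof (rule finite_residual_finite[where \<Phi>="\<lambda>h. h \<prec>\<^sub>g (\<lambda>n. exp (real n powr (1/2)))", OF G])
    show "f \<prec>\<^sub>g (\<lambda>n. exp (real n powr (1/2)))"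
      if "h \<prec>\<^sub>g (\<lambda>n. exp (real n powr (1/2)))" "c > 0" "\<And>n. f n \<le> h (c * n)" for f h c
      by (rule growth_prec_mono[OF that])
    show "\<not> (\<lambda>n. exp (real n powr (1/2))) \<preceq>\<^sub>g h" if "h \<prec>\<^sub>g (\<lambda>n. exp (real n powr (1/2)))" for h
      using that by (simp add: growth_prec_def)
    show "pc Q {\<one>\<^bsub>Q\<^esub>} (carrier Q)" if "group Q" "infinite (carrier Q)" "fin_gen_set Q B" "residually_finite Q \<or> is_simple Q"
      "growth Q B \<prec>\<^sub>g (\<lambda>n. exp (real n powr (1/2)))" for Q :: "nat monoid" and B
      by (rule polynomially_bounded_pc[OF that(1,3) poly[OF that]])
  qed
  then obtain Q :: "nat monoid" and f where f: "group_hom G Q f" "f ` carrier G = carrier Q" "finite {x\<in>carrier G. f x = \<one>\<^bsub>Q\<^esub>}"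
    "residually_finite Q" "infinite (carrier Q)" "fin_gen_set Q (f ` A)" "growth Q (f ` A) \<prec>\<^sub>g (\<lambda>n. exp (real n powr (1/2)))"
    by blast
  interpret f: group_hom G Q f by (rule f(1))
  let ?r = "real (card {x\<in>carrier G. f x = \<one>\<^bsub>Q\<^esub>})"
  have "polynomially_bounded (growth Q (f ` A))" by (rule poly[OF f.H.is_group f(5,6) _ f(7)]) (use f(4) in simp)
  then obtain C d :: real where C: "C > 0" "d > 0" "\<And>n. n \<ge> 1 \<Longrightarrow> growth Q (f ` A) n < C * real n powr d"
    by (auto simp: polynomially_bounded_def)
  have "\<one>\<^bsub>G\<^esub> \<in> {x\<in>carrier G. f x = \<one>\<^bsub>Q\<^esub>}" by simp
  then have r: "?r > 0" using f(3) by (metis card_gt_0_iff empty_iff of_nat_0_less_iff)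
  have "growth G A n < ?r * C * real n powr d" if n: "n \<ge> 1" for n
  proof -
    have "growth G A n \<le> ?r * growth Q (f ` A) n" by (rule f.growth_finite_kernel[OF G(3) f(2,3)])
    also have "\<dots> < ?r * (C * real n powr d)" using C(3)[OF n] r by (rule mult_strict_left_mono)
    finally show ?thesis by (simp add: mult.assoc)
  qed
  then show "polynomially_bounded (growth G A)" unfolding polynomially_bounded_def
    using C(1,2) r by (intro exI[of _ "?r * C"] exI[of _ d]) simp
qed

lemma gap_star_residually_finite_simple:
  assumes rf: "gap_star_holds (1/2) (\<lambda>G :: nat monoid. residually_finite G)"
    and si: "gap_star_holds (1/2) (\<lambda>G :: nat monoid. is_simple G)"
  shows "gap_star_holds (1/2) (\<lambda>G :: 'a monoid. True)"
  unfolding gap_star_holds_def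
proof (intro allI impI, elim conjE, rule ccontr)
  fix G :: "'a monoid" and A
  assume G: "group G" "infinite (carrier G)" "fin_gen_set G A"
    and nv: "\<not> virtually_nilpotent G" and slow: "\<not> (\<lambda>n. exp (real n powr (1/2))) \<preceq>\<^sub>g growth G A"
  have vn: "virtually_nilpotent Q"
    if "group Q" "infinite (carrier Q)" "fin_gen_set Q B" "residually_finite Q \<or> is_simple Q"
      "\<not> (\<lambda>n. exp (real n powr (1/2))) \<preceq>\<^sub>g growth Q B" for Q :: "nat monoid" and B
    using that rf si unfolding gap_star_holds_def by blast
  have "\<exists>(Q::nat monoid) f. group_hom G Q f \<and> f ` carrier G = carrier Q \<and> finite {x\<in>carrier G. f x = \<one>\<^bsub>Q\<^esub>} \<and>
    residually_finite Q \<and> infinite (carrier Q) \<and> fin_gen_set Q (f ` A) \<and> \<not> (\<lambda>n. exp (real n powr (1/2))) \<preceq>\<^sub>g growth Q (f ` A)"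
  proof (rule finite_residual_finite[where \<Phi>="\<lambda>h. \<not> (\<lambda>n. exp (real n powr (1/2))) \<preceq>\<^sub>g h", OF G slow])
    show "\<not> (\<lambda>n. exp (real n powr (1/2))) \<preceq>\<^sub>g f"
      if "\<not> (\<lambda>n. exp (real n powr (1/2))) \<preceq>\<^sub>g h" "c > 0" "\<And>n. f n \<le> h (c * n)" for f h c
      by (rule not_growth_succeq_mono[OF that])
    show "pc Q {\<one>\<^bsub>Q\<^esub>} (carrier Q)" if Q: "group Q" "infinite (carrier Q)" "fin_gen_set Q B" "residually_finite Q \<or> is_simple Q"
      "\<not> (\<lambda>n. exp (real n powr (1/2))) \<preceq>\<^sub>g growth Q B" for Q :: "nat monoid" and B
    proof -
      interpret Q: group Q by (rule Q(1))
      have "finite B" "B \<subseteq> carrier Q" "generate Q B = carrier Q" using Q(3) by (auto simp: fin_gen_set_def)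
      then have "sgen Q (insert \<one>\<^bsub>Q\<^esub> (B \<union> (\<lambda>a. inv\<^bsub>Q\<^esub> a) ` B)) (carrier Q)" using Q.sgen_generate by metis
      then show ?thesis by (rule Q.virtually_nilpotent_pc[OF _ growth_preceq_exp_subexp[OF Q(1,3,5)] vn[OF Q]])
    qed
  qed
  then obtain Q :: "nat monoid" and f where f: "group_hom G Q f" "f ` carrier G = carrier Q" "finite {x\<in>carrier G. f x = \<one>\<^bsub>Q\<^esub>}"
    "residually_finite Q" "infinite (carrier Q)" "fin_gen_set Q (f ` A)" "\<not> (\<lambda>n. exp (real n powr (1/2))) \<preceq>\<^sub>g growth Q (f ` A)"
    by blast
  interpret f: group_hom G Q f by (rule f(1))
  have "virtually_nilpotent Q" by (rule vn[OF f.H.is_group f(5,6) _ f(7)]) (use f(4) in simp)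
  then show False using nv virtually_nilpotent_finite_kernel[OF f(1,2,3)] by blast
qed

theorem theorem8p4:
  shows "(gap_holds (1/2) (\<lambda>G :: nat monoid. residually_finite G) \<and>
          gap_holds (1/2) (\<lambda>G :: nat monoid. is_simple G)
            \<longrightarrow> gap_holds (1/2) (\<lambda>G :: 'a monoid. True)) \<and>
         (gap_star_holds (1/2) (\<lambda>G :: nat monoid. residually_finite G) \<and>
          gap_star_holds (1/2) (\<lambda>G :: nat monoid. is_simple G)
            \<longrightarrow> gap_star_holds (1/2) (\<lambda>G :: 'a monoid. True))"
  using gap_residually_finite_simple gap_star_residually_finite_simple by blast

end
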